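(* Consider the closed-loop system consisting of the $N$ nonlinear subsystems $$\dot x_{i,l}=x_{i,l+1}+\psi_{i,l}(x_{i,1},\dots,x_{i,l})^T\theta_i,\ l=1,\dots,r_i-1,\qquad \dot x_{i,r_i}=u_i+\psi_{i,r_i}(x_{i,1},\dots,x_{i,r_i})^T\theta_i,\qquad y_i=x_{i,1},\qquad i=1,\dots,N,$$ the leader $\dot x_0=Ax_0$, $y_0=Cx_0$, the dynamic compensator $$\dot{\eta}_{i,l}=A\eta_{i,l}-KC(\eta_{i,l}-\eta_{i,l+1}),\quad l=1,\dots,r_i,$$ $$\dot{\eta}_{i,r_i+1}=A\eta_{i,r_i+1}-KC\sum_{j=0}^N a_{ij}(\eta_{i,r_i+1}-\eta_{i,1})-K\sum_{j=0}^N a_{ij}(y_i-y_j),\qquad \hat y_i=C\eta_{i,1},\qquad i=1,\dots,N,$$ with gain $K=\mu P_0C^T$ as specified in the context, and the adaptive controllers $u_i=\alpha_{i,r_i}$, $\dot{\hat\theta}_i=\tau_{i,r_i}$, $i=1,\dots,N$, where the functions $\alpha_{i,k},\tau_{i,k}$ are defined recursively in the context. Assume that all the eigenvalues of $A$ are semi-simple with zero real parts, and that the digraph $\bar{\mathcal G}$ contains a directed spanning tree with node $v_0$ as its root. Then all signals in the closed-loop system are globally uniformly bounded, and asymptotic consensus tracking of all the subsystems' outputs to $y_0$ is achieved, i.e., $\lim_{t\to\infty}[y_i(t)-y_0(t)]=0$ for $i=1,\dots,N$.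
   Context: Data. For $i=1,\dots,N$: orders $r_i\ge 1$ (possibly different), state $x_i=[x_{i,1},\dots,x_{i,r_i}]^T\in\mathbb{R}^{r_i}$, input $u_i\in\mathbb{R}$, output $y_i\in\mathbb{R}$, unknown constant vector $\theta_i\in\mathbb{R}^{m_i}$, known smooth functions $\psi_{i,l}:\mathbb{R}^l\to\mathbb{R}^{m_i}$. Leader: $x_0\in\mathbb{R}^\nu$, $A\in\mathbb{R}^{\nu\times\nu}$, $C\in\mathbb{R}^{1\times\nu}$. Standing assumption: $(A,C)$ is detectable. Compensator states are $\eta_{i,l}\in\mathbb{R}^\nu$, $l=1,\dots,r_i+1$; $K\in\mathbb{R}^{\nu\times1}$; $\hat\theta_i\in\mathbb{R}^{m_i}$ is the estimate of $\theta_i$. Graph. $\bar{\mathcal{G}}=\{\bar{\mathcal V},\bar{\mathcal E}\}$ is a digraph with nodes $\bar{\mathcal V}=\{v_0,v_1,\dots,v_N\}$ ($v_0$ the leader, $v_i$ the $i$th subsystem), and weighted adjacency matrix $[a_{ij}]_{i,j=0}^N$ with nonnegative entries, $a_{ii}=0$, and, for $i=1,\dots,N$, $j=0,\dots,N$, $a_{ij}>0$ if and only if $(v_j,v_i)\in\bar{\mathcal E}$ (an edge from $v_j$ to $v_i$). Gain design. Let $\hat{\mathcal H}=\hat{\mathcal L}+\hat\Delta$, a square matrix of size $\sum_{i=1}^N(r_i+1)$, where $\hat{\mathcal L}=[\hat L_{ij}]_{i,j=1}^N$ is the block matrix such that: $\hat L_{ii}\in\mathbb{R}^{(r_i+1)\times(r_i+1)}$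 has $1$ in diagonal positions $1,\dots,r_i$, $-1$ in positions $(l,l+1)$ for $l=1,\dots,r_i$, $\sum_{j=1}^N a_{ij}$ in position $(r_i+1,r_i+1)$, and zeros elsewhere; for $i\ne j$, $\hat L_{ij}\in\mathbb{R}^{(r_i+1)\times(r_j+1)}$ has $-a_{ij}$ in position $(r_i+1,1)$ and zeros elsewhere; and $\hat\Delta=\mathrm{diag}\{\hat\Delta_1,\dots,\hat\Delta_N\}$ with $\hat\Delta_i=\mathrm{diag}\{0,\dots,0,a_{i0}\}\in\mathbb{R}^{(r_i+1)\times(r_i+1)}$. Under the spanning tree assumption all eigenvalues of $\hat{\mathcal H}$ have positive real parts; $\lambda_1(\hat{\mathcal H})$ denotes an eigenvalue with the smallest real part. $P_0=P_0^T>0$ is the unique positive definite solution of $AP_0+P_0A^T+I_\nu-P_0C^TCP_0=0$, and $K=\mu P_0C^T$ with $\mu\ge 1/\mathrm{Re}\{\lambda_1(\hat{\mathcal H})\}$. Controller (adaptive backstepping). Let $c_{i,l}>0$, $l=1,\dots,r_i$, be design constants. Errors: $\hat e_{i,1}=y_i-\hat y_i$ and $\hat e_{i,l}=x_{i,l}-\alpha_{i,l-1}$ for $l=2,\dots,r_i$. First step: $$\tau_{i,1}=\psi_{i,1}\hat e_{i,1},\qquad \alpha_{i,1}=-c_{i,1}\hat e_{i,1}-\psi_{i,1}^T\hat\theta_i+CA\eta_{i,1}-CKC(\eta_{i,1}-\eta_{i,2}).$$ For $k=2,\dots,r_i$, with $w_{i,k}:=\psi_{i,k}-\sum_{l=1}^{k-1}\psi_{i,l}\frac{\partial\alpha_{i,k-1}}{\partial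 x_{i,l}}$: $$\tau_{i,k}=\tau_{i,k-1}+w_{i,k}\hat e_{i,k},$$ $$\alpha_{i,k}=-c_{i,k}\hat e_{i,k}-\hat e_{i,k-1}-\psi_{i,k}^T\hat\theta_i+\sum_{l=1}^{k-1}\frac{\partial\alpha_{i,k-1}}{\partial x_{i,l}}(x_{i,l+1}+\psi_{i,l}^T\hat\theta_i)+\sum_{l=1}^{k}\frac{\partial\alpha_{i,k-1}}{\partial\eta_{i,l}^T}[A\eta_{i,l}-KC(\eta_{i,l}-\eta_{i,l+1})]+\frac{\partial\alpha_{i,k-1}}{\partial\hat\theta_i^T}\tau_{i,k}+\sum_{l=2}^{k-1}\hat e_{i,l}\frac{\partial\alpha_{i,l-1}}{\partial\hat\theta_i^T}w_{i,k}.$$ Here $\alpha_{i,k}$ is regarded as a function of $x_{i,1},\dots,x_{i,k},\eta_{i,1},\dots,\eta_{i,k+1},\hat\theta_i$; $\partial\alpha/\partial\eta_{i,l}^T$ and $\partial\alpha/\partial\hat\theta_i^T$ are row vectors of partial derivatives; empty sums are zero. The control and update laws are $u_i=\alpha_{i,r_i}$, $\dot{\hat\theta}_i=\tau_{i,r_i}$ (for $r_i=1$ these are the first-step formulas). Globally uniformly bounded: for arbitrary initial conditions the solution exists for all $t\ge0$ and all signals ($x_0$, $x_i$, $\eta_{i,l}$, $\hat\theta_i$, $u_i$) are bounded on $[0,\infty)$, with a bound that depends only on a bound on the size of the initial condition. *)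

theory Defs
  imports
    "HOL-Analysis.Derivative"
    "HOL-Analysis.Function_Topology"
    "Jordan_Normal_Form.Matrix_Kernel"
    "Jordan_Normal_Form.Char_Poly"
    "Graph_Theory.Graph_Theory"
begin

(* the bullet is the scalar product of the vectors of Jordan_Normal_Form *)
no_notation inner (infix \<open>\<bullet>\<close> 70)

text \<open>
  Conventions. Subsystems, chain positions and their data carry the 1-based indices of the
  mathematical text, with subsystem index 0 reserved for the leader; the components of vectors and
  matrices of the Jordan_Normal_Form library are 0-based. Vectors of \<open>\<real>\<^sup>\<nu>\<close> and of the parameter
  spaces are elements of \<open>carrier_vec\<close>, while the chain state \<open>x\<^sub>1, \<dots>, x\<^sub>l\<close> of a subsystem is the
  initial part of a function on natural numbers.
\<close>


section \<open>Smooth functions of finitely many real variables\<close>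

text \<open>A function of the \<open>l\<close> real variables \<open>x 1, \<dots>, x l\<close> is a function on \<open>nat \<Rightarrow> real\<close> that
  ignores all other coordinates. For such a function, continuity for the product topology on
  \<open>nat \<Rightarrow> real\<close> is continuity on \<open>\<real>\<^sup>l\<close>.\<close>

definition depends_on_first :: "nat \<Rightarrow> ((nat \<Rightarrow> real) \<Rightarrow> 'a) \<Rightarrow> bool" where
  "depends_on_first l f \<longleftrightarrow> (\<forall>x y. (\<forall>p\<in>{1..l}. x p = y p) \<longrightarrow> f x = f y)"

primrec Ck_fun :: "nat \<Rightarrow> nat \<Rightarrow> ((nat \<Rightarrow> real) \<Rightarrow> real) \<Rightarrow> bool" where
  "Ck_fun l 0 f \<longleftrightarrow> continuous_on UNIV f"
| "Ck_fun l (Suc k) f \<longleftrightarrow> continuous_on UNIV f \<and>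
     (\<forall>p\<in>{1..l}. (\<forall>x. (\<lambda>s. f (x(p := s))) differentiable at (x p)) \<and>
        Ck_fun l k (\<lambda>x. deriv (\<lambda>s. f (x(p := s))) (x p)))"

definition smooth_map :: "nat \<Rightarrow> nat \<Rightarrow> ((nat \<Rightarrow> real) \<Rightarrow> real vec) \<Rightarrow> bool" where
  "smooth_map l m f \<longleftrightarrow> depends_on_first l f \<and> (\<forall>x. f x \<in> carrier_vec m) \<and>
     (\<forall>q<m. \<forall>k. Ck_fun l k (\<lambda>x. f x $ q))"


section \<open>Matrices and digraphs\<close>

abbreviation cmat :: "real mat \<Rightarrow> complex mat" where
  "cmat M \<equiv> map_mat complex_of_real M"

definition detectable :: "nat \<Rightarrow> real mat \<Rightarrow> real mat \<Rightarrow> bool" where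
  "detectable \<nu> A C \<longleftrightarrow> (\<exists>L\<in>carrier_mat \<nu> 1. \<forall>z. eigenvalue (cmat (A - L * C)) z \<longrightarrow> Re z < 0)"

text \<open>Algebraic and geometric multiplicity coincide.\<close>

definition semisimple_eigenvalue :: "complex mat \<Rightarrow> complex \<Rightarrow> bool" where
  "semisimple_eigenvalue M z \<longleftrightarrow>
     eigenvalue M z \<and> order z (char_poly M) = kernel_dim (char_matrix M z)"

definition pos_def_mat :: "nat \<Rightarrow> real mat \<Rightarrow> bool" where
  "pos_def_mat n P \<longleftrightarrow> P \<in> carrier_mat n n \<and> transpose_mat P = P \<and>
     (\<forall>v\<in>carrier_vec n. v \<noteq> 0\<^sub>v n \<longrightarrow> v \<bullet> (P *\<^sub>v v) > 0)"

text \<open>The library's \<open>spanning_tree\<close> is about symmetric digraphs, so directed trees are introduced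
  here: every node except the root has exactly one parent, and all nodes are reachable from
  the root.\<close>

definition directed_tree :: "('a, 'b) pre_digraph \<Rightarrow> 'a \<Rightarrow> bool" where
  "directed_tree T u \<longleftrightarrow> wf_digraph T \<and> u \<in> verts T \<and> in_arcs T u = {} \<and>
     (\<forall>v\<in>verts T - {u}. in_degree T v = 1) \<and> (\<forall>v\<in>verts T. u \<rightarrow>\<^sup>*\<^bsub>T\<^esub> v)"

definition has_directed_spanning_tree :: "('a, 'b) pre_digraph \<Rightarrow> 'a \<Rightarrow> bool" where
  "has_directed_spanning_tree G u \<longleftrightarrow> (\<exists>T. spanning T G \<and> directed_tree T u)"

text \<open>The rows and columns of the block matrices below are listed in the order of \<open>block_index\<close>:
  block \<open>i\<close> ranges over \<open>{1..N}\<close>, and the position inside block \<open>i\<close> over \<open>{1..r i + 1}\<close>.\<close>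

definition block_index :: "nat \<Rightarrow> (nat \<Rightarrow> nat) \<Rightarrow> (nat \<times> nat) list" where
  "block_index N r = concat (map (\<lambda>i. map (Pair i) [1..<r i + 2]) [1..<N + 1])"

definition block_mat ::
  "nat \<Rightarrow> (nat \<Rightarrow> nat) \<Rightarrow> (nat \<Rightarrow> nat \<Rightarrow> nat \<Rightarrow> nat \<Rightarrow> real) \<Rightarrow> real mat" where
  "block_mat N r B =
     (let ix = block_index N r; n = length ix
      in mat n n (\<lambda>(p, q). B (fst (ix ! p)) (fst (ix ! q)) (snd (ix ! p)) (snd (ix ! q))))"

definition L_block ::
  "nat \<Rightarrow> (nat \<Rightarrow> nat) \<Rightarrow> (nat \<Rightarrow> nat \<Rightarrow> real) \<Rightarrow> nat \<Rightarrow> nat \<Rightarrow> nat \<Rightarrow> nat \<Rightarrow> real" where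
  "L_block N r a i j k l =
     (if i = j then
        (if k \<le> r i then (if l = k then 1 else if l = k + 1 then - 1 else 0)
         else (if l = r i + 1 then (\<Sum>j'=1..N. a i j') else 0))
      else (if k = r i + 1 \<and> l = 1 then - a i j else 0))"

definition Delta_block ::
  "(nat \<Rightarrow> nat) \<Rightarrow> (nat \<Rightarrow> nat \<Rightarrow> real) \<Rightarrow> nat \<Rightarrow> nat \<Rightarrow> nat \<Rightarrow> nat \<Rightarrow> real" where
  "Delta_block r a i j k l = (if i = j \<and> k = r i + 1 \<and> l = r i + 1 then a i 0 else 0)"

definition H_hat :: "nat \<Rightarrow> (nat \<Rightarrow> nat) \<Rightarrow> (nat \<Rightarrow> nat \<Rightarrow> real) \<Rightarrow> real mat" where
  "H_hat N r a = block_mat N r (L_block N r a) + block_mat N r (Delta_block r a)"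


section \<open>Signals of the closed loop\<close>

record agent_state =
  plant :: "nat \<Rightarrow> real"        \<comment> \<open>\<open>x\<^sub>l\<close>\<close>
  compens :: "nat \<Rightarrow> real vec"     \<comment> \<open>\<open>\<eta>\<^sub>l\<close>\<close>
  estim :: "real vec"           \<comment> \<open>parameter estimate\<close>

record net_state =
  leader :: "real vec"
  agent :: "nat \<Rightarrow> agent_state"

definition vec_has_derivative ::
  "nat \<Rightarrow> (real \<Rightarrow> real vec) \<Rightarrow> real vec \<Rightarrow> real \<Rightarrow> real set \<Rightarrow> bool" where
  "vec_has_derivative n f D t S \<longleftrightarrow>
     (\<forall>q<n. ((\<lambda>s. f s $ q) has_real_derivative D $ q) (at t within S))"

definition d_plant :: "(agent_state \<Rightarrow> real) \<Rightarrow> nat \<Rightarrow> agent_state \<Rightarrow> real" where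
  "d_plant f l z = deriv (\<lambda>s. f (z\<lparr>plant := (plant z)(l := s)\<rparr>)) (plant z l)"

definition d_comp :: "nat \<Rightarrow> (agent_state \<Rightarrow> real) \<Rightarrow> nat \<Rightarrow> agent_state \<Rightarrow> real vec" where
  "d_comp n f l z = vec n (\<lambda>q.
     deriv (\<lambda>s. f (z\<lparr>compens := (compens z)(l := update_vec (compens z l) q s)\<rparr>)) (compens z l $ q))"

definition d_estim :: "nat \<Rightarrow> (agent_state \<Rightarrow> real) \<Rightarrow> agent_state \<Rightarrow> real vec" where
  "d_estim n f z = vec n (\<lambda>q.
     deriv (\<lambda>s. f (z\<lparr>estim := update_vec (estim z) q s\<rparr>)) (estim z $ q))"


section \<open>Adaptive backstepping for one subsystem\<close>

locale backstepping =
  fixes \<nu> :: nat and A C K :: "real mat"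
    and m :: nat and c :: "nat \<Rightarrow> real" and \<psi> :: "nat \<Rightarrow> (nat \<Rightarrow> real) \<Rightarrow> real vec"
begin

definition eta_rhs :: "nat \<Rightarrow> agent_state \<Rightarrow> real vec" where
  "eta_rhs l z = A *\<^sub>v compens z l - (K * C) *\<^sub>v (compens z l - compens z (l + 1))"

text \<open>\<open>err k\<close>, \<open>reg k\<close>, \<open>tau k\<close> and \<open>alpha k\<close> are the error, the regressor \<open>w\<^sub>k\<close>, the tuning
  function and the stabilizing function of step \<open>k \<ge> 1\<close>. The branch \<open>k \<le> 1\<close> is step 1; \<open>k = 0\<close> is
  never used.\<close>

function err :: "nat \<Rightarrow> agent_state \<Rightarrow> real"
  and reg :: "nat \<Rightarrow> agent_state \<Rightarrow> real vec"
  and tau :: "nat \<Rightarrow> agent_state \<Rightarrow> real vec"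
  and alpha :: "nat \<Rightarrow> agent_state \<Rightarrow> real" where
  "err k = (\<lambda>z.
     if k \<le> 1 then plant z 1 - (C *\<^sub>v compens z 1) $ 0
     else plant z k - alpha (k - 1) z)"
| "reg k = (\<lambda>z.
     if k \<le> 1 then \<psi> k (plant z)
     else vec m (\<lambda>q. \<psi> k (plant z) $ q
       - (\<Sum>l=1..k - 1. \<psi> l (plant z) $ q * d_plant (alpha (k - 1)) l z)))"
| "tau k = (\<lambda>z.
     if k \<le> 1 then err k z \<cdot>\<^sub>v \<psi> k (plant z)
     else tau (k - 1) z + err k z \<cdot>\<^sub>v reg k z)"
| "alpha k = (\<lambda>z.
     if k \<le> 1 then
       - c k * err k z - \<psi> k (plant z) \<bullet> estim z
       + (C *\<^sub>v (A *\<^sub>v compens z 1)) $ 0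
       - (C *\<^sub>v ((K * C) *\<^sub>v (compens z 1 - compens z 2))) $ 0
     else
       - c k * err k z - err (k - 1) z - \<psi> k (plant z) \<bullet> estim z
       + (\<Sum>l=1..k - 1. d_plant (alpha (k - 1)) l z
            * (plant z (l + 1) + \<psi> l (plant z) \<bullet> estim z))
       + (\<Sum>l=1..k. d_comp \<nu> (alpha (k - 1)) l z \<bullet> eta_rhs l z)
       + d_estim m (alpha (k - 1)) z \<bullet> tau k z
       + (\<Sum>l=2..k - 1. err l z * (d_estim m (alpha (l - 1)) z \<bullet> reg k z)))"
  by pat_completeness auto
termination
  by (relation "measure (\<lambda>x. case x of
        Inl (Inl k) \<Rightarrow> 3 * k | Inl (Inr k) \<Rightarrow> 3 * k
      | Inr (Inl k) \<Rightarrow> 3 * k + 1 | Inr (Inr k) \<Rightarrow> 3 * k + 2)") auto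

declare err.simps [simp del] reg.simps [simp del] tau.simps [simp del] alpha.simps [simp del]

end


section \<open>The closed-loop network\<close>

locale closed_loop =
  fixes \<nu> :: nat                                  \<comment> \<open>order of the leader\<close>
    and A C K :: "real mat"
    and N :: nat                                  \<comment> \<open>number of subsystems\<close>
    and r :: "nat \<Rightarrow> nat"                         \<comment> \<open>orders of the subsystems\<close>
    and m :: "nat \<Rightarrow> nat"                         \<comment> \<open>numbers of unknown parameters\<close>
    and a :: "nat \<Rightarrow> nat \<Rightarrow> real"                 \<comment> \<open>weighted adjacency matrix\<close>
    and c :: "nat \<Rightarrow> nat \<Rightarrow> real"                 \<comment> \<open>design constants\<close>
    and \<psi> :: "nat \<Rightarrow> nat \<Rightarrow> (nat \<Rightarrow> real) \<Rightarrow> real vec"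
    and \<theta> :: "nat \<Rightarrow> real vec"                    \<comment> \<open>unknown parameters\<close>
begin

text \<open>Index 0 gives the output of the leader.\<close>

definition sys_output :: "net_state \<Rightarrow> nat \<Rightarrow> real" where
  "sys_output z j = (if j = 0 then (C *\<^sub>v leader z) $ 0 else plant (agent z j) 1)"

definition control :: "nat \<Rightarrow> net_state \<Rightarrow> real" where
  "control i z = backstepping.alpha \<nu> A C K (m i) (c i) (\<psi> i) (r i) (agent z i)"

definition update_law :: "nat \<Rightarrow> net_state \<Rightarrow> real vec" where
  "update_law i z = backstepping.tau \<nu> A C K (m i) (c i) (\<psi> i) (r i) (agent z i)"

definition last_eta_rhs :: "nat \<Rightarrow> net_state \<Rightarrow> real vec" where
  "last_eta_rhs i z =
     (let \<eta> = compens (agent z i) in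
        A *\<^sub>v \<eta> (r i + 1)
        - (\<Sum>j=0..N. a i j) \<cdot>\<^sub>v ((K * C) *\<^sub>v (\<eta> (r i + 1) - \<eta> 1))
        - (\<Sum>j=0..N. a i j * (sys_output z i - sys_output z j)) \<cdot>\<^sub>v col K 0)"

definition state_space :: "net_state set" where
  "state_space = {z. leader z \<in> carrier_vec \<nu> \<and>
     (\<forall>i\<in>{1..N}. (\<forall>l\<in>{1..r i + 1}. compens (agent z i) l \<in> carrier_vec \<nu>) \<and>
        estim (agent z i) \<in> carrier_vec (m i))}"

definition solution_on :: "real set \<Rightarrow> (real \<Rightarrow> net_state) \<Rightarrow> bool" where
  "solution_on S z \<longleftrightarrow> (\<forall>t\<in>S. z t \<in> state_space \<and>
     vec_has_derivative \<nu> (\<lambda>s. leader (z s)) (A *\<^sub>v leader (z t)) t S \<and>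
     (\<forall>i\<in>{1..N}. let x = plant (agent (z t) i) in
        (\<forall>l\<in>{1..<r i}. ((\<lambda>s. plant (agent (z s) i) l) has_real_derivative
             x (l + 1) + \<psi> i l x \<bullet> \<theta> i) (at t within S)) \<and>
        ((\<lambda>s. plant (agent (z s) i) (r i)) has_real_derivative
             control i (z t) + \<psi> i (r i) x \<bullet> \<theta> i) (at t within S) \<and>
        (\<forall>l\<in>{1..r i}. vec_has_derivative \<nu> (\<lambda>s. compens (agent (z s) i) l)
             (backstepping.eta_rhs A C K l (agent (z t) i)) t S) \<and>
        vec_has_derivative \<nu> (\<lambda>s. compens (agent (z s) i) (r i + 1)) (last_eta_rhs i (z t)) t S \<and>
        vec_has_derivative (m i) (\<lambda>s. estim (agent (z s) i)) (update_law i (z t)) t S))"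

text \<open>A \<open>net_state\<close> also has components outside the index ranges of the network; they carry no
  meaning, so states are compared and measured on the relevant components only.\<close>

definition same_state :: "net_state \<Rightarrow> net_state \<Rightarrow> bool" where
  "same_state z z' \<longleftrightarrow> leader z = leader z' \<and>
     (\<forall>i\<in>{1..N}. (\<forall>l\<in>{1..r i}. plant (agent z i) l = plant (agent z' i) l) \<and>
        (\<forall>l\<in>{1..r i + 1}. compens (agent z i) l = compens (agent z' i) l) \<and>
        estim (agent z i) = estim (agent z' i))"

definition vec_bounded :: "real \<Rightarrow> real vec \<Rightarrow> bool" where
  "vec_bounded B v \<longleftrightarrow> (\<forall>q<dim_vec v. \<bar>v $ q\<bar> \<le> B)"

definition state_bounded :: "real \<Rightarrow> net_state \<Rightarrow> bool" where
  "state_bounded B z \<longleftrightarrow> vec_bounded B (leader z) \<and>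
     (\<forall>i\<in>{1..N}. (\<forall>l\<in>{1..r i}. \<bar>plant (agent z i) l\<bar> \<le> B) \<and>
        (\<forall>l\<in>{1..r i + 1}. vec_bounded B (compens (agent z i) l)) \<and>
        vec_bounded B (estim (agent z i)))"

text \<open>From every initial state there is a solution on \<open>[0, \<infinity>)\<close>, and every solution with the same
  initial state on a bounded interval is a part of it.\<close>

definition forward_complete :: bool where
  "forward_complete \<longleftrightarrow> (\<forall>z\<^sub>0\<in>state_space. \<exists>z. solution_on {0..} z \<and> z 0 = z\<^sub>0 \<and>
     (\<forall>T>0. \<forall>z'. solution_on {0..<T} z' \<and> z' 0 = z\<^sub>0 \<longrightarrow>
        (\<forall>t\<in>{0..<T}. same_state (z' t) (z t))))"

definition globally_uniformly_bounded :: bool where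
  "globally_uniformly_bounded \<longleftrightarrow> forward_complete \<and>
     (\<forall>R. \<exists>B. \<forall>z. solution_on {0..} z \<and> state_bounded R (z 0) \<longrightarrow>
        (\<forall>t\<ge>0. state_bounded B (z t) \<and> (\<forall>i\<in>{1..N}. \<bar>control i (z t)\<bar> \<le> B)))"

definition consensus_tracking :: bool where
  "consensus_tracking \<longleftrightarrow> (\<forall>z. solution_on {0..} z \<longrightarrow>
     (\<forall>i\<in>{1..N}. ((\<lambda>t. sys_output (z t) i - sys_output (z t) 0) \<longlongrightarrow> 0) at_top))"

end

end

theory Submission
  imports
    "HOL-Analysis.Henstock_Kurzweil_Integration"
    "Jordan_Normal_Form.Jordan_Normal_Form_Uniqueness"
    "Jordan_Normal_Form.Jordan_Normal_Form_Existence"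
    Defs
begin

text \<open>The argument separates the uncertain chains from the compensators.

\<^emph>\<open>Chains.\<close> Write \<open>e\<^sub>k\<close> for the backstepping errors of a subsystem, \<open>w\<^sub>k\<close> for its regressors and
\<open>\<vartheta>\<close> for the estimate of \<open>\<theta>\<close>. The stabilizing functions contain the motion of the compensators
exactly, so that the errors obey
\<open>e\<^sub>k' = - c\<^sub>k e\<^sub>k - e\<^sub>k\<^sub>-\<^sub>1 + e\<^sub>k\<^sub>+\<^sub>1 + w\<^sub>k \<bullet> (\<theta> - \<vartheta>)\<close> up to terms caused by the update law, and no
compensator signal appears (\<open>err_has_derivative\<close>). In the derivative of
\<open>V = (\<Sum> e\<^sub>k\<^sup>2) / 2 + \<bar>\<theta> - \<vartheta>\<bar>\<^sup>2 / 2\<close> the products of neighbouring errors cancel in pairs, the terms of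
the update law cancel after exchanging the order of a double sum (\<open>backstepping_cancellation\<close>), and
the parameter terms cancel because \<open>\<vartheta>\<close> moves with \<open>\<Sum> e\<^sub>k w\<^sub>k\<close>. What remains is \<open>- \<Sum> c\<^sub>k e\<^sub>k\<^sup>2\<close>
(\<open>lyap_has_derivative\<close>). Hence errors and estimates stay bounded, whatever the rest of the network
does.

\<^emph>\<open>Compensators.\<close> Since \<open>y\<^sub>i - y\<^sub>0\<close> is \<open>e\<^sub>i\<^sub>,\<^sub>1\<close> plus the output of \<open>\<eta>\<^sub>i\<^sub>,\<^sub>1 - x\<^sub>0\<close>, the deviations
\<open>\<zeta> = \<eta> - x\<^sub>0\<close> solve a linear system with matrix \<open>I \<otimes> A - H \<otimes> K C\<close> whose input is a linear function of
the first errors (\<open>coupled_deviation\<close>); \<open>H\<close> is the matrix of the gain design. Its eigenvalues have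
positive real part: for any other eigenvalue the largest modulus among the entries of an eigenvector
would spread backwards along the edges of the graph to the root, whose entry counts as 0
(\<open>H_hat_eigenvalue_pos\<close>). In complex coordinates in which \<open>H\<close> is upper triangular, each block of
\<open>\<zeta>\<close> is governed by \<open>A - \<lambda> K C\<close> and driven by the later blocks. The Riccati equation makes
\<open>v \<bullet> P\<^sub>0\<^sup>-\<^sup>1 v\<close> decay along every such block, because \<open>\<mu> Re \<lambda> \<ge> 1\<close> leaves a surplus that absorbs the
later blocks (\<open>complex_quad_rate\<close>, \<open>coupled_scalar_cascade\<close>). Solving the resulting cascade of
scalar inequalities from the last block to the first shows that bounded inputs give bounded
deviations and vanishing inputs give vanishing deviations (\<open>coupled_bounded\<close>, \<open>coupled_tendsto_0\<close>).

\<^emph>\<open>Conclusion.\<close> The leader is bounded because \<open>A\<close> is diagonalizable over the complex numbers with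
imaginary eigenvalues (\<open>semisimple_flow_bounded\<close>), so the compensators are bounded. The chain
states follow one after the other from \<open>x\<^sub>1 = e\<^sub>1 + C \<eta>\<^sub>1\<close> and \<open>x\<^sub>k\<^sub>+\<^sub>1 = e\<^sub>k\<^sub>+\<^sub>1 + \<alpha>\<^sub>k\<close>, where \<open>\<alpha>\<^sub>k\<close> is a
continuous function of states already known to be bounded (\<open>plant_bounded\<close>). The resulting bound
holds on every time interval from 0 on and depends only on the size of the initial state
(\<open>trajectories_bounded\<close>). The vector field is Lipschitz on bounded sets, so an a priori bound yields
a global solution (\<open>flow_solution_exists\<close>), and this solution is unique. Finally \<open>V\<close> is
bounded below and dissipates \<open>e\<^sub>1\<^sup>2\<close>, and the derivative of \<open>e\<^sub>1\<close> is bounded; hence \<open>e\<^sub>1\<close> tends to 0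
(\<open>dissipated_signal_tendsto_0\<close>), then the input of the deviations and the deviations themselves tend
to 0, and so does \<open>y\<^sub>i - y\<^sub>0\<close>.\<close>

(* \<open>$\<close>, the bullet and \<open>vec\<close> denote operations on the vectors of Jordan_Normal_Form. *)
no_notation Finite_Cartesian_Product.vec.vec_nth (infixl \<open>$\<close> 90)
no_notation inner (infix \<open>\<bullet>\<close> 70)
hide_type (open) Finite_Cartesian_Product.vec
hide_const (open) Finite_Cartesian_Product.vec

section \<open>Scalar differential inequalities\<close>

text \<open>Derivatives are taken within the time set \<open>S\<close> on which a trajectory is defined, so that the same
lemmas serve the half line and half-open intervals.\<close>

lemma nonincreasing_of_deriv_nonpos:
  fixes V :: "real \<Rightarrow> real"
  assumes "s \<le> t" "{s..t} \<subseteq> S"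
    and der: "\<And>x. x \<in> {s..t} \<Longrightarrow> (V has_real_derivative V' x) (at x within S)"
    and np: "\<And>x. x \<in> {s..t} \<Longrightarrow> V' x \<le> 0"
  shows "V t \<le> V s"
proof -
  have "\<exists>x\<in>{s..t}. V t - V s = V' x * (t - s)"
    using assms(1)
    by (rule mvt_very_simple)
      (use der assms(2) in \<open>auto intro: has_derivative_subset simp: has_field_derivative_def\<close>)
  then show ?thesis
    using np \<open>s \<le> t\<close> by (smt (verit, best) mult_nonneg_nonpos mult.commute)
qed

text \<open>The function \<open>exp (\<epsilon> t) (V t - G / \<epsilon>)\<close> is nonincreasing. Negative \<open>\<epsilon>\<close> is allowed and gives
Gronwall's growth estimate.\<close>

lemma comparison_decay:
  fixes V :: "real \<Rightarrow> real"
  assumes "s \<le> t" "{s..t} \<subseteq> S" "\<epsilon> \<noteq> 0"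
    and der: "\<And>x. x \<in> {s..t} \<Longrightarrow> (V has_real_derivative V' x) (at x within S)"
    and le: "\<And>x. x \<in> {s..t} \<Longrightarrow> V' x \<le> - \<epsilon> * V x + G"
  shows "V t \<le> G / \<epsilon> + exp (- \<epsilon> * (t - s)) * (V s - G / \<epsilon>)"
proof -
  have "exp (\<epsilon> * t) * (V t - G / \<epsilon>) \<le> exp (\<epsilon> * s) * (V s - G / \<epsilon>)"
  proof (rule nonincreasing_of_deriv_nonpos[OF assms(1,2)])
    fix x assume x: "x \<in> {s..t}"
    show "((\<lambda>x. exp (\<epsilon> * x) * (V x - G / \<epsilon>)) has_real_derivative
       exp (\<epsilon> * x) * (\<epsilon> * V x - G + V' x)) (at x within S)"
      using \<open>\<epsilon> \<noteq> 0\<close> by (auto intro!: derivative_eq_intros der[OF x] simp: algebra_simps)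
    show "exp (\<epsilon> * x) * (\<epsilon> * V x - G + V' x) \<le> 0"
      using le[OF x] by (intro mult_nonneg_nonpos) auto
  qed
  then have "exp (- \<epsilon> * t) * (exp (\<epsilon> * t) * (V t - G / \<epsilon>))
      \<le> exp (- \<epsilon> * t) * (exp (\<epsilon> * s) * (V s - G / \<epsilon>))"
    by (intro mult_left_mono) auto
  moreover have "exp (- \<epsilon> * t) * exp (\<epsilon> * t) = 1"
    unfolding exp_add[symmetric] by simp
  moreover have "exp (- \<epsilon> * t) * exp (\<epsilon> * s) = exp (- \<epsilon> * (t - s))"
    unfolding exp_add[symmetric] by (simp add: algebra_simps)
  ultimately have "V t - G / \<epsilon> \<le> exp (- \<epsilon> * (t - s)) * (V s - G / \<epsilon>)"
    unfolding mult.assoc[symmetric] by (simp only: mult_1_left)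
  then show ?thesis by linarith
qed

lemma comparison_bounded:
  fixes V :: "real \<Rightarrow> real"
  assumes "s \<le> t" "{s..t} \<subseteq> S" "0 < \<epsilon>" "0 \<le> G" "0 \<le> V s"
    and der: "\<And>x. x \<in> {s..t} \<Longrightarrow> (V has_real_derivative V' x) (at x within S)"
    and le: "\<And>x. x \<in> {s..t} \<Longrightarrow> V' x \<le> - \<epsilon> * V x + G"
  shows "V t \<le> G / \<epsilon> + exp (- \<epsilon> * (t - s)) * V s" and "V t \<le> G / \<epsilon> + V s"
proof -
  have "V t \<le> G / \<epsilon> + exp (- \<epsilon> * (t - s)) * (V s - G / \<epsilon>)"
    using assms by (intro comparison_decay[of s t S \<epsilon> V V' G]) auto
  moreover have "exp (- \<epsilon> * (t - s)) * (V s - G / \<epsilon>) \<le> exp (- \<epsilon> * (t - s)) * V s"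
    using assms by (intro mult_left_mono) (auto simp: divide_nonneg_pos)
  ultimately show *: "V t \<le> G / \<epsilon> + exp (- \<epsilon> * (t - s)) * V s" by linarith
  have "exp (- \<epsilon> * (t - s)) * V s \<le> V s"
    using assms by (intro mult_left_le_one_le) auto
  with * show "V t \<le> G / \<epsilon> + V s" by simp
qed

text \<open>After the time at which \<open>g\<close> has become small, \<open>V\<close> decays to within a small distance of 0.\<close>

lemma comparison_tendsto_0:
  fixes V :: "real \<Rightarrow> real"
  assumes "0 < \<epsilon>" "\<And>t. 0 \<le> t \<Longrightarrow> 0 \<le> V t"
    and der: "\<And>x. 0 \<le> x \<Longrightarrow> (V has_real_derivative V' x) (at x within {0..})"
    and le: "\<And>x. 0 \<le> x \<Longrightarrow> V' x \<le> - \<epsilon> * V x + g x"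
    and g: "(g \<longlongrightarrow> 0) at_top"
  shows "(V \<longlongrightarrow> 0) at_top"
proof (rule tendstoI)
  fix e :: real assume "0 < e"
  define G where "G = \<epsilon> * e / 2"
  have "0 < G" using \<open>0 < e\<close> assms(1) by (simp add: G_def)
  from order_tendstoD(2)[OF g this] obtain T\<^sub>1 where T\<^sub>1: "\<And>t. t \<ge> T\<^sub>1 \<Longrightarrow> g t < G"
    by (auto simp: eventually_at_top_linorder)
  define T where "T = max T\<^sub>1 0"
  have bd: "V t \<le> e / 2 + exp (- \<epsilon> * (t - T)) * V T" if "t \<ge> T" for t
  proof -
    have le': "V' x \<le> - \<epsilon> * V x + G" if "T \<le> x" for x
      using le[of x] T\<^sub>1[of x] that by (auto simp: T_def)
    have "V t \<le> G / \<epsilon> + exp (- \<epsilon> * (t - T)) * V T"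
      using that \<open>0 < G\<close> assms(1)
      by (intro comparison_bounded(1)[where S = "{0..}" and V' = V'])
        (use der le' assms(2) in \<open>auto simp: T_def\<close>)
    then show ?thesis using assms(1) by (simp add: G_def)
  qed
  have "((\<lambda>t. exp (- \<epsilon> * (t - T)) * V T) \<longlongrightarrow> 0) at_top"
    using assms(1) by real_asymp
  from order_tendstoD(2)[OF this, of "e / 2"] \<open>0 < e\<close>
  have "eventually (\<lambda>t. exp (- \<epsilon> * (t - T)) * V T < e / 2) at_top" by simp
  then show "eventually (\<lambda>t. dist (V t) 0 < e) at_top"
    using eventually_ge_at_top[of T]
  proof eventually_elim
    case (elim t)
    then have "0 \<le> V t" using assms(2) by (simp add: T_def)
    with bd[of t] elim show ?case by simp
  qed
qed

lemma gronwall_zero: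
  fixes D :: "real \<Rightarrow> real"
  assumes "s \<le> t" "{s..t} \<subseteq> S" "D s = 0" "0 \<le> D t"
    and der: "\<And>x. x \<in> {s..t} \<Longrightarrow> (D has_real_derivative D' x) (at x within S)"
    and le: "\<And>x. x \<in> {s..t} \<Longrightarrow> D' x \<le> k * D x" and "k > 0"
  shows "D t = 0"
proof -
  have le': "D' x \<le> - (- k) * D x + 0" if "x \<in> {s..t}" for x using le[OF that] by simp
  have "D t \<le> 0 / (- k) + exp (- (- k) * (t - s)) * (D s - 0 / (- k))"
    by (rule comparison_decay[where S = S and V' = D', OF assms(1,2) _ der le'])
      (use \<open>k > 0\<close> in linarith)
  also have "\<dots> = 0"
    unfolding \<open>D s = 0\<close> div_0 diff_self mult_zero_right add_0 by (rule refl)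
  finally show ?thesis using \<open>0 \<le> D t\<close> by (rule antisym)
qed

text \<open>A form of Barbalat's lemma. A signal with bounded derivative that is at least \<open>d\<close> at some instant
remains above \<open>d / 2\<close> for a fixed length of time. Each such occurrence costs a fixed amount of the
nonnegative, nonincreasing function \<open>W\<close>, which is impossible once \<open>W\<close> is close to its infimum.\<close>

lemma dissipated_signal_tendsto_0:
  fixes W e :: "real \<Rightarrow> real"
  assumes "0 < k" and W0: "\<And>t. 0 \<le> t \<Longrightarrow> 0 \<le> W t"
    and derW: "\<And>t. 0 \<le> t \<Longrightarrow> (W has_real_derivative W' t) (at t within {0..})"
    and W': "\<And>t. 0 \<le> t \<Longrightarrow> W' t \<le> - k * (e t)\<^sup>2"
    and dere: "\<And>t. 0 \<le> t \<Longrightarrow> (e has_real_derivative e' t) (at t within {0..})"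
    and e': "\<And>t. 0 \<le> t \<Longrightarrow> \<bar>e' t\<bar> \<le> D"
  shows "(e \<longlongrightarrow> 0) at_top"
proof -
  have W'_np: "W' t \<le> 0" if "0 \<le> t" for t
  proof -
    have "0 \<le> k * (e t)\<^sup>2" using \<open>0 < k\<close> by simp
    with W'[OF that] show ?thesis by linarith
  qed
  have mono: "W t \<le> W s" if "0 \<le> s" "s \<le> t" for s t
    by (rule nonincreasing_of_deriv_nonpos[where S = "{0..}" and V' = W'])
      (use that in \<open>auto simp: derW W'_np\<close>)
  define L where "L = Inf (W ` {0..})"
  have bdd: "bdd_below (W ` {0..})" using W0 by (auto intro!: bdd_belowI[of _ 0])
  have L: "L \<le> W t" if "0 \<le> t" for t
    unfolding L_def using that by (intro cInf_lower bdd) auto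
  have Wlim: "\<exists>T\<ge>0. \<forall>t\<ge>T. W t < L + d" if "0 < d" for d
  proof -
    have "Inf (W ` {0..}) < L + d" using that by (simp add: L_def)
    then obtain T where "T \<ge> 0" "W T < L + d"
      using cInf_lessD[of "W ` {0..}" "L + d"] by auto
    then show ?thesis using mono by (intro exI[of _ T]) (auto intro: le_less_trans)
  qed
  \<comment> \<open>a positive Lipschitz constant, so that it can be divided by\<close>
  define D' where "D' = max D 1"
  have D': "0 < D'" "\<And>t. 0 \<le> t \<Longrightarrow> \<bar>e' t\<bar> \<le> D'"
    using e' by (auto simp: D'_def le_max_iff_disj)
  have lip: "\<bar>e t - e s\<bar> \<le> D' * (t - s)" if "0 \<le> s" "s \<le> t" for s t
  proof -
    have "\<exists>x\<in>{s..t}. e t - e s = e' x * (t - s)"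
      using that(2)
      by (rule mvt_very_simple)
        (use that in \<open>auto intro!: has_derivative_subset[OF dere[unfolded has_field_derivative_def]]\<close>)
    then obtain x where x: "x \<in> {s..t}" "e t - e s = e' x * (t - s)" by blast
    have "\<bar>e' x\<bar> * (t - s) \<le> D' * (t - s)"
      using x that D'(2) by (intro mult_right_mono) auto
    then show ?thesis using x that by (simp add: abs_mult)
  qed
  show ?thesis
  proof (rule tendstoI)
    fix d :: real assume "0 < d"
    \<comment> \<open>in time \<open>h\<close> the signal changes by at most \<open>d / 2\<close>; \<open>drop\<close> is the loss of \<open>W\<close> during that time\<close>
    define h where "h = d / (2 * D')"
    have "0 < h" using \<open>0 < d\<close> D' by (simp add: h_def)
    define drop where "drop = k * (d / 2)\<^sup>2 * h"
    have "0 < drop" using \<open>0 < h\<close> \<open>0 < k\<close> \<open>0 < d\<close> by (simp add: drop_def)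
    from Wlim[OF this] obtain T where T: "T \<ge> 0" "\<And>t. t \<ge> T \<Longrightarrow> W t < L + drop" by auto
    have "\<bar>e t\<bar> < d" if "t \<ge> T" for t
    proof (rule ccontr)
      assume "\<not> \<bar>e t\<bar> < d"
      have t: "0 \<le> t" using that T by simp
      have big: "d / 2 \<le> \<bar>e s\<bar>" if s: "s \<in> {t..t + h}" for s
      proof -
        have "\<bar>e s - e t\<bar> \<le> D' * (s - t)" using lip[of t s] t s by auto
        also have "\<dots> \<le> D' * h" using s D' by (intro mult_left_mono) auto
        also have "\<dots> = d / 2" using D' by (simp add: h_def)
        finally show ?thesis using \<open>\<not> \<bar>e t\<bar> < d\<close> by linarith
      qed
      have "W (t + h) + k * (d / 2)\<^sup>2 * (t + h) \<le> W t + k * (d / 2)\<^sup>2 * t"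
      proof (rule nonincreasing_of_deriv_nonpos[where S = "{0..}" and V = "\<lambda>x. W x + k * (d / 2)\<^sup>2 * x"
            and V' = "\<lambda>s. W' s + k * (d / 2)\<^sup>2"])
        fix s assume s: "s \<in> {t..t + h}"
        show "((\<lambda>x. W x + k * (d / 2)\<^sup>2 * x) has_real_derivative W' s + k * (d / 2)\<^sup>2) (at s within {0..})"
          using s t by (auto intro!: derivative_eq_intros derW)
        have "(d / 2)\<^sup>2 \<le> (e s)\<^sup>2" using big[OF s] \<open>0 < d\<close> by (simp add: abs_le_square_iff[symmetric])
        then have "k * (d / 2)\<^sup>2 \<le> k * (e s)\<^sup>2" using \<open>0 < k\<close> by (intro mult_left_mono) auto
        with W'[of s] s t show "W' s + k * (d / 2)\<^sup>2 \<le> 0" by auto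
      qed (use \<open>0 < h\<close> t in auto)
      then have "W (t + h) + drop \<le> W t" by (simp add: drop_def algebra_simps)
      moreover have "W t < L + drop" using T that by auto
      moreover have "L \<le> W (t + h)" using L t \<open>0 < h\<close> by auto
      ultimately show False by linarith
    qed
    then show "eventually (\<lambda>t. dist (e t) 0 < d) at_top"
      by (auto simp: eventually_at_top_linorder intro!: exI[of _ T])
  qed
qed

section \<open>Picard iteration for globally Lipschitz fields\<close>

text \<open>The type of indices may be infinite; only the coordinates in the finite set \<open>I\<close> move, the others
keep their initial values. The Picard iterates \<open>u n\<close> satisfy
\<open>\<bar>u (n + 1) t i - u n t i\<bar> \<le> M k\<^sup>n t\<^sup>n\<^sup>+\<^sup>1 / (n + 1)!\<close> with \<open>k = L \<bar>I\<bar>\<close>, hence they converge uniformly on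
every bounded interval, and no restriction to short times occurs.\<close>

lemma lipschitz_ode_exists:
  fixes F :: "('i \<Rightarrow> real) \<Rightarrow> 'i \<Rightarrow> real" and x\<^sub>0 :: "'i \<Rightarrow> real"
  assumes I: "finite I" and L: "0 \<le> L"
    and lip: "\<And>x y i. i \<in> I \<Longrightarrow> \<bar>F x i - F y i\<bar> \<le> L * (\<Sum>j\<in>I. \<bar>x j - y j\<bar>)"
  obtains x :: "real \<Rightarrow> 'i \<Rightarrow> real"
  where "\<And>i. x 0 i = x\<^sub>0 i"
    "\<And>i t. i \<in> I \<Longrightarrow> 0 \<le> t \<Longrightarrow> ((\<lambda>s. x s i) has_real_derivative F (x t) i) (at t within {0..})"
proof -
  have Fcont: "continuous_on S (\<lambda>s. F (u s) i)"
    if i: "i \<in> I" and u: "\<And>j. j \<in> I \<Longrightarrow> continuous_on S (\<lambda>s. u s j)"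
    for u :: "real \<Rightarrow> 'i \<Rightarrow> real" and i S
    unfolding continuous_on_def
  proof
    fix t assume t: "t \<in> S"
    have "((\<lambda>s. L * (\<Sum>j\<in>I. \<bar>u s j - u t j\<bar>)) \<longlongrightarrow> L * (\<Sum>j\<in>I. \<bar>u t j - u t j\<bar>)) (at t within S)"
      using u t by (intro tendsto_intros) (auto simp: continuous_on_def)
    then have "((\<lambda>s. L * (\<Sum>j\<in>I. \<bar>u s j - u t j\<bar>)) \<longlongrightarrow> 0) (at t within S)" by simp
    then have "((\<lambda>s. F (u s) i - F (u t) i) \<longlongrightarrow> 0) (at t within S)"
      by (rule Lim_null_comparison[rotated]) (simp add: lip[OF i])
    then show "((\<lambda>s. F (u s) i) \<longlongrightarrow> F (u t) i) (at t within S)"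
      by (simp add: LIM_zero_iff)
  qed
  define u :: "nat \<Rightarrow> real \<Rightarrow> 'i \<Rightarrow> real" where "u n = rec_nat (\<lambda>t. x\<^sub>0)
    (\<lambda>_ v t i. if i \<in> I then x\<^sub>0 i + integral {0..t} (\<lambda>s. F (v s) i) else x\<^sub>0 i) n" for n
  have u0: "u 0 t = x\<^sub>0" for t by (simp add: u_def)
  have uS: "u (Suc n) t i = x\<^sub>0 i + integral {0..t} (\<lambda>s. F (u n s) i)" if "i \<in> I" for n t i
    using that by (simp add: u_def)
  have uo: "u n t i = x\<^sub>0 i" if "i \<notin> I" for n t i
    using that by (cases n) (simp_all add: u_def)
  have ucont: "continuous_on {0..T} (\<lambda>s. u n s i)" if "i \<in> I" for n i T
    using that
  proof (induction n arbitrary: i)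
    case (Suc n)
    have "continuous_on {0..T} (\<lambda>s. F (u n s) i)"
      by (rule Fcont) (use Suc in auto)
    then have "continuous_on {0..T} (\<lambda>t. integral {0..t} (\<lambda>s. F (u n s) i))"
      by (intro indefinite_integral_continuous_1 integrable_continuous_real)
    then show ?case using Suc.prems by (auto simp: uS intro!: continuous_intros)
  qed (simp add: u0)
  have Fint: "(\<lambda>s. F (u n s) i) integrable_on {0..T}" if "i \<in> I" for n i T
    by (intro integrable_continuous_real Fcont ucont that)
  define M where "M = (\<Sum>i\<in>I. \<bar>F x\<^sub>0 i\<bar>)"
  have M: "\<bar>F x\<^sub>0 i\<bar> \<le> M" if "i \<in> I" for i
    unfolding M_def using that I by (intro member_le_sum) auto
  have "0 \<le> M" by (auto simp: M_def intro: sum_nonneg)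
  define k where "k = L * card I"
  have "0 \<le> k" using L by (simp add: k_def)
  have step: "\<bar>u (Suc n) t i - u n t i\<bar> \<le> M * k ^ n * t ^ Suc n / fact (Suc n)"
    if "i \<in> I" "0 \<le> t" for n t i
    using that
  proof (induction n arbitrary: i t)
    case 0
    then have "\<bar>F x\<^sub>0 i\<bar> * t \<le> M * t" using M by (intro mult_right_mono)
    then show ?case using 0 by (simp add: uS u0 abs_mult mult.commute)
  next
    case (Suc n)
    define g where "g s = L * (card I * (M * k ^ n * s ^ Suc n / fact (Suc n)))" for s :: real
    have gint: "(g has_integral M * k ^ Suc n * t ^ Suc (Suc n) / fact (Suc (Suc n))) {0..t}"
    proof -
      define G where "G s = M * k ^ Suc n * s ^ Suc (Suc n) / fact (Suc (Suc n))" for s :: real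
      have "(G has_vector_derivative g s) (at s within {0..t})" for s
      proof -
        define c where "c = M * k ^ Suc n / fact (Suc (Suc n))"
        have "((\<lambda>s. c * s ^ Suc (Suc n)) has_real_derivative c * (real (Suc (Suc n)) * s ^ Suc n))
            (at s within {0..t})"
          by (rule DERIV_cmult, rule DERIV_cong[OF DERIV_pow]) simp
        moreover have "(\<lambda>s. c * s ^ Suc (Suc n)) = G" by (simp add: c_def G_def fun_eq_iff)
        moreover have "c * real (Suc (Suc n)) = M * k ^ Suc n / fact (Suc n)"
          by (simp add: c_def fact_Suc[of "Suc n"] del: fact_Suc of_nat_Suc)
        then have "c * (real (Suc (Suc n)) * s ^ Suc n) = g s"
          by (simp add: mult.assoc[symmetric] g_def k_def del: fact_Suc of_nat_Suc)
        ultimately show ?thesis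
          by (simp add: has_real_derivative_iff_has_vector_derivative)
      qed
      then have "(g has_integral G t - G 0) {0..t}"
        using Suc.prems by (intro fundamental_theorem_of_calculus) auto
      then show ?thesis by (simp add: G_def)
    qed
    have "u (Suc (Suc n)) t i - u (Suc n) t i
        = integral {0..t} (\<lambda>s. F (u (Suc n) s) i - F (u n s) i)"
      using Suc.prems by (simp add: uS Henstock_Kurzweil_Integration.integral_diff Fint)
    also have "\<bar>\<dots>\<bar> \<le> integral {0..t} g"
      unfolding real_norm_def[symmetric]
    proof (rule integral_norm_bound_integral)
      show "(\<lambda>s. F (u (Suc n) s) i - F (u n s) i) integrable_on {0..t}"
        using Suc.prems by (intro integrable_diff Fint)
      show "g integrable_on {0..t}" using gint by blast
      fix s assume s: "s \<in> {0..t}"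
      have "\<bar>F (u (Suc n) s) i - F (u n s) i\<bar> \<le> L * (\<Sum>j\<in>I. \<bar>u (Suc n) s j - u n s j\<bar>)"
        by (rule lip) fact
      also have "\<dots> \<le> g s"
        unfolding g_def using L s
        by (intro mult_left_mono sum_bounded_above Suc.IH) auto
      finally show "norm (F (u (Suc n) s) i - F (u n s) i) \<le> g s" by simp
    qed
    also have "\<dots> = M * k ^ Suc n * t ^ Suc (Suc n) / fact (Suc (Suc n))"
      using gint by (rule integral_unique)
    finally show ?case .
  qed
  define x where "x t i = x\<^sub>0 i + (\<Sum>n. u (Suc n) t i - u n t i)" for t i
  have unif: "uniform_limit {0..T} (\<lambda>n t. u n t i) (\<lambda>t. x t i) sequentially"
    if i: "i \<in> I" and "0 \<le> T" for i T
  proof -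
    define b where "b n = M * T * ((k * T) ^ n /\<^sub>R fact n)" for n
    have "summable b" unfolding b_def by (intro summable_mult summable_exp_generic)
    moreover have "norm (u (Suc n) t i - u n t i) \<le> b n" if "t \<in> {0..T}" for n t
    proof -
      have "\<bar>u (Suc n) t i - u n t i\<bar> \<le> M * k ^ n * t ^ Suc n / fact (Suc n)"
        using step[OF i] that by auto
      also have "\<dots> \<le> M * k ^ n * T ^ Suc n / fact n"
        using that \<open>0 \<le> M\<close> \<open>0 \<le> k\<close>
        by (intro frac_le mult_left_mono power_mono fact_mono) auto
      also have "\<dots> = b n"
        by (simp add: b_def power_mult_distrib divide_inverse mult_ac)
      finally show ?thesis by simp
    qed
    ultimately have "uniform_limit {0..T} (\<lambda>n t. \<Sum>j<n. u (Suc j) t i - u j t i)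
      (\<lambda>t. \<Sum>j. u (Suc j) t i - u j t i) sequentially"
      by (intro Weierstrass_m_test)
    then have "uniform_limit {0..T} (\<lambda>n t. x\<^sub>0 i + (\<Sum>j<n. u (Suc j) t i - u j t i))
      (\<lambda>t. x\<^sub>0 i + (\<Sum>j. u (Suc j) t i - u j t i)) sequentially"
      by (intro uniform_limit_add uniform_limit_const)
    moreover have "x\<^sub>0 i + (\<Sum>j<n. u (Suc j) t i - u j t i) = u n t i" for n t
      using sum_lessThan_telescope[of "\<lambda>j. u j t i" n] by (simp add: u0)
    ultimately show ?thesis by (simp add: x_def[abs_def])
  qed
  have xcont: "continuous_on {0..T} (\<lambda>t. x t i)" if "i \<in> I" "0 \<le> T" for i T
    by (rule uniform_limit_theorem[OF _ unif]) (use that ucont in auto)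
  have xint: "x t i = x\<^sub>0 i + integral {0..t} (\<lambda>s. F (x s) i)" if i: "i \<in> I" and t: "0 \<le> t" for i t
  proof -
    have "uniform_limit {0..t} (\<lambda>n s. L * (\<Sum>j\<in>I. \<bar>u n s j - x s j\<bar>)) (\<lambda>s. 0) sequentially"
    proof (rule uniform_limitI)
      fix e :: real assume "0 < e"
      define d where "d = e / (k + 1)"
      have "0 < d" using \<open>0 < e\<close> \<open>0 \<le> k\<close> by (simp add: d_def)
      have "\<forall>\<^sub>F n in sequentially. \<forall>j\<in>I. \<forall>s\<in>{0..t}. dist (u n s j) (x s j) < d"
        using I unif[OF _ t] \<open>0 < d\<close> by (auto intro!: eventually_ball_finite uniform_limitD)
      then show "\<forall>\<^sub>F n in sequentially. \<forall>s\<in>{0..t}. dist (L * (\<Sum>j\<in>I. \<bar>u n s j - x s j\<bar>)) 0 < e"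
      proof eventually_elim
        case (elim n)
        show ?case
        proof
          fix s assume s: "s \<in> {0..t}"
          have "(\<Sum>j\<in>I. \<bar>u n s j - x s j\<bar>) \<le> card I * d"
            using elim s by (intro sum_bounded_above) (auto simp: dist_real_def less_imp_le)
          then have "L * (\<Sum>j\<in>I. \<bar>u n s j - x s j\<bar>) \<le> L * (card I * d)"
            using L by (intro mult_left_mono)
          also have "\<dots> = k * d" by (simp add: k_def)
          also have "\<dots> < (k + 1) * d" using \<open>0 < d\<close> by simp
          also have "\<dots> = e" using \<open>0 \<le> k\<close> by (simp add: d_def)
          finally show "dist (L * (\<Sum>j\<in>I. \<bar>u n s j - x s j\<bar>)) 0 < e"
            using L by (simp add: abs_mult sum_nonneg)
        qed
      qed
    qed
    then have "uniform_limit {0..t} (\<lambda>n s. F (u n s) i - F (x s) i) (\<lambda>s. 0) sequentially"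
      by (rule uniform_limit_null_comparison[rotated]) (use lip[OF i] in auto)
    from uniform_limit_add[OF this uniform_limit_const[where c = "\<lambda>s. F (x s) i"]]
    have ul: "uniform_limit {0..t} (\<lambda>n s. F (u n s) i) (\<lambda>s. F (x s) i) sequentially" by simp
    obtain J K where JK: "\<And>n. ((\<lambda>s. F (u n s) i) has_integral J n) {0..t}"
        "((\<lambda>s. F (x s) i) has_integral K) {0..t}" "J \<longlonglongrightarrow> K"
      by (rule uniform_limit_integral[OF ul]) (use Fcont[OF i] ucont in auto)
    then have "(\<lambda>n. u (Suc n) t i) \<longlonglongrightarrow> x\<^sub>0 i + integral {0..t} (\<lambda>s. F (x s) i)"
    proof -
      have "integral {0..t} (\<lambda>s. F (u n s) i) = J n" for n using JK(1) by (rule integral_unique)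
      moreover have "integral {0..t} (\<lambda>s. F (x s) i) = K" using JK(2) by (rule integral_unique)
      ultimately show ?thesis using i JK(3) by (simp add: uS tendsto_add)
    qed
    moreover have "(\<lambda>n. u (Suc n) t i) \<longlonglongrightarrow> x t i"
      using tendsto_uniform_limitI[OF unif[OF i t], of t] t by (intro LIMSEQ_Suc) auto
    ultimately show ?thesis by (metis LIMSEQ_unique)
  qed
  show thesis
  proof (rule that[of x])
    show "x 0 i = x\<^sub>0 i" for i
    proof (cases "i \<in> I")
      case True
      then show ?thesis using xint[of i 0] by simp
    next
      case False
      then show ?thesis by (simp add: x_def uo)
    qed
    show "((\<lambda>s. x s i) has_real_derivative F (x t) i) (at t within {0..})" if i: "i \<in> I" and t: "0 \<le> t" for i t
    proof -
      have c: "continuous_on {0..t + 1} (\<lambda>s. F (x s) i)"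
        using t by (intro Fcont i xcont) auto
      have "((\<lambda>s. x\<^sub>0 i + integral {0..s} (\<lambda>s. F (x s) i)) has_real_derivative 0 + F (x t) i)
          (at t within {0..t + 1})"
        by (intro DERIV_add DERIV_const integral_has_real_derivative[OF c]) (use t in auto)
      then have "((\<lambda>s. x s i) has_real_derivative F (x t) i) (at t within {0..t + 1})"
        unfolding add_0
        by (rule has_field_derivative_transform_within[where d = 1]) (use i t xint in auto)
      moreover have "at t within {0..t + 1} = at t within {0..}"
        by (rule at_within_nhd[of _ "{..<t + 1}"]) auto
      ultimately show ?thesis by simp
    qed
  qed
qed

section \<open>Fields that are Lipschitz on boxes\<close>

definition box_lipschitz :: "'i set \<Rightarrow> (('i \<Rightarrow> real) \<Rightarrow> real) \<Rightarrow> bool" where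
  "box_lipschitz I f \<longleftrightarrow> (\<forall>B. \<exists>L\<ge>0. \<forall>x y. (\<forall>j\<in>I. \<bar>x j\<bar> \<le> B \<and> \<bar>y j\<bar> \<le> B) \<longrightarrow>
     \<bar>f x - f y\<bar> \<le> L * (\<Sum>j\<in>I. \<bar>x j - y j\<bar>))"

definition flow_solution ::
  "'i set \<Rightarrow> (('i \<Rightarrow> real) \<Rightarrow> 'i \<Rightarrow> real) \<Rightarrow> real set \<Rightarrow> (real \<Rightarrow> 'i \<Rightarrow> real) \<Rightarrow> bool" where
  "flow_solution I F S x \<longleftrightarrow> (\<forall>t\<in>S. \<forall>i\<in>I. ((\<lambda>s. x s i) has_real_derivative F (x t) i) (at t within S))"

lemma box_lipschitz_uniform:
  assumes "finite I" and lip: "\<forall>i\<in>I. box_lipschitz I (\<lambda>x. F x i)"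
  shows "\<exists>L\<ge>0. \<forall>i\<in>I. \<forall>x y. (\<forall>j\<in>I. \<bar>x j\<bar> \<le> B \<and> \<bar>y j\<bar> \<le> B) \<longrightarrow>
     \<bar>F x i - F y i\<bar> \<le> L * (\<Sum>j\<in>I. \<bar>x j - y j\<bar>)"
proof -
  have "\<forall>i\<in>I. \<exists>L\<ge>0. \<forall>x y. (\<forall>j\<in>I. \<bar>x j\<bar> \<le> B \<and> \<bar>y j\<bar> \<le> B) \<longrightarrow>
     \<bar>F x i - F y i\<bar> \<le> L * (\<Sum>j\<in>I. \<bar>x j - y j\<bar>)"
    using lip unfolding box_lipschitz_def by blast
  then obtain l where l: "\<And>i. i \<in> I \<Longrightarrow> l i \<ge> 0"
    "\<And>i x y. i \<in> I \<Longrightarrow> (\<forall>j\<in>I. \<bar>x j\<bar> \<le> B \<and> \<bar>y j\<bar> \<le> B) \<Longrightarrow>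
     \<bar>F x i - F y i\<bar> \<le> l i * (\<Sum>j\<in>I. \<bar>x j - y j\<bar>)" by metis
  show ?thesis
  proof (intro exI[of _ "\<Sum>i\<in>I. l i"] conjI ballI allI impI)
    show "0 \<le> (\<Sum>i\<in>I. l i)" using l by (simp add: sum_nonneg)
    fix x y i assume i: "i \<in> I" and "\<forall>j\<in>I. \<bar>x j\<bar> \<le> B \<and> \<bar>y j\<bar> \<le> B"
    then have "\<bar>F x i - F y i\<bar> \<le> l i * (\<Sum>j\<in>I. \<bar>x j - y j\<bar>)" by (intro l)
    also have "\<dots> \<le> (\<Sum>i\<in>I. l i) * (\<Sum>j\<in>I. \<bar>x j - y j\<bar>)"
      using i l \<open>finite I\<close> by (intro mult_right_mono member_le_sum sum_nonneg) auto
    finally show "\<bar>F x i - F y i\<bar> \<le> (\<Sum>i\<in>I. l i) * (\<Sum>j\<in>I. \<bar>x j - y j\<bar>)" .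
  qed
qed

text \<open>Gronwall's inequality for \<open>\<Sum> (x\<^sub>i - y\<^sub>i)\<^sup>2\<close>.\<close>

lemma flow_solution_unique:
  fixes x y :: "real \<Rightarrow> 'i \<Rightarrow> real"
  assumes I: "finite I" and lip: "\<And>i. i \<in> I \<Longrightarrow> box_lipschitz I (\<lambda>x. F x i)"
    and x: "flow_solution I F {0..<T} x" and y: "flow_solution I F {0..<T} y"
    and init: "\<And>i. i \<in> I \<Longrightarrow> x 0 i = y 0 i"
    and x_bd: "\<And>t i. t \<in> {0..<T} \<Longrightarrow> i \<in> I \<Longrightarrow> \<bar>x t i\<bar> \<le> B"
    and y_bd: "\<And>t i. t \<in> {0..<T} \<Longrightarrow> i \<in> I \<Longrightarrow> \<bar>y t i\<bar> \<le> B"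
    and t: "t \<in> {0..<T}" and i: "i \<in> I"
  shows "x t i = y t i"
proof -
  obtain L where L0: "0 \<le> L" and L1: "\<forall>i\<in>I. \<forall>x y. (\<forall>j\<in>I. \<bar>x j\<bar> \<le> B \<and> \<bar>y j\<bar> \<le> B) \<longrightarrow>
     \<bar>F x i - F y i\<bar> \<le> L * (\<Sum>j\<in>I. \<bar>x j - y j\<bar>)"
    using box_lipschitz_uniform[of I F, OF I, where B = B] lip by blast
  have L2: "\<bar>F x i - F y i\<bar> \<le> L * (\<Sum>j\<in>I. \<bar>x j - y j\<bar>)"
    if "i \<in> I" "\<And>j. j \<in> I \<Longrightarrow> \<bar>x j\<bar> \<le> B" "\<And>j. j \<in> I \<Longrightarrow> \<bar>y j\<bar> \<le> B" for x y i
    by (rule L1[rule_format]) (simp_all add: that)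
  note L = L0 L2
  define D where "D s = (\<Sum>i\<in>I. (x s i - y s i)\<^sup>2)" for s
  \<comment> \<open>Cauchy-Schwarz turns the square of the sum of distances into \<open>card I\<close> times \<open>D\<close>;
    the summand 1 makes \<open>k\<close> positive\<close>
  define k where "k = 2 * L * card I + 1"
  have "D t = 0"
  proof (rule gronwall_zero[where D = D and s = 0 and S = "{0..<T}" and k = k
        and D' = "\<lambda>s. \<Sum>i\<in>I. 2 * (x s i - y s i) * (F (x s) i - F (y s) i)"])
    show "0 \<le> t" "{0..t} \<subseteq> {0..<T}" using t by auto
    show "D 0 = 0" using init by (simp add: D_def)
    show "0 \<le> D t" by (simp add: D_def sum_nonneg)
    show "k > 0" using L by (simp add: k_def add_nonneg_pos)
  next
    fix s assume "s \<in> {0..t}"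
    with t have s: "s \<in> {0..<T}" by auto
    have dx: "((\<lambda>s. x s i) has_real_derivative F (x s) i) (at s within {0..<T})"
      and dy: "((\<lambda>s. y s i) has_real_derivative F (y s) i) (at s within {0..<T})" if "i \<in> I" for i
      using x y s that by (auto simp: flow_solution_def)
    show "(D has_real_derivative (\<Sum>i\<in>I. 2 * (x s i - y s i) * (F (x s) i - F (y s) i)))
        (at s within {0..<T})"
      unfolding D_def
      by (intro DERIV_sum) (auto intro!: derivative_eq_intros dx dy)
    have "(\<Sum>i\<in>I. 2 * (x s i - y s i) * (F (x s) i - F (y s) i))
        \<le> (\<Sum>i\<in>I. 2 * \<bar>x s i - y s i\<bar> * (L * (\<Sum>j\<in>I. \<bar>x s j - y s j\<bar>)))"
    proof (rule sum_mono)
      fix i assume i: "i \<in> I"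
      have "2 * (x s i - y s i) * (F (x s) i - F (y s) i)
          \<le> \<bar>2 * (x s i - y s i) * (F (x s) i - F (y s) i)\<bar>" by simp
      also have "\<dots> = 2 * \<bar>x s i - y s i\<bar> * \<bar>F (x s) i - F (y s) i\<bar>"
        by (simp only: abs_mult abs_numeral)
      also have "\<dots> \<le> 2 * \<bar>x s i - y s i\<bar> * (L * (\<Sum>j\<in>I. \<bar>x s j - y s j\<bar>))"
        using i s by (intro mult_left_mono L x_bd y_bd) auto
      finally show "2 * (x s i - y s i) * (F (x s) i - F (y s) i)
        \<le> 2 * \<bar>x s i - y s i\<bar> * (L * (\<Sum>j\<in>I. \<bar>x s j - y s j\<bar>))" .
    qed
    also have "\<dots> = 2 * L * (\<Sum>i\<in>I. \<bar>x s i - y s i\<bar>)\<^sup>2"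
      by (simp add: sum_distrib_right[symmetric] sum_distrib_left[symmetric] power2_eq_square mult_ac)
    also have "\<dots> \<le> 2 * L * (D s * card I)"
      using sum_squared_le_sum_of_squares[of "\<lambda>i. \<bar>x s i - y s i\<bar>" I] L
      by (intro mult_left_mono) (auto simp: D_def)
    also have "\<dots> \<le> k * D s"
      by (simp add: k_def algebra_simps D_def sum_nonneg)
    finally show "(\<Sum>i\<in>I. 2 * (x s i - y s i) * (F (x s) i - F (y s) i)) \<le> k * D s" .
  qed
  then show ?thesis using I i by (simp add: D_def sum_nonneg_eq_0_iff)
qed

text \<open>Composing the field with the projection to a box makes it globally Lipschitz. A solution of the
truncated system solves the original one until it first reaches the boundary of the box, and up to
that time the a priori bound applies to it. As the box is larger than the bound, continuity shows
that the boundary is never reached.\<close>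

lemma flow_solution_exists:
  fixes x\<^sub>0 :: "'i \<Rightarrow> real"
  assumes I: "finite I" and lip: "\<And>i. i \<in> I \<Longrightarrow> box_lipschitz I (\<lambda>x. F x i)"
    and apriori: "\<And>T x t i. 0 < T \<Longrightarrow> flow_solution I F {0..<T} x \<Longrightarrow> (\<And>i. x 0 i = x\<^sub>0 i) \<Longrightarrow>
      t \<in> {0..<T} \<Longrightarrow> i \<in> I \<Longrightarrow> \<bar>x t i\<bar> \<le> B"
  obtains x where "flow_solution I F {0..} x" "\<And>i. x 0 i = x\<^sub>0 i"
proof -
  \<comment> \<open>the margin 1 separates the boundary of the box from the a priori bound\<close>
  define B' where "B' = max B (\<Sum>i\<in>I. \<bar>x\<^sub>0 i\<bar>) + 1"
  have "0 \<le> max B (\<Sum>i\<in>I. \<bar>x\<^sub>0 i\<bar>)" by (rule max.coboundedI2) (simp add: sum_nonneg)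
  then have "0 < B'" by (simp add: B'_def)
  have B'0: "\<bar>x\<^sub>0 i\<bar> < B'" if "i \<in> I" for i
    using member_le_sum[of i I "\<lambda>i. \<bar>x\<^sub>0 i\<bar>"] that I by (auto simp: B'_def)
  define clamp where "clamp x = (\<lambda>i::'i. max (- B') (min B' (x i)))" for x
  have clamp_bd: "\<bar>clamp x i\<bar> \<le> B'" for x i using \<open>0 < B'\<close> by (auto simp: clamp_def)
  have clamp_lip: "\<bar>clamp x i - clamp y i\<bar> \<le> \<bar>x i - y i\<bar>" for x y i by (auto simp: clamp_def)
  obtain L where L0: "0 \<le> L" and L1: "\<forall>i\<in>I. \<forall>x y. (\<forall>j\<in>I. \<bar>x j\<bar> \<le> B' \<and> \<bar>y j\<bar> \<le> B') \<longrightarrow>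
     \<bar>F x i - F y i\<bar> \<le> L * (\<Sum>j\<in>I. \<bar>x j - y j\<bar>)"
    using box_lipschitz_uniform[of I F, OF I, where B = B'] lip by blast
  have L2: "\<bar>F x i - F y i\<bar> \<le> L * (\<Sum>j\<in>I. \<bar>x j - y j\<bar>)"
    if "i \<in> I" "\<And>j. j \<in> I \<Longrightarrow> \<bar>x j\<bar> \<le> B'" "\<And>j. j \<in> I \<Longrightarrow> \<bar>y j\<bar> \<le> B'" for x y i
    by (rule L1[rule_format]) (simp_all add: that)
  note L = L0 L2
  have lip': "\<bar>F (clamp x) i - F (clamp y) i\<bar> \<le> L * (\<Sum>j\<in>I. \<bar>x j - y j\<bar>)" if "i \<in> I" for x y i
  proof -
    have "\<bar>F (clamp x) i - F (clamp y) i\<bar> \<le> L * (\<Sum>j\<in>I. \<bar>clamp x j - clamp y j\<bar>)"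
      by (rule L(2)[OF that clamp_bd clamp_bd])
    also have "\<dots> \<le> L * (\<Sum>j\<in>I. \<bar>x j - y j\<bar>)"
      by (rule mult_left_mono[OF sum_mono[OF clamp_lip] L(1)])
    finally show ?thesis .
  qed
  obtain x where x0: "\<And>i. x 0 i = x\<^sub>0 i" and
    dx: "\<And>i t. i \<in> I \<Longrightarrow> 0 \<le> t \<Longrightarrow>
      ((\<lambda>s. x s i) has_real_derivative F (clamp (x t)) i) (at t within {0..})"
    using lipschitz_ode_exists[OF I L(1), of "\<lambda>x. F (clamp x)" x\<^sub>0] lip' by blast
  have xcont: "continuous_on {0..} (\<lambda>t. x t i)" if "i \<in> I" for i
    by (rule DERIV_continuous_on) (use dx that in auto)
  \<comment> \<open>the times at which the truncation is about to become active\<close>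
  define E where "E = (\<Union>i\<in>I. {t\<in>{0..}. B' \<le> \<bar>x t i\<bar>})"
  have "E = {}"
  proof (rule ccontr)
    assume "E \<noteq> {}"
    have "closed E"
      unfolding E_def
      by (intro closed_UN[OF I] ballI continuous_on_closed_Collect_le continuous_intros xcont)
    moreover have bdd: "bdd_below E" by (auto simp: E_def intro: bdd_belowI[of _ 0])
    ultimately have "Inf E \<in> E" using \<open>E \<noteq> {}\<close> by (intro closed_contains_Inf)
    define T where "T = Inf E"
    from \<open>Inf E \<in> E\<close> obtain i where i: "i \<in> I" and "0 \<le> T" and big: "B' \<le> \<bar>x T i\<bar>"
      by (auto simp: E_def T_def)
    have "T \<noteq> 0" using big B'0[OF i] x0 by auto
    with \<open>0 \<le> T\<close> have "0 < T" by simp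
    have small: "\<bar>x t j\<bar> < B'" if "t \<in> {0..<T}" "j \<in> I" for t j
    proof (rule ccontr)
      assume "\<not> \<bar>x t j\<bar> < B'"
      then have "t \<in> E" using that by (auto simp: E_def not_less)
      then have "T \<le> t" unfolding T_def by (intro cInf_lower bdd)
      with that show False by simp
    qed
    have "flow_solution I F {0..<T} x"
      unfolding flow_solution_def
    proof (intro ballI)
      fix t j assume t: "t \<in> {0..<T}" and j: "j \<in> I"
      have "\<bar>F (x t) j - F (clamp (x t)) j\<bar> \<le> L * (\<Sum>l\<in>I. \<bar>x t l - clamp (x t) l\<bar>)"
        by (rule L(2)[OF j less_imp_le[OF small[OF t]] clamp_bd])
      moreover have "clamp (x t) l = x t l" if "l \<in> I" for l
        using small[OF t that] by (auto simp: clamp_def)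
      ultimately have "F (clamp (x t)) j = F (x t) j" by simp
      with dx[OF j, of t] t show "((\<lambda>s. x s j) has_real_derivative F (x t) j) (at t within {0..<T})"
        by (auto intro: has_field_derivative_subset)
    qed
    from apriori[OF \<open>0 < T\<close> this x0 _ i]
    have le: "\<bar>x t i\<bar> \<le> B" if "t \<in> {0..<T}" for t using that by blast
    have "((\<lambda>t. x t i) \<longlongrightarrow> x T i) (at T within {0..})"
      using xcont[OF i] \<open>0 \<le> T\<close> by (simp add: continuous_on_def)
    then have "((\<lambda>t. x t i) \<longlongrightarrow> x T i) (at T within {0..<T})"
      by (rule tendsto_within_subset) auto
    then have "((\<lambda>t. \<bar>x t i\<bar>) \<longlongrightarrow> \<bar>x T i\<bar>) (at T within {0..<T})"
      by (rule tendsto_rabs)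
    moreover have "\<forall>\<^sub>F t in at T within {0..<T}. \<bar>x t i\<bar> \<le> B"
      unfolding eventually_at_filter using le by (intro always_eventually) blast
    moreover have "at T within {0..<T} \<noteq> bot"
    proof -
      have "at T within {0..<T} = at_left T"
        by (rule at_within_nhd[of _ "{0<..}"]) (use \<open>0 < T\<close> in auto)
      then show ?thesis by simp
    qed
    ultimately have "\<bar>x T i\<bar> \<le> B" by (rule tendsto_upperbound)
    with big show False by (auto simp: B'_def)
  qed
  then have small: "\<bar>x t j\<bar> < B'" if "0 \<le> t" "j \<in> I" for t j
    using that by (force simp: E_def)
  have "flow_solution I F {0..} x"
    unfolding flow_solution_def
  proof (intro ballI)
    fix t j assume t: "t \<in> {0::real..}" and j: "j \<in> I"
    have "\<bar>F (x t) j - F (clamp (x t)) j\<bar> \<le> L * (\<Sum>l\<in>I. \<bar>x t l - clamp (x t) l\<bar>)"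
      by (rule L(2)[OF j less_imp_le[OF small] clamp_bd]) (use t in auto)
    moreover have "clamp (x t) l = x t l" if "l \<in> I" for l
      using small[of t l] that t by (auto simp: clamp_def)
    ultimately have "F (clamp (x t)) j = F (x t) j" by simp
    with dx[OF j, of t] t show "((\<lambda>s. x s j) has_real_derivative F (x t) j) (at t within {0..})"
      by auto
  qed
  then show thesis using that x0 by blast
qed

lemma box_lipschitz_const: "box_lipschitz I (\<lambda>x. c)"
  by (auto simp: box_lipschitz_def intro!: exI[of _ 0])

lemma box_lipschitz_coord:
  assumes "finite I" "i \<in> I" shows "box_lipschitz I (\<lambda>x. x i)"
  unfolding box_lipschitz_def
proof (intro allI exI[of _ 1] conjI impI)
  fix x y :: "_ \<Rightarrow> real"
  show "\<bar>x i - y i\<bar> \<le> 1 * (\<Sum>j\<in>I. \<bar>x j - y j\<bar>)"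
    using member_le_sum[of i I "\<lambda>j. \<bar>x j - y j\<bar>"] assms by auto
qed simp

lemma box_lipschitz_add:
  assumes "box_lipschitz I f" "box_lipschitz I g" shows "box_lipschitz I (\<lambda>x. f x + g x)"
  unfolding box_lipschitz_def
proof
  fix B
  obtain L where L: "L \<ge> 0" "\<And>x y. (\<forall>j\<in>I. \<bar>x j\<bar> \<le> B \<and> \<bar>y j\<bar> \<le> B) \<Longrightarrow>
     \<bar>f x - f y\<bar> \<le> L * (\<Sum>j\<in>I. \<bar>x j - y j\<bar>)" using assms(1) unfolding box_lipschitz_def by blast
  obtain M where M: "M \<ge> 0" "\<And>x y. (\<forall>j\<in>I. \<bar>x j\<bar> \<le> B \<and> \<bar>y j\<bar> \<le> B) \<Longrightarrow>
     \<bar>g x - g y\<bar> \<le> M * (\<Sum>j\<in>I. \<bar>x j - y j\<bar>)" using assms(2) unfolding box_lipschitz_def by blast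
  show "\<exists>L\<ge>0. \<forall>x y. (\<forall>j\<in>I. \<bar>x j\<bar> \<le> B \<and> \<bar>y j\<bar> \<le> B) \<longrightarrow>
     \<bar>f x + g x - (f y + g y)\<bar> \<le> L * (\<Sum>j\<in>I. \<bar>x j - y j\<bar>)"
  proof (intro exI[of _ "L + M"] conjI allI impI)
    fix x y assume "\<forall>j\<in>I. \<bar>x j\<bar> \<le> B \<and> \<bar>y j\<bar> \<le> B"
    from L(2)[OF this] M(2)[OF this]
    show "\<bar>f x + g x - (f y + g y)\<bar> \<le> (L + M) * (\<Sum>j\<in>I. \<bar>x j - y j\<bar>)"
      unfolding distrib_right by linarith
  qed (use L M in simp)
qed

lemma box_lipschitz_cmult:
  assumes "box_lipschitz I f" shows "box_lipschitz I (\<lambda>x. c * f x)"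
  unfolding box_lipschitz_def
proof
  fix B
  obtain L where L: "L \<ge> 0" "\<And>x y. (\<forall>j\<in>I. \<bar>x j\<bar> \<le> B \<and> \<bar>y j\<bar> \<le> B) \<Longrightarrow>
     \<bar>f x - f y\<bar> \<le> L * (\<Sum>j\<in>I. \<bar>x j - y j\<bar>)" using assms(1) unfolding box_lipschitz_def by blast
  show "\<exists>L\<ge>0. \<forall>x y. (\<forall>j\<in>I. \<bar>x j\<bar> \<le> B \<and> \<bar>y j\<bar> \<le> B) \<longrightarrow>
     \<bar>c * f x - c * f y\<bar> \<le> L * (\<Sum>j\<in>I. \<bar>x j - y j\<bar>)"
  proof (intro exI[of _ "\<bar>c\<bar> * L"] conjI allI impI)
    fix x y assume "\<forall>j\<in>I. \<bar>x j\<bar> \<le> B \<and> \<bar>y j\<bar> \<le> B"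
    from mult_left_mono[OF L(2)[OF this], of "\<bar>c\<bar>"]
    show "\<bar>c * f x - c * f y\<bar> \<le> \<bar>c\<bar> * L * (\<Sum>j\<in>I. \<bar>x j - y j\<bar>)"
      by (simp add: right_diff_distrib[symmetric] abs_mult mult.assoc)
  qed (use L in simp)
qed

lemma box_lipschitz_diff:
  assumes "box_lipschitz I f" "box_lipschitz I g" shows "box_lipschitz I (\<lambda>x. f x - g x)"
  using box_lipschitz_add[OF assms(1) box_lipschitz_cmult[OF assms(2), of "-1"]] by simp

lemma box_lipschitz_sum:
  assumes "\<And>a. a \<in> A \<Longrightarrow> box_lipschitz I (f a)" shows "box_lipschitz I (\<lambda>x. \<Sum>a\<in>A. f a x)"
  using assms by (induction A rule: infinite_finite_induct) (auto intro: box_lipschitz_const box_lipschitz_add)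

lemma box_lipschitz_reindex:
  assumes f: "box_lipschitz J f" and e: "inj e" "e ` J \<subseteq> I" "finite I"
  shows "box_lipschitz I (\<lambda>x. f (\<lambda>j. x (e j)))"
  unfolding box_lipschitz_def
proof
  fix B
  obtain L where L: "L \<ge> 0" "\<And>x y. (\<forall>j\<in>J. \<bar>x j\<bar> \<le> B \<and> \<bar>y j\<bar> \<le> B) \<Longrightarrow>
     \<bar>f x - f y\<bar> \<le> L * (\<Sum>j\<in>J. \<bar>x j - y j\<bar>)" using f unfolding box_lipschitz_def by blast
  show "\<exists>L\<ge>0. \<forall>x y. (\<forall>j\<in>I. \<bar>x j\<bar> \<le> B \<and> \<bar>y j\<bar> \<le> B) \<longrightarrow>
     \<bar>f (\<lambda>j. x (e j)) - f (\<lambda>j. y (e j))\<bar> \<le> L * (\<Sum>j\<in>I. \<bar>x j - y j\<bar>)"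
  proof (intro exI[of _ L] conjI allI impI)
    fix x y assume "\<forall>j\<in>I. \<bar>x j\<bar> \<le> B \<and> \<bar>y j\<bar> \<le> B"
    then have "\<bar>f (\<lambda>j. x (e j)) - f (\<lambda>j. y (e j))\<bar> \<le> L * (\<Sum>j\<in>J. \<bar>x (e j) - y (e j)\<bar>)"
      using e by (intro L) auto
    also have "(\<Sum>j\<in>J. \<bar>x (e j) - y (e j)\<bar>) = (\<Sum>j\<in>e ` J. \<bar>x j - y j\<bar>)"
      using e by (simp add: sum.reindex inj_on_subset)
    also have "L * \<dots> \<le> L * (\<Sum>j\<in>I. \<bar>x j - y j\<bar>)"
      using e L by (intro mult_left_mono sum_mono2) auto
    finally show "\<bar>f (\<lambda>j. x (e j)) - f (\<lambda>j. y (e j))\<bar> \<le> L * (\<Sum>j\<in>I. \<bar>x j - y j\<bar>)" .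
  qed (use L in simp)
qed

section \<open>Functions of class \<open>C\<^sup>k\<close> of coordinates and the chain rule\<close>

definition partial_deriv :: "'i \<Rightarrow> (('i \<Rightarrow> real) \<Rightarrow> real) \<Rightarrow> ('i \<Rightarrow> real) \<Rightarrow> real" where
  "partial_deriv p g x = deriv (\<lambda>s. g (x(p := s))) (x p)"

text \<open>Continuity refers to the product topology, whatever the number of coordinates. For a function of
finitely many of them this is the usual notion, and boxes are compact by Tychonoff's theorem.\<close>

primrec Ck :: "nat \<Rightarrow> (('i \<Rightarrow> real) \<Rightarrow> real) \<Rightarrow> bool" where
  "Ck 0 g \<longleftrightarrow> continuous_on UNIV g"
| "Ck (Suc k) g \<longleftrightarrow> continuous_on UNIV g \<and>
     (\<forall>p. (\<forall>x. (\<lambda>s. g (x(p := s))) differentiable at (x p)) \<and> Ck k (partial_deriv p g))"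

lemma Ck_continuous: "Ck k g \<Longrightarrow> continuous_on UNIV g"
  by (cases k) auto

lemma Ck_has_partial_deriv:
  assumes "Ck (Suc k) g"
  shows "((\<lambda>s. g (x(p := s))) has_real_derivative partial_deriv p g (x(p := s))) (at s)"
proof -
  have "(\<lambda>s. g (y(p := s))) differentiable at (y p)" for y
    using assms by auto
  from this[of "x(p := s)"] show ?thesis
    by (simp add: partial_deriv_def DERIV_deriv_iff_real_differentiable)
qed

lemma CkI:
  assumes "continuous_on UNIV g"
    and "\<And>p x. ((\<lambda>s. g (x(p := s))) has_real_derivative g' p x) (at (x p))"
    and "\<And>p. Ck k (g' p)"
  shows "Ck (Suc k) g" and "partial_deriv p g = g' p"
proof -
  have *: "partial_deriv p g = g' p" for p
    using assms(2) by (auto simp: partial_deriv_def intro!: ext DERIV_imp_deriv)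
  then show "partial_deriv p g = g' p" .
  show "Ck (Suc k) g"
    unfolding Ck.simps * real_differentiable_def using assms by blast
qed

lemma Ck_has_partial_deriv_at:
  assumes "Ck (Suc k) g"
  shows "((\<lambda>s. g (x(p := s))) has_real_derivative partial_deriv p g x) (at (x p))"
  using Ck_has_partial_deriv[OF assms, of x p "x p"] by simp

lemma Ck_Suc_imp: "Ck (Suc k) g \<Longrightarrow> Ck k g"
  by (induction k arbitrary: g) auto

lemma Ck_const: "Ck k (\<lambda>_. c)"
proof (induction k arbitrary: c)
  case (Suc k)
  show ?case by (rule CkI(1)[where g' = "\<lambda>_ _. 0"]) (use Suc in auto)
qed simp

lemma Ck_coord: "Ck k (\<lambda>x. x p)"
proof (cases k)
  case (Suc l)
  show ?thesis unfolding Suc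
    by (rule CkI(1)[where g' = "\<lambda>q _. if q = p then 1 else 0"])
      (auto intro: Ck_const)
qed simp

lemma Ck_add: "Ck k f \<Longrightarrow> Ck k g \<Longrightarrow> Ck k (\<lambda>x. f x + g x)"
proof (induction k arbitrary: f g)
  case (Suc k)
  show ?case
  proof (rule CkI(1))
    show "continuous_on UNIV (\<lambda>x. f x + g x)"
      using Suc.prems by (intro continuous_on_add Ck_continuous)
    show "((\<lambda>s. f (x(p := s)) + g (x(p := s))) has_real_derivative partial_deriv p f x + partial_deriv p g x) (at (x p))"
      for p x by (intro DERIV_add Ck_has_partial_deriv_at[OF Suc.prems(1)] Ck_has_partial_deriv_at[OF Suc.prems(2)])
    show "Ck k (\<lambda>x. partial_deriv p f x + partial_deriv p g x)" for p
      using Suc.prems by (intro Suc.IH) auto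
  qed
qed (auto intro: continuous_on_add)

lemma Ck_mult: "Ck k f \<Longrightarrow> Ck k g \<Longrightarrow> Ck k (\<lambda>x. f x * g x)"
proof (induction k arbitrary: f g)
  case (Suc k)
  show ?case
  proof (rule CkI(1))
    show "continuous_on UNIV (\<lambda>x. f x * g x)"
      using Suc.prems by (intro continuous_on_mult Ck_continuous)
    show "((\<lambda>s. f (x(p := s)) * g (x(p := s))) has_real_derivative partial_deriv p f x * g x + partial_deriv p g x * f x)
        (at (x p))" for p x
      using DERIV_mult[OF Ck_has_partial_deriv_at[OF Suc.prems(1), of x p] Ck_has_partial_deriv_at[OF Suc.prems(2), of x p]] by (simp only: fun_upd_triv)
    show "Ck k (\<lambda>x. partial_deriv p f x * g x + partial_deriv p g x * f x)" for p
      using Suc.prems Ck_Suc_imp[OF Suc.prems(1)] Ck_Suc_imp[OF Suc.prems(2)]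
      by (intro Ck_add Suc.IH) auto
  qed
qed (auto intro: continuous_on_mult)

lemma Ck_sum: "(\<And>a. a \<in> A \<Longrightarrow> Ck k (f a)) \<Longrightarrow> Ck k (\<lambda>x. \<Sum>a\<in>A. f a x)"
  by (induction A rule: infinite_finite_induct) (auto intro: Ck_const Ck_add)

lemma Ck_cmult: "Ck k f \<Longrightarrow> Ck k (\<lambda>x. c * f x)"
  by (intro Ck_mult Ck_const)

lemma Ck_diff: "Ck k f \<Longrightarrow> Ck k g \<Longrightarrow> Ck k (\<lambda>x. f x - g x)"
  using Ck_add[OF _ Ck_cmult[of k g "-1"], of f] by simp

text \<open>Transport from the smoothness notion for the functions \<open>\<psi>\<close> to \<open>Ck\<close>: the variables \<open>1, \<dots>, l\<close>
become the coordinates \<open>e 1, \<dots>, e l\<close>.\<close>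

lemma Ck_of_Ck_fun:
  fixes e :: "nat \<Rightarrow> 'i"
  assumes "inj e"
  shows "Ck_fun l k f \<Longrightarrow> depends_on_first l f \<Longrightarrow> Ck k (\<lambda>x. f (\<lambda>j. x (e j)))"
proof (induction k arbitrary: f)
  case 0
  have "continuous_on UNIV (f \<circ> (\<lambda>x j. x (e j)))"
    using 0 by (intro continuous_on_compose continuous_on_coordinatewise_then_product)
      (auto intro: continuous_on_subset)
  then show ?case by (simp add: o_def)
next
  case (Suc k)
  define f' where "f' j = (\<lambda>x. deriv (\<lambda>s. f (x(j := s))) (x j))" for j
  have dep: "f x = f y" if "\<And>p. p \<in> {1..l} \<Longrightarrow> x p = y p" for x y
    using Suc.prems(2) that by (auto simp: depends_on_first_def)
  have dep': "depends_on_first l (f' j)" if "j \<in> {1..l}" for j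
    unfolding depends_on_first_def
  proof (intro allI impI)
    fix x y :: "nat \<Rightarrow> real" assume *: "\<forall>p\<in>{1..l}. x p = y p"
    have "(\<lambda>s. f (x(j := s))) = (\<lambda>s. f (y(j := s)))"
      using * by (intro ext dep) auto
    with * that show "f' j x = f' j y" by (simp add: f'_def)
  qed
  \<comment> \<open>the partial derivative with respect to \<open>p\<close> is that of \<open>f\<close> in the variable placed at \<open>p\<close>,
    and 0 if there is none\<close>
  define g' where "g' p = (if \<exists>j\<in>{1..l}. p = e j then (\<lambda>x. f' (THE j. p = e j) (\<lambda>j. x (e j))) else (\<lambda>_. 0))" for p
  have g'1: "g' (e j) = (\<lambda>x. f' j (\<lambda>j. x (e j)))" if "j \<in> {1..l}" for j
  proof -
    have "(THE i. e j = e i) = j" using \<open>inj e\<close> by (auto dest: injD)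
    with that show ?thesis by (auto simp: g'_def)
  qed
  have g'2: "g' p = (\<lambda>_. 0)" if "\<And>j. j \<in> {1..l} \<Longrightarrow> p \<noteq> e j" for p
    using that by (auto simp: g'_def)
  show ?case
  proof (rule CkI(1)[where g' = g'])
    have "continuous_on UNIV (f \<circ> (\<lambda>x j. x (e j)))"
      using Suc.prems by (intro continuous_on_compose continuous_on_coordinatewise_then_product)
        (auto intro: continuous_on_subset)
    then show "continuous_on UNIV (\<lambda>x. f (\<lambda>j. x (e j)))" by (simp add: o_def)
  next
    fix p and x :: "'i \<Rightarrow> real"
    show "((\<lambda>s. f (\<lambda>j. (x(p := s)) (e j))) has_real_derivative g' p x) (at (x p))"
    proof (cases "\<exists>j\<in>{1..l}. p = e j")
      case True
      then obtain j where j: "j \<in> {1..l}" "p = e j" by blast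
      have "(\<lambda>i. (x(p := s)) (e i)) = (\<lambda>i. x (e i))(j := s)" for s
        using j \<open>inj e\<close> by (auto simp: fun_eq_iff dest: injD)
      moreover have "(\<lambda>s. f ((\<lambda>i. x (e i))(j := s))) differentiable at ((\<lambda>i. x (e i)) j)"
        using Suc.prems(1) j(1) unfolding Ck_fun.simps by blast
      ultimately show ?thesis
        using j by (simp add: g'1 f'_def DERIV_deriv_iff_real_differentiable)
    next
      case False
      then have "g' p = (\<lambda>_. 0)" by (intro g'2) blast
      moreover from False have "(\<lambda>s. f (\<lambda>j. (x(p := s)) (e j))) = (\<lambda>s. f (\<lambda>j. x (e j)))"
        by (intro ext dep) auto
      ultimately show ?thesis by simp
    qed
  next
    fix p
    show "Ck k (g' p)"
    proof (cases "\<exists>j\<in>{1..l}. p = e j")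
      case True
      then obtain j where j: "j \<in> {1..l}" "p = e j" by blast
      have "Ck_fun l k (f' j)" using Suc.prems(1) j(1) unfolding Ck_fun.simps f'_def by blast
      from Suc.IH[OF this dep'[OF j(1)]] show ?thesis using j by (simp add: g'1)
    next
      case False
      then have "g' p = (\<lambda>_. 0)" by (intro g'2) blast
      then show ?thesis by (simp add: Ck_const)
    qed
  qed
qed

text \<open>Move from \<open>x\<close> to \<open>y\<close> along the coordinate axes and use the mean value theorem on every segment. In
this way partial derivatives suffice and no total derivative is introduced; the intermediate point
\<open>\<xi> p\<close> depends on the segment \<open>p\<close>.\<close>

lemma coordinatewise_mean_value:
  fixes x y :: "'i \<Rightarrow> real"
  assumes "finite J" "Ck (Suc 0) g" "\<And>q. q \<notin> J \<Longrightarrow> y q = x q"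
  shows "\<exists>\<xi>. g y - g x = (\<Sum>p\<in>J. partial_deriv p g (\<xi> p) * (y p - x p)) \<and>
     (\<forall>p q. min (x q) (y q) \<le> \<xi> p q \<and> \<xi> p q \<le> max (x q) (y q))"
  using assms(1,3)
proof (induction J arbitrary: y rule: finite_induct)
  case empty
  then have "y = x" by auto
  then show ?case by (auto intro!: exI[of _ "\<lambda>_. x"])
next
  case (insert j J)
  define y' where "y' = y(j := x j)"
  have y': "y' q = x q" if "q \<notin> J" for q using insert that by (auto simp: y'_def)
  from insert.IH[OF this] obtain \<xi> where \<xi>: "g y' - g x = (\<Sum>p\<in>J. partial_deriv p g (\<xi> p) * (y' p - x p))"
    "\<And>p q. min (x q) (y' q) \<le> \<xi> p q" "\<And>p q. \<xi> p q \<le> max (x q) (y' q)" by blast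
  have "\<exists>z. min (x j) (y j) \<le> z \<and> z \<le> max (x j) (y j) \<and>
      g (y(j := y j)) - g (y(j := x j)) = partial_deriv j g (y(j := z)) * (y j - x j)"
  proof (cases "x j" "y j" rule: linorder_cases)
    case less
    from MVT2[OF this, of "\<lambda>s. g (y(j := s))" "\<lambda>s. partial_deriv j g (y(j := s))"] Ck_has_partial_deriv[OF assms(2)]
    obtain z where "x j < z" "z < y j"
      "g (y(j := y j)) - g (y(j := x j)) = (y j - x j) * partial_deriv j g (y(j := z))" by blast
    then show ?thesis by (intro exI[of _ z]) (auto simp: mult.commute)
  next
    case greater
    from MVT2[OF this, of "\<lambda>s. g (y(j := s))" "\<lambda>s. partial_deriv j g (y(j := s))"] Ck_has_partial_deriv[OF assms(2)]
    obtain z where "y j < z" "z < x j"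
      "g (y(j := x j)) - g (y(j := y j)) = (x j - y j) * partial_deriv j g (y(j := z))" by blast
    then show ?thesis by (intro exI[of _ z]) (auto simp: algebra_simps)
  qed auto
  then obtain z where z: "min (x j) (y j) \<le> z" "z \<le> max (x j) (y j)"
      "g y - g y' = partial_deriv j g (y(j := z)) * (y j - x j)" by (auto simp: y'_def)
  define \<xi>' where "\<xi>' = \<xi>(j := y(j := z))"
  have "(\<Sum>p\<in>J. partial_deriv p g (\<xi> p) * (y' p - x p)) = (\<Sum>p\<in>J. partial_deriv p g (\<xi>' p) * (y p - x p))"
    using insert.hyps by (intro sum.cong) (auto simp: \<xi>'_def y'_def)
  then have "g y - g x = (\<Sum>p\<in>insert j J. partial_deriv p g (\<xi>' p) * (y p - x p))"
    using \<xi>(1) z(3) insert.hyps by (simp add: \<xi>'_def)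
  moreover have "min (x q) (y q) \<le> \<xi>' p q \<and> \<xi>' p q \<le> max (x q) (y q)" for p q
    using \<xi>(2)[of q p] \<xi>(3)[of p q] z(1,2) by (auto simp: \<xi>'_def y'_def split: if_splits)
  ultimately show ?case by blast
qed

definition depends_on :: "'i set \<Rightarrow> (('i \<Rightarrow> real) \<Rightarrow> 'a) \<Rightarrow> bool" where
  "depends_on J g \<longleftrightarrow> (\<forall>x y. (\<forall>p\<in>J. x p = y p) \<longrightarrow> g x = g y)"

lemma depends_onD: "depends_on J g \<Longrightarrow> (\<And>p. p \<in> J \<Longrightarrow> x p = y p) \<Longrightarrow> g x = g y"
  by (auto simp: depends_on_def)

lemma compact_box: "compact {x :: 'i \<Rightarrow> real. \<forall>p. \<bar>x p\<bar> \<le> B}"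
proof -
  have "compactin (product_topology (\<lambda>_. euclidean) UNIV) (PiE (UNIV::'i set) (\<lambda>_. {-B..B::real}))"
    by (auto simp: compactin_PiE)
  moreover have "PiE (UNIV::'i set) (\<lambda>_. {-B..B::real}) = {x. \<forall>p. \<bar>x p\<bar> \<le> B}"
  proof -
    have "{-B..B} = {r. \<bar>r\<bar> \<le> B}" by auto
    then show ?thesis by (auto simp: PiE_iff)
  qed
  ultimately show ?thesis by (simp add: euclidean_product_topology)
qed

lemma continuous_bounded_on_box:
  fixes g :: "('i \<Rightarrow> real) \<Rightarrow> real"
  assumes "continuous_on UNIV g"
  shows "\<exists>M\<ge>0. \<forall>x. (\<forall>p. \<bar>x p\<bar> \<le> B) \<longrightarrow> \<bar>g x\<bar> \<le> M"
proof -
  have "compact (g ` {x. \<forall>p. \<bar>x p\<bar> \<le> B})"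
    by (intro compact_continuous_image compact_box continuous_on_subset[OF assms]) auto
  from compact_imp_bounded[OF this] obtain M where M: "\<forall>y\<in>g ` {x. \<forall>p. \<bar>x p\<bar> \<le> B}. norm y \<le> M"
    unfolding bounded_iff by blast
  show ?thesis
  proof (intro exI[of _ "max M 0"] conjI allI impI)
    fix x :: "'i \<Rightarrow> real" assume "\<forall>p. \<bar>x p\<bar> \<le> B"
    with M have "norm (g x) \<le> M" by blast
    then show "\<bar>g x\<bar> \<le> max M 0" by simp
  qed simp
qed

text \<open>Setting the irrelevant coordinates to 0 moves the argument into a box with all coordinates bounded.\<close>

lemma continuous_bounded_on_finite_box:
  fixes g :: "('i \<Rightarrow> real) \<Rightarrow> real"
  assumes "continuous_on UNIV g" "depends_on J g"
  shows "\<exists>M\<ge>0. \<forall>x. (\<forall>p\<in>J. \<bar>x p\<bar> \<le> B) \<longrightarrow> \<bar>g x\<bar> \<le> M"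
proof -
  obtain M where M: "0 \<le> M" "\<And>x. \<forall>p. \<bar>x p\<bar> \<le> max B 0 \<Longrightarrow> \<bar>g x\<bar> \<le> M"
    using continuous_bounded_on_box[OF assms(1), where B = "max B 0"] by blast
  show ?thesis
  proof (intro exI[of _ M] conjI allI impI M(1))
    fix x :: "'i \<Rightarrow> real" assume x: "\<forall>p\<in>J. \<bar>x p\<bar> \<le> B"
    have "g x = g (\<lambda>p. if p \<in> J then x p else 0)" by (rule depends_onD[OF assms(2)]) auto
    then show "\<bar>g x\<bar> \<le> M" using M(2)[of "\<lambda>p. if p \<in> J then x p else 0"] x
      by (auto simp: le_max_iff_disj)
  qed
qed

text \<open>The coordinatewise mean value theorem with bounds of the partial derivatives on the box.\<close>

lemma Ck_box_lipschitz:
  fixes g :: "('i \<Rightarrow> real) \<Rightarrow> real"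
  assumes "finite J" "Ck (Suc 0) g" "depends_on J g"
  shows "box_lipschitz J g"
  unfolding box_lipschitz_def
proof
  fix B
  have "\<exists>M\<ge>0. \<forall>x. (\<forall>q. \<bar>x q\<bar> \<le> max B 0) \<longrightarrow> \<bar>partial_deriv p g x\<bar> \<le> M" for p
  proof -
    have "continuous_on UNIV (partial_deriv p g)" using assms(2) by auto
    then show ?thesis by (rule continuous_bounded_on_box)
  qed
  then obtain M where M: "\<And>p. 0 \<le> M p" "\<And>p x. (\<forall>q. \<bar>x q\<bar> \<le> max B 0) \<Longrightarrow> \<bar>partial_deriv p g x\<bar> \<le> M p"
    by metis
  show "\<exists>L\<ge>0. \<forall>x y. (\<forall>j\<in>J. \<bar>x j\<bar> \<le> B \<and> \<bar>y j\<bar> \<le> B) \<longrightarrow>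
     \<bar>g x - g y\<bar> \<le> L * (\<Sum>j\<in>J. \<bar>x j - y j\<bar>)"
  proof (intro exI[of _ "\<Sum>p\<in>J. M p"] conjI allI impI)
    show "0 \<le> (\<Sum>p\<in>J. M p)" by (intro sum_nonneg M)
    fix x y :: "'i \<Rightarrow> real" assume xy: "\<forall>j\<in>J. \<bar>x j\<bar> \<le> B \<and> \<bar>y j\<bar> \<le> B"
    define x' where "x' p = (if p \<in> J then x p else 0)" for p
    define y' where "y' p = (if p \<in> J then y p else 0)" for p
    have gx: "g x = g x'" "g y = g y'"
      by (auto intro!: depends_onD[OF assms(3)] simp: x'_def y'_def)
    have "\<exists>\<xi>. g x' - g y' = (\<Sum>p\<in>J. partial_deriv p g (\<xi> p) * (x' p - y' p)) \<and>
     (\<forall>p q. min (y' q) (x' q) \<le> \<xi> p q \<and> \<xi> p q \<le> max (y' q) (x' q))"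
      by (rule coordinatewise_mean_value[OF assms(1,2)]) (simp add: x'_def y'_def)
    then obtain \<xi> where \<xi>: "g x' - g y' = (\<Sum>p\<in>J. partial_deriv p g (\<xi> p) * (x' p - y' p))"
      "\<And>p q. min (y' q) (x' q) \<le> \<xi> p q" "\<And>p q. \<xi> p q \<le> max (y' q) (x' q)" by blast
    have "\<bar>x' q\<bar> \<le> max B 0" "\<bar>y' q\<bar> \<le> max B 0" for q
      using xy by (auto simp: x'_def y'_def le_max_iff_disj)
    then have "\<bar>\<xi> p q\<bar> \<le> max B 0" for p q
      using \<xi>(2)[of q p] \<xi>(3)[of p q] unfolding abs_le_iff min_def max_def
      by (smt (verit, best))
    then have pdM: "\<bar>partial_deriv p g (\<xi> p)\<bar> \<le> M p" for p by (intro M) auto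
    have "\<bar>g x - g y\<bar> \<le> (\<Sum>p\<in>J. \<bar>partial_deriv p g (\<xi> p) * (x' p - y' p)\<bar>)"
      unfolding gx \<xi>(1) by (rule sum_abs)
    also have "\<dots> \<le> (\<Sum>p\<in>J. (\<Sum>p\<in>J. M p) * \<bar>x p - y p\<bar>)"
    proof (rule sum_mono)
      fix p assume p: "p \<in> J"
      have "\<bar>partial_deriv p g (\<xi> p)\<bar> \<le> (\<Sum>p\<in>J. M p)"
        by (rule order_trans[OF pdM member_le_sum[OF p]]) (use M(1) assms(1) in auto)
      then show "\<bar>partial_deriv p g (\<xi> p) * (x' p - y' p)\<bar> \<le> (\<Sum>p\<in>J. M p) * \<bar>x p - y p\<bar>"
        using p by (simp add: abs_mult x'_def y'_def mult_right_mono)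
    qed
    finally show "\<bar>g x - g y\<bar> \<le> (\<Sum>p\<in>J. M p) * (\<Sum>j\<in>J. \<bar>x j - y j\<bar>)"
      by (simp add: sum_distrib_left)
  qed
qed

text \<open>The difference quotient is written by the coordinatewise mean value theorem; the intermediate points
are squeezed between \<open>u t\<close> and \<open>u s\<close>, so continuity of the partial derivatives gives the limit.\<close>

lemma Ck_chain_rule:
  fixes g :: "('i \<Rightarrow> real) \<Rightarrow> real" and u :: "real \<Rightarrow> 'i \<Rightarrow> real"
  assumes J: "finite J" and g: "Ck (Suc 0) g" "depends_on J g"
    and u: "\<And>p. p \<in> J \<Longrightarrow> ((\<lambda>s. u s p) has_real_derivative d p) (at t within S)"
  shows "((\<lambda>s. g (u s)) has_real_derivative (\<Sum>p\<in>J. partial_deriv p g (u t) * d p)) (at t within S)"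
proof -
  \<comment> \<open>freezing the coordinates outside \<open>J\<close> makes all of \<open>v s\<close> converge to \<open>u t\<close>\<close>
  define v where "v s p = (if p \<in> J then u s p else u t p)" for s p
  have gv: "g (u s) = g (v s)" for s
    by (rule depends_onD[OF g(2)]) (simp add: v_def)
  have "\<forall>s. \<exists>\<xi>. g (v s) - g (v t) = (\<Sum>p\<in>J. partial_deriv p g (\<xi> p) * (v s p - v t p)) \<and>
     (\<forall>p q. min (v t q) (v s q) \<le> \<xi> p q \<and> \<xi> p q \<le> max (v t q) (v s q))"
    by (intro allI coordinatewise_mean_value[OF J g(1)]) (simp add: v_def)
  from choice[OF this] obtain \<xi> where \<xi>0:
    "\<forall>s. g (v s) - g (v t) = (\<Sum>p\<in>J. partial_deriv p g (\<xi> s p) * (v s p - v t p)) \<and>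
     (\<forall>p q. min (v t q) (v s q) \<le> \<xi> s p q \<and> \<xi> s p q \<le> max (v t q) (v s q))" ..
  then have \<xi>: "g (v s) - g (v t) = (\<Sum>p\<in>J. partial_deriv p g (\<xi> s p) * (v s p - v t p))"
    "min (v t q) (v s q) \<le> \<xi> s p q" "\<xi> s p q \<le> max (v t q) (v s q)" for s p q by blast+
  have vlim: "((\<lambda>s. v s q) \<longlongrightarrow> v t q) (at t within S)" for q
  proof (cases "q \<in> J")
    case True
    then have vu: "v s q = u s q" for s by (simp add: v_def)
    have "((\<lambda>s. u s q) \<longlongrightarrow> u t q) (at t within S)"
      using DERIV_continuous[OF u[OF True]] unfolding continuous_within .
    then show ?thesis unfolding vu .
  qed (simp add: v_def)
  have \<xi>lim: "((\<lambda>s. \<xi> s p q) \<longlongrightarrow> v t q) (at t within S)" for p q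
  proof (rule tendsto_sandwich)
    show "((\<lambda>s. min (v t q) (v s q)) \<longlongrightarrow> v t q) (at t within S)"
      using tendsto_min[OF tendsto_const vlim, of "v t q" q] unfolding min.idem .
    show "((\<lambda>s. max (v t q) (v s q)) \<longlongrightarrow> v t q) (at t within S)"
      using tendsto_max[OF tendsto_const vlim, of "v t q" q] unfolding max.idem .
  qed (use \<xi>(2,3) in auto)
  have "((\<lambda>s. \<xi> s p) \<longlongrightarrow> v t) (at t within S)" for p
  proof -
    have "limitin (product_topology (\<lambda>_. euclidean) UNIV) (\<lambda>s. \<xi> s p) (v t) (at t within S)"
      using \<xi>lim by (simp add: limitin_componentwise)
    then show ?thesis by (simp add: euclidean_product_topology)
  qed
  then have pdlim: "((\<lambda>s. partial_deriv p g (\<xi> s p)) \<longlongrightarrow> partial_deriv p g (v t)) (at t within S)" for p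
    using g(1) by (intro continuous_on_tendsto_compose[of UNIV "partial_deriv p g"]) auto
  have "((\<lambda>s. (v s p - v t p) / (s - t)) \<longlongrightarrow> d p) (at t within S)" if "p \<in> J" for p
  proof -
    have "(\<lambda>s. (v s p - v t p) / (s - t)) = (\<lambda>s. (u s p - u t p) / (s - t))"
      using that by (simp add: v_def)
    then show ?thesis using u[OF that] unfolding has_field_derivative_iff by (simp only:)
  qed
  then have "((\<lambda>s. \<Sum>p\<in>J. partial_deriv p g (\<xi> s p) * ((v s p - v t p) / (s - t))) \<longlongrightarrow>
      (\<Sum>p\<in>J. partial_deriv p g (v t) * d p)) (at t within S)"
    by (intro tendsto_sum tendsto_mult pdlim)
  then have "((\<lambda>s. (g (v s) - g (v t)) / (s - t)) \<longlongrightarrow> (\<Sum>p\<in>J. partial_deriv p g (v t) * d p)) (at t within S)"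
    unfolding \<xi>(1) sum_divide_distrib times_divide_eq_right .
  moreover have "v t = u t" by (auto simp: v_def)
  ultimately show ?thesis
    unfolding has_field_derivative_iff gv[symmetric] by (simp only:)
qed

section \<open>Smoothness and locality of the backstepping functions\<close>

text \<open>Names for the real coordinates of a subsystem. They allow functions of an \<open>agent_state\<close> to be
treated as functions of real variables.\<close>

datatype coord = Plant nat | Comp nat nat | Estim nat

definition flat :: "agent_state \<Rightarrow> coord \<Rightarrow> real" where
  "flat z p = (case p of Plant l \<Rightarrow> plant z l | Comp l q \<Rightarrow> compens z l $ q | Estim q \<Rightarrow> estim z $ q)"

definition unflat :: "nat \<Rightarrow> nat \<Rightarrow> (coord \<Rightarrow> real) \<Rightarrow> agent_state" where
  "unflat \<nu> m x = \<lparr>plant = (\<lambda>l. x (Plant l)), compens = (\<lambda>l. vec \<nu> (\<lambda>q. x (Comp l q))),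
     estim = vec m (\<lambda>q. x (Estim q))\<rparr>"

text \<open>The coordinates that step \<open>k\<close> of the recursion sees: \<open>x\<^sub>1, \<dots>, x\<^sub>k\<close>, \<open>\<eta>\<^sub>1, \<dots>, \<eta>\<^sub>k\<^sub>+\<^sub>1\<close> and the estimate.\<close>

definition coords_upto :: "nat \<Rightarrow> nat \<Rightarrow> nat \<Rightarrow> coord set" where
  "coords_upto \<nu> m k = Plant ` {1..k} \<union> (\<lambda>(l, q). Comp l q) ` ({1..k + 1} \<times> {..<\<nu>}) \<union> Estim ` {..<m}"

definition agree_upto :: "nat \<Rightarrow> agent_state \<Rightarrow> agent_state \<Rightarrow> bool" where
  "agree_upto k z z' \<longleftrightarrow> (\<forall>l\<in>{1..k}. plant z l = plant z' l) \<and>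
     (\<forall>l\<in>{1..k + 1}. compens z l = compens z' l) \<and> estim z = estim z'"

definition depends_upto :: "nat \<Rightarrow> (agent_state \<Rightarrow> 'b) \<Rightarrow> bool" where
  "depends_upto k f \<longleftrightarrow> (\<forall>z z'. agree_upto k z z' \<longrightarrow> f z = f z')"

lemma depD: "depends_upto k f \<Longrightarrow> agree_upto k z z' \<Longrightarrow> f z = f z'"
  by (simp add: depends_upto_def)

lemma agree_mono: "agree_upto k z z' \<Longrightarrow> l \<le> k \<Longrightarrow> agree_upto l z z'"
  by (auto simp: agree_upto_def)

lemma dep_mono: "depends_upto l f \<Longrightarrow> l \<le> k \<Longrightarrow> depends_upto k f"
  by (auto simp: depends_upto_def intro: agree_mono)

lemma dep_comp2: "depends_upto k f \<Longrightarrow> depends_upto k g \<Longrightarrow> depends_upto k (\<lambda>z. F (f z) (g z))"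
  by (simp add: depends_upto_def)

lemma dep_comp1: "depends_upto k f \<Longrightarrow> depends_upto k (\<lambda>z. F (f z))"
  by (simp add: depends_upto_def)

lemma dep_plant: "l \<in> {1..k} \<Longrightarrow> depends_upto k (\<lambda>z. plant z l)"
  by (auto simp: depends_upto_def agree_upto_def)

lemma dep_compens: "l \<in> {1..k + 1} \<Longrightarrow> depends_upto k (\<lambda>z. compens z l)"
  by (auto simp: depends_upto_def agree_upto_def)

lemma dep_estim: "depends_upto k estim"
  by (auto simp: depends_upto_def agree_upto_def)

lemma dep_d_plant:
  assumes "depends_upto k f" "l \<in> {1..k}" shows "depends_upto k (d_plant f l)"
  unfolding depends_upto_def
proof (intro allI impI)
  fix z z' assume *: "agree_upto k z z'"
  have "f (z\<lparr>plant := (plant z)(l := s)\<rparr>) = f (z'\<lparr>plant := (plant z')(l := s)\<rparr>)" for s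
    using * by (intro depD[OF assms(1)]) (auto simp: agree_upto_def)
  moreover have "plant z l = plant z' l" using * assms(2) by (auto simp: agree_upto_def)
  ultimately show "d_plant f l z = d_plant f l z'" by (simp add: d_plant_def)
qed

lemma dep_d_comp:
  assumes "depends_upto k f" "l \<in> {1..k + 1}" shows "depends_upto k (d_comp n f l)"
  unfolding depends_upto_def
proof (intro allI impI)
  fix z z' assume *: "agree_upto k z z'"
  have l: "compens z l = compens z' l" using * assms(2) by (auto simp: agree_upto_def)
  have "f (z\<lparr>compens := (compens z)(l := v)\<rparr>) = f (z'\<lparr>compens := (compens z')(l := v)\<rparr>)" for v
    using * by (intro depD[OF assms(1)]) (auto simp: agree_upto_def)
  with l show "d_comp n f l z = d_comp n f l z'" by (simp add: d_comp_def)
qed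

lemma dep_d_estim:
  assumes "depends_upto k f" shows "depends_upto k (d_estim n f)"
  unfolding depends_upto_def
proof (intro allI impI)
  fix z z' assume *: "agree_upto k z z'"
  have l: "estim z = estim z'" using * by (auto simp: agree_upto_def)
  have "f (z\<lparr>estim := v\<rparr>) = f (z'\<lparr>estim := v\<rparr>)" for v
    using * by (intro depD[OF assms(1)]) (auto simp: agree_upto_def)
  with l show "d_estim n f z = d_estim n f z'" by (simp add: d_estim_def)
qed

lemma finite_coords_upto: "finite (coords_upto \<nu> m k)"
  by (auto simp: coords_upto_def)

lemma sum_coords_upto:
  fixes h :: "coord \<Rightarrow> real"
  shows "(\<Sum>p\<in>coords_upto \<nu> m k. h p)
    = (\<Sum>l=1..k. h (Plant l)) + (\<Sum>l=1..k + 1. \<Sum>q<\<nu>. h (Comp l q)) + (\<Sum>q<m. h (Estim q))"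
proof -
  have "(\<Sum>p\<in>coords_upto \<nu> m k. h p) = (\<Sum>p\<in>Plant ` {1..k}. h p)
      + (\<Sum>p\<in>(\<lambda>(l, q). Comp l q) ` ({1..k + 1} \<times> {..<\<nu>}). h p) + (\<Sum>p\<in>Estim ` {..<m}. h p)"
    unfolding coords_upto_def
    by (subst sum.union_disjoint; (subst sum.union_disjoint)?) auto
  also have "(\<Sum>p\<in>Plant ` {1..k}. h p) = (\<Sum>l=1..k. h (Plant l))"
    by (simp add: sum.reindex inj_on_def)
  also have "(\<Sum>p\<in>(\<lambda>(l, q). Comp l q) ` ({1..k + 1} \<times> {..<\<nu>}). h p)
      = (\<Sum>p\<in>{1..k + 1} \<times> {..<\<nu>}. h (case p of (l, q) \<Rightarrow> Comp l q))"
    by (subst sum.reindex) (auto simp: inj_on_def)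
  also have "\<dots> = (\<Sum>l=1..k + 1. \<Sum>q<\<nu>. h (Comp l q))"
    by (simp add: sum.cartesian_product split_def)
  also have "(\<Sum>p\<in>Estim ` {..<m}. h p) = (\<Sum>q<m. h (Estim q))"
    by (simp add: sum.reindex inj_on_def)
  finally show ?thesis .
qed

lemma scalar_prod_sum: "v \<in> carrier_vec n \<Longrightarrow> (u :: 'a :: semiring_0 vec) \<bullet> v = (\<Sum>q<n. u $ q * v $ q)"
  by (auto simp: scalar_prod_def lessThan_atLeast0)

text \<open>The controller, which is given by the extended locale, does not know \<open>\<theta>\<close>; the parameter enters with
the dynamics.\<close>

locale adaptive_agent = backstepping +
  fixes r :: nat and \<theta> :: "real vec"
  assumes r1: "1 \<le> r" and A: "A \<in> carrier_mat \<nu> \<nu>" and C: "C \<in> carrier_mat 1 \<nu>"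
    and K: "K \<in> carrier_mat \<nu> 1" and \<theta>: "\<theta> \<in> carrier_vec m"
    and smooth_\<psi>: "\<And>l. l \<in> {1..r} \<Longrightarrow> smooth_map l m (\<psi> l)"
    and c_pos: "\<And>l. l \<in> {1..r} \<Longrightarrow> 0 < c l"
begin

abbreviation "U \<equiv> unflat \<nu> m"

text \<open>Functions are tested on the states that arise from real coordinates, which have vectors of the right
dimensions.\<close>

definition smooth_fun :: "(agent_state \<Rightarrow> real) \<Rightarrow> bool" where
  "smooth_fun h \<longleftrightarrow> (\<forall>k. Ck k (\<lambda>x. h (U x)))"

definition smooth_vec :: "nat \<Rightarrow> (agent_state \<Rightarrow> real vec) \<Rightarrow> bool" where
  "smooth_vec n h \<longleftrightarrow> (\<forall>x. h (U x) \<in> carrier_vec n) \<and> (\<forall>q<n. smooth_fun (\<lambda>z. h z $ q))"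

lemma smooth_fun_cong: "(\<And>x. h (U x) = h' (U x)) \<Longrightarrow> smooth_fun h' \<Longrightarrow> smooth_fun h"
  by (simp add: smooth_fun_def)

lemma smooth_fun_const: "smooth_fun (\<lambda>z. a)"
  by (simp add: smooth_fun_def Ck_const)

lemma smooth_fun_add: "smooth_fun f \<Longrightarrow> smooth_fun g \<Longrightarrow> smooth_fun (\<lambda>z. f z + g z)"
  and smooth_fun_diff: "smooth_fun f \<Longrightarrow> smooth_fun g \<Longrightarrow> smooth_fun (\<lambda>z. f z - g z)"
  and smooth_fun_mult: "smooth_fun f \<Longrightarrow> smooth_fun g \<Longrightarrow> smooth_fun (\<lambda>z. f z * g z)"
  by (simp_all add: smooth_fun_def Ck_add Ck_diff Ck_mult)

lemma smooth_fun_sum: "(\<And>a. a \<in> I \<Longrightarrow> smooth_fun (f a)) \<Longrightarrow> smooth_fun (\<lambda>z. \<Sum>a\<in>I. f a z)"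
  by (simp add: smooth_fun_def Ck_sum)

lemma smooth_plant: "smooth_fun (\<lambda>z. plant z l)"
  by (simp add: smooth_fun_def unflat_def Ck_coord)

lemma smooth_compens: "smooth_vec \<nu> (\<lambda>z. compens z l)"
  by (simp add: smooth_vec_def smooth_fun_def unflat_def Ck_coord)

lemma smooth_estim: "smooth_vec m estim"
  by (simp add: smooth_vec_def smooth_fun_def unflat_def Ck_coord)

lemma smooth_vec_nth: "smooth_vec n f \<Longrightarrow> q < n \<Longrightarrow> smooth_fun (\<lambda>z. f z $ q)"
  by (simp add: smooth_vec_def)

lemma smooth_scalar_prod:
  assumes "smooth_vec n f" "smooth_vec n g" shows "smooth_fun (\<lambda>z. f z \<bullet> g z)"
proof (rule smooth_fun_cong)
  show "f (U x) \<bullet> g (U x) = (\<Sum>q<n. f (U x) $ q * g (U x) $ q)" for x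
    using assms by (simp add: smooth_vec_def scalar_prod_sum)
  show "smooth_fun (\<lambda>z. \<Sum>q<n. f z $ q * g z $ q)"
    using assms by (intro smooth_fun_sum smooth_fun_mult) (auto simp: smooth_vec_def)
qed

lemma smooth_mult_mat_vec:
  assumes "M \<in> carrier_mat n' n" "smooth_vec n f" shows "smooth_vec n' (\<lambda>z. M *\<^sub>v f z)"
  unfolding smooth_vec_def
proof (intro conjI allI impI)
  show "M *\<^sub>v f (U x) \<in> carrier_vec n'" for x using assms by (auto simp: smooth_vec_def)
  fix q assume q: "q < n'"
  show "smooth_fun (\<lambda>z. (M *\<^sub>v f z) $ q)"
  proof (rule smooth_fun_cong)
    show "(M *\<^sub>v f (U x)) $ q = row M q \<bullet> f (U x)" for x
      using assms q by (simp add: smooth_vec_def)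
    show "smooth_fun (\<lambda>z. row M q \<bullet> f z)"
      by (rule smooth_scalar_prod[OF _ assms(2)])
        (use assms(1) q in \<open>auto simp: smooth_vec_def smooth_fun_const\<close>)
  qed
qed

lemma smooth_vec_add:
  assumes "smooth_vec n f" "smooth_vec n g" shows "smooth_vec n (\<lambda>z. f z + g z)"
  unfolding smooth_vec_def
proof (intro conjI allI impI)
  show "f (U x) + g (U x) \<in> carrier_vec n" for x using assms by (auto simp: smooth_vec_def)
  fix q assume q: "q < n"
  show "smooth_fun (\<lambda>z. (f z + g z) $ q)"
  proof (rule smooth_fun_cong)
    have "dim_vec (g (U x)) = n" for x using assms by (auto simp: smooth_vec_def)
    then show "(f (U x) + g (U x)) $ q = f (U x) $ q + g (U x) $ q" for x using q by simp
    show "smooth_fun (\<lambda>z. f z $ q + g z $ q)"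
      by (rule smooth_fun_add[OF smooth_vec_nth[OF assms(1) q] smooth_vec_nth[OF assms(2) q]])
  qed
qed

lemma smooth_vec_diff:
  assumes "smooth_vec n f" "smooth_vec n g" shows "smooth_vec n (\<lambda>z. f z - g z)"
  unfolding smooth_vec_def
proof (intro conjI allI impI)
  show "f (U x) - g (U x) \<in> carrier_vec n" for x using assms by (auto simp: smooth_vec_def)
  fix q assume q: "q < n"
  show "smooth_fun (\<lambda>z. (f z - g z) $ q)"
  proof (rule smooth_fun_cong)
    have "dim_vec (g (U x)) = n" for x using assms by (auto simp: smooth_vec_def)
    then show "(f (U x) - g (U x)) $ q = f (U x) $ q - g (U x) $ q" for x using q by simp
    show "smooth_fun (\<lambda>z. f z $ q - g z $ q)"
      by (rule smooth_fun_diff[OF smooth_vec_nth[OF assms(1) q] smooth_vec_nth[OF assms(2) q]])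
  qed
qed

lemma smooth_vec_smult:
  assumes "smooth_fun f" "smooth_vec n g" shows "smooth_vec n (\<lambda>z. f z \<cdot>\<^sub>v g z)"
  unfolding smooth_vec_def
proof (intro conjI allI impI)
  show "f (U x) \<cdot>\<^sub>v g (U x) \<in> carrier_vec n" for x using assms by (auto simp: smooth_vec_def)
  fix q assume q: "q < n"
  show "smooth_fun (\<lambda>z. (f z \<cdot>\<^sub>v g z) $ q)"
  proof (rule smooth_fun_cong)
    have "dim_vec (g (U x)) = n" for x using assms by (auto simp: smooth_vec_def)
    then show "(f (U x) \<cdot>\<^sub>v g (U x)) $ q = f (U x) * g (U x) $ q" for x using q by simp
    show "smooth_fun (\<lambda>z. f z * g z $ q)"
      by (rule smooth_fun_mult[OF assms(1) smooth_vec_nth[OF assms(2) q]])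
  qed
qed

lemma \<psi>_carrier: "l \<in> {1..r} \<Longrightarrow> \<psi> l x \<in> carrier_vec m"
  using smooth_\<psi> by (auto simp: smooth_map_def)

lemma smooth_\<psi>_plant:
  assumes "l \<in> {1..r}" shows "smooth_vec m (\<lambda>z. \<psi> l (plant z))"
  unfolding smooth_vec_def
proof (intro conjI allI impI)
  show "\<psi> l (plant (U x)) \<in> carrier_vec m" for x using \<psi>_carrier assms .
  fix q assume q: "q < m"
  have "depends_on_first l (\<lambda>x. \<psi> l x $ q)"
    using smooth_\<psi>[OF assms] unfolding smooth_map_def depends_on_first_def by metis
  moreover have "Ck_fun l k (\<lambda>x. \<psi> l x $ q)" for k
    using smooth_\<psi>[OF assms] q by (simp add: smooth_map_def)
  moreover have "inj Plant" by (simp add: inj_def)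
  ultimately have "Ck k (\<lambda>x. \<psi> l (\<lambda>j. x (Plant j)) $ q)" for k
    by (intro Ck_of_Ck_fun[where l = l])
  then show "smooth_fun (\<lambda>z. \<psi> l (plant z) $ q)" by (simp add: smooth_fun_def unflat_def)
qed

lemma dep_\<psi>: "l \<in> {1..k} \<Longrightarrow> k \<le> r \<Longrightarrow> depends_upto k (\<lambda>z. \<psi> l (plant z))"
  unfolding depends_upto_def
proof (intro allI impI)
  fix z z' assume l: "l \<in> {1..k}" "k \<le> r" and *: "agree_upto k z z'"
  have "depends_on_first l (\<psi> l)" using smooth_\<psi>[of l] l by (simp add: smooth_map_def)
  moreover have "\<forall>p\<in>{1..l}. plant z p = plant z' p" using * l by (simp add: agree_upto_def)
  ultimately show "\<psi> l (plant z) = \<psi> l (plant z')" unfolding depends_on_first_def by blast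
qed

lemma partial_deriv_unflat_plant: "partial_deriv (Plant l) (\<lambda>x. f (U x)) x = d_plant f l (U x)"
proof -
  have "U (x(Plant l := s)) = (U x)\<lparr>plant := (plant (U x))(l := s)\<rparr>" for s
    by (auto simp: unflat_def fun_eq_iff)
  then show ?thesis by (simp add: partial_deriv_def d_plant_def) (simp add: unflat_def)
qed

lemma partial_deriv_unflat_comp:
  assumes "q < \<nu>" shows "partial_deriv (Comp l q) (\<lambda>x. f (U x)) x = d_comp \<nu> f l (U x) $ q"
proof -
  have "U (x(Comp l q := s))
      = (U x)\<lparr>compens := (compens (U x))(l := update_vec (compens (U x) l) q s)\<rparr>" for s
    by (auto simp: unflat_def fun_eq_iff update_vec_def)
  then show ?thesis using assms by (simp add: partial_deriv_def d_comp_def) (simp add: unflat_def)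
qed

lemma partial_deriv_unflat_estim:
  assumes "q < m" shows "partial_deriv (Estim q) (\<lambda>x. f (U x)) x = d_estim m f (U x) $ q"
proof -
  have "U (x(Estim q := s)) = (U x)\<lparr>estim := update_vec (estim (U x)) q s\<rparr>" for s
    by (auto simp: unflat_def fun_eq_iff update_vec_def)
  then show ?thesis using assms by (simp add: partial_deriv_def d_estim_def) (simp add: unflat_def)
qed

lemma Ck_partial_deriv: "(\<forall>k. Ck k g) \<Longrightarrow> Ck k (partial_deriv p g)"
  using Ck.simps(2)[of k g] by blast

lemma smooth_d_plant: "smooth_fun f \<Longrightarrow> smooth_fun (d_plant f l)"
  using Ck_partial_deriv[of "\<lambda>x. f (U x)" _ "Plant l"]
  by (simp add: smooth_fun_def partial_deriv_unflat_plant[abs_def])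

lemma smooth_d_comp:
  assumes "smooth_fun f" shows "smooth_vec \<nu> (d_comp \<nu> f l)"
proof -
  have "Ck k (\<lambda>x. d_comp \<nu> f l (U x) $ q)" if "q < \<nu>" for k q
  proof -
    have "partial_deriv (Comp l q) (\<lambda>x. f (U x)) = (\<lambda>x. d_comp \<nu> f l (U x) $ q)"
      by (rule ext) (rule partial_deriv_unflat_comp[OF that])
    then show ?thesis
      using Ck_partial_deriv[OF assms[unfolded smooth_fun_def], of k "Comp l q"] by (simp only:)
  qed
  then show ?thesis by (simp add: smooth_vec_def smooth_fun_def d_comp_def)
qed

lemma smooth_d_estim:
  assumes "smooth_fun f" shows "smooth_vec m (d_estim m f)"
proof -
  have "Ck k (\<lambda>x. d_estim m f (U x) $ q)" if "q < m" for k q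
  proof -
    have "partial_deriv (Estim q) (\<lambda>x. f (U x)) = (\<lambda>x. d_estim m f (U x) $ q)"
      by (rule ext) (rule partial_deriv_unflat_estim[OF that])
    then show ?thesis
      using Ck_partial_deriv[OF assms[unfolded smooth_fun_def], of k "Estim q"] by (simp only:)
  qed
  then show ?thesis by (simp add: smooth_vec_def smooth_fun_def d_estim_def)
qed

lemma smooth_eta_rhs: "smooth_vec \<nu> (eta_rhs l)"
  unfolding eta_rhs_def[abs_def]
  by (rule smooth_vec_diff[OF smooth_mult_mat_vec[OF A smooth_compens]
      smooth_mult_mat_vec[OF mult_carrier_mat[OF K C] smooth_vec_diff[OF smooth_compens smooth_compens]]])

lemmas smooth_intros = smooth_fun_add smooth_fun_diff smooth_fun_mult smooth_fun_sum smooth_fun_const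
  smooth_scalar_prod smooth_vec_smult smooth_vec_add smooth_d_plant smooth_d_comp smooth_d_estim
  smooth_eta_rhs smooth_plant smooth_estim smooth_\<psi>_plant

lemma err_1: "err 1 z = plant z 1 - (C *\<^sub>v compens z 1) $ 0"
  and reg_1: "reg 1 z = \<psi> 1 (plant z)"
  and tau_1: "tau 1 z = err 1 z \<cdot>\<^sub>v \<psi> 1 (plant z)"
  and alpha_1: "alpha 1 z = - c 1 * err 1 z - \<psi> 1 (plant z) \<bullet> estim z + (C *\<^sub>v (A *\<^sub>v compens z 1)) $ 0
         - (C *\<^sub>v ((K * C) *\<^sub>v (compens z 1 - compens z 2))) $ 0"
  by (simp_all add: err.simps[of 1] reg.simps[of 1] tau.simps[of 1] alpha.simps[of 1] del: One_nat_def)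

text \<open>Step \<open>k\<close> differentiates \<open>\<alpha>\<^sub>k\<^sub>-\<^sub>1\<close>, so a fixed order of differentiability would be used up along the
recursion; \<open>smooth_fun\<close> therefore asks for all orders.\<close>

lemma smooth_backstepping:
  assumes "k \<in> {1..r}"
  shows "smooth_fun (err k) \<and> smooth_vec m (reg k) \<and> smooth_vec m (tau k) \<and> smooth_fun (alpha k)"
  using assms
proof (induction k rule: less_induct)
  case (less k)
  have kr: "1 \<le> k" "k \<le> r" using less.prems by auto
  have C1: "smooth_fun (\<lambda>z. (C *\<^sub>v compens z 1) $ 0)"
    by (rule smooth_vec_nth[OF smooth_mult_mat_vec[OF C smooth_compens]]) simp
  have C2: "smooth_fun (\<lambda>z. (C *\<^sub>v (A *\<^sub>v compens z 1)) $ 0)"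
    by (rule smooth_vec_nth[OF smooth_mult_mat_vec[OF C smooth_mult_mat_vec[OF A smooth_compens]]]) simp
  have C3: "smooth_fun (\<lambda>z. (C *\<^sub>v ((K * C) *\<^sub>v (compens z 1 - compens z 2))) $ 0)"
    by (rule smooth_vec_nth[OF smooth_mult_mat_vec[OF C smooth_mult_mat_vec[OF mult_carrier_mat[OF K C]
            smooth_vec_diff[OF smooth_compens smooth_compens]]]]) simp
  show ?case
  proof (cases "k = 1")
    case True
    have e: "smooth_fun (err 1)"
      unfolding err.simps[of 1] using C1 by (auto intro: smooth_intros)
    have w: "smooth_vec m (reg 1)"
      unfolding reg.simps[of 1] using r1 by (auto intro: smooth_intros)
    have t: "smooth_vec m (tau 1)"
      unfolding tau_1[abs_def] by (rule smooth_vec_smult[OF e smooth_\<psi>_plant]) (use r1 in simp)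
    have "smooth_fun (\<lambda>z. - c 1 * err 1 z - \<psi> 1 (plant z) \<bullet> estim z + (C *\<^sub>v (A *\<^sub>v compens z 1)) $ 0
         - (C *\<^sub>v ((K * C) *\<^sub>v (compens z 1 - compens z 2))) $ 0)"
      by (intro smooth_fun_add smooth_fun_diff smooth_fun_mult smooth_fun_const C2 C3 e
          smooth_scalar_prod[OF smooth_\<psi>_plant smooth_estim]) (use r1 in simp)
    then have "smooth_fun (alpha 1)"
      unfolding alpha_1[abs_def] .
    with e w t True show ?thesis by simp
  next
    case False
    with kr have k2: "2 \<le> k" "\<not> k \<le> 1" by auto
    have IH: "smooth_fun (err l)" "smooth_vec m (reg l)" "smooth_vec m (tau l)" "smooth_fun (alpha l)"
      if "1 \<le> l" "l < k" for l
      using less.IH[of l] that kr by auto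
    have e: "smooth_fun (err k)"
      unfolding err.simps[of k] using k2 by (auto intro!: smooth_intros IH)
    have w: "smooth_vec m (reg k)"
      unfolding reg.simps[of k] using k2 kr
      by (auto simp: smooth_vec_def intro!: smooth_intros IH smooth_vec_nth[OF smooth_\<psi>_plant])
    have t: "smooth_vec m (tau k)"
      unfolding tau.simps[of k] using k2 by (auto intro!: smooth_intros IH e w)
    have "smooth_fun (\<lambda>z. - c k * err k z - err (k - 1) z - \<psi> k (plant z) \<bullet> estim z
       + (\<Sum>l=1..k - 1. d_plant (alpha (k - 1)) l z * (plant z (l + 1) + \<psi> l (plant z) \<bullet> estim z))
       + (\<Sum>l=1..k. d_comp \<nu> (alpha (k - 1)) l z \<bullet> eta_rhs l z)
       + d_estim m (alpha (k - 1)) z \<bullet> tau k z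
       + (\<Sum>l=2..k - 1. err l z * (d_estim m (alpha (l - 1)) z \<bullet> reg k z)))"
      by (intro smooth_fun_add smooth_fun_diff smooth_fun_mult smooth_fun_sum smooth_fun_const
          smooth_scalar_prod[OF smooth_\<psi>_plant smooth_estim] smooth_scalar_prod[OF smooth_d_comp smooth_eta_rhs]
          smooth_scalar_prod[OF smooth_d_estim t] smooth_scalar_prod[OF smooth_d_estim w]
          smooth_d_plant smooth_plant IH e) (use k2 kr in auto)
    then have "smooth_fun (alpha k)"
      using k2 by (simp add: alpha.simps[of k, abs_def])
    with e w t show ?thesis by simp
  qed
qed

text \<open>Locality is what allows \<open>\<alpha>\<^sub>k\<close> to define the next error and the chain states to be recovered
one by one; it is preserved by the partial derivatives that enter the recursion.\<close>

lemma dep_backstepping: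
  assumes "k \<in> {1..r}"
  shows "depends_upto k (err k) \<and> depends_upto k (reg k) \<and> depends_upto k (tau k) \<and> depends_upto k (alpha k)"
  using assms
proof (induction k rule: less_induct)
  case (less k)
  have kr: "1 \<le> k" "k \<le> r" using less.prems by auto
  have ce: "depends_upto k (\<lambda>z. compens z l)" if "l \<in> {1..k + 1}" for l by (rule dep_compens[OF that])
  show ?case
  proof (cases "k = 1")
    case True
    have comp: "compens z 1 = compens z' 1" "compens z 2 = compens z' 2" "plant z 1 = plant z' 1"
      "estim z = estim z'" if "agree_upto 1 z z'" for z z'
      using that by (auto simp: agree_upto_def)
    have e: "err 1 z = err 1 z'" and p: "\<psi> 1 (plant z) = \<psi> 1 (plant z')" if "agree_upto 1 z z'" for z z'
      using comp[OF that] depD[OF dep_\<psi>[of 1 1] that] r1 by (simp_all add: err.simps)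
    have w: "reg 1 z = reg 1 z'" if "agree_upto 1 z z'" for z z'
      using p[OF that] by (simp add: reg.simps)
    have t: "tau 1 z = tau 1 z'" if "agree_upto 1 z z'" for z z'
      using p[OF that] e[OF that] by (simp add: tau.simps)
    have "alpha 1 z = alpha 1 z'" if "agree_upto 1 z z'" for z z'
      unfolding alpha_1 p[OF that] e[OF that] comp[OF that] by (rule refl)
    with e w t True show ?thesis by (simp add: depends_upto_def)
  next
    case False
    with kr have k2: "2 \<le> k" "\<not> k \<le> 1" by auto
    have IH0: "depends_upto l (err l)" "depends_upto l (reg l)" "depends_upto l (tau l)" "depends_upto l (alpha l)"
      if "1 \<le> l" "l < k" for l
      using less.IH[of l] that kr by auto
    have IH: "depends_upto k (err l)" "depends_upto k (tau l)" "depends_upto k (alpha l)" if "1 \<le> l" "l < k" for l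
      using IH0[OF that] that by (auto intro: dep_mono[of l])
    have dp: "depends_upto k (d_plant (alpha (k - 1)) l)" if "l \<in> {1..k - 1}" for l
      using that k2 by (intro dep_mono[OF dep_d_plant[OF IH0(4)], of "k - 1"]) auto
    have dc: "depends_upto k (d_comp \<nu> (alpha (k - 1)) l)" if "l \<in> {1..k}" for l
      using that k2 by (intro dep_mono[OF dep_d_comp[OF IH0(4)], of "k - 1"]) auto
    have de: "depends_upto k (d_estim m (alpha (l - 1)))" if "l \<in> {2..k}" for l
      using that k2 by (intro dep_mono[OF dep_d_estim[OF IH0(4)], of "l - 1"]) auto
    have eta: "depends_upto k (eta_rhs l)" if "l \<in> {1..k}" for l
      unfolding eta_rhs_def[abs_def] using that
      by (intro dep_comp2[where F = "(-)"] dep_comp1[of k _ "(*\<^sub>v) A"] dep_comp1[of k _ "(*\<^sub>v) (K * C)"] ce) auto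
    have ps: "depends_upto k (\<lambda>z. \<psi> l (plant z))" if "l \<in> {1..k}" for l
      using dep_\<psi> that kr by blast
    have e: "err k z = err k z'" if "agree_upto k z z'" for z z'
      using depD[OF IH(3) that, of "k - 1"] depD[OF dep_plant that, of k] k2 by (simp add: err.simps[of k])
    have w: "reg k z = reg k z'" if "agree_upto k z z'" for z z'
    proof -
      have "(\<Sum>l=1..k - 1. \<psi> l (plant z) $ q * d_plant (alpha (k - 1)) l z)
          = (\<Sum>l=1..k - 1. \<psi> l (plant z') $ q * d_plant (alpha (k - 1)) l z')" for q
        by (intro sum.cong refl arg_cong2[where f = "(*)"] arg_cong[where f = "\<lambda>v. v $ q"]
            depD[OF ps that] depD[OF dp that]) auto
      then show ?thesis using k2 depD[OF ps that, of k] by (simp add: reg.simps[of k])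
    qed
    have t: "tau k z = tau k z'" if "agree_upto k z z'" for z z'
      using depD[OF IH(2) that, of "k - 1"] e[OF that] w[OF that] k2 by (simp add: tau.simps[of k])
    have "alpha k z = alpha k z'" if zz: "agree_upto k z z'" for z z'
    proof -
      have es: "estim z = estim z'" using depD[OF dep_estim zz] .
      have 1: "(\<Sum>l=1..k - 1. d_plant (alpha (k - 1)) l z * (plant z (l + 1) + \<psi> l (plant z) \<bullet> estim z'))
        = (\<Sum>l=1..k - 1. d_plant (alpha (k - 1)) l z' * (plant z' (l + 1) + \<psi> l (plant z') \<bullet> estim z'))"
        by (intro sum.cong refl arg_cong2[where f = "(*)"] arg_cong2[where f = "(+)"]
            arg_cong[where f = "\<lambda>v. v \<bullet> estim z'"]
            depD[OF ps zz] depD[OF dp zz] depD[OF dep_plant zz]) auto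
      have 2: "(\<Sum>l=1..k. d_comp \<nu> (alpha (k - 1)) l z \<bullet> eta_rhs l z)
        = (\<Sum>l=1..k. d_comp \<nu> (alpha (k - 1)) l z' \<bullet> eta_rhs l z')"
        by (intro sum.cong refl arg_cong2[where f = "(\<bullet>)"] depD[OF dc zz] depD[OF eta zz]) auto
      have 3: "(\<Sum>l=2..k - 1. err l z * (d_estim m (alpha (l - 1)) z \<bullet> reg k z))
        = (\<Sum>l=2..k - 1. err l z' * (d_estim m (alpha (l - 1)) z' \<bullet> reg k z'))"
        by (intro sum.cong refl arg_cong2[where f = "(*)"] arg_cong2[where f = "(\<bullet>)"] depD[OF de zz]
            depD[OF IH(1) zz] w[OF zz]) auto
      have 4: "\<psi> k (plant z) = \<psi> k (plant z')" using depD[OF ps zz, of k] kr by simp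
      have 5: "d_estim m (alpha (k - 1)) z = d_estim m (alpha (k - 1)) z'"
        using depD[OF de zz, of k] k2 by simp
      have 6: "err (k - 1) z = err (k - 1) z'" using depD[OF IH(1) zz, of "k - 1"] k2 by simp
      show ?thesis
        unfolding alpha.simps[of k] using k2(2)
        by (simp only: if_False 1 2 3 4 5 6 es e[OF zz] t[OF zz])
    qed
    with e w t show ?thesis by (simp add: depends_upto_def)
  qed
qed

lemma reg_carrier: "k \<in> {1..r} \<Longrightarrow> reg k z \<in> carrier_vec m"
  by (simp add: reg.simps[of k] \<psi>_carrier)

lemma tau_carrier: "k \<in> {1..r} \<Longrightarrow> tau k z \<in> carrier_vec m"
proof (induction k)
  case (Suc k)
  show ?case
  proof (cases "k = 0")
    case True
    then show ?thesis using Suc.prems \<psi>_carrier[of 1] by (simp add: tau.simps[of "Suc 0"])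
  next
    case False
    then show ?thesis using Suc reg_carrier[of "Suc k"] by (simp add: tau.simps[of "Suc k"])
  qed
qed simp

lemma eta_rhs_carrier:
  "compens z l \<in> carrier_vec \<nu> \<Longrightarrow> compens z (l + 1) \<in> carrier_vec \<nu> \<Longrightarrow> eta_rhs l z \<in> carrier_vec \<nu>"
  unfolding eta_rhs_def using A C K by auto

end

section \<open>The Lyapunov function of adaptive backstepping\<close>

text \<open>The algebra behind the tuning functions. The products \<open>e\<^sub>k e\<^sub>k\<^sub>+\<^sub>1\<close> and \<open>e\<^sub>k e\<^sub>k\<^sub>-\<^sub>1\<close> cancel after an index
shift. The two double sums run over the pairs \<open>2 \<le> k < j \<le> r\<close>, once by rows and once by columns: the
correction of step \<open>j\<close> makes up for the part of the update law that step \<open>k\<close> could not anticipate.\<close>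

lemma backstepping_cancellation:
  fixes e c w :: "nat \<Rightarrow> real" and G :: "nat \<Rightarrow> nat \<Rightarrow> real"
  shows "(\<Sum>k=1..r. e k * (- c k * e k - (if 2 \<le> k then e (k - 1) else 0) + (if k < r then e (k + 1) else 0)
      + w k - (if 2 \<le> k then \<Sum>j=k + 1..r. e j * G k j else 0) + (\<Sum>l=2..k - 1. e l * G l k)))
    = (\<Sum>k=1..r. e k * w k) - (\<Sum>k=1..r. c k * (e k)\<^sup>2)"
proof -
  have chain: "(\<Sum>k=1..r. e k * (if k < r then e (k + 1) else 0))
      = (\<Sum>k=1..r. e k * (if 2 \<le> k then e (k - 1) else 0))"
  proof -
    have "(\<Sum>k=1..r. e k * (if k < r then e (k + 1) else 0)) = (\<Sum>k\<in>{1..<r}. e k * e (k + 1))"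
      by (rule sum.mono_neutral_cong_right) auto
    also have "\<dots> = (\<Sum>k\<in>{2..r}. e (k - 1) * e k)"
      by (rule sum.reindex_bij_witness[of _ "\<lambda>k. k - 1" "\<lambda>k. k + 1"]) auto
    also have "\<dots> = (\<Sum>k=1..r. e k * (if 2 \<le> k then e (k - 1) else 0))"
      by (rule sum.mono_neutral_cong_left) auto
    finally show ?thesis .
  qed
  have swap: "(\<Sum>k=1..r. e k * (if 2 \<le> k then \<Sum>j=k + 1..r. e j * G k j else 0))
      = (\<Sum>k=1..r. e k * (\<Sum>l=2..k - 1. e l * G l k))"
  proof (induction r)
    case (Suc r)
    have "(\<Sum>k=1..Suc r. e k * (if 2 \<le> k then \<Sum>j=k + 1..Suc r. e j * G k j else 0))
        = (\<Sum>k=1..r. e k * (if 2 \<le> k then \<Sum>j=k + 1..Suc r. e j * G k j else 0))" by simp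
    also have "\<dots> = (\<Sum>k=1..r. e k * (if 2 \<le> k then \<Sum>j=k + 1..r. e j * G k j else 0)
        + (if 2 \<le> k then e k * (e (Suc r) * G k (Suc r)) else 0))"
      by (intro sum.cong) (auto simp: distrib_left)
    also have "\<dots> = (\<Sum>k=1..r. e k * (\<Sum>l=2..k - 1. e l * G l k))
        + (\<Sum>k=1..r. if 2 \<le> k then e k * (e (Suc r) * G k (Suc r)) else 0)"
      using Suc by (simp add: sum.distrib)
    also have "(\<Sum>k=1..r. if 2 \<le> k then e k * (e (Suc r) * G k (Suc r)) else 0)
        = (\<Sum>k=2..r. e k * (e (Suc r) * G k (Suc r)))"
      by (rule sum.mono_neutral_cong_right) auto
    also have "\<dots> = e (Suc r) * (\<Sum>l=2..r. e l * G l (Suc r))"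
      by (simp add: sum_distrib_left mult_ac)
    finally show ?case by simp
  qed simp
  have "(\<Sum>k=1..r. e k * (- c k * e k - (if 2 \<le> k then e (k - 1) else 0) + (if k < r then e (k + 1) else 0)
      + w k - (if 2 \<le> k then \<Sum>j=k + 1..r. e j * G k j else 0) + (\<Sum>l=2..k - 1. e l * G l k)))
    = (\<Sum>k=1..r. - (c k * (e k)\<^sup>2) - e k * (if 2 \<le> k then e (k - 1) else 0)
      + e k * (if k < r then e (k + 1) else 0) + e k * w k
      - e k * (if 2 \<le> k then \<Sum>j=k + 1..r. e j * G k j else 0) + e k * (\<Sum>l=2..k - 1. e l * G l k))"
    by (intro sum.cong refl) (simp only: power2_eq_square distrib_left right_diff_distrib mult_ac mult_minus_left mult_minus_right)
  also have "\<dots> = (\<Sum>k=1..r. e k * w k) - (\<Sum>k=1..r. c k * (e k)\<^sup>2)"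
    unfolding sum.distrib sum_subtractf sum_negf chain swap by simp
  finally show ?thesis .
qed

context adaptive_agent begin

definition well_formed :: "nat \<Rightarrow> agent_state \<Rightarrow> bool" where
  "well_formed k z \<longleftrightarrow> (\<forall>l\<in>{1..k + 1}. compens z l \<in> carrier_vec \<nu>) \<and> estim z \<in> carrier_vec m"

lemma well_formed_mono: "well_formed k z \<Longrightarrow> l \<le> k \<Longrightarrow> well_formed l z"
  by (auto simp: well_formed_def)

lemma agree_unflat_flat:
  assumes "well_formed k z" shows "agree_upto k (U (flat z)) z"
proof -
  have "vec n (\<lambda>q. v $ q) = v" if "v \<in> carrier_vec n" for n and v :: "real vec"
    using that by (intro eq_vecI) auto
  with assms show ?thesis by (simp add: agree_upto_def well_formed_def unflat_def flat_def)
qed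

lemma depends_on_coords:
  assumes "depends_upto k f" shows "depends_on (coords_upto \<nu> m k) (\<lambda>x. f (U x))"
  unfolding depends_on_def
proof (intro allI impI)
  fix x y :: "coord \<Rightarrow> real" assume *: "\<forall>p\<in>coords_upto \<nu> m k. x p = y p"
  show "f (U x) = f (U y)"
  proof (rule depD[OF assms])
    have "x (Plant l) = y (Plant l)" if "l \<in> {1..k}" for l
      using * that by (auto simp: coords_upto_def)
    moreover have "x (Comp l q) = y (Comp l q)" if "l \<in> {1..k + 1}" "q < \<nu>" for l q
      using * that by (force simp: coords_upto_def)
    moreover have "x (Estim q) = y (Estim q)" if "q < m" for q
      using * that by (auto simp: coords_upto_def)
    ultimately show "agree_upto k (U x) (U y)" by (auto simp: agree_upto_def unflat_def)
  qed
qed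

text \<open>The chain rule in the coordinates of a subsystem, with the partial derivatives as they occur in the
control law. The state is replaced by the one built from its coordinates; locality ensures that
neither the function nor its partial derivatives notice.\<close>

lemma agent_chain_rule:
  assumes f: "smooth_fun f" "depends_upto k f" and t: "t \<in> S"
    and wf: "\<And>s. s \<in> S \<Longrightarrow> well_formed k (z s)"
    and dx: "\<And>l. l \<in> {1..k} \<Longrightarrow> ((\<lambda>s. plant (z s) l) has_real_derivative x' l) (at t within S)"
    and d\<eta>: "\<And>l. l \<in> {1..k + 1} \<Longrightarrow> vec_has_derivative \<nu> (\<lambda>s. compens (z s) l) (\<eta>' l) t S"
    and d\<theta>: "vec_has_derivative m (\<lambda>s. estim (z s)) \<theta>' t S"
    and carr: "\<And>l. l \<in> {1..k + 1} \<Longrightarrow> \<eta>' l \<in> carrier_vec \<nu>" "\<theta>' \<in> carrier_vec m"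
  shows "((\<lambda>s. f (z s)) has_real_derivative
      (\<Sum>l=1..k. d_plant f l (z t) * x' l) + (\<Sum>l=1..k + 1. d_comp \<nu> f l (z t) \<bullet> \<eta>' l)
      + d_estim m f (z t) \<bullet> \<theta>') (at t within S)"
proof -
  define g where "g x = f (U x)" for x
  define d where "d p = (case p of Plant l \<Rightarrow> x' l | Comp l q \<Rightarrow> \<eta>' l $ q | Estim q \<Rightarrow> \<theta>' $ q)" for p
  have fg: "f (z s) = g (flat (z s))" if "s \<in> S" for s
    unfolding g_def using depD[OF f(2) agree_unflat_flat[OF wf[OF that]]] by simp
  have "((\<lambda>s. flat (z s) p) has_real_derivative d p) (at t within S)" if "p \<in> coords_upto \<nu> m k" for p
    using that dx d\<eta> d\<theta> unfolding coords_upto_def flat_def d_def vec_has_derivative_def by auto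
  then have *: "((\<lambda>s. g (flat (z s))) has_real_derivative
      (\<Sum>p\<in>coords_upto \<nu> m k. partial_deriv p g (flat (z t)) * d p)) (at t within S)"
  proof (intro Ck_chain_rule finite_coords_upto)
    show "Ck (Suc 0) g" unfolding g_def[abs_def] by (rule f(1)[unfolded smooth_fun_def, rule_format])
    show "depends_on (coords_upto \<nu> m k) g" unfolding g_def[abs_def] by (rule depends_on_coords[OF f(2)])
  qed
  have ag: "agree_upto k (U (flat (z t))) (z t)" by (rule agree_unflat_flat[OF wf[OF t]])
  have p1: "partial_deriv (Plant l) g (flat (z t)) = d_plant f l (z t)" if "l \<in> {1..k}" for l
    using depD[OF dep_d_plant[OF f(2) that] ag] by (simp add: g_def[abs_def] partial_deriv_unflat_plant)
  have p2: "partial_deriv (Comp l q) g (flat (z t)) = d_comp \<nu> f l (z t) $ q" if "l \<in> {1..k + 1}" "q < \<nu>" for l q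
    using depD[OF dep_d_comp[OF f(2) that(1)] ag] that by (simp add: g_def[abs_def] partial_deriv_unflat_comp)
  have p3: "partial_deriv (Estim q) g (flat (z t)) = d_estim m f (z t) $ q" if "q < m" for q
    using depD[OF dep_d_estim[OF f(2)] ag] that by (simp add: g_def[abs_def] partial_deriv_unflat_estim)
  have "(\<Sum>p\<in>coords_upto \<nu> m k. partial_deriv p g (flat (z t)) * d p)
      = (\<Sum>l=1..k. d_plant f l (z t) * x' l) + (\<Sum>l=1..k + 1. d_comp \<nu> f l (z t) \<bullet> \<eta>' l)
      + d_estim m f (z t) \<bullet> \<theta>'"
  proof -
    have "(\<Sum>l=1..k + 1. \<Sum>q<\<nu>. partial_deriv (Comp l q) g (flat (z t)) * d (Comp l q))
        = (\<Sum>l=1..k + 1. d_comp \<nu> f l (z t) \<bullet> \<eta>' l)"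
      by (intro sum.cong refl) (simp add: scalar_prod_sum[OF carr(1)] p2 d_def)
    moreover have "(\<Sum>q<m. partial_deriv (Estim q) g (flat (z t)) * d (Estim q)) = d_estim m f (z t) \<bullet> \<theta>'"
      by (simp add: scalar_prod_sum[OF carr(2)] p3 d_def)
    moreover have "(\<Sum>l=1..k. partial_deriv (Plant l) g (flat (z t)) * d (Plant l)) = (\<Sum>l=1..k. d_plant f l (z t) * x' l)"
      by (intro sum.cong refl) (simp add: p1 d_def)
    ultimately show ?thesis unfolding sum_coords_upto by simp
  qed
  with * have "((\<lambda>s. g (flat (z s))) has_real_derivative
      (\<Sum>l=1..k. d_plant f l (z t) * x' l) + (\<Sum>l=1..k + 1. d_comp \<nu> f l (z t) \<bullet> \<eta>' l)
      + d_estim m f (z t) \<bullet> \<theta>') (at t within S)" by (simp only:)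
  then show ?thesis
    by (rule has_field_derivative_transform_within[where d = 1]) (use t fg in auto)
qed

definition bounded_upto :: "nat \<Rightarrow> real \<Rightarrow> agent_state \<Rightarrow> bool" where
  "bounded_upto k B z \<longleftrightarrow> (\<forall>l\<in>{1..k}. \<bar>plant z l\<bar> \<le> B) \<and>
     (\<forall>l\<in>{1..k + 1}. \<forall>q<\<nu>. \<bar>compens z l $ q\<bar> \<le> B) \<and> (\<forall>q<m. \<bar>estim z $ q\<bar> \<le> B)"

text \<open>Compactness of boxes in the finitely many coordinates on which the function depends.\<close>

lemma smooth_fun_bounded:
  assumes "smooth_fun f" "depends_upto k f"
  shows "\<exists>M\<ge>0. \<forall>z. well_formed k z \<and> bounded_upto k B z \<longrightarrow> \<bar>f z\<bar> \<le> M"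
proof -
  have "continuous_on UNIV (\<lambda>x. f (U x))" using assms(1) by (auto simp: smooth_fun_def intro: Ck_continuous)
  from continuous_bounded_on_finite_box[OF this depends_on_coords[OF assms(2)], of B]
  obtain M where M: "0 \<le> M" "\<And>x. \<forall>p\<in>coords_upto \<nu> m k. \<bar>x p\<bar> \<le> B \<Longrightarrow> \<bar>f (U x)\<bar> \<le> M" by blast
  have "\<bar>f z\<bar> \<le> M" if z: "well_formed k z" "bounded_upto k B z" for z
  proof -
    have "f z = f (U (flat z))" using depD[OF assms(2) agree_unflat_flat[OF z(1)]] by simp
    moreover have "\<forall>p\<in>coords_upto \<nu> m k. \<bar>flat z p\<bar> \<le> B"
      using z by (auto simp: coords_upto_def flat_def bounded_upto_def)
    ultimately show ?thesis using M(2) by simp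
  qed
  with M(1) show ?thesis by blast
qed

lemma scalar_prod_tau:
  assumes "v \<in> carrier_vec m" "k \<in> {1..r}"
  shows "v \<bullet> tau k z = (\<Sum>j=1..k. err j z * (v \<bullet> reg j z))"
  using assms(2)
proof (induction k)
  case (Suc k)
  show ?case
  proof (cases "k = 0")
    case True
    have "v \<bullet> (err 1 z \<cdot>\<^sub>v \<psi> 1 (plant z)) = err 1 z * (v \<bullet> \<psi> 1 (plant z))"
      using assms(1) \<psi>_carrier[of 1] r1 by (intro scalar_prod_smult_distrib) auto
    with True show ?thesis by (simp add: tau.simps[of "Suc 0"] reg.simps[of "Suc 0"])
  next
    case False
    have rc: "reg (Suc k) z \<in> carrier_vec m" using Suc.prems by (rule reg_carrier)
    have tc: "tau k z \<in> carrier_vec m" using Suc.prems False by (intro tau_carrier) auto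
    have "v \<bullet> tau (Suc k) z = v \<bullet> (tau k z + err (Suc k) z \<cdot>\<^sub>v reg (Suc k) z)"
      using False by (simp add: tau.simps[of "Suc k"])
    also have "\<dots> = v \<bullet> tau k z + err (Suc k) z * (v \<bullet> reg (Suc k) z)"
      using assms(1) rc tc by (simp add: scalar_prod_add_distrib[of _ m])
    finally show ?thesis using Suc False by simp
  qed
qed simp

text \<open>The last compensator \<open>\<eta>\<^sub>r\<^sub>+\<^sub>1\<close>, which receives the signals of the neighbours, is left arbitrary: the
Lyapunov argument holds for every motion of it.\<close>

definition agent_solution :: "real set \<Rightarrow> (real \<Rightarrow> agent_state) \<Rightarrow> bool" where
  "agent_solution S z \<longleftrightarrow> (\<forall>t\<in>S. well_formed r (z t) \<and>
     (\<forall>l\<in>{1..<r}. ((\<lambda>s. plant (z s) l) has_real_derivative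
        plant (z t) (l + 1) + \<psi> l (plant (z t)) \<bullet> \<theta>) (at t within S)) \<and>
     ((\<lambda>s. plant (z s) r) has_real_derivative alpha r (z t) + \<psi> r (plant (z t)) \<bullet> \<theta>) (at t within S) \<and>
     (\<forall>l\<in>{1..r}. vec_has_derivative \<nu> (\<lambda>s. compens (z s) l) (eta_rhs l (z t)) t S) \<and>
     vec_has_derivative m (\<lambda>s. estim (z s)) (tau r (z t)) t S)"

text \<open>The last two sums are the mismatch between the update law \<open>tau r\<close> and the tuning function
\<open>tau k\<close> known to step \<open>k\<close>, and the correction for the mismatch of the earlier steps.\<close>

definition err_rate :: "nat \<Rightarrow> agent_state \<Rightarrow> real" where
  "err_rate k z = - c k * err k z - (if 2 \<le> k then err (k - 1) z else 0)
     + (if k < r then err (k + 1) z else 0) + reg k z \<bullet> (\<theta> - estim z)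
     - (if 2 \<le> k then \<Sum>j=k + 1..r. err j z * (d_estim m (alpha (k - 1)) z \<bullet> reg j z) else 0)
     + (\<Sum>l=2..k - 1. err l z * (d_estim m (alpha (l - 1)) z \<bullet> reg k z))"

text \<open>By the chain rule \<open>\<alpha>\<^sub>k\<^sub>-\<^sub>1\<close> moves with the true parameter, the compensator dynamics and \<open>tau r\<close>.
The control law contains the same terms with the estimate and \<open>tau k\<close> instead. The differences are
\<open>w\<^sub>k \<bullet> (\<theta> - \<vartheta>)\<close> (facts \<open>rr\<close> and \<open>pp\<close>) and the tail of the update law (fact \<open>tt\<close>).\<close>

lemma err_has_derivative:
  assumes sol: "agent_solution S z" and t: "t \<in> S" and k: "k \<in> {1..r}"
  shows "((\<lambda>s. err k (z s)) has_real_derivative err_rate k (z t)) (at t within S)"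
proof -
  define Z where "Z = z t"
  have wf: "well_formed r (z s)" if "s \<in> S" for s using sol that by (auto simp: agent_solution_def)
  have dx: "((\<lambda>s. plant (z s) l) has_real_derivative
        plant Z (l + 1) + \<psi> l (plant Z) \<bullet> \<theta>) (at t within S)" if "l \<in> {1..<r}" for l
    using sol t that by (auto simp: agent_solution_def Z_def)
  have d\<eta>: "vec_has_derivative \<nu> (\<lambda>s. compens (z s) l) (eta_rhs l Z) t S" if "l \<in> {1..r}" for l
    using sol t that by (auto simp: agent_solution_def Z_def)
  have d\<theta>: "vec_has_derivative m (\<lambda>s. estim (z s)) (tau r Z) t S"
    using sol t by (auto simp: agent_solution_def Z_def)
  have es: "estim Z \<in> carrier_vec m" using wf[OF t] by (simp add: well_formed_def Z_def)
  have cm: "compens Z l \<in> carrier_vec \<nu>" if "l \<in> {1..r + 1}" for l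
    using wf[OF t] that by (simp add: well_formed_def Z_def)
  have \<psi>\<theta>: "\<psi> l (plant Z) \<bullet> (\<theta> - estim Z) = \<psi> l (plant Z) \<bullet> \<theta> - \<psi> l (plant Z) \<bullet> estim Z"
    if "l \<in> {1..r}" for l
    by (rule scalar_prod_minus_distrib[OF \<psi>_carrier[OF that] \<theta> es])
  \<comment> \<open>the next chain state, or the control for \<open>k = r\<close>, is \<open>\<alpha>\<^sub>k\<close> plus the next error\<close>
  have dk: "((\<lambda>s. plant (z s) k) has_real_derivative
      alpha k Z + (if k < r then err (k + 1) Z else 0) + \<psi> k (plant Z) \<bullet> \<theta>) (at t within S)"
  proof (cases "k < r")
    case True
    then have "plant Z (k + 1) = err (k + 1) Z + alpha k Z" using k by (simp add: err.simps[of "Suc k"])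
    with dx[of k] True k show ?thesis by (simp add: add_ac)
  next
    case False
    then have "k = r" using k by simp
    then show ?thesis using sol t by (auto simp: agent_solution_def Z_def)
  qed
  show ?thesis
  proof (cases "k = 1")
    case True
    have C_sum: "(C *\<^sub>v v) $ 0 = (\<Sum>q<\<nu>. C $$ (0, q) * v $ q)" if "v \<in> carrier_vec \<nu>" for v
      using C that by (simp add: scalar_prod_sum[OF that])
    have "((\<lambda>s. \<Sum>q<\<nu>. C $$ (0, q) * compens (z s) 1 $ q) has_real_derivative
        (\<Sum>q<\<nu>. C $$ (0, q) * eta_rhs 1 Z $ q)) (at t within S)"
      using d\<eta>[of 1] r1 unfolding vec_has_derivative_def
      by (intro DERIV_sum DERIV_cmult) auto
    then have h1: "((\<lambda>s. (C *\<^sub>v compens (z s) 1) $ 0) has_real_derivative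
        (\<Sum>q<\<nu>. C $$ (0, q) * eta_rhs 1 Z $ q)) (at t within S)"
    proof (rule has_field_derivative_transform_within[where d = 1])
      fix s assume "s \<in> S"
      then have "compens (z s) 1 \<in> carrier_vec \<nu>" using wf[of s] by (simp add: well_formed_def)
      from C_sum[OF this] show "(\<Sum>q<\<nu>. C $$ (0, q) * compens (z s) 1 $ q) = (C *\<^sub>v compens (z s) 1) $ 0" ..
    qed (use t in auto)
    have h2: "(\<Sum>q<\<nu>. C $$ (0, q) * eta_rhs 1 Z $ q) = (C *\<^sub>v eta_rhs 1 Z) $ 0"
      using cm r1 by (intro C_sum[symmetric] eta_rhs_carrier) auto
    have h3: "(C *\<^sub>v eta_rhs 1 Z) $ 0 = (C *\<^sub>v (A *\<^sub>v compens Z 1)) $ 0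
         - (C *\<^sub>v ((K * C) *\<^sub>v (compens Z 1 - compens Z 2))) $ 0"
    proof -
      have c12: "compens Z 1 \<in> carrier_vec \<nu>" "compens Z 2 \<in> carrier_vec \<nu>" using cm r1 by auto
      have "C *\<^sub>v eta_rhs 1 Z = C *\<^sub>v (A *\<^sub>v compens Z 1) - C *\<^sub>v ((K * C) *\<^sub>v (compens Z 1 - compens Z 2))"
        unfolding eta_rhs_def one_add_one
        by (rule mult_minus_distrib_mat_vec[OF C]) (use c12 A K C in auto)
      then show ?thesis using C by simp
    qed
    have "((\<lambda>s. plant (z s) 1 - (C *\<^sub>v compens (z s) 1) $ 0) has_real_derivative
       (alpha 1 Z + (if 1 < r then err (1 + 1) Z else 0) + \<psi> 1 (plant Z) \<bullet> \<theta>)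
        - ((C *\<^sub>v (A *\<^sub>v compens Z 1)) $ 0
         - (C *\<^sub>v ((K * C) *\<^sub>v (compens Z 1 - compens Z 2))) $ 0)) (at t within S)"
      by (rule DERIV_diff[OF dk[unfolded True] h1[unfolded h2 h3]])
    moreover have "(alpha 1 Z + (if 1 < r then err (1 + 1) Z else 0) + \<psi> 1 (plant Z) \<bullet> \<theta>)
        - ((C *\<^sub>v (A *\<^sub>v compens Z 1)) $ 0
         - (C *\<^sub>v ((K * C) *\<^sub>v (compens Z 1 - compens Z 2))) $ 0) = err_rate 1 Z"
    proof -
      have "\<psi> 1 (plant Z) \<bullet> (\<theta> - estim Z) = \<psi> 1 (plant Z) \<bullet> \<theta> - \<psi> 1 (plant Z) \<bullet> estim Z"
        using r1 by (intro \<psi>\<theta>) simp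
      then show ?thesis unfolding alpha_1 err_rate_def reg_1 by simp
    qed
    ultimately show ?thesis unfolding True err_1 Z_def[symmetric] by (simp only:)
  next
    case False
    with k have k2: "2 \<le> k" "k \<le> r" by auto
    define g where "g j = d_estim m (alpha (j - 1)) Z" for j
    define p where "p l = d_plant (alpha (k - 1)) l Z" for l
    have gc: "g j \<in> carrier_vec m" for j by (simp add: g_def d_estim_def)
    have k1: "k - 1 \<in> {1..r}" using k2 by auto
    have da: "((\<lambda>s. alpha (k - 1) (z s)) has_real_derivative
      (\<Sum>l=1..k - 1. p l * (plant Z (l + 1) + \<psi> l (plant Z) \<bullet> \<theta>))
      + (\<Sum>l=1..k. d_comp \<nu> (alpha (k - 1)) l Z \<bullet> eta_rhs l Z) + g k \<bullet> tau r Z) (at t within S)"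
    proof -
      have "((\<lambda>s. alpha (k - 1) (z s)) has_real_derivative
        (\<Sum>l=1..k - 1. d_plant (alpha (k - 1)) l (z t) * (plant Z (l + 1) + \<psi> l (plant Z) \<bullet> \<theta>))
        + (\<Sum>l=1..(k - 1) + 1. d_comp \<nu> (alpha (k - 1)) l (z t) \<bullet> eta_rhs l Z)
        + d_estim m (alpha (k - 1)) (z t) \<bullet> tau r Z) (at t within S)"
      proof (rule agent_chain_rule[OF _ _ t])
        show "smooth_fun (alpha (k - 1))" "depends_upto (k - 1) (alpha (k - 1))"
          using smooth_backstepping[OF k1] dep_backstepping[OF k1] by auto
        show "well_formed (k - 1) (z s)" if "s \<in> S" for s
          by (rule well_formed_mono[OF wf[OF that]]) (use k2 in simp)
        show "((\<lambda>s. plant (z s) l) has_real_derivative plant Z (l + 1) + \<psi> l (plant Z) \<bullet> \<theta>) (at t within S)"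
          if "l \<in> {1..k - 1}" for l by (rule dx) (use that k2 in auto)
        show "vec_has_derivative \<nu> (\<lambda>s. compens (z s) l) (eta_rhs l Z) t S" "eta_rhs l Z \<in> carrier_vec \<nu>"
          if "l \<in> {1..(k - 1) + 1}" for l
        proof -
          have "l \<in> {1..r}" using that k2 by auto
          then show "vec_has_derivative \<nu> (\<lambda>s. compens (z s) l) (eta_rhs l Z) t S"
            and "eta_rhs l Z \<in> carrier_vec \<nu>"
            by (auto intro!: d\<eta> eta_rhs_carrier cm)
        qed
        show "vec_has_derivative m (\<lambda>s. estim (z s)) (tau r Z) t S" by (rule d\<theta>)
        show "tau r Z \<in> carrier_vec m" by (rule tau_carrier) (use r1 in simp)
      qed
      then show ?thesis using k2 by (simp add: p_def g_def Z_def)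
    qed
    have ek: "(\<lambda>s. err k (z s)) = (\<lambda>s. plant (z s) k - alpha (k - 1) (z s))"
      using k2 by (simp add: err.simps[of k])
    have ak: "alpha k Z = - c k * err k Z - err (k - 1) Z - \<psi> k (plant Z) \<bullet> estim Z
       + (\<Sum>l=1..k - 1. p l * (plant Z (l + 1) + \<psi> l (plant Z) \<bullet> estim Z))
       + (\<Sum>l=1..k. d_comp \<nu> (alpha (k - 1)) l Z \<bullet> eta_rhs l Z)
       + g k \<bullet> tau k Z + (\<Sum>l=2..k - 1. err l Z * (g l \<bullet> reg k Z))"
      using k2 by (simp add: alpha.simps[of k] p_def g_def)
    have tt: "g k \<bullet> tau r Z = g k \<bullet> tau k Z + (\<Sum>j=k + 1..r. err j Z * (g k \<bullet> reg j Z))"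
    proof -
      have "{1..r} = {1..k} \<union> {k + 1..r}" "{1..k} \<inter> {k + 1..r} = {}" using k by auto
      then have "(\<Sum>j=1..r. err j Z * (g k \<bullet> reg j Z)) = (\<Sum>j=1..k. err j Z * (g k \<bullet> reg j Z))
          + (\<Sum>j=k + 1..r. err j Z * (g k \<bullet> reg j Z))"
        by (simp add: sum.union_disjoint)
      then show ?thesis using k r1 by (simp add: scalar_prod_tau[OF gc])
    qed
    have rr: "reg k Z \<bullet> (\<theta> - estim Z) = \<psi> k (plant Z) \<bullet> (\<theta> - estim Z)
        - (\<Sum>l=1..k - 1. p l * (\<psi> l (plant Z) \<bullet> (\<theta> - estim Z)))"
    proof -
      have d: "\<theta> - estim Z \<in> carrier_vec m" using \<theta> es by simp
      have "reg k Z \<bullet> (\<theta> - estim Z)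
          = (\<Sum>q<m. (\<psi> k (plant Z) $ q - (\<Sum>l=1..k - 1. \<psi> l (plant Z) $ q * p l)) * (\<theta> - estim Z) $ q)"
        using k2 by (simp add: scalar_prod_sum[OF d] reg.simps[of k] p_def del: index_minus_vec)
      also have "\<dots> = (\<Sum>q<m. \<psi> k (plant Z) $ q * (\<theta> - estim Z) $ q
          - (\<Sum>l=1..k - 1. p l * (\<psi> l (plant Z) $ q * (\<theta> - estim Z) $ q)))"
        unfolding left_diff_distrib sum_distrib_right by (simp only: mult_ac)
      also have "\<dots> = (\<Sum>q<m. \<psi> k (plant Z) $ q * (\<theta> - estim Z) $ q)
          - (\<Sum>q<m. \<Sum>l=1..k - 1. p l * (\<psi> l (plant Z) $ q * (\<theta> - estim Z) $ q))"
        by (rule sum_subtractf)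
      also have "(\<Sum>q<m. \<Sum>l=1..k - 1. p l * (\<psi> l (plant Z) $ q * (\<theta> - estim Z) $ q))
          = (\<Sum>l=1..k - 1. p l * (\<Sum>q<m. \<psi> l (plant Z) $ q * (\<theta> - estim Z) $ q))"
        by (subst sum.swap) (simp only: sum_distrib_left)
      finally show ?thesis by (simp only: scalar_prod_sum[OF d])
    qed
    have pp: "(\<Sum>l=1..k - 1. p l * (plant Z (l + 1) + \<psi> l (plant Z) \<bullet> \<theta>))
        = (\<Sum>l=1..k - 1. p l * (plant Z (l + 1) + \<psi> l (plant Z) \<bullet> estim Z))
        + (\<Sum>l=1..k - 1. p l * (\<psi> l (plant Z) \<bullet> (\<theta> - estim Z)))"
      unfolding sum.distrib[symmetric]
    proof (intro sum.cong refl)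
      fix l assume "l \<in> {1..k - 1}"
      then have "l \<in> {1..r}" using k2 by auto
      from \<psi>\<theta>[OF this]
      show "p l * (plant Z (l + 1) + \<psi> l (plant Z) \<bullet> \<theta>) = p l * (plant Z (l + 1) + \<psi> l (plant Z) \<bullet> estim Z)
          + p l * (\<psi> l (plant Z) \<bullet> (\<theta> - estim Z))"
        by (simp only: distrib_left right_diff_distrib)
    qed
    have "(alpha k Z + (if k < r then err (k + 1) Z else 0) + \<psi> k (plant Z) \<bullet> \<theta>)
      - ((\<Sum>l=1..k - 1. p l * (plant Z (l + 1) + \<psi> l (plant Z) \<bullet> \<theta>))
      + (\<Sum>l=1..k. d_comp \<nu> (alpha (k - 1)) l Z \<bullet> eta_rhs l Z) + g k \<bullet> tau r Z) = err_rate k Z"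
      unfolding err_rate_def ak pp tt rr \<psi>\<theta>[OF k] g_def[symmetric] using k2 by simp
    with DERIV_diff[OF dk da] show ?thesis unfolding ek Z_def[symmetric] by (simp only:)
  qed
qed

definition lyap :: "agent_state \<Rightarrow> real" where
  "lyap z = (\<Sum>k=1..r. (err k z)\<^sup>2) / 2 + (\<Sum>q<m. (\<theta> $ q - estim z $ q)\<^sup>2) / 2"

text \<open>The estimates move with \<open>tau r\<close>, the sum of all \<open>e\<^sub>k w\<^sub>k\<close>, which cancels the parameter terms of the
error equations; the remaining terms cancel by \<open>backstepping_cancellation\<close>.\<close>

lemma lyap_has_derivative:
  assumes sol: "agent_solution S z" and t: "t \<in> S"
  shows "((\<lambda>s. lyap (z s)) has_real_derivative - (\<Sum>k=1..r. c k * (err k (z t))\<^sup>2)) (at t within S)"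
proof -
  define Z where "Z = z t"
  have es: "estim Z \<in> carrier_vec m" using sol t by (simp add: agent_solution_def well_formed_def Z_def)
  have d: "\<theta> - estim Z \<in> carrier_vec m" using \<theta> es by simp
  have d\<theta>: "((\<lambda>s. estim (z s) $ q) has_real_derivative tau r Z $ q) (at t within S)" if "q < m" for q
    using sol t that by (auto simp: agent_solution_def Z_def vec_has_derivative_def)
  have d1: "((\<lambda>s. (\<Sum>k=1..r. (err k (z s))\<^sup>2) / 2) has_real_derivative
      (\<Sum>k=1..r. 2 * (err k Z * err_rate k Z)) / 2) (at t within S)"
    unfolding Z_def
    by (intro DERIV_cdivide DERIV_sum)
      (auto intro!: derivative_eq_intros err_has_derivative[OF sol t])
  have d2: "((\<lambda>s. (\<Sum>q<m. (\<theta> $ q - estim (z s) $ q)\<^sup>2) / 2) has_real_derivative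
      (\<Sum>q<m. - 2 * (tau r Z $ q * (\<theta> $ q - estim Z $ q))) / 2) (at t within S)"
    unfolding Z_def
    by (intro DERIV_cdivide DERIV_sum)
      (auto intro!: derivative_eq_intros d\<theta>[unfolded Z_def])
  have td: "(\<Sum>q<m. tau r Z $ q * (\<theta> $ q - estim Z $ q)) = (\<Sum>k=1..r. err k Z * (reg k Z \<bullet> (\<theta> - estim Z)))"
  proof -
    have "(\<Sum>q<m. tau r Z $ q * (\<theta> $ q - estim Z $ q)) = tau r Z \<bullet> (\<theta> - estim Z)"
      using \<theta> es by (simp add: scalar_prod_sum[OF d])
    also have "\<dots> = (\<theta> - estim Z) \<bullet> tau r Z"
      using d tau_carrier[of r] r1 by (intro comm_scalar_prod) auto
    also have "\<dots> = (\<Sum>k=1..r. err k Z * ((\<theta> - estim Z) \<bullet> reg k Z))"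
      using r1 by (intro scalar_prod_tau[OF d]) auto
    also have "\<dots> = (\<Sum>k=1..r. err k Z * (reg k Z \<bullet> (\<theta> - estim Z)))"
      by (intro sum.cong refl arg_cong2[where f = "(*)"] comm_scalar_prod[OF d] reg_carrier)
    finally show ?thesis .
  qed
  have "(\<Sum>k=1..r. 2 * (err k Z * err_rate k Z)) / 2 + (\<Sum>q<m. - 2 * (tau r Z $ q * (\<theta> $ q - estim Z $ q))) / 2
      = (\<Sum>k=1..r. err k Z * err_rate k Z) - (\<Sum>q<m. tau r Z $ q * (\<theta> $ q - estim Z $ q))"
    unfolding sum_distrib_left[symmetric] by simp
  also have "\<dots> = - (\<Sum>k=1..r. c k * (err k Z)\<^sup>2)"
    using backstepping_cancellation[where e = "\<lambda>k. err k Z" and c = c and r = r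
        and w = "\<lambda>k. reg k Z \<bullet> (\<theta> - estim Z)" and G = "\<lambda>k j. d_estim m (alpha (k - 1)) Z \<bullet> reg j Z"]
    unfolding td err_rate_def by (simp only:)
  finally show ?thesis
    using DERIV_add[OF d1 d2] unfolding lyap_def Z_def by simp
qed

end

section \<open>A quadratic form from the Riccati equation\<close>

lemma DERIV_scalar_prod:
  fixes f g :: "real \<Rightarrow> real vec"
  assumes t: "t \<in> S"
    and c: "\<And>s. s \<in> S \<Longrightarrow> g s \<in> carrier_vec n" "f' \<in> carrier_vec n" "g' \<in> carrier_vec n"
    and d: "vec_has_derivative n f f' t S" "vec_has_derivative n g g' t S"
  shows "((\<lambda>s. f s \<bullet> g s) has_real_derivative f' \<bullet> g t + f t \<bullet> g') (at t within S)"
proof -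
  have "((\<lambda>s. \<Sum>q<n. f s $ q * g s $ q) has_real_derivative
      (\<Sum>q<n. f' $ q * g t $ q + g' $ q * f t $ q)) (at t within S)"
    using d unfolding vec_has_derivative_def by (intro DERIV_sum DERIV_mult) auto
  then have "((\<lambda>s. f s \<bullet> g s) has_real_derivative (\<Sum>q<n. f' $ q * g t $ q + g' $ q * f t $ q)) (at t within S)"
  proof (rule has_field_derivative_transform_within[where d = 1])
    fix s assume "s \<in> S"
    from scalar_prod_sum[OF c(1)[OF this], of "f s"]
    show "(\<Sum>q<n. f s $ q * g s $ q) = f s \<bullet> g s" ..
  qed (use t in auto)
  moreover have "(\<Sum>q<n. f' $ q * g t $ q + g' $ q * f t $ q) = f' \<bullet> g t + f t \<bullet> g'"
    by (simp add: scalar_prod_sum[OF c(1)[OF t]] scalar_prod_sum[OF c(3)] sum.distrib mult.commute)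
  ultimately show ?thesis by (simp only:)
qed

lemma vec_has_derivative_mult_mat:
  assumes M: "M \<in> carrier_mat n' n" and t: "t \<in> S"
    and c: "\<And>s. s \<in> S \<Longrightarrow> f s \<in> carrier_vec n" "f' \<in> carrier_vec n"
    and d: "vec_has_derivative n f f' t S"
  shows "vec_has_derivative n' (\<lambda>s. M *\<^sub>v f s) (M *\<^sub>v f') t S"
  unfolding vec_has_derivative_def
proof (intro allI impI)
  fix q assume q: "q < n'"
  have e: "(M *\<^sub>v v) $ q = (\<Sum>i<n. M $$ (q, i) * v $ i)" if "v \<in> carrier_vec n" for v
    using M q that by (simp add: scalar_prod_sum[OF that])
  have "((\<lambda>s. \<Sum>i<n. M $$ (q, i) * f s $ i) has_real_derivative (\<Sum>i<n. M $$ (q, i) * f' $ i)) (at t within S)"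
    using d unfolding vec_has_derivative_def by (intro DERIV_sum DERIV_cmult) auto
  then have "((\<lambda>s. (M *\<^sub>v f s) $ q) has_real_derivative (\<Sum>i<n. M $$ (q, i) * f' $ i)) (at t within S)"
    by (rule has_field_derivative_transform_within[where d = 1]) (use t e[OF c(1)] in auto)
  then show "((\<lambda>s. (M *\<^sub>v f s) $ q) has_real_derivative (M *\<^sub>v f') $ q) (at t within S)"
    unfolding e[OF c(2)] .
qed

text \<open>Turns bounds of squares into bounds without square roots.\<close>

lemma abs_le_square_plus_1: "\<bar>x :: real\<bar> \<le> x\<^sup>2 + 1"
proof -
  have "0 \<le> (\<bar>x\<bar> - 1)\<^sup>2" by simp
  then have "2 * \<bar>x\<bar> \<le> \<bar>x\<bar>\<^sup>2 + 1" by (simp add: power2_diff)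
  then show ?thesis using zero_le_power2[of x] by (simp add: power2_abs) 
qed

locale riccati =
  fixes \<nu> :: nat and A C P :: "real mat" and \<mu> :: real
  assumes A: "A \<in> carrier_mat \<nu> \<nu>" and C: "C \<in> carrier_mat 1 \<nu>" and pos: "pos_def_mat \<nu> P"
    and ric: "A * P + P * transpose_mat A + 1\<^sub>m \<nu> - P * transpose_mat C * C * P = 0\<^sub>m \<nu> \<nu>"
begin

definition gain :: "real vec" where "gain = \<mu> \<cdot>\<^sub>v (P *\<^sub>v row C 0)"

definition out :: "real vec \<Rightarrow> real" where "out v = row C 0 \<bullet> v"

lemma P: "P \<in> carrier_mat \<nu> \<nu>" and Psym: "transpose_mat P = P"
  and Ppos: "v \<in> carrier_vec \<nu> \<Longrightarrow> v \<noteq> 0\<^sub>v \<nu> \<Longrightarrow> 0 < v \<bullet> (P *\<^sub>v v)"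
  using pos by (auto simp: pos_def_mat_def)

lemma C0: "row C 0 \<in> carrier_vec \<nu>" using C by auto

lemma gain_carrier: "gain \<in> carrier_vec \<nu>" unfolding gain_def using P C0 by auto

lemma P_nonneg: "v \<in> carrier_vec \<nu> \<Longrightarrow> 0 \<le> v \<bullet> (P *\<^sub>v v)"
  using Ppos[of v] P by (cases "v = 0\<^sub>v \<nu>") auto

text \<open>A positive definite matrix has trivial kernel, hence nonzero determinant.\<close>

lemma ex_inverse: "\<exists>Q\<in>carrier_mat \<nu> \<nu>. P * Q = 1\<^sub>m \<nu> \<and> Q * P = 1\<^sub>m \<nu>"
proof -
  have "det P \<noteq> 0"
  proof
    assume "det P = 0"
    then obtain v where v: "v \<in> carrier_vec \<nu>" "v \<noteq> 0\<^sub>v \<nu>" "P *\<^sub>v v = 0\<^sub>v \<nu>"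
      using det_0_iff_vec_prod_zero[OF P] by blast
    then show False using Ppos[OF v(1,2)] by simp
  qed
  define Q where "Q = (1 / det P) \<cdot>\<^sub>m adj_mat P"
  have Qc: "Q \<in> carrier_mat \<nu> \<nu>" unfolding Q_def using adj_mat(1)[OF P] by simp
  have "P * Q = (1 / det P) \<cdot>\<^sub>m (P * adj_mat P)"
    unfolding Q_def by (rule mult_smult_distrib[OF P adj_mat(1)[OF P]])
  also have "\<dots> = 1\<^sub>m \<nu>" using \<open>det P \<noteq> 0\<close> unfolding adj_mat(2)[OF P] by (intro eq_matI) auto
  finally have "P * Q = 1\<^sub>m \<nu>" .
  with mat_mult_left_right_inverse[OF P Qc] Qc show ?thesis by blast
qed

text \<open>The inverse of \<open>P\<close>, the weight of the Lyapunov function \<open>quad\<close> of the compensators.\<close>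

definition Q :: "real mat" where "Q = (SOME Q. Q \<in> carrier_mat \<nu> \<nu> \<and> P * Q = 1\<^sub>m \<nu> \<and> Q * P = 1\<^sub>m \<nu>)"

lemma Q: "Q \<in> carrier_mat \<nu> \<nu>" and PQ: "P * Q = 1\<^sub>m \<nu>"
  using someI_ex[of "\<lambda>Q. Q \<in> carrier_mat \<nu> \<nu> \<and> P * Q = 1\<^sub>m \<nu> \<and> Q * P = 1\<^sub>m \<nu>"] ex_inverse
  by (auto simp: Q_def[symmetric])

lemma Qc: "v \<in> carrier_vec \<nu> \<Longrightarrow> Q *\<^sub>v v \<in> carrier_vec \<nu>" using Q by auto

lemma P_Q_vec: "v \<in> carrier_vec \<nu> \<Longrightarrow> P *\<^sub>v (Q *\<^sub>v v) = v"
  using assoc_mult_mat_vec[OF P Q, of v] by (simp add: PQ)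

lemma P_sym_prod: "x \<in> carrier_vec \<nu> \<Longrightarrow> y \<in> carrier_vec \<nu> \<Longrightarrow> x \<bullet> (P *\<^sub>v y) = (P *\<^sub>v x) \<bullet> y"
  using transpose_vec_mult_scalar[OF P, of y x] by (simp add: Psym)

lemma Q_sym_prod:
  assumes "x \<in> carrier_vec \<nu>" "y \<in> carrier_vec \<nu>" shows "x \<bullet> (Q *\<^sub>v y) = (Q *\<^sub>v x) \<bullet> y"
proof -
  have "x \<bullet> (Q *\<^sub>v y) = (P *\<^sub>v (Q *\<^sub>v x)) \<bullet> (Q *\<^sub>v y)" using assms by (simp add: P_Q_vec)
  also have "\<dots> = (Q *\<^sub>v x) \<bullet> (P *\<^sub>v (Q *\<^sub>v y))" using assms by (simp add: P_sym_prod Qc)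
  finally show ?thesis using assms by (simp add: P_Q_vec)
qed

definition quad :: "real vec \<Rightarrow> real" where "quad v = v \<bullet> (Q *\<^sub>v v)"

lemma quad_P: "v \<in> carrier_vec \<nu> \<Longrightarrow> quad v = (Q *\<^sub>v v) \<bullet> (P *\<^sub>v (Q *\<^sub>v v))"
  unfolding quad_def by (simp add: P_Q_vec Q_sym_prod)

lemma quad_nonneg: "v \<in> carrier_vec \<nu> \<Longrightarrow> 0 \<le> quad v"
  by (simp add: quad_P P_nonneg Qc)

lemma quad_has_derivative:
  assumes t: "t \<in> S" and c: "\<And>s. s \<in> S \<Longrightarrow> v s \<in> carrier_vec \<nu>" "v' \<in> carrier_vec \<nu>"
    and d: "vec_has_derivative \<nu> v v' t S"
  shows "((\<lambda>s. quad (v s)) has_real_derivative 2 * ((Q *\<^sub>v v t) \<bullet> v')) (at t within S)"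
proof -
  have "((\<lambda>s. quad (v s)) has_real_derivative v' \<bullet> (Q *\<^sub>v v t) + v t \<bullet> (Q *\<^sub>v v')) (at t within S)"
    unfolding quad_def
    by (rule DERIV_scalar_prod[OF t _ c(2) _ d vec_has_derivative_mult_mat[OF Q t c d]])
      (use c Qc in auto)
  moreover have "v' \<bullet> (Q *\<^sub>v v t) + v t \<bullet> (Q *\<^sub>v v') = 2 * ((Q *\<^sub>v v t) \<bullet> v')"
    using Q_sym_prod[OF c(1)[OF t] c(2)] comm_scalar_prod[OF c(2) Qc[OF c(1)[OF t]]] by simp
  ultimately show ?thesis by (simp only:)
qed

lemma quad_gain:
  assumes "v \<in> carrier_vec \<nu>" shows "(Q *\<^sub>v v) \<bullet> gain = \<mu> * out v"
proof -
  have "(Q *\<^sub>v v) \<bullet> (P *\<^sub>v row C 0) = row C 0 \<bullet> v"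
    using assms C0 by (simp add: P_sym_prod Qc P_Q_vec comm_scalar_prod[of v \<nu>])
  then show ?thesis unfolding gain_def out_def
    using assms C0 P Qc by (subst scalar_prod_smult_distrib[of _ \<nu>]) auto
qed

text \<open>With \<open>\<xi> = Q v\<close> the Riccati equation, multiplied by \<open>\<xi>\<close> from both sides, gives
\<open>2 \<xi> \<bullet> A P \<xi> + \<bar>\<xi>\<bar>\<^sup>2 - (C P \<xi>)\<^sup>2 = 0\<close>, and \<open>P \<xi> = v\<close>.\<close>

lemma quad_drift:
  assumes v: "v \<in> carrier_vec \<nu>"
  shows "2 * ((Q *\<^sub>v v) \<bullet> (A *\<^sub>v v)) = (out v)\<^sup>2 - (Q *\<^sub>v v) \<bullet> (Q *\<^sub>v v)"
proof -
  define \<xi> where "\<xi> = Q *\<^sub>v v"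
  have \<xi>: "\<xi> \<in> carrier_vec \<nu>" "P *\<^sub>v \<xi> = v" using v by (auto simp: \<xi>_def Qc P_Q_vec)
  have At: "transpose_mat A \<in> carrier_mat \<nu> \<nu>" and Ct: "transpose_mat C \<in> carrier_mat \<nu> 1"
    using A C by auto
  define w where "w = transpose_mat A *\<^sub>v \<xi>"
  have w: "w \<in> carrier_vec \<nu>" unfolding w_def using At \<xi> by auto
  define Cv where "Cv = C *\<^sub>v v"
  have Cv: "Cv \<in> carrier_vec 1" unfolding Cv_def using C v by auto
  define u where "u = transpose_mat C *\<^sub>v Cv"
  have u: "u \<in> carrier_vec \<nu>" unfolding u_def using Ct Cv by auto
  have c1: "A * P \<in> carrier_mat \<nu> \<nu>" "P * transpose_mat A \<in> carrier_mat \<nu> \<nu>"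
    "P * transpose_mat C * C * P \<in> carrier_mat \<nu> \<nu>"
    using A P C At Ct by (auto intro!: mult_carrier_mat)
  have "0\<^sub>v \<nu> = 0\<^sub>m \<nu> \<nu> *\<^sub>v \<xi>" using \<xi>(1) by (intro eq_vecI) auto
  also have "\<dots> = (A * P + P * transpose_mat A + 1\<^sub>m \<nu> - P * transpose_mat C * C * P) *\<^sub>v \<xi>"
    by (simp only: ric)
  also have "\<dots> = (A * P) *\<^sub>v \<xi> + (P * transpose_mat A) *\<^sub>v \<xi> + 1\<^sub>m \<nu> *\<^sub>v \<xi> - (P * transpose_mat C * C * P) *\<^sub>v \<xi>"
    using c1 \<xi>(1) mult_mat_vec_carrier[OF c1(1) \<xi>(1)] mult_mat_vec_carrier[OF c1(2) \<xi>(1)]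
    by (simp add: minus_mult_distrib_mat_vec[of _ \<nu> \<nu>] add_mult_distrib_mat_vec[of _ \<nu> \<nu>] assoc_add_vec[of _ \<nu>])
  also have "(A * P) *\<^sub>v \<xi> = A *\<^sub>v v" using A P \<xi> by simp
  also have "(P * transpose_mat A) *\<^sub>v \<xi> = P *\<^sub>v w"
    unfolding w_def by (rule assoc_mult_mat_vec[OF P At \<xi>(1)])
  also have "(P * transpose_mat C * C * P) *\<^sub>v \<xi> = P *\<^sub>v u"
  proof -
    have "(P * transpose_mat C * C * P) *\<^sub>v \<xi> = (P * transpose_mat C * C) *\<^sub>v v"
      by (rule assoc_mult_mat_vec[OF mult_carrier_mat[OF mult_carrier_mat[OF P Ct] C] P \<xi>(1), unfolded \<xi>(2)])
    also have "\<dots> = (P * transpose_mat C) *\<^sub>v Cv"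
      unfolding Cv_def by (rule assoc_mult_mat_vec[OF mult_carrier_mat[OF P Ct] C v])
    also have "\<dots> = P *\<^sub>v u"
      unfolding u_def by (rule assoc_mult_mat_vec[OF P Ct Cv])
    finally show ?thesis .
  qed
  finally have z: "A *\<^sub>v v + P *\<^sub>v w + \<xi> - P *\<^sub>v u = 0\<^sub>v \<nu>" using \<xi> by simp
  have Av: "A *\<^sub>v v \<in> carrier_vec \<nu>" and Pw: "P *\<^sub>v w \<in> carrier_vec \<nu>" and Pu: "P *\<^sub>v u \<in> carrier_vec \<nu>"
    using A P v w u by auto
  have "\<xi> \<bullet> (A *\<^sub>v v + P *\<^sub>v w + \<xi> - P *\<^sub>v u) = \<xi> \<bullet> 0\<^sub>v \<nu>" by (simp only: z)
  then have "\<xi> \<bullet> (A *\<^sub>v v) + \<xi> \<bullet> (P *\<^sub>v w) + \<xi> \<bullet> \<xi> - \<xi> \<bullet> (P *\<^sub>v u) = 0"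
    using Av Pw Pu \<xi>(1) by (simp add: scalar_prod_minus_distrib[of _ \<nu>] scalar_prod_add_distrib[of _ \<nu>])
  moreover have "\<xi> \<bullet> (P *\<^sub>v w) = \<xi> \<bullet> (A *\<^sub>v v)"
  proof -
    have "\<xi> \<bullet> (P *\<^sub>v w) = v \<bullet> w" using P_sym_prod[OF \<xi>(1) w] \<xi> by simp
    also have "\<dots> = w \<bullet> v" by (rule comm_scalar_prod[OF v w])
    also have "\<dots> = \<xi> \<bullet> (A *\<^sub>v v)" unfolding w_def by (rule transpose_vec_mult_scalar[OF A v \<xi>(1)])
    finally show ?thesis .
  qed
  moreover have "\<xi> \<bullet> (P *\<^sub>v u) = (out v)\<^sup>2"
  proof -
    have "\<xi> \<bullet> (P *\<^sub>v u) = v \<bullet> u" using P_sym_prod[OF \<xi>(1) u] \<xi> by simp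
    also have "\<dots> = u \<bullet> v" by (rule comm_scalar_prod[OF v u])
    also have "\<dots> = Cv \<bullet> (C *\<^sub>v v)" unfolding u_def by (rule transpose_vec_mult_scalar[OF C v Cv])
    also have "\<dots> = (out v)\<^sup>2"
      using C unfolding scalar_prod_sum[OF Cv[unfolded Cv_def]] Cv_def
      by (simp add: out_def power2_eq_square)
    finally show ?thesis .
  qed
  ultimately show ?thesis unfolding \<xi>_def[symmetric] by simp
qed

text \<open>The Cauchy-Schwarz inequality between the dual forms of \<open>P\<close> and \<open>Q\<close>. It bounds every component and
the output by \<open>quad\<close>.\<close>

lemma quad_cauchy_schwarz:
  assumes a: "a \<in> carrier_vec \<nu>" and v: "v \<in> carrier_vec \<nu>"
  shows "(a \<bullet> v)\<^sup>2 \<le> (a \<bullet> (P *\<^sub>v a)) * quad v"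
proof (cases "a = 0\<^sub>v \<nu>")
  case True
  then show ?thesis using v P by simp
next
  case False
  define \<xi> where "\<xi> = Q *\<^sub>v v"
  have \<xi>: "\<xi> \<in> carrier_vec \<nu>" "P *\<^sub>v \<xi> = v" using v by (auto simp: \<xi>_def Qc P_Q_vec)
  define d where "d = a \<bullet> (P *\<^sub>v a)"
  have "0 < d" using Ppos[OF a False] by (simp add: d_def)
  define s where "s = (a \<bullet> v) / d"
  have sa: "s \<cdot>\<^sub>v a \<in> carrier_vec \<nu>" using a by simp
  have Pa: "P *\<^sub>v a \<in> carrier_vec \<nu>" using P a by simp
  have Px: "P *\<^sub>v (\<xi> - s \<cdot>\<^sub>v a) = v - s \<cdot>\<^sub>v (P *\<^sub>v a)"
    using mult_minus_distrib_mat_vec[OF P \<xi>(1) sa] mult_mat_vec[OF P a, of s] \<xi>(2) by simp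
  \<comment> \<open>\<open>s\<close> minimizes the \<open>P\<close>-norm of \<open>\<xi> - s a\<close>\<close>
  have "0 \<le> (\<xi> - s \<cdot>\<^sub>v a) \<bullet> (P *\<^sub>v (\<xi> - s \<cdot>\<^sub>v a))" using \<xi> sa by (intro P_nonneg) simp
  also have "\<dots> = \<xi> \<bullet> v - s * (\<xi> \<bullet> (P *\<^sub>v a)) - s * (a \<bullet> v) + s * s * d"
    unfolding Px d_def using \<xi>(1) a v Pa
    by (simp add: minus_scalar_prod_distrib[of _ \<nu>] scalar_prod_minus_distrib[of _ \<nu>] algebra_simps)
  also have "\<xi> \<bullet> (P *\<^sub>v a) = a \<bullet> v"
    using P_sym_prod[OF \<xi>(1) a] \<xi> comm_scalar_prod[OF v a] by simp
  also have "\<xi> \<bullet> v = quad v" unfolding quad_def \<xi>_def using v Q_sym_prod[OF v v] by simp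
  also have "quad v - s * (a \<bullet> v) - s * (a \<bullet> v) + s * s * d = quad v - (a \<bullet> v)\<^sup>2 / d"
    using \<open>0 < d\<close> by (simp add: s_def field_simps power2_eq_square)
  finally have "(a \<bullet> v)\<^sup>2 / d \<le> quad v" by simp
  then show ?thesis using \<open>0 < d\<close> by (simp add: d_def[symmetric] field_simps)
qed

lemma quad_component:
  assumes "v \<in> carrier_vec \<nu>" "q < \<nu>" shows "(v $ q)\<^sup>2 \<le> (unit_vec \<nu> q \<bullet> (P *\<^sub>v unit_vec \<nu> q)) * quad v"
  using quad_cauchy_schwarz[of "unit_vec \<nu> q" v] assms by simp

definition comp_const :: real where
  "comp_const = (\<Sum>q<\<nu>. unit_vec \<nu> q \<bullet> (P *\<^sub>v unit_vec \<nu> q)) + row C 0 \<bullet> (P *\<^sub>v row C 0)"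

lemma comp_const_nonneg: "0 \<le> comp_const"
  unfolding comp_const_def by (intro add_nonneg_nonneg sum_nonneg P_nonneg C0) auto

lemma component_le:
  assumes "v \<in> carrier_vec \<nu>" "q < \<nu>" shows "(v $ q)\<^sup>2 \<le> comp_const * quad v"
proof -
  have "unit_vec \<nu> q \<bullet> (P *\<^sub>v unit_vec \<nu> q) \<le> (\<Sum>q<\<nu>. unit_vec \<nu> q \<bullet> (P *\<^sub>v unit_vec \<nu> q))"
    by (rule member_le_sum) (use assms P_nonneg in auto)
  also have "\<dots> \<le> comp_const" unfolding comp_const_def using P_nonneg[OF C0] by simp
  finally show ?thesis
    using quad_component[OF assms] quad_nonneg[OF assms(1)] mult_right_mono order_trans by blast
qed

lemma out_le:
  assumes "v \<in> carrier_vec \<nu>" shows "(out v)\<^sup>2 \<le> comp_const * quad v"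
proof -
  have "0 \<le> (\<Sum>q<\<nu>. unit_vec \<nu> q \<bullet> (P *\<^sub>v unit_vec \<nu> q))" by (intro sum_nonneg P_nonneg) auto
  then have "row C 0 \<bullet> (P *\<^sub>v row C 0) \<le> comp_const" unfolding comp_const_def by simp
  then show ?thesis unfolding out_def
    using quad_cauchy_schwarz[OF C0 assms] quad_nonneg[OF assms] mult_right_mono order_trans by blast
qed

lemma sq_norm_sum: "v \<in> carrier_vec n \<Longrightarrow> (v :: real vec) \<bullet> v = (\<Sum>q<n. (v $ q)\<^sup>2)"
  by (simp add: scalar_prod_sum power2_eq_square)

text \<open>A crude operator bound: no eigenvalues of real symmetric matrices enter.\<close>

definition form_const :: "real mat \<Rightarrow> real" where
  "form_const M = (\<Sum>i<\<nu>. \<Sum>j<\<nu>. \<bar>M $$ (i, j)\<bar>)"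

lemma form_const_nonneg: "0 \<le> form_const M" by (simp add: form_const_def sum_nonneg)

lemma form_le:
  assumes M: "M \<in> carrier_mat \<nu> \<nu>" and v: "v \<in> carrier_vec \<nu>"
    and b: "\<And>q. q < \<nu> \<Longrightarrow> (v $ q)\<^sup>2 \<le> b"
  shows "v \<bullet> (M *\<^sub>v v) \<le> form_const M * b"
proof -
  have Mv: "M *\<^sub>v v \<in> carrier_vec \<nu>" using M v by auto
  have "v \<bullet> (M *\<^sub>v v) = (\<Sum>i<\<nu>. v $ i * (\<Sum>j<\<nu>. M $$ (i, j) * v $ j))"
    unfolding scalar_prod_sum[OF Mv] using M v by (intro sum.cong refl) (simp add: scalar_prod_sum[OF v])
  also have "\<dots> = (\<Sum>i<\<nu>. \<Sum>j<\<nu>. M $$ (i, j) * (v $ i * v $ j))"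
    by (simp add: sum_distrib_left mult_ac)
  also have "\<dots> \<le> (\<Sum>i<\<nu>. \<Sum>j<\<nu>. \<bar>M $$ (i, j)\<bar> * b)"
  proof (intro sum_mono)
    fix i j assume ij: "i \<in> {..<\<nu>}" "j \<in> {..<\<nu>}"
    have "0 \<le> (\<bar>v $ i\<bar> - \<bar>v $ j\<bar>)\<^sup>2" by simp
    then have "2 * (\<bar>v $ i\<bar> * \<bar>v $ j\<bar>) \<le> (v $ i)\<^sup>2 + (v $ j)\<^sup>2" by (simp add: power2_diff)
    then have "\<bar>v $ i * v $ j\<bar> \<le> b" using b[of i] b[of j] ij by (simp add: abs_mult)
    have "M $$ (i, j) * (v $ i * v $ j) \<le> \<bar>M $$ (i, j)\<bar> * \<bar>v $ i * v $ j\<bar>"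
      unfolding abs_mult[symmetric] by (rule abs_ge_self)
    also have "\<dots> \<le> \<bar>M $$ (i, j)\<bar> * b" by (rule mult_left_mono) (fact, simp)
    finally show "M $$ (i, j) * (v $ i * v $ j) \<le> \<bar>M $$ (i, j)\<bar> * b" .
  qed
  also have "\<dots> = form_const M * b" by (simp add: form_const_def sum_distrib_right)
  finally show ?thesis .
qed

text \<open>The summand 1 avoids a division by zero. The decay uses half of the term \<open>\<bar>Q v\<bar>\<^sup>2\<close> of \<open>quad_drift\<close>;
the other half absorbs the input (\<open>young\<close>).\<close>

definition decay :: real where "decay = 1 / (2 * (form_const P + 1))"

lemma decay_pos: "0 < decay" using form_const_nonneg[of P] by (simp add: decay_def)

lemma decay_quad_le:
  assumes v: "v \<in> carrier_vec \<nu>" shows "decay * quad v \<le> (Q *\<^sub>v v) \<bullet> (Q *\<^sub>v v) / 2"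
proof -
  have "quad v \<le> form_const P * ((Q *\<^sub>v v) \<bullet> (Q *\<^sub>v v))"
    unfolding quad_P[OF v]
  proof (rule form_le[OF P Qc[OF v]])
    fix q assume "q < \<nu>"
    then show "((Q *\<^sub>v v) $ q)\<^sup>2 \<le> (Q *\<^sub>v v) \<bullet> (Q *\<^sub>v v)"
      unfolding sq_norm_sum[OF Qc[OF v]] by (intro member_le_sum[of q "{..<\<nu>}" "\<lambda>q. ((Q *\<^sub>v v) $ q)\<^sup>2"]) auto
  qed
  also have "\<dots> \<le> (form_const P + 1) * ((Q *\<^sub>v v) \<bullet> (Q *\<^sub>v v))"
    by (intro mult_right_mono) (auto simp: sq_norm_sum[OF Qc[OF v]] sum_nonneg)
  finally show ?thesis using form_const_nonneg[of P] by (simp add: decay_def field_simps)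
qed

lemma young:
  assumes "x \<in> carrier_vec \<nu>" "d \<in> carrier_vec \<nu>"
  shows "2 * (x \<bullet> d) \<le> (x \<bullet> x) / 2 + 2 * (d \<bullet> (d :: real vec))"
proof -
  have "0 \<le> (\<Sum>q<\<nu>. (x $ q - 2 * d $ q)\<^sup>2)" by (simp add: sum_nonneg)
  also have "\<dots> = (\<Sum>q<\<nu>. (x $ q)\<^sup>2) - 4 * (\<Sum>q<\<nu>. x $ q * d $ q) + 4 * (\<Sum>q<\<nu>. (d $ q)\<^sup>2)"
    by (simp add: power2_diff sum.distrib sum_subtractf sum_distrib_left mult_ac power_mult_distrib)
  finally show ?thesis
    unfolding sq_norm_sum[OF assms(1)] sq_norm_sum[OF assms(2)] scalar_prod_sum[OF assms(2), of x] by simp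
qed

text \<open>The right-hand side for one block: the leader's drift, a feedback signal \<open>s\<close> entering through the
gain, and an input \<open>d\<close>.\<close>

definition block_field :: "real \<Rightarrow> real vec \<Rightarrow> real vec \<Rightarrow> real vec" where
  "block_field s d v = A *\<^sub>v v - s \<cdot>\<^sub>v gain + d"

lemma block_field_carrier:
  "v \<in> carrier_vec \<nu> \<Longrightarrow> d \<in> carrier_vec \<nu> \<Longrightarrow> block_field s d v \<in> carrier_vec \<nu>"
  unfolding block_field_def using A gain_carrier by auto

lemma quad_rate:
  assumes v: "v \<in> carrier_vec \<nu>" and d: "d \<in> carrier_vec \<nu>"
  shows "2 * ((Q *\<^sub>v v) \<bullet> block_field s d v)
    \<le> - decay * quad v + (out v)\<^sup>2 - 2 * \<mu> * s * out v + 2 * (d \<bullet> d)"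
proof -
  have Av: "A *\<^sub>v v \<in> carrier_vec \<nu>" using A v by auto
  have "(Q *\<^sub>v v) \<bullet> block_field s d v = (Q *\<^sub>v v) \<bullet> (A *\<^sub>v v) - s * ((Q *\<^sub>v v) \<bullet> gain) + (Q *\<^sub>v v) \<bullet> d"
    unfolding block_field_def using Av Qc[OF v] d gain_carrier
    by (simp add: scalar_prod_add_distrib[of _ \<nu>] scalar_prod_minus_distrib[of _ \<nu>])
  then show ?thesis
    using quad_drift[OF v] quad_gain[OF v] young[OF Qc[OF v] d] decay_quad_le[OF v] by simp
qed

text \<open>For a complex block \<open>v\<^sub>r + i v\<^sub>i\<close> with output \<open>y\<close>, drift and feedback \<open>\<lambda> y + \<rho>\<close> contribute
\<open>\<bar>y\<bar>\<^sup>2 - 2 \<mu> Re \<lambda> \<bar>y\<bar>\<^sup>2 - 2 \<mu> Re (\<rho> y\<^sup>*)\<close>, where \<open>y\<^sup>*\<close> is the conjugate of \<open>y\<close>. As \<open>\<mu> Re \<lambda> \<ge> 1\<close>, at least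
\<open>- \<bar>y\<bar>\<^sup>2\<close> is left for completing the square, at the cost \<open>\<mu>\<^sup>2 \<bar>\<rho>\<bar>\<^sup>2\<close>. Real and imaginary parts are
kept as two real vectors, so that all derivatives are real.\<close>

lemma complex_quad_rate:
  assumes vr: "vr \<in> carrier_vec \<nu>" and vi: "vi \<in> carrier_vec \<nu>"
    and dr: "dr \<in> carrier_vec \<nu>" and di: "di \<in> carrier_vec \<nu>" and l: "1 \<le> \<mu> * Re l"
    and s: "s = l * Complex (out vr) (out vi) + \<rho>"
  shows "2 * ((Q *\<^sub>v vr) \<bullet> block_field (Re s) dr vr) + 2 * ((Q *\<^sub>v vi) \<bullet> block_field (Im s) di vi)
    \<le> - decay * (quad vr + quad vi) + (\<mu>\<^sup>2 * (cmod \<rho>)\<^sup>2 + 2 * (dr \<bullet> dr + di \<bullet> di))"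
proof -
  define yr yi where "yr = out vr" and "yi = out vi"
  have "Re s * yr + Im s * yi = Re l * (yr\<^sup>2 + yi\<^sup>2) + Re \<rho> * yr + Im \<rho> * yi"
    unfolding s yr_def[symmetric] yi_def[symmetric] by (simp add: algebra_simps power2_eq_square)
  then have "2 * \<mu> * (Re s * yr + Im s * yi)
      = 2 * ((\<mu> * Re l) * (yr\<^sup>2 + yi\<^sup>2)) + 2 * \<mu> * (Re \<rho> * yr + Im \<rho> * yi)"
    by (simp only: distrib_left mult.assoc)
  then have e: "2 * \<mu> * Re s * yr + 2 * \<mu> * Im s * yi
      = 2 * ((\<mu> * Re l) * (yr\<^sup>2 + yi\<^sup>2)) + 2 * \<mu> * (Re \<rho> * yr + Im \<rho> * yi)"
    by (simp only: distrib_left mult.assoc)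
  have "1 * (yr\<^sup>2 + yi\<^sup>2) \<le> (\<mu> * Re l) * (yr\<^sup>2 + yi\<^sup>2)" using l by (intro mult_right_mono) auto
  \<comment> \<open>completing the square in \<open>y\<close>\<close>
  moreover have "0 \<le> (yr + \<mu> * Re \<rho>)\<^sup>2 + (yi + \<mu> * Im \<rho>)\<^sup>2" by simp
  then have "- (2 * \<mu> * (Re \<rho> * yr + Im \<rho> * yi)) \<le> yr\<^sup>2 + yi\<^sup>2 + \<mu>\<^sup>2 * (cmod \<rho>)\<^sup>2"
    by (simp add: cmod_power2 power2_sum power_mult_distrib algebra_simps)
  moreover have "x - (2 * m + z) \<le> b" if "1 * x \<le> m" "- z \<le> x + b" for x m z b :: real
    using that by linarith
  ultimately have "yr\<^sup>2 + yi\<^sup>2 - (2 * \<mu> * Re s * yr + 2 * \<mu> * Im s * yi) \<le> \<mu>\<^sup>2 * (cmod \<rho>)\<^sup>2"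
    unfolding e by blast
  then show ?thesis
    using quad_rate[OF vr dr, of "Re s"] quad_rate[OF vi di, of "Im s"]
    unfolding yr_def yi_def by (simp add: algebra_simps)
qed

end

section \<open>Cascades of scalar differential inequalities\<close>

text \<open>Intervals that begin at time 0; the empty set is included.\<close>

definition time_interval :: "real set \<Rightarrow> bool" where
  "time_interval S \<longleftrightarrow> (\<forall>t\<in>S. 0 \<le> t \<and> {0..t} \<subseteq> S)"

lemma time_intervalD: "time_interval S \<Longrightarrow> t \<in> S \<Longrightarrow> 0 \<le> t" "time_interval S \<Longrightarrow> t \<in> S \<Longrightarrow> {0..t} \<subseteq> S"
  by (auto simp: time_interval_def)

text \<open>Component \<open>p\<close> is driven only by the components \<open>j > p\<close> and by the input \<open>g p\<close>.\<close>

definition scalar_cascade :: "nat \<Rightarrow> real \<Rightarrow> (nat \<Rightarrow> nat \<Rightarrow> real) \<Rightarrow> real set \<Rightarrow>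
    (nat \<Rightarrow> real \<Rightarrow> real) \<Rightarrow> (nat \<Rightarrow> real \<Rightarrow> real) \<Rightarrow> bool" where
  "scalar_cascade n \<epsilon> \<gamma> S V g \<longleftrightarrow> (\<forall>t\<in>S. \<forall>p<n. 0 \<le> V p t \<and>
     (\<exists>V'. (V p has_real_derivative V') (at t within S) \<and>
       V' \<le> - \<epsilon> * V p t + ((\<Sum>j\<in>{p<..<n}. \<gamma> p j * V j t) + g p t)))"

text \<open>Component \<open>n - 1\<close> has no predecessor, so the components can be bounded in descending order. The bound
is chosen before the time set and the trajectory, as uniform boundedness demands.\<close>

lemma scalar_cascade_bounded:
  assumes "0 < \<epsilon>" and \<gamma>: "\<And>p j. 0 \<le> \<gamma> p j"
  shows "\<exists>B\<ge>0. \<forall>S V g. time_interval S \<and> scalar_cascade n \<epsilon> \<gamma> S V g \<and>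
     (\<forall>p<n. V p 0 \<le> R \<and> (\<forall>t\<in>S. g p t \<le> R)) \<longrightarrow> (\<forall>t\<in>S. \<forall>p<n. V p t \<le> B)"
proof -
  define R' where "R' = max R 0"
  \<comment> \<open>induction over the number \<open>k\<close> of components, counted from the last, that are already bounded\<close>
  have "\<exists>B\<ge>0. \<forall>S V g. time_interval S \<and> scalar_cascade n \<epsilon> \<gamma> S V g \<and>
     (\<forall>p<n. V p 0 \<le> R \<and> (\<forall>t\<in>S. g p t \<le> R)) \<longrightarrow> (\<forall>t\<in>S. \<forall>p<n. n \<le> p + k \<longrightarrow> V p t \<le> B)" for k
  proof (induction k)
    case (Suc k)
    then obtain B where B: "0 \<le> B" "\<forall>S V g. time_interval S \<and> scalar_cascade n \<epsilon> \<gamma> S V g \<and>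
       (\<forall>p<n. V p 0 \<le> R \<and> (\<forall>t\<in>S. g p t \<le> R)) \<longrightarrow> (\<forall>t\<in>S. \<forall>p<n. n \<le> p + k \<longrightarrow> V p t \<le> B)"
      by (elim exE conjE)
    define G where "G = (\<Sum>p<n. \<Sum>j<n. \<gamma> p j) * B + R'"
    have "0 \<le> G" unfolding G_def using B(1) \<gamma> by (simp add: R'_def sum_nonneg)
    show ?case
    proof (intro exI[of _ "B + (G / \<epsilon> + R')"] conjI allI impI ballI)
      show "0 \<le> B + (G / \<epsilon> + R')" using B(1) \<open>0 \<le> G\<close> assms(1) by (simp add: R'_def)
      fix S V g t p
      assume *: "time_interval S \<and> scalar_cascade n \<epsilon> \<gamma> S V g \<and> (\<forall>p<n. V p 0 \<le> R \<and> (\<forall>t\<in>S. g p t \<le> R))"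
        and t: "t \<in> S" and p: "p < n" and np: "n \<le> p + Suc k"
      have bd: "V j s \<le> B" if "s \<in> S" "j < n" "p < j" for j s
        using B(2)[THEN spec, of S, THEN spec, of V, THEN spec, of g, THEN mp, OF *] that np by auto
      have tS: "0 \<le> t" "{0..t} \<subseteq> S" using time_intervalD * t by auto
      have "\<forall>s\<in>S. \<exists>V'. (V p has_real_derivative V') (at s within S) \<and>
         V' \<le> - \<epsilon> * V p s + ((\<Sum>j\<in>{p<..<n}. \<gamma> p j * V j s) + g p s)"
        using * p unfolding scalar_cascade_def by blast
      then obtain V' where V': "\<And>s. s \<in> S \<Longrightarrow> (V p has_real_derivative V' s) (at s within S)"
        "\<And>s. s \<in> S \<Longrightarrow> V' s \<le> - \<epsilon> * V p s + ((\<Sum>j\<in>{p<..<n}. \<gamma> p j * V j s) + g p s)"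
        by metis
      have le: "V' s \<le> - \<epsilon> * V p s + G" if s: "s \<in> {0..t}" for s
      proof -
        have sS: "s \<in> S" using s tS by auto
        have "(\<Sum>j\<in>{p<..<n}. \<gamma> p j * V j s) \<le> (\<Sum>j\<in>{p<..<n}. \<gamma> p j * B)"
          using sS bd by (intro sum_mono mult_left_mono \<gamma>) auto
        also have "\<dots> \<le> (\<Sum>j<n. \<gamma> p j * B)"
          using \<gamma> B(1) by (intro sum_mono2) auto
        also have "\<dots> = (\<Sum>j<n. \<gamma> p j) * B" by (simp add: sum_distrib_right)
        also have "\<dots> \<le> (\<Sum>p<n. \<Sum>j<n. \<gamma> p j) * B"
          using p B(1) \<gamma> by (intro mult_right_mono member_le_sum[of p "{..<n}" "\<lambda>p. \<Sum>j<n. \<gamma> p j"])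
            (auto intro: sum_nonneg)
        finally have "(\<Sum>j\<in>{p<..<n}. \<gamma> p j * V j s) + g p s \<le> G"
          using * p sS by (force simp: G_def R'_def)
        with V'(2)[OF sS] show ?thesis by simp
      qed
      have V0: "0 \<le> V p 0" "V p 0 \<le> R'"
        using * p tS unfolding scalar_cascade_def R'_def by auto
      have "V p t \<le> G / \<epsilon> + V p 0"
        by (rule comparison_bounded(2)[where V = "V p" and V' = V' and S = S])
          (use tS \<open>0 < \<epsilon>\<close> \<open>0 \<le> G\<close> V0(1) V'(1) le in auto)
      then show "V p t \<le> B + (G / \<epsilon> + R')" using V0 B(1) by simp
    qed
  qed (auto intro: exI[of _ 0])
  from this[of n] show ?thesis by simp
qed

lemma scalar_cascade_tendsto_0:
  assumes "0 < \<epsilon>" and casc: "scalar_cascade n \<epsilon> \<gamma> {0..} V g"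
    and g: "\<And>p. p < n \<Longrightarrow> (g p \<longlongrightarrow> 0) at_top"
  shows "p < n \<Longrightarrow> (V p \<longlongrightarrow> 0) at_top"
proof (induction "n - p" arbitrary: p rule: less_induct)
  case less
  have "\<forall>s\<in>{0..}. \<exists>V'. (V p has_real_derivative V') (at s within {0..}) \<and>
     V' \<le> - \<epsilon> * V p s + ((\<Sum>j\<in>{p<..<n}. \<gamma> p j * V j s) + g p s)"
    using casc less.prems unfolding scalar_cascade_def by blast
  then obtain V' where V': "\<And>s. s \<in> {0..} \<Longrightarrow> (V p has_real_derivative V' s) (at s within {0..})"
    "\<And>s. s \<in> {0..} \<Longrightarrow> V' s \<le> - \<epsilon> * V p s + ((\<Sum>j\<in>{p<..<n}. \<gamma> p j * V j s) + g p s)"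
    by metis
  have "((\<lambda>s. (\<Sum>j\<in>{p<..<n}. \<gamma> p j * V j s) + g p s) \<longlongrightarrow> (\<Sum>j\<in>{p<..<n}. \<gamma> p j * 0) + 0) at_top"
    using less.hyps by (intro tendsto_add tendsto_sum tendsto_mult_left g less.prems) auto
  then have "((\<lambda>s. (\<Sum>j\<in>{p<..<n}. \<gamma> p j * V j s) + g p s) \<longlongrightarrow> 0) at_top" by simp
  then show ?case
    by (rule comparison_tendsto_0[OF \<open>0 < \<epsilon>\<close> _ V'(1) V'(2), rotated 3])
      (use casc less.prems in \<open>auto simp: scalar_cascade_def\<close>)
qed

section \<open>Triangular coordinates for coupled blocks\<close>

definition lin_comb :: "nat \<Rightarrow> nat \<Rightarrow> (nat \<Rightarrow> real) \<Rightarrow> (nat \<Rightarrow> real vec) \<Rightarrow> real vec" where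
  "lin_comb \<nu> n c v = vec \<nu> (\<lambda>q. \<Sum>s<n. c s * v s $ q)"

lemma lin_comb_carrier: "lin_comb \<nu> n c v \<in> carrier_vec \<nu>" by (simp add: lin_comb_def)

lemma lin_comb_nth: "q < \<nu> \<Longrightarrow> lin_comb \<nu> n c v $ q = (\<Sum>s<n. c s * v s $ q)" by (simp add: lin_comb_def)

lemma lin_comb_has_derivative:
  assumes "\<And>s. s < n \<Longrightarrow> vec_has_derivative \<nu> (f s) (f' s) t S"
  shows "vec_has_derivative \<nu> (\<lambda>t. lin_comb \<nu> n c (\<lambda>s. f s t)) (lin_comb \<nu> n c f') t S"
  using assms unfolding vec_has_derivative_def
  by (auto simp: lin_comb_nth intro!: DERIV_sum DERIV_cmult)

lemma scalar_prod_comb: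
  assumes "x \<in> carrier_vec \<nu>" "\<And>s. s < n \<Longrightarrow> v s \<in> carrier_vec \<nu>"
  shows "x \<bullet> lin_comb \<nu> n c v = (\<Sum>s<n. c s * (x \<bullet> v s))"
proof -
  have "x \<bullet> lin_comb \<nu> n c v = (\<Sum>q<\<nu>. \<Sum>s<n. c s * (x $ q * v s $ q))"
    unfolding scalar_prod_sum[OF lin_comb_carrier]
    by (intro sum.cong refl) (simp add: lin_comb_nth sum_distrib_left mult_ac)
  also have "\<dots> = (\<Sum>s<n. c s * (\<Sum>q<\<nu>. x $ q * v s $ q))"
    by (subst sum.swap) (simp only: sum_distrib_left)
  also have "\<dots> = (\<Sum>s<n. c s * (x \<bullet> v s))"
    by (intro sum.cong refl) (simp add: scalar_prod_sum[OF assms(2)])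
  finally show ?thesis .
qed

lemma mult_mat_comb:
  assumes M: "M \<in> carrier_mat \<nu> \<nu>" and v: "\<And>s. s < n \<Longrightarrow> v s \<in> carrier_vec \<nu>" and q: "q < \<nu>"
  shows "(M *\<^sub>v lin_comb \<nu> n c v) $ q = (\<Sum>s<n. c s * (M *\<^sub>v v s) $ q)"
proof -
  have "(M *\<^sub>v lin_comb \<nu> n c v) $ q = row M q \<bullet> lin_comb \<nu> n c v" using M q by simp
  also have "\<dots> = (\<Sum>s<n. c s * (row M q \<bullet> v s))" by (rule scalar_prod_comb) (use M q v in auto)
  finally show ?thesis using M q by simp
qed

text \<open>The identities \<open>T Y = Y H\<close> and \<open>X Y = I\<close> in components.\<close>

lemma change_of_coordinates:
  fixes H T X Y :: "complex mat" and u :: "nat \<Rightarrow> complex"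
  assumes wit: "similar_mat_wit H T X Y" and H: "H \<in> carrier_mat n n" and p: "p < n"
  shows "(\<Sum>i<n. T $$ (p, i) * (\<Sum>j<n. Y $$ (i, j) * u j)) = (\<Sum>s<n. Y $$ (p, s) * (\<Sum>j<n. H $$ (s, j) * u j))"
    and "(\<Sum>i<n. X $$ (p, i) * (\<Sum>j<n. Y $$ (i, j) * u j)) = u p"
proof -
  note w = similar_mat_witD2[OF H wit]
  have YH: "Y * H = T * Y"
  proof -
    have "Y * H = Y * (X * T * Y)" using w(3) by simp
    also have "\<dots> = Y * (X * (T * Y))" using w by (simp add: assoc_mult_mat[of _ n n _ n _ n])
    also have "\<dots> = (Y * X) * (T * Y)"
      by (rule assoc_mult_mat[symmetric, OF w(7) w(6) mult_carrier_mat[OF w(5) w(7)]])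
    also have "\<dots> = T * Y" using w by simp
    finally show ?thesis .
  qed
  have prod: "(M * M') $$ (p, j) = (\<Sum>i<n. M $$ (p, i) * M' $$ (i, j))"
    if "M \<in> carrier_mat n n" "M' \<in> carrier_mat n n" "j < n" for M M' :: "complex mat" and j
    using that p by (auto simp: scalar_prod_def lessThan_atLeast0)
  have swap: "(\<Sum>i<n. M $$ (p, i) * (\<Sum>j<n. M' $$ (i, j) * u j)) = (\<Sum>j<n. (M * M') $$ (p, j) * u j)"
    if "M \<in> carrier_mat n n" "M' \<in> carrier_mat n n" for M M' :: "complex mat"
  proof -
    have "(\<Sum>i<n. M $$ (p, i) * (\<Sum>j<n. M' $$ (i, j) * u j)) = (\<Sum>j<n. \<Sum>i<n. M $$ (p, i) * M' $$ (i, j) * u j)"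
      unfolding sum_distrib_left by (subst sum.swap) (simp only: mult.assoc)
    also have "\<dots> = (\<Sum>j<n. (M * M') $$ (p, j) * u j)"
      by (intro sum.cong refl) (simp add: prod[OF that] sum_distrib_right)
    finally show ?thesis .
  qed
  show "(\<Sum>i<n. T $$ (p, i) * (\<Sum>j<n. Y $$ (i, j) * u j)) = (\<Sum>s<n. Y $$ (p, s) * (\<Sum>j<n. H $$ (s, j) * u j))"
    using swap[OF w(5,7)] swap[OF w(7) H] YH by simp
  have "(\<Sum>j<n. (X * Y) $$ (p, j) * u j) = (\<Sum>j<n. if j = p then u j else 0)"
    unfolding w(1) using p by (intro sum.cong) auto
  then show "(\<Sum>i<n. X $$ (p, i) * (\<Sum>j<n. Y $$ (i, j) * u j)) = u p"
    using swap[OF w(6,7)] p by simp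
qed

context riccati begin

text \<open>The system \<open>\<zeta>' = (I \<otimes> A - H \<otimes> K C) \<zeta> + d\<close>, written block by block.\<close>

definition coupled :: "nat \<Rightarrow> (nat \<Rightarrow> nat \<Rightarrow> real) \<Rightarrow> real set \<Rightarrow> (nat \<Rightarrow> real \<Rightarrow> real vec) \<Rightarrow>
    (nat \<Rightarrow> real \<Rightarrow> real vec) \<Rightarrow> bool" where
  "coupled n H S \<zeta> d \<longleftrightarrow> (\<forall>t\<in>S. \<forall>p<n. \<zeta> p t \<in> carrier_vec \<nu> \<and> d p t \<in> carrier_vec \<nu> \<and>
     vec_has_derivative \<nu> (\<zeta> p) (block_field (\<Sum>s<n. H p s * out (\<zeta> s t)) (d p t) (\<zeta> p t)) t S)"

lemma block_field_comb:
  assumes v: "\<And>s. s < n \<Longrightarrow> v s \<in> carrier_vec \<nu>" and d: "\<And>s. s < n \<Longrightarrow> d s \<in> carrier_vec \<nu>"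
  shows "lin_comb \<nu> n c (\<lambda>s. block_field (\<sigma> s) (d s) (v s))
    = block_field (\<Sum>s<n. c s * \<sigma> s) (lin_comb \<nu> n c d) (lin_comb \<nu> n c v)"
proof (rule eq_vecI)
  have dims: "dim_vec gain = \<nu>" "dim_row A = \<nu>" using gain_carrier A by auto
  show "dim_vec (lin_comb \<nu> n c (\<lambda>s. block_field (\<sigma> s) (d s) (v s)))
      = dim_vec (block_field (\<Sum>s<n. c s * \<sigma> s) (lin_comb \<nu> n c d) (lin_comb \<nu> n c v))"
    by (simp add: lin_comb_def block_field_def)
  fix q assume "q < dim_vec (block_field (\<Sum>s<n. c s * \<sigma> s) (lin_comb \<nu> n c d) (lin_comb \<nu> n c v))"
  then have q: "q < \<nu>" by (simp add: block_field_def lin_comb_def)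
  have "block_field (\<sigma> s) (d s) (v s) $ q = (A *\<^sub>v v s) $ q - \<sigma> s * gain $ q + d s $ q" if "s < n" for s
    using q dims d[OF that] by (simp add: block_field_def del: index_mult_mat_vec)
  then have "lin_comb \<nu> n c (\<lambda>s. block_field (\<sigma> s) (d s) (v s)) $ q
      = (\<Sum>s<n. c s * ((A *\<^sub>v v s) $ q - \<sigma> s * gain $ q + d s $ q))"
    using q by (simp add: lin_comb_nth)
  also have "\<dots> = (\<Sum>s<n. c s * (A *\<^sub>v v s) $ q) - (\<Sum>s<n. c s * \<sigma> s) * gain $ q + (\<Sum>s<n. c s * d s $ q)"
    by (simp add: algebra_simps sum.distrib sum_subtractf sum_distrib_left)
  also have "\<dots> = block_field (\<Sum>s<n. c s * \<sigma> s) (lin_comb \<nu> n c d) (lin_comb \<nu> n c v) $ q"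
    using q dims mult_mat_comb[OF A v q, where c = c and n = n] lin_comb_nth[OF q, of n c d] lin_comb_carrier[of \<nu> n c d]
    by (simp add: block_field_def del: index_mult_mat_vec)
  finally show "lin_comb \<nu> n c (\<lambda>s. block_field (\<sigma> s) (d s) (v s)) $ q
      = block_field (\<Sum>s<n. c s * \<sigma> s) (lin_comb \<nu> n c d) (lin_comb \<nu> n c v) $ q" .
qed

lemma out_comb: "(\<And>s. s < n \<Longrightarrow> v s \<in> carrier_vec \<nu>) \<Longrightarrow> out (lin_comb \<nu> n c v) = (\<Sum>s<n. c s * out (v s))"
  unfolding out_def by (rule scalar_prod_comb[OF C0])

text \<open>The weight with which block \<open>j\<close> drives block \<open>p\<close> in triangular coordinates, including the factor
\<open>n\<close> from the Cauchy-Schwarz inequality for the sum over \<open>j\<close>.\<close>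

definition cascade_gain :: "nat \<Rightarrow> complex mat \<Rightarrow> nat \<Rightarrow> nat \<Rightarrow> real" where
  "cascade_gain n T p j = \<mu>\<^sup>2 * (real n * ((cmod (T $$ (p, j)))\<^sup>2 * comp_const))"

text \<open>For \<open>c = Re\<close> and \<open>c = Im\<close> these are the real and the imaginary part of block \<open>p\<close> of \<open>Y u\<close>.\<close>

definition modal_part :: "nat \<Rightarrow> complex mat \<Rightarrow> (complex \<Rightarrow> real) \<Rightarrow> (nat \<Rightarrow> real \<Rightarrow> real vec) \<Rightarrow> nat \<Rightarrow> real \<Rightarrow> real vec" where
  "modal_part n Y c u p t = lin_comb \<nu> n (\<lambda>s. c (Y $$ (p, s))) (\<lambda>s. u s t)"

lemma modal_part_carrier: "modal_part n Y c u p t \<in> carrier_vec \<nu>"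
  by (simp add: modal_part_def lin_comb_carrier)

lemma modal_part_recombine:
  assumes "similar_mat_wit H T X Y" "H \<in> carrier_mat n n" "p < n" "q < \<nu>"
  shows "complex_of_real (u p t $ q)
    = (\<Sum>i<n. X $$ (p, i) * Complex (modal_part n Y Re u i t $ q) (modal_part n Y Im u i t $ q))"
proof -
  have "(\<Sum>j<n. Y $$ (i, j) * complex_of_real (u j t $ q))
      = Complex (modal_part n Y Re u i t $ q) (modal_part n Y Im u i t $ q)" for i
    by (rule complex_eqI) (simp_all add: modal_part_def lin_comb_nth[OF assms(4)])
  then show ?thesis
    using change_of_coordinates(2)[OF assms(1-3), of "\<lambda>j. complex_of_real (u j t $ q)"] by simp
qed

text \<open>The drift and the gain commute with the change of block coordinates, so the real and imaginary parts
of the blocks of \<open>Y \<zeta>\<close> follow \<open>block_field\<close> with the feedback \<open>\<sigma> = (T y)\<^sub>p\<close> built from the outputs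
\<open>y\<close>. As \<open>T\<close> is triangular, \<open>\<sigma>\<close> consists of the diagonal part \<open>T\<^sub>p\<^sub>p y\<^sub>p\<close>, which the gain dominates, and
the contribution \<open>\<rho>\<close> of the later blocks, which their quadratic forms bound.\<close>

lemma coupled_scalar_cascade:
  fixes n :: nat and H :: "real mat" and T X Y :: "complex mat"
  defines "W \<equiv> modal_part n Y"
  assumes coup: "coupled n (\<lambda>p s. H $$ (p, s)) S \<zeta> d"
    and H: "H \<in> carrier_mat n n" and wit: "similar_mat_wit (cmat H) T X Y" and ut: "upper_triangular T"
    and \<mu>: "\<And>p. p < n \<Longrightarrow> 1 \<le> \<mu> * Re (T $$ (p, p))"
  shows "scalar_cascade n decay (cascade_gain n T) S
     (\<lambda>p t. quad (W Re \<zeta> p t) + quad (W Im \<zeta> p t))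
     (\<lambda>p t. 2 * (W Re d p t \<bullet> W Re d p t + W Im d p t \<bullet> W Im d p t))"
  unfolding scalar_cascade_def
proof (intro ballI allI impI conjI)
  fix t p assume t: "t \<in> S" and p: "p < n"
  have Wc: "W c u p t \<in> carrier_vec \<nu>" for c u p t unfolding W_def by (rule modal_part_carrier)
  show "0 \<le> quad (W Re \<zeta> p t) + quad (W Im \<zeta> p t)" by (intro add_nonneg_nonneg quad_nonneg Wc)
  have \<zeta>: "\<zeta> s t \<in> carrier_vec \<nu>" and d: "d s t \<in> carrier_vec \<nu>"
    and der: "vec_has_derivative \<nu> (\<zeta> s) (block_field (\<Sum>j<n. H $$ (s, j) * out (\<zeta> j t)) (d s t) (\<zeta> s t)) t S"
    if "s < n" for s
    using coup t that by (auto simp: coupled_def)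
  define y where "y i = (\<Sum>j<n. Y $$ (i, j) * complex_of_real (out (\<zeta> j t)))" for i
  define \<sigma> where "\<sigma> = (\<Sum>i<n. T $$ (p, i) * y i)"
  have y: "y i = Complex (out (W Re \<zeta> i t)) (out (W Im \<zeta> i t))" for i
    unfolding W_def modal_part_def y_def by (rule complex_eqI) (simp_all add: out_comb[OF \<zeta>])
  have cH: "cmat H \<in> carrier_mat n n" using H by simp
  have \<sigma>': "\<sigma> = (\<Sum>s<n. Y $$ (p, s) * of_real (\<Sum>j<n. H $$ (s, j) * out (\<zeta> j t)))"
    using change_of_coordinates(1)[OF wit cH p, of "\<lambda>j. complex_of_real (out (\<zeta> j t))"] H
    by (simp add: \<sigma>_def y_def)
  have dW: "vec_has_derivative \<nu> (\<lambda>t. W c \<zeta> p t)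
      (block_field (\<Sum>s<n. c (Y $$ (p, s)) * (\<Sum>j<n. H $$ (s, j) * out (\<zeta> j t))) (W c d p t) (W c \<zeta> p t)) t S" for c
    unfolding W_def modal_part_def
    using lin_comb_has_derivative[of n \<nu> \<zeta> _ t S "\<lambda>s. c (Y $$ (p, s))", OF der]
    by (simp add: block_field_comb[OF \<zeta> d])
  have dR: "vec_has_derivative \<nu> (\<lambda>t. W Re \<zeta> p t) (block_field (Re \<sigma>) (W Re d p t) (W Re \<zeta> p t)) t S"
    using dW[of Re] by (simp add: \<sigma>')
  have dI: "vec_has_derivative \<nu> (\<lambda>t. W Im \<zeta> p t) (block_field (Im \<sigma>) (W Im d p t) (W Im \<zeta> p t)) t S"
    using dW[of Im] by (simp add: \<sigma>')
  define V' where "V' = 2 * ((Q *\<^sub>v W Re \<zeta> p t) \<bullet> block_field (Re \<sigma>) (W Re d p t) (W Re \<zeta> p t))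
     + 2 * ((Q *\<^sub>v W Im \<zeta> p t) \<bullet> block_field (Im \<sigma>) (W Im d p t) (W Im \<zeta> p t))"
  have derV: "((\<lambda>t. quad (W Re \<zeta> p t) + quad (W Im \<zeta> p t)) has_real_derivative V') (at t within S)"
    unfolding V'_def
    by (intro DERIV_add quad_has_derivative[OF t] Wc block_field_carrier dR dI)
  define \<rho> where "\<rho> = (\<Sum>j\<in>{p<..<n}. T $$ (p, j) * y j)"
  have Tc: "dim_row T = n" using similar_mat_witD2(5)[OF cH wit] by simp
  have "\<sigma> = (\<Sum>i\<in>insert p {p<..<n}. T $$ (p, i) * y i)"
    unfolding \<sigma>_def using p ut Tc
    by (intro sum.mono_neutral_right) (auto simp: upper_triangular_def)
  then have s: "\<sigma> = T $$ (p, p) * Complex (out (W Re \<zeta> p t)) (out (W Im \<zeta> p t)) + \<rho>"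
    by (simp add: \<rho>_def y)
  have "(cmod \<rho>)\<^sup>2 \<le> (\<Sum>j\<in>{p<..<n}. cmod (T $$ (p, j) * y j))\<^sup>2"
    unfolding \<rho>_def by (intro power_mono norm_sum) simp
  also have "\<dots> \<le> (\<Sum>j\<in>{p<..<n}. (cmod (T $$ (p, j) * y j))\<^sup>2) * card {p<..<n}"
    by (rule sum_squared_le_sum_of_squares)
  also have "\<dots> \<le> (\<Sum>j\<in>{p<..<n}. (cmod (T $$ (p, j) * y j))\<^sup>2) * n"
    by (intro mult_left_mono) (auto simp: sum_nonneg)
  also have "\<dots> \<le> (\<Sum>j\<in>{p<..<n}. (cmod (T $$ (p, j)))\<^sup>2 * (comp_const * (quad (W Re \<zeta> j t) + quad (W Im \<zeta> j t)))) * n"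
  proof (intro mult_right_mono sum_mono)
    fix j
    have "(cmod (y j))\<^sup>2 = (out (W Re \<zeta> j t))\<^sup>2 + (out (W Im \<zeta> j t))\<^sup>2"
      by (simp add: y cmod_power2)
    also have "\<dots> \<le> comp_const * (quad (W Re \<zeta> j t) + quad (W Im \<zeta> j t))"
      unfolding distrib_left by (intro add_mono out_le Wc)
    finally show "(cmod (T $$ (p, j) * y j))\<^sup>2
        \<le> (cmod (T $$ (p, j)))\<^sup>2 * (comp_const * (quad (W Re \<zeta> j t) + quad (W Im \<zeta> j t)))"
      by (simp add: norm_mult power_mult_distrib mult_left_mono)
  qed simp
  finally have "\<mu>\<^sup>2 * (cmod \<rho>)\<^sup>2
      \<le> \<mu>\<^sup>2 * ((\<Sum>j\<in>{p<..<n}. (cmod (T $$ (p, j)))\<^sup>2 * (comp_const * (quad (W Re \<zeta> j t) + quad (W Im \<zeta> j t)))) * n)"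
    by (intro mult_left_mono) simp_all
  also have "\<dots> = (\<Sum>j\<in>{p<..<n}. cascade_gain n T p j * (quad (W Re \<zeta> j t) + quad (W Im \<zeta> j t)))"
    unfolding sum_distrib_left sum_distrib_right cascade_gain_def by (intro sum.cong refl) (simp add: mult_ac)
  finally have \<rho>: "\<mu>\<^sup>2 * (cmod \<rho>)\<^sup>2
      \<le> (\<Sum>j\<in>{p<..<n}. cascade_gain n T p j * (quad (W Re \<zeta> j t) + quad (W Im \<zeta> j t)))" .
  have "V' \<le> - decay * (quad (W Re \<zeta> p t) + quad (W Im \<zeta> p t))
      + (\<mu>\<^sup>2 * (cmod \<rho>)\<^sup>2 + 2 * (W Re d p t \<bullet> W Re d p t + W Im d p t \<bullet> W Im d p t))"
    unfolding V'_def by (rule complex_quad_rate[OF Wc Wc Wc Wc \<mu>[OF p] s])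
  with \<rho> derV show "\<exists>V'. ((\<lambda>t. quad (W Re \<zeta> p t) + quad (W Im \<zeta> p t)) has_real_derivative V') (at t within S) \<and>
     V' \<le> - decay * (quad (W Re \<zeta> p t) + quad (W Im \<zeta> p t))
       + ((\<Sum>j\<in>{p<..<n}. cascade_gain n T p j * (quad (W Re \<zeta> j t) + quad (W Im \<zeta> j t)))
       + 2 * (W Re d p t \<bullet> W Re d p t + W Im d p t \<bullet> W Im d p t))"
    by (intro exI[of _ V']) linarith
qed

end

section \<open>Triangularization and flows with imaginary spectrum\<close>

lemma triangular_eigenvalue:
  assumes M: "M \<in> carrier_mat n n" and sim: "similar_mat M T" and ut: "upper_triangular T" and p: "p < n"
  shows "eigenvalue M ((T :: complex mat) $$ (p, p))"
proof -
  obtain X Y where "similar_mat_wit M T X Y" using sim unfolding similar_mat_def by blast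
  note w = similar_mat_witD2[OF M this]
  have "char_poly M = (\<Prod>a\<leftarrow>diag_mat T. [:- a, 1:])"
    using char_poly_similar[OF sim] char_poly_upper_triangular[OF w(5) ut] by simp
  moreover have "T $$ (p, p) \<in> set (diag_mat T)" using p w(5) by (auto simp: diag_mat_def)
  ultimately have "poly (char_poly M) (T $$ (p, p)) = 0"
    by (auto simp: poly_prod_list prod_list_zero_iff image_iff)
  then show ?thesis using eigenvalue_root_char_poly[OF M] by blast
qed

lemma jordan_matrix_triangular: "upper_triangular (jordan_matrix n_as)"
  by (rule upper_triangularI) (auto simp: jordan_matrix_upper_triangular)

lemma complex_jordan_nf_exists:
  assumes M: "(M :: complex mat) \<in> carrier_mat n n" shows "\<exists>n_as. jordan_nf M n_as"
  using char_poly_factorized[OF M] jordan_nf_exists[OF M] by blast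

lemma ex_triangular_similar:
  assumes M: "(M :: complex mat) \<in> carrier_mat n n"
  obtains T X Y where "similar_mat_wit M T X Y" "upper_triangular T" "\<And>p. p < n \<Longrightarrow> eigenvalue M (T $$ (p, p))"
proof -
  obtain n_as where j: "jordan_nf M n_as" using complex_jordan_nf_exists[OF M] by blast
  then have sim: "similar_mat M (jordan_matrix n_as)" by (simp add: jordan_nf_def)
  then obtain X Y where "similar_mat_wit M (jordan_matrix n_as) X Y" unfolding similar_mat_def by blast
  then show thesis
    using that jordan_matrix_triangular triangular_eigenvalue[OF M sim jordan_matrix_triangular] by blast
qed

lemma jordan_matrix_diagonal:
  assumes "\<And>na. na \<in> set n_as \<Longrightarrow> fst na = 1" "i < length n_as" "j < length n_as" "i \<noteq> j"
  shows "jordan_matrix n_as $$ (i, j) = 0"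
  using assms
proof (induction n_as arbitrary: i j)
  case (Cons na n_as)
  obtain a where na: "na = (1, a)" using Cons.prems(1)[of na] by (cases na) auto
  have len: "sum_list (map fst n_as) = length n_as"
    using Cons.prems(1) by (simp add: sum_list_triv map_idI[symmetric] cong: map_cong)
  show ?case
    unfolding na jordan_matrix_Cons
    using Cons.prems Cons.IH[of "i - 1" "j - 1"] by (auto simp: len)
qed simp

text \<open>Let the Jordan blocks of an eigenvalue have sizes \<open>k\<^sub>1, k\<^sub>2, \<dots>\<close>. Its algebraic multiplicity is the
sum of the \<open>k\<^sub>i\<close> and its geometric multiplicity the sum of the \<open>min 1 k\<^sub>i\<close>. Equality of the sums
forces \<open>k\<^sub>i = 1\<close> for all \<open>i\<close>.\<close>

lemma semisimple_blocks:
  assumes M: "M \<in> carrier_mat n n" and j: "jordan_nf M n_as"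
    and ss: "\<And>z. eigenvalue M z \<Longrightarrow> semisimple_eigenvalue M z" and na: "na \<in> set n_as"
  shows "fst na = 1"
proof -
  define ev where "ev = snd na"
  define L where "L = map fst (filter (\<lambda>na. snd na = ev) n_as)"
  have fL: "fst na \<in> set L" using na by (auto simp: L_def ev_def)
  have pos: "0 < fst na" using j na unfolding jordan_nf_def by (metis gr0I image_eqI)
  have ord: "Polynomial.order ev (char_poly M) = sum_list L" unfolding L_def by (rule jordan_nf_order[OF j])
  have "sum_list L \<noteq> 0" using fL pos by (metis less_numeral_extra(3) sum_list_eq_0_iff)
  then have "poly (char_poly M) ev = 0" unfolding order_root ord by simp
  then have "eigenvalue M ev" using eigenvalue_root_char_poly[OF M] by blast
  then have "semisimple_eigenvalue M ev" by (rule ss)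
  then have "Polynomial.order ev (char_poly M) = kernel_dim (char_matrix M ev)" by (simp add: semisimple_eigenvalue_def)
  also have "\<dots> = dim_gen_eigenspace M ev 1"
  proof -
    have "char_matrix M ev \<in> carrier_mat n n" using M by (simp add: char_matrix_def)
    then have "char_matrix M ev ^\<^sub>m 1 = char_matrix M ev" by simp
    then show ?thesis by (simp add: dim_gen_eigenspace_def)
  qed
  also have "\<dots> = sum_list (map (min 1) L)"
    unfolding dim_gen_eigenspace[OF j] L_def by (simp add: split_def)
  finally have eq: "sum_list L = sum_list (map (min 1) L)" using ord by simp
  have "x = min 1 x" if "x \<in> set L" "sum_list L = sum_list (map (min 1) L)" for x and L :: "nat list"
    using that
  proof (induction L)
    case (Cons y L)
    have le: "sum_list (map (min 1) L) \<le> sum_list L"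
      using sum_list_mono[of L "min 1" id] by simp
    moreover have "y + sum_list L = min 1 y + sum_list (map (min 1) L)" using Cons.prems(2) by simp
    moreover have "min 1 y \<le> y" by simp
    ultimately have "y = min 1 y \<and> sum_list L = sum_list (map (min 1) L)" by linarith
    with Cons show ?case by auto
  qed simp
  from this[OF fL eq] pos show ?thesis by simp
qed

lemma ex_diagonal_similar:
  assumes M: "M \<in> carrier_mat n n" and ss: "\<And>z. eigenvalue M z \<Longrightarrow> semisimple_eigenvalue M z"
  obtains D X Y where "similar_mat_wit M D X Y"
    "\<And>i j. i < n \<Longrightarrow> j < n \<Longrightarrow> i \<noteq> j \<Longrightarrow> D $$ (i, j) = 0" "\<And>p. p < n \<Longrightarrow> eigenvalue M (D $$ (p, p))"
proof -
  obtain n_as where j: "jordan_nf M n_as" using complex_jordan_nf_exists[OF M] by blast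
  then have sim: "similar_mat M (jordan_matrix n_as)" by (simp add: jordan_nf_def)
  then obtain X Y where wit: "similar_mat_wit M (jordan_matrix n_as) X Y" unfolding similar_mat_def by blast
  have one: "fst na = 1" if "na \<in> set n_as" for na by (rule semisimple_blocks[OF M j ss that])
  have "sum_list (map fst n_as) = length n_as"
    using one by (simp add: sum_list_triv cong: map_cong)
  then have "n = length n_as" using carrier_matD(1)[OF similar_mat_witD2(5)[OF M wit]] by simp
  then show thesis
    using that[OF wit] jordan_matrix_diagonal[OF one] triangular_eigenvalue[OF M sim jordan_matrix_triangular]
    by blast
qed

text \<open>In diagonalizing coordinates every component satisfies \<open>y' = \<omega> y\<close> with imaginary \<open>\<omega>\<close>, hence its
modulus is constant.\<close>

lemma semisimple_flow_bounded:
  assumes A: "A \<in> carrier_mat \<nu> \<nu>"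
    and ev: "\<And>z. eigenvalue (cmat A) z \<Longrightarrow> Re z = 0 \<and> semisimple_eigenvalue (cmat A) z"
  shows "\<exists>c\<ge>0. \<forall>S x R. time_interval S \<and>
      (\<forall>t\<in>S. x t \<in> carrier_vec \<nu> \<and> vec_has_derivative \<nu> x (A *\<^sub>v x t) t S) \<and>
      (\<forall>q<\<nu>. \<bar>x 0 $ q\<bar> \<le> R) \<longrightarrow> (\<forall>t\<in>S. \<forall>q<\<nu>. \<bar>x t $ q\<bar> \<le> c * R)"
proof -
  have cA: "cmat A \<in> carrier_mat \<nu> \<nu>" using A by simp
  obtain D X Y where wit: "similar_mat_wit (cmat A) D X Y"
    and diag: "\<And>i j. i < \<nu> \<Longrightarrow> j < \<nu> \<Longrightarrow> i \<noteq> j \<Longrightarrow> D $$ (i, j) = 0"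
    and evD: "\<And>p. p < \<nu> \<Longrightarrow> eigenvalue (cmat A) (D $$ (p, p))"
    using ex_diagonal_similar[OF cA] ev by metis
  define c where "c = (\<Sum>q<\<nu>. \<Sum>p<\<nu>. cmod (X $$ (q, p)) * (\<Sum>j<\<nu>. cmod (Y $$ (p, j))))"
  have c0: "0 \<le> c" by (simp add: c_def sum_nonneg)
  have main: "\<bar>x t $ q\<bar> \<le> c * R"
    if S: "time_interval S"
      and sol: "\<And>t. t \<in> S \<Longrightarrow> x t \<in> carrier_vec \<nu> \<and> vec_has_derivative \<nu> x (A *\<^sub>v x t) t S"
      and R: "\<And>q. q < \<nu> \<Longrightarrow> \<bar>x 0 $ q\<bar> \<le> R" and t: "t \<in> S" and q: "q < \<nu>" for S x R t q
  proof -
    define y where "y p s = (\<Sum>j<\<nu>. Y $$ (p, j) * complex_of_real (x s $ j))" for p s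
    have "0 \<le> R" using R[OF q] by simp
    \<comment> \<open>the derivative of \<open>\<bar>y\<bar>\<^sup>2 = (Re y)\<^sup>2 + (Im y)\<^sup>2\<close> vanishes; real and imaginary parts avoid complex derivatives\<close>
    have const: "(cmod (y p t))\<^sup>2 \<le> (cmod (y p 0))\<^sup>2" if p: "p < \<nu>" for p
    proof (rule nonincreasing_of_deriv_nonpos[where V = "\<lambda>s. (cmod (y p s))\<^sup>2" and V' = "\<lambda>_. 0" and S = S])
      show "0 \<le> t" "{0..t} \<subseteq> S" using time_intervalD[OF S t] by auto
      fix s assume "s \<in> {0..t}"
      then have s: "s \<in> S" using time_intervalD[OF S t] by auto
      define \<omega> where "\<omega> = D $$ (p, p)"
      have dx: "((\<lambda>s. x s $ j) has_real_derivative (A *\<^sub>v x s) $ j) (at s within S)" if "j < \<nu>" for j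
        using sol[OF s] that by (simp add: vec_has_derivative_def)
      have sumD: "(\<Sum>j<\<nu>. Y $$ (p, j) * complex_of_real ((A *\<^sub>v x s) $ j)) = \<omega> * y p s"
      proof -
        have Ax: "complex_of_real ((A *\<^sub>v x s) $ j) = (\<Sum>i<\<nu>. cmat A $$ (j, i) * complex_of_real (x s $ i))"
          if "j < \<nu>" for j
        proof -
          have "x s \<in> carrier_vec \<nu>" using sol[OF s] by simp
          then have "(A *\<^sub>v x s) $ j = (\<Sum>i<\<nu>. A $$ (j, i) * x s $ i)"
            using A that by (simp add: scalar_prod_sum)
          then show ?thesis using A that by simp
        qed
        have "(\<Sum>j<\<nu>. Y $$ (p, j) * complex_of_real ((A *\<^sub>v x s) $ j))
            = (\<Sum>j<\<nu>. Y $$ (p, j) * (\<Sum>i<\<nu>. cmat A $$ (j, i) * complex_of_real (x s $ i)))"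
          by (intro sum.cong refl) (simp only: Ax lessThan_iff)
        also have "\<dots> = (\<Sum>i<\<nu>. D $$ (p, i) * y i s)"
          unfolding y_def by (rule change_of_coordinates(1)[OF wit cA p, symmetric])
        also have "\<dots> = (\<Sum>i<\<nu>. if i = p then \<omega> * y p s else 0)"
          by (intro sum.cong refl) (use diag p in \<open>auto simp: \<omega>_def\<close>)
        finally show ?thesis using p by simp
      qed
      have dr: "((\<lambda>s. Re (y p s)) has_real_derivative Re (\<omega> * y p s)) (at s within S)"
        unfolding sumD[symmetric] unfolding y_def Re_sum Re_complex_of_real times_complex.sel Im_complex_of_real
        by (auto intro!: DERIV_sum derivative_eq_intros dx)
      have di: "((\<lambda>s. Im (y p s)) has_real_derivative Im (\<omega> * y p s)) (at s within S)"
        unfolding sumD[symmetric] unfolding y_def Im_sum Re_complex_of_real times_complex.sel Im_complex_of_real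
        by (auto intro!: DERIV_sum derivative_eq_intros dx)
      have "Re \<omega> = 0" using ev[OF evD[OF p]] by (simp add: \<omega>_def)
      then have z: "2 * Re (y p s) * Re (\<omega> * y p s) + 2 * Im (y p s) * Im (\<omega> * y p s) = 0"
        by (simp add: algebra_simps)
      have dsq: "((\<lambda>s. (f s)\<^sup>2) has_real_derivative 2 * f s * f') (at s within S)"
        if "(f has_real_derivative f') (at s within S)" for f f'
        by (rule DERIV_cong[OF DERIV_power[OF that]]) simp
      have "((\<lambda>s. (Re (y p s))\<^sup>2 + (Im (y p s))\<^sup>2) has_real_derivative
          2 * Re (y p s) * Re (\<omega> * y p s) + 2 * Im (y p s) * Im (\<omega> * y p s)) (at s within S)"
        by (rule DERIV_add[OF dsq[OF dr] dsq[OF di]])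
      then show "((\<lambda>s. (cmod (y p s))\<^sup>2) has_real_derivative 0) (at s within S)"
        unfolding cmod_power2 z .
    qed simp
    then have const': "cmod (y p t) \<le> cmod (y p 0)" if "p < \<nu>" for p
      using that power2_le_imp_le norm_ge_zero by blast
    have y0: "cmod (y p 0) \<le> (\<Sum>j<\<nu>. cmod (Y $$ (p, j))) * R" for p
    proof -
      have "cmod (y p 0) \<le> (\<Sum>j<\<nu>. cmod (Y $$ (p, j) * complex_of_real (x 0 $ j)))"
        unfolding y_def by (rule norm_sum)
      also have "\<dots> \<le> (\<Sum>j<\<nu>. cmod (Y $$ (p, j)) * R)"
        by (intro sum_mono) (simp add: norm_mult mult_left_mono R)
      finally show ?thesis by (simp add: sum_distrib_right)
    qed
    have "complex_of_real (x t $ q) = (\<Sum>p<\<nu>. X $$ (q, p) * y p t)"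
      unfolding y_def
      using change_of_coordinates(2)[OF wit cA q, of "\<lambda>j. complex_of_real (x t $ j)"] by simp
    then have "\<bar>x t $ q\<bar> = cmod (\<Sum>p<\<nu>. X $$ (q, p) * y p t)" by (metis norm_of_real)
    also have "\<dots> \<le> (\<Sum>p<\<nu>. cmod (X $$ (q, p) * y p t))" by (rule norm_sum)
    also have "\<dots> \<le> (\<Sum>p<\<nu>. cmod (X $$ (q, p)) * ((\<Sum>j<\<nu>. cmod (Y $$ (p, j))) * R))"
      unfolding norm_mult
      by (intro sum_mono mult_left_mono) (use const' y0 order_trans in \<open>auto intro: order_trans\<close>)
    also have "\<dots> = (\<Sum>p<\<nu>. cmod (X $$ (q, p)) * (\<Sum>j<\<nu>. cmod (Y $$ (p, j)))) * R"
      by (simp only: sum_distrib_right mult.assoc)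
    also have "\<dots> \<le> c * R"
      unfolding c_def using q \<open>0 \<le> R\<close>
      by (intro mult_right_mono member_le_sum[of q "{..<\<nu>}" "\<lambda>q. \<Sum>p<\<nu>. cmod (X $$ (q, p)) * (\<Sum>j<\<nu>. cmod (Y $$ (p, j)))"])
        (auto intro!: sum_nonneg mult_nonneg_nonneg)
    finally show ?thesis .
  qed
  show ?thesis
  proof (intro exI[of _ c] conjI c0 allI impI ballI)
    fix S x R t q
    assume *: "time_interval S \<and> (\<forall>t\<in>S. x t \<in> carrier_vec \<nu> \<and> vec_has_derivative \<nu> x (A *\<^sub>v x t) t S) \<and>
      (\<forall>q<\<nu>. \<bar>x 0 $ q\<bar> \<le> R)" and t: "t \<in> S" and q: "q < \<nu>"
    show "\<bar>x t $ q\<bar> \<le> c * R" by (rule main[OF _ _ _ t q]) (use * in auto)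
  qed
qed

section \<open>Inputs and states of coupled blocks\<close>

context riccati begin

text \<open>Pass to triangular coordinates, bound the quadratic forms of the blocks by the cascade, and return.
The constants depend on \<open>H\<close> and \<open>R\<close> only.\<close>

lemma coupled_bounded:
  assumes H: "H \<in> carrier_mat n n" and ev: "\<And>z. eigenvalue (cmat H) z \<Longrightarrow> 1 \<le> \<mu> * Re z"
  shows "\<exists>B. \<forall>S \<zeta> d. time_interval S \<and> coupled n (\<lambda>p s. H $$ (p, s)) S \<zeta> d \<and>
     (\<forall>p<n. \<forall>q<\<nu>. \<bar>\<zeta> p 0 $ q\<bar> \<le> R \<and> (\<forall>t\<in>S. \<bar>d p t $ q\<bar> \<le> R)) \<longrightarrow>
     (\<forall>t\<in>S. \<forall>p<n. \<forall>q<\<nu>. \<bar>\<zeta> p t $ q\<bar> \<le> B)"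
proof -
  have cH: "cmat H \<in> carrier_mat n n" using H by simp
  obtain T X Y where wit: "similar_mat_wit (cmat H) T X Y" and ut: "upper_triangular T"
    and evT: "\<And>p. p < n \<Longrightarrow> eigenvalue (cmat H) (T $$ (p, p))"
    using ex_triangular_similar[OF cH] by metis
  have \<mu>T: "1 \<le> \<mu> * Re (T $$ (p, p))" if "p < n" for p using ev evT that by blast
  define W where "W = modal_part n Y"
  define cY where "cY = (\<Sum>p<n. \<Sum>s<n. cmod (Y $$ (p, s)))"
  define cX where "cX = (\<Sum>p<n. \<Sum>s<n. cmod (X $$ (p, s)))"
  define R1 where "R1 = (cY * R)\<^sup>2"
  \<comment> \<open>bounds both the initial quadratic forms and the inputs of the cascade\<close>
  define R2 where "R2 = 2 * (form_const Q * R1) + 4 * (\<nu> * R1)"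
  have R1: "0 \<le> R1" by (simp add: R1_def)
  have W_le: "(W c u p t $ q)\<^sup>2 \<le> R1"
    if c: "\<And>z. \<bar>c z\<bar> \<le> cmod z" and u: "\<And>s. s < n \<Longrightarrow> \<bar>u s t $ q\<bar> \<le> R" and p: "p < n" and q: "q < \<nu>" for c u p t q
  proof -
    have "0 \<le> R" using u[OF p] by simp
    have "\<bar>W c u p t $ q\<bar> \<le> (\<Sum>s<n. \<bar>c (Y $$ (p, s)) * u s t $ q\<bar>)"
      unfolding W_def modal_part_def lin_comb_nth[OF q] by (rule sum_abs)
    also have "\<dots> \<le> (\<Sum>s<n. cmod (Y $$ (p, s)) * R)"
      unfolding abs_mult by (intro sum_mono mult_mono c u) auto
    also have "\<dots> = (\<Sum>s<n. cmod (Y $$ (p, s))) * R" by (simp add: sum_distrib_right)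
    also have "\<dots> \<le> cY * R"
      unfolding cY_def using p \<open>0 \<le> R\<close>
      by (intro mult_right_mono member_le_sum[of p "{..<n}" "\<lambda>p. \<Sum>s<n. cmod (Y $$ (p, s))"]) (auto intro!: sum_nonneg)
    finally show ?thesis unfolding R1_def by (metis abs_ge_zero power2_abs power_mono)
  qed
  have sq_le: "v \<bullet> v \<le> \<nu> * R1" if "v \<in> carrier_vec \<nu>" "\<And>q. q < \<nu> \<Longrightarrow> (v $ q)\<^sup>2 \<le> R1" for v
    using sum_bounded_above[of "{..<\<nu>}" "\<lambda>q. (v $ q)\<^sup>2" R1] that by (simp add: sq_norm_sum)
  have Wc: "W c u p t \<in> carrier_vec \<nu>" for c u p t unfolding W_def by (rule modal_part_carrier)
  have gain_nonneg: "0 \<le> cascade_gain n T p j" for p j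
    unfolding cascade_gain_def using comp_const_nonneg by simp
  obtain B where B: "0 \<le> B" "\<forall>S V g. time_interval S \<and> scalar_cascade n decay (cascade_gain n T) S V g \<and>
     (\<forall>p<n. V p 0 \<le> R2 \<and> (\<forall>t\<in>S. g p t \<le> R2)) \<longrightarrow> (\<forall>t\<in>S. \<forall>p<n. V p t \<le> B)"
    using scalar_cascade_bounded[where \<epsilon> = decay and \<gamma> = "cascade_gain n T" and n = n and R = R2, OF decay_pos gain_nonneg] by (elim exE conjE)
  define B1 where "B1 = comp_const * B + 1"
  show ?thesis
  proof (intro exI[of _ "cX * (2 * B1)"] allI impI ballI)
    fix S \<zeta> d t p q
    assume *: "time_interval S \<and> coupled n (\<lambda>p s. H $$ (p, s)) S \<zeta> d \<and>
     (\<forall>p<n. \<forall>q<\<nu>. \<bar>\<zeta> p 0 $ q\<bar> \<le> R \<and> (\<forall>t\<in>S. \<bar>d p t $ q\<bar> \<le> R))"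
      and t: "t \<in> S" and p: "p < n" and q: "q < \<nu>"
    define V where "V p t = quad (W Re \<zeta> p t) + quad (W Im \<zeta> p t)" for p t
    define g where "g p t = 2 * (W Re d p t \<bullet> W Re d p t + W Im d p t \<bullet> W Im d p t)" for p t
    have casc: "scalar_cascade n decay (cascade_gain n T) S V g"
      unfolding V_def[abs_def] g_def[abs_def] W_def
      by (rule coupled_scalar_cascade[OF _ H wit ut \<mu>T]) (use * in auto)
    have V0: "V p 0 \<le> R2" if p: "p < n" for p
    proof -
      have "quad (W c \<zeta> p 0) \<le> form_const Q * R1" if "\<And>z. \<bar>c z\<bar> \<le> cmod z" for c
        unfolding quad_def by (rule form_le[OF Q Wc W_le[OF that _ p]]) (use * in auto)
      from this[of Re] this[of Im] have "V p 0 \<le> 2 * (form_const Q * R1)"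
        unfolding V_def using abs_Re_le_cmod abs_Im_le_cmod by fastforce
      then show ?thesis using mult_nonneg_nonneg[of "real \<nu>" R1] R1 unfolding R2_def by linarith
    qed
    have g0: "g p s \<le> R2" if p: "p < n" and s: "s \<in> S" for p s
    proof -
      have "W c d p s \<bullet> W c d p s \<le> \<nu> * R1" if "\<And>z. \<bar>c z\<bar> \<le> cmod z" for c
        by (rule sq_le[OF Wc W_le[OF that _ p]]) (use * s in auto)
      from this[of Re] this[of Im] have "g p s \<le> 4 * (\<nu> * R1)"
        unfolding g_def using abs_Re_le_cmod abs_Im_le_cmod by fastforce
      then show ?thesis using mult_nonneg_nonneg[OF form_const_nonneg R1, of Q] unfolding R2_def by linarith
    qed
    have V: "V i t \<le> B" if "i < n" for i
      using B(2)[THEN spec, of S, THEN spec, of V, THEN spec, of g] * casc V0 g0 t that by blast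
    have Wb: "\<bar>W Re \<zeta> i t $ q\<bar> \<le> B1" "\<bar>W Im \<zeta> i t $ q\<bar> \<le> B1" if i: "i < n" for i
    proof -
      have qn: "0 \<le> quad (W c \<zeta> i t)" for c by (rule quad_nonneg[OF Wc])
      have "quad (W Re \<zeta> i t) \<le> B" "quad (W Im \<zeta> i t) \<le> B"
        using V[OF i] qn[of Re] qn[of Im] by (auto simp: V_def)
      then have "comp_const * quad (W Re \<zeta> i t) \<le> comp_const * B" "comp_const * quad (W Im \<zeta> i t) \<le> comp_const * B"
        using comp_const_nonneg by (auto intro: mult_left_mono)
      then show "\<bar>W Re \<zeta> i t $ q\<bar> \<le> B1" "\<bar>W Im \<zeta> i t $ q\<bar> \<le> B1"
        using component_le[OF Wc q, of Re \<zeta> i t] component_le[OF Wc q, of Im \<zeta> i t]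
          abs_le_square_plus_1[of "W Re \<zeta> i t $ q"] abs_le_square_plus_1[of "W Im \<zeta> i t $ q"]
        unfolding B1_def by linarith+
    qed
    have B10: "0 \<le> B1" using B(1) comp_const_nonneg by (simp add: B1_def)
    have "complex_of_real (\<zeta> p t $ q) = (\<Sum>i<n. X $$ (p, i) * Complex (W Re \<zeta> i t $ q) (W Im \<zeta> i t $ q))"
      unfolding W_def by (rule modal_part_recombine[OF wit cH p q])
    then have "\<bar>\<zeta> p t $ q\<bar> = cmod (\<Sum>i<n. X $$ (p, i) * Complex (W Re \<zeta> i t $ q) (W Im \<zeta> i t $ q))"
      by (metis norm_of_real)
    also have "\<dots> \<le> (\<Sum>i<n. cmod (X $$ (p, i) * Complex (W Re \<zeta> i t $ q) (W Im \<zeta> i t $ q)))" by (rule norm_sum)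
    also have "\<dots> \<le> (\<Sum>i<n. cmod (X $$ (p, i)) * (2 * B1))"
      unfolding norm_mult
    proof (intro sum_mono mult_left_mono)
      fix i assume "i \<in> {..<n}"
      then show "cmod (Complex (W Re \<zeta> i t $ q) (W Im \<zeta> i t $ q)) \<le> 2 * B1"
        using cmod_le[of "Complex (W Re \<zeta> i t $ q) (W Im \<zeta> i t $ q)"] Wb[of i] by simp
    qed simp
    also have "\<dots> = (\<Sum>i<n. cmod (X $$ (p, i))) * (2 * B1)" by (simp add: sum_distrib_right)
    also have "\<dots> \<le> cX * (2 * B1)"
      unfolding cX_def using p B10
      by (intro mult_right_mono member_le_sum[of p "{..<n}" "\<lambda>p. \<Sum>s<n. cmod (X $$ (p, s))"]) (auto intro!: sum_nonneg)
    finally show "\<bar>\<zeta> p t $ q\<bar> \<le> cX * (2 * B1)" .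
  qed
qed

text \<open>The same passage; the inputs of the cascade tend to 0, hence so do the quadratic forms.\<close>

lemma coupled_tendsto_0:
  assumes H: "H \<in> carrier_mat n n" and ev: "\<And>z. eigenvalue (cmat H) z \<Longrightarrow> 1 \<le> \<mu> * Re z"
    and coup: "coupled n (\<lambda>p s. H $$ (p, s)) {0..} \<zeta> d"
    and d: "\<And>p q. p < n \<Longrightarrow> q < \<nu> \<Longrightarrow> ((\<lambda>t. d p t $ q) \<longlongrightarrow> 0) at_top"
    and p: "p < n" and q: "q < \<nu>"
  shows "((\<lambda>t. \<zeta> p t $ q) \<longlongrightarrow> 0) at_top"
proof -
  have cH: "cmat H \<in> carrier_mat n n" using H by simp
  obtain T X Y where wit: "similar_mat_wit (cmat H) T X Y" and ut: "upper_triangular T"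
    and evT: "\<And>p. p < n \<Longrightarrow> eigenvalue (cmat H) (T $$ (p, p))"
    using ex_triangular_similar[OF cH] by metis
  have \<mu>T: "1 \<le> \<mu> * Re (T $$ (p, p))" if "p < n" for p using ev evT that by blast
  define W where "W = modal_part n Y"
  define V where "V p t = quad (W Re \<zeta> p t) + quad (W Im \<zeta> p t)" for p t
  define g where "g p t = 2 * (W Re d p t \<bullet> W Re d p t + W Im d p t \<bullet> W Im d p t)" for p t
  have Wc: "W c u p t \<in> carrier_vec \<nu>" for c u p t unfolding W_def by (rule modal_part_carrier)
  have casc: "scalar_cascade n decay (cascade_gain n T) {0..} V g"
    unfolding V_def[abs_def] g_def[abs_def] W_def
    by (rule coupled_scalar_cascade[OF coup H wit ut \<mu>T])
  have "((\<lambda>t. W c d i t \<bullet> W c d i t) \<longlongrightarrow> (\<Sum>q<\<nu>. (\<Sum>s<n. c (Y $$ (i, s)) * 0)\<^sup>2)) at_top" for c i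
  proof -
    have "W c d i t \<bullet> W c d i t = (\<Sum>q<\<nu>. (\<Sum>s<n. c (Y $$ (i, s)) * d s t $ q)\<^sup>2)" for t
      unfolding sq_norm_sum[OF Wc] by (intro sum.cong refl) (simp add: W_def modal_part_def lin_comb_nth)
    moreover have "((\<lambda>t. \<Sum>q<\<nu>. (\<Sum>s<n. c (Y $$ (i, s)) * d s t $ q)\<^sup>2)
        \<longlongrightarrow> (\<Sum>q<\<nu>. (\<Sum>s<n. c (Y $$ (i, s)) * 0)\<^sup>2)) at_top"
      by (intro tendsto_sum tendsto_power tendsto_mult_left d) auto
    ultimately show ?thesis by (simp only:)
  qed
  then have "((\<lambda>t. W c d i t \<bullet> W c d i t) \<longlongrightarrow> 0) at_top" for c i by simp
  from tendsto_mult_left[OF tendsto_add[OF this[of Re] this[of Im]], of 2]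
  have g0: "(g i \<longlongrightarrow> 0) at_top" for i unfolding g_def[abs_def] by simp
  have V: "(V i \<longlongrightarrow> 0) at_top" if "i < n" for i
    by (rule scalar_cascade_tendsto_0[OF decay_pos casc g0 that])
  have W: "((\<lambda>t. W c \<zeta> i t $ q) \<longlongrightarrow> 0) at_top" if i: "i < n" and c: "c = Re \<or> c = Im" for c i
  proof -
    have up: "((\<lambda>t. comp_const * V i t) \<longlongrightarrow> 0) at_top" using tendsto_mult_left[OF V[OF i], of comp_const] by simp
    have le: "(W c \<zeta> i t $ q)\<^sup>2 \<le> comp_const * V i t" for t
    proof -
      have "quad (W c \<zeta> i t) \<le> V i t"
        using c quad_nonneg[OF Wc, of Re \<zeta> i t] quad_nonneg[OF Wc, of Im \<zeta> i t] by (auto simp: V_def)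
      then show ?thesis
        using component_le[OF Wc q, of c \<zeta> i t] mult_left_mono[OF _ comp_const_nonneg] order_trans by blast
    qed
    have "((\<lambda>t. (W c \<zeta> i t $ q)\<^sup>2) \<longlongrightarrow> 0) at_top"
      by (rule tendsto_sandwich[OF _ _ tendsto_const up]) (simp_all add: le)
    from tendsto_real_sqrt[OF this] have "((\<lambda>t. \<bar>W c \<zeta> i t $ q\<bar>) \<longlongrightarrow> 0) at_top" by simp
    then show ?thesis by (simp only: tendsto_rabs_zero_iff)
  qed
  have eq: "\<zeta> p t $ q = (\<Sum>i<n. Re (X $$ (p, i)) * W Re \<zeta> i t $ q - Im (X $$ (p, i)) * W Im \<zeta> i t $ q)" for t
  proof -
    have "complex_of_real (\<zeta> p t $ q) = (\<Sum>i<n. X $$ (p, i) * Complex (W Re \<zeta> i t $ q) (W Im \<zeta> i t $ q))"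
      unfolding W_def by (rule modal_part_recombine[OF wit cH p q])
    then have "Re (complex_of_real (\<zeta> p t $ q)) = Re (\<Sum>i<n. X $$ (p, i) * Complex (W Re \<zeta> i t $ q) (W Im \<zeta> i t $ q))"
      by (rule arg_cong)
    then show ?thesis by simp
  qed
  have "((\<lambda>t. \<Sum>i<n. Re (X $$ (p, i)) * W Re \<zeta> i t $ q - Im (X $$ (p, i)) * W Im \<zeta> i t $ q)
      \<longlongrightarrow> (\<Sum>i<n. Re (X $$ (p, i)) * 0 - Im (X $$ (p, i)) * 0)) at_top"
    by (intro tendsto_sum tendsto_diff tendsto_mult_left W) auto
  then show ?thesis unfolding eq[abs_def] by simp
qed

end

section \<open>The eigenvalues of the gain design matrix\<close>

lemma set_block_index: "set (block_index N r) = Sigma {1..N} (\<lambda>i. {1..r i + 1})"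
  by (force simp: block_index_def image_iff simp del: upt_Suc)

lemma distinct_block_index: "distinct (block_index N r)"
proof -
  have "distinct (concat (map (\<lambda>i. map (Pair i) [1..<r i + 2]) xs))" if "distinct xs" for xs :: "nat list"
    using that by (induction xs) (auto simp: distinct_map inj_on_def)
  then show ?thesis unfolding block_index_def by simp
qed

lemma sum_block_index:
  "(\<Sum>q<length (block_index N r). f (block_index N r ! q)) = (\<Sum>j=1..N. \<Sum>l=1..r j + 1. (f (j, l) :: 'a :: comm_monoid_add))"
proof -
  have "(\<Sum>q<length (block_index N r). f (block_index N r ! q)) = (\<Sum>x\<in>set (block_index N r). f x)"
    by (rule sum.reindex_bij_betw[OF bij_betw_nth[OF distinct_block_index refl refl]])
  also have "\<dots> = (\<Sum>j=1..N. \<Sum>l=1..r j + 1. f (j, l))"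
    unfolding set_block_index
    using sum.Sigma[of "{1..N}" "\<lambda>j. {1..r j + 1}" "\<lambda>j l. f (j, l)"]
    by (simp add: split_def del: sum.cl_ivl_Suc)
  finally show ?thesis .
qed

lemma H_hat_carrier: "H_hat N r a \<in> carrier_mat (length (block_index N r)) (length (block_index N r))"
  by (simp add: H_hat_def block_mat_def Let_def)

text \<open>The rows of \<open>H\<close> as a linear operator: inside a block the row takes differences of neighbouring
positions; the last row of a block takes the weighted difference to the first positions of the
neighbours. The edge from the leader contributes to the diagonal only. Vector values cover both
the real dynamics and complex eigenvectors.\<close>

lemma H_hat_row:
  fixes f :: "nat \<times> nat \<Rightarrow> 'a :: real_vector"
  assumes r: "\<And>i. i \<in> {1..N} \<Longrightarrow> 1 \<le> r i" and a0: "\<And>i. i \<in> {1..N} \<Longrightarrow> a i i = 0"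
    and p: "p < length (block_index N r)" and ip: "block_index N r ! p = (i, k)"
  shows "(\<Sum>q<length (block_index N r). H_hat N r a $$ (p, q) *\<^sub>R f (block_index N r ! q))
    = (if k \<le> r i then f (i, k) - f (i, k + 1)
       else (\<Sum>j=0..N. a i j) *\<^sub>R f (i, r i + 1) - (\<Sum>j=1..N. a i j *\<^sub>R f (j, 1)))"
proof -
  have ik: "i \<in> {1..N}" "k \<in> {1..r i + 1}"
    using nth_mem[OF p] unfolding ip set_block_index by auto
  define h where "h x = L_block N r a i (fst x) k (snd x) + Delta_block r a i (fst x) k (snd x)" for x
  have "(\<Sum>q<length (block_index N r). H_hat N r a $$ (p, q) *\<^sub>R f (block_index N r ! q))
      = (\<Sum>q<length (block_index N r). h (block_index N r ! q) *\<^sub>R f (block_index N r ! q))"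
    using p by (intro sum.cong refl) (simp add: H_hat_def block_mat_def Let_def ip h_def)
  also have "\<dots> = (\<Sum>j=1..N. \<Sum>l=1..r j + 1. h (j, l) *\<^sub>R f (j, l))"
    by (rule sum_block_index[of "\<lambda>x. h x *\<^sub>R f x"])
  also have "\<dots> = (if k \<le> r i then f (i, k) - f (i, k + 1)
       else (\<Sum>j=0..N. a i j) *\<^sub>R f (i, r i + 1) - (\<Sum>j=1..N. a i j *\<^sub>R f (j, 1)))"
  proof (cases "k \<le> r i")
    case True
    have "(\<Sum>l=1..r j + 1. h (j, l) *\<^sub>R f (j, l)) = (if j = i then f (i, k) - f (i, k + 1) else 0)" for j
    proof (cases "j = i")
      case True
      have "(\<Sum>l=1..r i + 1. h (i, l) *\<^sub>R f (i, l))
          = (\<Sum>l=1..r i + 1. (if l = k then f (i, k) else 0) - (if l = k + 1 then f (i, k + 1) else 0))"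
        using \<open>k \<le> r i\<close> by (intro sum.cong refl) (auto simp: h_def L_block_def Delta_block_def)
      also have "\<dots> = f (i, k) - f (i, k + 1)"
        unfolding sum_subtractf using ik \<open>k \<le> r i\<close> by simp
      finally show ?thesis using True by simp
    next
      case False
      then show ?thesis using \<open>k \<le> r i\<close> by (simp add: h_def L_block_def Delta_block_def)
    qed
    then show ?thesis using True ik by simp
  next
    case False
    then have k: "k = r i + 1" using ik by auto
    have "(\<Sum>l=1..r j + 1. h (j, l) *\<^sub>R f (j, l))
        = (if j = i then (\<Sum>j=0..N. a i j) *\<^sub>R f (i, r i + 1) else 0) - a i j *\<^sub>R f (j, 1)"
      if j: "j \<in> {1..N}" for j
    proof (cases "j = i")
      case True
      have "(\<Sum>l=1..r i + 1. h (i, l) *\<^sub>R f (i, l))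
          = (\<Sum>l=1..r i + 1. if l = r i + 1 then ((\<Sum>j=1..N. a i j) + a i 0) *\<^sub>R f (i, r i + 1) else 0)"
        by (intro sum.cong refl) (auto simp: h_def L_block_def Delta_block_def k)
      also have "\<dots> = ((\<Sum>j=1..N. a i j) + a i 0) *\<^sub>R f (i, r i + 1)" by simp
      also have "(\<Sum>j=1..N. a i j) + a i 0 = (\<Sum>j=0..N. a i j)" by (simp add: sum.atLeast_Suc_atMost)
      finally show ?thesis using True a0[OF ik(1)] by simp
    next
      case False
      have "(\<Sum>l=1..r j + 1. h (j, l) *\<^sub>R f (j, l))
          = (\<Sum>l=1..r j + 1. if l = 1 then - a i j *\<^sub>R f (j, 1) else 0)"
        using False by (intro sum.cong refl) (auto simp: h_def L_block_def Delta_block_def k)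
      then show ?thesis using False by simp
    qed
    then have "(\<Sum>j=1..N. \<Sum>l=1..r j + 1. h (j, l) *\<^sub>R f (j, l))
        = (\<Sum>j=1..N. (if j = i then (\<Sum>j=0..N. a i j) *\<^sub>R f (i, r i + 1) else 0) - a i j *\<^sub>R f (j, 1))"
      by (intro sum.cong refl)
    also have "\<dots> = (\<Sum>j=0..N. a i j) *\<^sub>R f (i, r i + 1) - (\<Sum>j=1..N. a i j *\<^sub>R f (j, 1))"
      unfolding sum_subtractf using ik by simp
    finally show ?thesis using False by simp
  qed
  finally show ?thesis .
qed

text \<open>Suppose \<open>Re z \<le> 0\<close> and let \<open>f\<close> be an eigenvector with largest modulus \<open>M\<close>. Inside a block
\<open>f (i, k + 1) = (1 - z) f (i, k)\<close> with \<open>\<bar>1 - z\<bar> \<ge> 1\<close>, so an entry of modulus \<open>M\<close> propagates to the last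
position of its block. The last row reads \<open>(s - z) f (i, r i + 1) = \<Sum> a i j f (j, 1)\<close>, where \<open>s\<close> is the
sum of all weights \<open>a i j\<close>, the leader's included, and \<open>\<bar>s - z\<bar> \<ge> s\<close>. Therefore all neighbours
attain \<open>M\<close>, and the leader, whose entry counts as 0, is not among them. This is impossible along the
path from the root to \<open>i\<close>.\<close>

lemma H_hat_eigenvalue_pos:
  fixes G :: "nat pair_pre_digraph"
  assumes r: "\<And>i. i \<in> {1..N} \<Longrightarrow> 1 \<le> r i" and a0: "\<And>i. i \<in> {1..N} \<Longrightarrow> a i i = 0"
    and an: "\<And>i j. i \<in> {0..N} \<Longrightarrow> j \<in> {0..N} \<Longrightarrow> 0 \<le> a i j"
    and vG: "pverts G = {0..N}"
    and aG: "\<And>i j. i \<in> {1..N} \<Longrightarrow> j \<in> {0..N} \<Longrightarrow> 0 < a i j \<longleftrightarrow> (j, i) \<in> parcs G"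
    and tree: "has_directed_spanning_tree (with_proj G) 0"
    and ev: "eigenvalue (cmat (H_hat N r a)) z"
  shows "0 < Re z"
proof (rule ccontr)
  assume "\<not> 0 < Re z"
  then have z: "Re z \<le> 0" by simp
  define ix where "ix = block_index N r"
  define n where "n = length ix"
  have H: "H_hat N r a \<in> carrier_mat n n" unfolding n_def ix_def by (rule H_hat_carrier)
  obtain v where v: "v \<in> carrier_vec n" "v \<noteq> 0\<^sub>v n" "cmat (H_hat N r a) *\<^sub>v v = z \<cdot>\<^sub>v v"
    using ev H unfolding eigenvalue_def eigenvector_def by auto
  have bij: "bij_betw ((!) ix) {..<n} (set ix)"
    unfolding n_def ix_def by (rule bij_betw_nth[OF distinct_block_index refl refl])
  \<comment> \<open>the eigenvector as a function of the pairs (block, position)\<close>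
  define f where "f x = v $ (the_inv_into {..<n} ((!) ix) x)" for x
  have f: "f (ix ! q) = v $ q" if "q < n" for q
    using bij that by (simp add: f_def bij_betw_def the_inv_into_f_f)
  have row: "(if k \<le> r i then f (i, k) - f (i, k + 1)
       else (\<Sum>j=0..N. a i j) *\<^sub>R f (i, r i + 1) - (\<Sum>j=1..N. a i j *\<^sub>R f (j, 1))) = z * f (i, k)"
    if ik: "i \<in> {1..N}" "k \<in> {1..r i + 1}" for i k
  proof -
    have "(i, k) \<in> set ix" unfolding ix_def set_block_index using ik by simp
    then obtain p where p: "p < n" "ix ! p = (i, k)" unfolding n_def in_set_conv_nth by blast
    have "(cmat (H_hat N r a) *\<^sub>v v) $ p = (\<Sum>q<n. H_hat N r a $$ (p, q) *\<^sub>R v $ q)"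
      using H v(1) p(1) by (simp add: scalar_prod_sum[OF v(1)] scaleR_conv_of_real)
    also have "\<dots> = (\<Sum>q<n. H_hat N r a $$ (p, q) *\<^sub>R f (ix ! q))" by (simp add: f)
    also have "\<dots> = (if k \<le> r i then f (i, k) - f (i, k + 1)
       else (\<Sum>j=0..N. a i j) *\<^sub>R f (i, r i + 1) - (\<Sum>j=1..N. a i j *\<^sub>R f (j, 1)))"
      unfolding n_def ix_def
      by (rule H_hat_row[OF r a0]) (use p in \<open>auto simp: n_def ix_def\<close>)
    finally have "(cmat (H_hat N r a) *\<^sub>v v) $ p = \<dots>" .
    moreover have "(cmat (H_hat N r a) *\<^sub>v v) $ p = z * f (i, k)"
      unfolding v(3) using v(1) p f[OF p(1)] by simp
    ultimately show ?thesis by simp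
  qed
  define M where "M = Max ((\<lambda>x. cmod (f x)) ` set ix)"
  obtain q0 where q0: "q0 < n" "v $ q0 \<noteq> 0"
    using v(1,2) by (metis carrier_vecD eq_vecI index_zero_vec(1) index_zero_vec(2))
  have ne: "set ix \<noteq> {}" using q0 by (auto simp: n_def)
  have Mle: "cmod (f (i, k)) \<le> M" if "i \<in> {1..N}" "k \<in> {1..r i + 1}" for i k
    unfolding M_def by (rule Max_ge) (use that in \<open>auto simp: ix_def set_block_index\<close>)
  have "M \<in> (\<lambda>x. cmod (f x)) ` set ix" unfolding M_def using ne by (intro Max_in) auto
  then obtain i0 k0 where ik0: "i0 \<in> {1..N}" "k0 \<in> {1..r i0 + 1}" "cmod (f (i0, k0)) = M"
    by (auto simp: ix_def set_block_index)
  have "0 < cmod (f (ix ! q0))" using q0 f by simp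
  also have "\<dots> \<le> M" unfolding M_def using q0(1) by (intro Max_ge) (auto simp: n_def)
  finally have M0: "0 < M" .
  have up: "cmod (f (i, k + 1)) = M" if "i \<in> {1..N}" "k \<in> {1..r i}" "cmod (f (i, k)) = M" for i k
  proof -
    have "f (i, k) - f (i, k + 1) = z * f (i, k)" using row[of i k] that by simp
    then have "f (i, k + 1) = (1 - z) * f (i, k)" by (simp add: algebra_simps)
    then have "cmod (f (i, k + 1)) = cmod (1 - z) * M" using that by (simp add: norm_mult)
    moreover have "1 \<le> cmod (1 - z)" using complex_Re_le_cmod[of "1 - z"] z by simp
    ultimately have "M \<le> cmod (f (i, k + 1))" using M0 by simp
    with Mle[of i "k + 1"] that show ?thesis by simp
  qed
  have top: "cmod (f (i, r i + 1)) = M" if i: "i \<in> {1..N}" and k: "k \<in> {1..r i + 1}" "cmod (f (i, k)) = M" for i k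
  proof -
    have "cmod (f (i, k + d)) = M" if "k + d \<le> r i + 1" for d
      using that
    proof (induction d)
      case (Suc d)
      then show ?case using up[OF i, of "k + d"] k by simp
    qed (use k in simp)
    from this[of "r i + 1 - k"] show ?thesis using k by simp
  qed
  have last: "a i 0 = 0 \<and> (\<forall>j\<in>{1..N}. 0 < a i j \<longrightarrow> cmod (f (j, r j + 1)) = M)"
    if i: "i \<in> {1..N}" and M: "cmod (f (i, r i + 1)) = M" for i
  proof -
    define s where "s = (\<Sum>j=0..N. a i j)"
    have s: "s = a i 0 + (\<Sum>j=1..N. a i j)" unfolding s_def by (simp add: sum.atLeast_Suc_atMost)
    have an': "0 \<le> a i j" if "j \<in> {0..N}" for j using an[of i j] i that by simp
    have "s *\<^sub>R f (i, r i + 1) - (\<Sum>j=1..N. a i j *\<^sub>R f (j, 1)) = z * f (i, r i + 1)"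
      using row[OF i, of "r i + 1"] by (simp add: s_def)
    then have "(of_real s - z) * f (i, r i + 1) = (\<Sum>j=1..N. a i j *\<^sub>R f (j, 1))"
      by (simp add: algebra_simps scaleR_conv_of_real)
    then have "cmod (of_real s - z) * M = cmod (\<Sum>j=1..N. a i j *\<^sub>R f (j, 1))"
      using M by (metis norm_mult)
    also have "\<dots> \<le> (\<Sum>j=1..N. cmod (a i j *\<^sub>R f (j, 1)))" by (rule norm_sum)
    also have "\<dots> = (\<Sum>j=1..N. a i j * cmod (f (j, 1)))" by (intro sum.cong refl) (simp add: an')
    finally have "cmod (of_real s - z) * M \<le> (\<Sum>j=1..N. a i j * cmod (f (j, 1)))" .
    moreover have "s * M \<le> cmod (of_real s - z) * M"
      using complex_Re_le_cmod[of "of_real s - z"] z M0 by (intro mult_right_mono) auto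
    ultimately have "s * M \<le> (\<Sum>j=1..N. a i j * cmod (f (j, 1)))" by linarith
    then have le: "a i 0 * M + (\<Sum>j=1..N. a i j * (M - cmod (f (j, 1)))) \<le> 0"
      unfolding s by (simp add: algebra_simps sum_subtractf sum_distrib_left)
    have nn: "0 \<le> a i j * (M - cmod (f (j, 1)))" if "j \<in> {1..N}" for j
      using an'[of j] Mle[of j 1] that by (intro mult_nonneg_nonneg) auto
    have sn: "0 \<le> (\<Sum>j=1..N. a i j * (M - cmod (f (j, 1))))" by (intro sum_nonneg nn)
    have am: "0 \<le> a i 0 * M" using an'[of 0] M0 by simp
    have "a i 0 * M = 0" and z0: "(\<Sum>j=1..N. a i j * (M - cmod (f (j, 1)))) = 0"
      using le sn am by linarith+
    then have "a i 0 = 0" using M0 by simp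
    moreover have "cmod (f (j, r j + 1)) = M" if j: "j \<in> {1..N}" "0 < a i j" for j
    proof -
      have "\<forall>j\<in>{1..N}. a i j * (M - cmod (f (j, 1))) = 0"
        using sum_nonneg_eq_0_iff[of "{1..N}" "\<lambda>j. a i j * (M - cmod (f (j, 1)))"] nn z0 by blast
      then have "a i j * (M - cmod (f (j, 1))) = 0" using j(1) by blast
      then have "cmod (f (j, 1)) = M" using j by simp
      then show ?thesis using top[of j 1] j by simp
    qed
    ultimately show ?thesis by blast
  qed
  obtain T where sp: "spanning T (with_proj G)" and dt: "directed_tree T 0"
    using tree unfolding has_directed_spanning_tree_def by blast
  have vT: "verts T = {0..N}" using sp vG by (simp add: spanning_def)
  have aT: "(u, w) \<in> parcs G" if uw: "u \<rightarrow>\<^bsub>T\<^esub> w" for u w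
  proof -
    obtain e where e: "e \<in> arcs T" "tail T e = u" "head T e = w"
      using reachableE[OF uw] .
    have "arcs T \<subseteq> parcs G" "tail T = fst" "head T = snd"
      using sp by (auto simp: spanning_def subgraph_def compatible_def)
    then show ?thesis using e by (metis prod.collapse subsetD)
  qed
  have wfT: "wf_digraph T" using dt by (simp add: directed_tree_def)
  have "0 \<rightarrow>\<^sup>*\<^bsub>T\<^esub> i0" using dt ik0(1) vT by (simp add: directed_tree_def)
  \<comment> \<open>no node reachable from the root attains \<open>M\<close>: if it did, so would its predecessor,
    and for the root as predecessor the weight \<open>a i 0\<close> would be 0\<close>
  then have "i0 \<noteq> 0 \<longrightarrow> cmod (f (i0, r i0 + 1)) \<noteq> M"
  proof (induction rule: wf_digraph.reachable_induct[OF wfT, consumes 1, case_names base step])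
    case (step x y)
    have arc: "(x, y) \<in> parcs G" by (rule aT) fact
    have xy: "x \<in> {0..N}" "y \<in> {0..N}"
      using wf_digraph.adj_in_verts[OF wfT step.hyps(2)] vT by auto
    show ?case
    proof (intro impI notI)
      assume y: "y \<noteq> 0" and M: "cmod (f (y, r y + 1)) = M"
      then have y1: "y \<in> {1..N}" using xy by auto
      have "0 < a y x" using aG[OF y1 xy(1)] arc by simp
      then show False using last[OF y1 M] step.IH xy(1) by (cases "x = 0") auto
    qed
  qed simp
  with top[OF ik0] ik0(1) show False by simp
qed

section \<open>Boundedness and error convergence of one subsystem\<close>

context adaptive_agent begin

lemma dep_err: "k \<in> {1..r} \<Longrightarrow> depends_upto r (err k)"
  and dep_reg: "k \<in> {1..r} \<Longrightarrow> depends_upto r (reg k)"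
  and dep_alpha: "k \<in> {1..r} \<Longrightarrow> depends_upto r (alpha k)"
  and dep_tau: "k \<in> {1..r} \<Longrightarrow> depends_upto r (tau k)"
  using dep_backstepping[of k] by (auto intro: dep_mono[of k])

lemma smooth_err: "k \<in> {1..r} \<Longrightarrow> smooth_fun (err k)"
  and smooth_alpha: "k \<in> {1..r} \<Longrightarrow> smooth_fun (alpha k)"
  and smooth_reg: "k \<in> {1..r} \<Longrightarrow> smooth_vec m (reg k)"
  and smooth_tau: "k \<in> {1..r} \<Longrightarrow> smooth_vec m (tau k)"
  using smooth_backstepping[of k] by auto

lemma lyap_bounded_initially:
  "\<exists>M. \<forall>z. well_formed r z \<and> bounded_upto r R z \<longrightarrow> lyap z \<le> M"
proof -
  have "\<forall>k\<in>{1..r}. \<exists>M\<ge>0. \<forall>z. well_formed r z \<and> bounded_upto r R z \<longrightarrow> \<bar>err k z\<bar> \<le> M"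
    using smooth_fun_bounded[OF smooth_err dep_err] by blast
  then obtain M where M: "\<forall>k\<in>{1..r}. 0 \<le> M k \<and> (\<forall>z. well_formed r z \<and> bounded_upto r R z \<longrightarrow> \<bar>err k z\<bar> \<le> M k)"
    by metis
  show ?thesis
  proof (intro exI allI impI)
    fix z assume z: "well_formed r z \<and> bounded_upto r R z"
    have "(err k z)\<^sup>2 \<le> (M k)\<^sup>2" if "k \<in> {1..r}" for k
      using M z that by (metis abs_ge_zero power2_abs power_mono)
    moreover have "(\<theta> $ q - estim z $ q)\<^sup>2 \<le> (\<bar>\<theta> $ q\<bar> + R)\<^sup>2" if "q < m" for q
    proof -
      have "\<bar>\<theta> $ q - estim z $ q\<bar> \<le> \<bar>\<theta> $ q\<bar> + R" using z that by (auto simp: bounded_upto_def)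
      then show ?thesis by (metis abs_ge_zero power2_abs power_mono)
    qed
    ultimately show "lyap z \<le> (\<Sum>k=1..r. (M k)\<^sup>2) / 2 + (\<Sum>q<m. (\<bar>\<theta> $ q\<bar> + R)\<^sup>2) / 2"
      unfolding lyap_def by (intro add_mono divide_right_mono sum_mono) auto
  qed
qed

lemma lyap_nonneg: "0 \<le> lyap z"
  unfolding lyap_def by (intro add_nonneg_nonneg divide_nonneg_pos sum_nonneg) auto

lemma err_sq_le_lyap: "k \<in> {1..r} \<Longrightarrow> (err k z)\<^sup>2 \<le> 2 * lyap z"
  and estim_sq_le_lyap: "q < m \<Longrightarrow> (\<theta> $ q - estim z $ q)\<^sup>2 \<le> 2 * lyap z"
proof -
  have s: "0 \<le> (\<Sum>k=1..r. (err k z)\<^sup>2)" "0 \<le> (\<Sum>q<m. (\<theta> $ q - estim z $ q)\<^sup>2)"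
    by (auto intro: sum_nonneg)
  show "(err k z)\<^sup>2 \<le> 2 * lyap z" if "k \<in> {1..r}"
    using member_le_sum[of k "{1..r}" "\<lambda>k. (err k z)\<^sup>2"] that s(2) by (simp add: lyap_def)
  show "(\<theta> $ q - estim z $ q)\<^sup>2 \<le> 2 * lyap z" if "q < m"
    using member_le_sum[of q "{..<m}" "\<lambda>q. (\<theta> $ q - estim z $ q)\<^sup>2"] that s(1) by (simp add: lyap_def)
qed

lemma lyap_decreasing:
  assumes sol: "agent_solution S z" and S: "time_interval S" and t: "t \<in> S"
  shows "lyap (z t) \<le> lyap (z 0)"
proof (rule nonincreasing_of_deriv_nonpos[where V = "\<lambda>s. lyap (z s)" and S = S
      and V' = "\<lambda>s. - (\<Sum>k=1..r. c k * (err k (z s))\<^sup>2)"])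
  show "0 \<le> t" "{0..t} \<subseteq> S" using time_intervalD[OF S t] by auto
  fix s assume "s \<in> {0..t}"
  then have s: "s \<in> S" using time_intervalD[OF S t] by auto
  show "((\<lambda>s. lyap (z s)) has_real_derivative - (\<Sum>k=1..r. c k * (err k (z s))\<^sup>2)) (at s within S)"
    by (rule lyap_has_derivative[OF sol s])
  show "- (\<Sum>k=1..r. c k * (err k (z s))\<^sup>2) \<le> 0"
    unfolding neg_le_0_iff_le by (intro sum_nonneg mult_nonneg_nonneg less_imp_le[OF c_pos]) auto
qed

text \<open>The Lyapunov function does not increase, and its initial value is bounded on bounded sets because the
errors are continuous functions of the state.\<close>

lemma err_estim_bounded:
  "\<exists>B. \<forall>S z. time_interval S \<and> agent_solution S z \<and> bounded_upto r R (z 0) \<longrightarrow>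
     (\<forall>t\<in>S. (\<forall>k\<in>{1..r}. \<bar>err k (z t)\<bar> \<le> B) \<and> (\<forall>q<m. \<bar>estim (z t) $ q\<bar> \<le> B))"
proof -
  obtain M where M: "\<And>z. well_formed r z \<Longrightarrow> bounded_upto r R z \<Longrightarrow> lyap z \<le> M"
    using lyap_bounded_initially by blast
  define B where "B = 2 * M + 1 + (\<Sum>q<m. \<bar>\<theta> $ q\<bar>)"
  show ?thesis
  proof (intro exI[of _ B] allI impI ballI)
    fix S z t assume *: "time_interval S \<and> agent_solution S z \<and> bounded_upto r R (z 0)" and t: "t \<in> S"
    have "0 \<in> S" using time_intervalD[of S t] * t by auto
    then have "lyap (z 0) \<le> M" using * by (intro M) (auto simp: agent_solution_def)
    then have V: "lyap (z t) \<le> M" using lyap_decreasing[of S z t] * t by auto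
    have S0: "0 \<le> (\<Sum>q<m. \<bar>\<theta> $ q\<bar>)" by (simp add: sum_nonneg)
    have "\<bar>err k (z t)\<bar> \<le> B" if "k \<in> {1..r}" for k
      using abs_le_square_plus_1[of "err k (z t)"] err_sq_le_lyap[OF that, of "z t"] V S0
      unfolding B_def by linarith
    moreover have "\<bar>estim (z t) $ q\<bar> \<le> B" if q: "q < m" for q
    proof -
      have "\<bar>\<theta> $ q\<bar> \<le> (\<Sum>q<m. \<bar>\<theta> $ q\<bar>)"
        using q by (intro member_le_sum[of q "{..<m}" "\<lambda>q. \<bar>\<theta> $ q\<bar>"]) auto
      then show ?thesis
        using abs_le_square_plus_1[of "\<theta> $ q - estim (z t) $ q"] estim_sq_le_lyap[OF q, of "z t"] V
        unfolding B_def by linarith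
    qed
    ultimately show "(\<forall>k\<in>{1..r}. \<bar>err k (z t)\<bar> \<le> B) \<and> (\<forall>q<m. \<bar>estim (z t) $ q\<bar> \<le> B)" by blast
  qed
qed

definition signals_bounded :: "real \<Rightarrow> agent_state \<Rightarrow> bool" where
  "signals_bounded B z \<longleftrightarrow> well_formed r z \<and> (\<forall>k\<in>{1..r}. \<bar>err k z\<bar> \<le> B) \<and>
     (\<forall>l\<in>{1..r + 1}. \<forall>q<\<nu>. \<bar>compens z l $ q\<bar> \<le> B) \<and> (\<forall>q<m. \<bar>estim z $ q\<bar> \<le> B)"

text \<open>Induction along the chain: \<open>x\<^sub>1 = e\<^sub>1 + C \<eta>\<^sub>1\<close>, and \<open>x\<^sub>k\<^sub>+\<^sub>1 = e\<^sub>k\<^sub>+\<^sub>1 + \<alpha>\<^sub>k\<close> where \<open>\<alpha>\<^sub>k\<close> sees only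
\<open>x\<^sub>1, \<dots>, x\<^sub>k\<close>, \<open>\<eta>\<^sub>1, \<dots>, \<eta>\<^sub>k\<^sub>+\<^sub>1\<close> and the estimate, hence is bounded.\<close>

lemma plant_bounded:
  assumes "k \<le> r"
  shows "\<exists>B'. \<forall>z. signals_bounded B z \<longrightarrow> (\<forall>l\<in>{1..k}. \<bar>plant z l\<bar> \<le> B')"
  using assms
proof (induction k)
  case (Suc k)
  then obtain B1 where B1: "\<forall>z. signals_bounded B z \<longrightarrow> (\<forall>l\<in>{1..k}. \<bar>plant z l\<bar> \<le> B1)" by auto
  have "\<exists>M. \<forall>z. signals_bounded B z \<longrightarrow> \<bar>plant z (Suc k)\<bar> \<le> M"
  proof (cases "k = 0")
    case True
    show ?thesis
    proof (intro exI allI impI)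
      fix z assume sb: "signals_bounded B z"
      note * = sb[unfolded signals_bounded_def]
      have c1: "compens z 1 \<in> carrier_vec \<nu>" using * by (simp add: well_formed_def)
      have "\<bar>(C *\<^sub>v compens z 1) $ 0\<bar> = \<bar>\<Sum>q<\<nu>. C $$ (0, q) * compens z 1 $ q\<bar>"
        using C c1 by (simp add: scalar_prod_sum)
      also have "\<dots> \<le> (\<Sum>q<\<nu>. \<bar>C $$ (0, q)\<bar> * B)"
        by (intro order_trans[OF sum_abs] sum_mono) (use * in \<open>auto simp: abs_mult intro!: mult_left_mono\<close>)
      finally have "\<bar>(C *\<^sub>v compens z 1) $ 0\<bar> \<le> (\<Sum>q<\<nu>. \<bar>C $$ (0, q)\<bar> * B)" .
      moreover have "\<bar>err 1 z\<bar> \<le> B" using * r1 by auto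
      ultimately have "\<bar>plant z 1\<bar> \<le> B + (\<Sum>q<\<nu>. \<bar>C $$ (0, q)\<bar> * B)" unfolding err_1 by linarith
      then show "\<bar>plant z (Suc k)\<bar> \<le> B + (\<Sum>q<\<nu>. \<bar>C $$ (0, q)\<bar> * B)" using True by simp
    qed
  next
    case False
    have k: "k \<in> {1..r}" using False Suc.prems by simp
    have "depends_upto k (alpha k)" using dep_backstepping[OF k] by simp
    from smooth_fun_bounded[OF smooth_alpha[OF k] this, of "max B B1"]
    obtain M where M: "\<forall>z. well_formed k z \<and> bounded_upto k (max B B1) z \<longrightarrow> \<bar>alpha k z\<bar> \<le> M" by blast
    show ?thesis
    proof (intro exI allI impI)
      fix z assume sb: "signals_bounded B z"
      note * = sb[unfolded signals_bounded_def]
      have "well_formed k z" using well_formed_mono[of r z k] * k by simp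
      moreover have "bounded_upto k (max B B1) z"
        using B1[THEN spec, THEN mp, OF sb] * k by (auto simp: bounded_upto_def le_max_iff_disj)
      ultimately have "\<bar>alpha k z\<bar> \<le> M" using M by blast
      moreover have "\<bar>err (Suc k) z\<bar> \<le> B" using * Suc.prems by auto
      moreover have "plant z (Suc k) = err (Suc k) z + alpha k z" using False by (simp add: err.simps[of "Suc k"])
      ultimately show "\<bar>plant z (Suc k)\<bar> \<le> B + M" by linarith
    qed
  qed
  then obtain M where M: "\<forall>z. signals_bounded B z \<longrightarrow> \<bar>plant z (Suc k)\<bar> \<le> M" by blast
  show ?case
  proof (intro exI[of _ "max B1 M"] allI impI ballI)
    fix z l assume sb: "signals_bounded B z" and l: "l \<in> {1..Suc k}"
    note * = sb[unfolded signals_bounded_def]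
    show "\<bar>plant z l\<bar> \<le> max B1 M"
    proof (cases "l = Suc k")
      case True
      then show ?thesis using M[THEN spec, THEN mp, OF sb] by (simp add: le_max_iff_disj)
    next
      case False
      then have "l \<in> {1..k}" using l by auto
      then show ?thesis using B1[THEN spec, THEN mp, OF sb] by (simp add: le_max_iff_disj)
    qed
  qed
qed simp

lemma state_control_bounded:
  "\<exists>B'. \<forall>z. signals_bounded B z \<longrightarrow> bounded_upto r B' z \<and> \<bar>alpha r z\<bar> \<le> B'"
proof -
  obtain B1 where B1: "\<forall>z. signals_bounded B z \<longrightarrow> (\<forall>l\<in>{1..r}. \<bar>plant z l\<bar> \<le> B1)" using plant_bounded[OF order.refl, of B] by blast
  have rr: "r \<in> {1..r}" using r1 by simp
  obtain M where M: "\<forall>z. well_formed r z \<and> bounded_upto r (max B B1) z \<longrightarrow> \<bar>alpha r z\<bar> \<le> M"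
    using smooth_fun_bounded[OF smooth_alpha[OF rr] dep_alpha[OF rr], of "max B B1"] by blast
  show ?thesis
  proof (intro exI[of _ "max M (max B B1)"] allI impI)
    fix z assume sb: "signals_bounded B z"
    note * = sb[unfolded signals_bounded_def]
    have b: "bounded_upto r (max B B1) z"
      using B1[THEN spec, THEN mp, OF sb] * by (auto simp: bounded_upto_def le_max_iff_disj)
    then have "\<bar>alpha r z\<bar> \<le> M" using M * by blast
    with b show "bounded_upto r (max M (max B B1)) z \<and> \<bar>alpha r z\<bar> \<le> max M (max B B1)"
      by (auto simp: bounded_upto_def le_max_iff_disj)
  qed
qed

text \<open>The Lyapunov function dissipates \<open>c\<^sub>1 e\<^sub>1\<^sup>2\<close>, and the derivative of \<open>e\<^sub>1\<close> is a continuous function of the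
bounded state.\<close>

lemma err_1_tendsto_0:
  assumes sol: "agent_solution {0..} z" and B: "\<And>t. 0 \<le> t \<Longrightarrow> bounded_upto r B (z t)"
  shows "((\<lambda>t. err 1 (z t)) \<longlongrightarrow> 0) at_top"
proof -
  have one: "1 \<in> {1..r}" using r1 by simp
  have e2: "err_rate 1 z = - c 1 * err 1 z + (if 1 < r then err 2 z else 0) + reg 1 z \<bullet> (\<theta> - estim z)" for z
    unfolding err_rate_def by (simp del: One_nat_def add: one_add_one)
  have sth: "smooth_vec m (\<lambda>z. \<theta> - estim z)"
    by (rule smooth_vec_diff[OF _ smooth_estim]) (use \<theta> in \<open>auto simp: smooth_vec_def smooth_fun_const\<close>)
  have "smooth_fun (err_rate 1)"
  proof -
    have "smooth_fun (\<lambda>z. if 1 < r then err 2 z else 0)"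
      by (cases "1 < r") (auto intro: smooth_err smooth_fun_const)
    then show ?thesis
      unfolding e2[abs_def]
      by (intro smooth_fun_add smooth_fun_mult smooth_fun_const smooth_err[OF one]
          smooth_scalar_prod[OF smooth_reg[OF one] sth])
  qed
  moreover have "depends_upto r (err_rate 1)"
  proof -
    have "err_rate 1 z = err_rate 1 z'" if zz: "agree_upto r z z'" for z z'
    proof -
      have "1 < r \<Longrightarrow> err 2 z = err 2 z'" by (rule depD[OF dep_err zz]) simp
      moreover have "err 1 z = err 1 z'" "reg 1 z = reg 1 z'" "estim z = estim z'"
        using depD[OF dep_err[OF one] zz] depD[OF dep_reg[OF one] zz] depD[OF dep_estim zz] by simp_all
      ultimately show ?thesis unfolding e2 by simp
    qed
    then show ?thesis by (simp add: depends_upto_def)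
  qed
  ultimately obtain M where M: "\<And>z. well_formed r z \<Longrightarrow> bounded_upto r B z \<Longrightarrow> \<bar>err_rate 1 z\<bar> \<le> M"
    using smooth_fun_bounded by blast
  show ?thesis
  proof (rule dissipated_signal_tendsto_0[where W = "\<lambda>t. lyap (z t)" and k = "c 1" and e' = "\<lambda>t. err_rate 1 (z t)"
        and W' = "\<lambda>t. - (\<Sum>k=1..r. c k * (err k (z t))\<^sup>2)" and D = M])
    show "0 < c 1" using c_pos[OF one] .
    show "0 \<le> lyap (z t)" for t by (rule lyap_nonneg)
    fix t :: real assume t: "0 \<le> t"
    show "((\<lambda>t. lyap (z t)) has_real_derivative - (\<Sum>k=1..r. c k * (err k (z t))\<^sup>2)) (at t within {0..})"
      using t by (intro lyap_has_derivative[OF sol]) simp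
    show "((\<lambda>t. err 1 (z t)) has_real_derivative err_rate 1 (z t)) (at t within {0..})"
      using t by (intro err_has_derivative[OF sol _ one]) simp
    show "\<bar>err_rate 1 (z t)\<bar> \<le> M" using sol t by (intro M B) (auto simp: agent_solution_def)
    have "c 1 * (err 1 (z t))\<^sup>2 \<le> (\<Sum>k=1..r. c k * (err k (z t))\<^sup>2)"
      by (rule member_le_sum[OF one]) (auto intro!: mult_nonneg_nonneg less_imp_le[OF c_pos])
    then show "- (\<Sum>k=1..r. c k * (err k (z t))\<^sup>2) \<le> - c 1 * (err 1 (z t))\<^sup>2" by simp
  qed
qed

end

section \<open>The network: a priori bounds\<close>

locale tracking_network = closed_loop +
  fixes P\<^sub>0 :: "real mat" and \<mu> :: real and \<kappa> :: complex and G :: "nat pair_pre_digraph"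
  assumes r1: "\<And>i. i \<in> {1..N} \<Longrightarrow> 1 \<le> r i"
    and \<theta>_carrier: "\<And>i. i \<in> {1..N} \<Longrightarrow> \<theta> i \<in> carrier_vec (m i)"
    and smooth_\<psi>: "\<And>i l. i \<in> {1..N} \<Longrightarrow> l \<in> {1..r i} \<Longrightarrow> smooth_map l (m i) (\<psi> i l)"
    and c_pos: "\<And>i l. i \<in> {1..N} \<Longrightarrow> l \<in> {1..r i} \<Longrightarrow> 0 < c i l"
    and A: "A \<in> carrier_mat \<nu> \<nu>" and C: "C \<in> carrier_mat 1 \<nu>"
    and leader_eigenvalues: "\<And>z. eigenvalue (cmat A) z \<Longrightarrow> Re z = 0 \<and> semisimple_eigenvalue (cmat A) z"
    and verts: "pverts G = {0..N}"
    and a_nonneg: "\<And>i j. i \<in> {0..N} \<Longrightarrow> j \<in> {0..N} \<Longrightarrow> 0 \<le> a i j"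
    and a_diag: "\<And>i. i \<in> {0..N} \<Longrightarrow> a i i = 0"
    and a_arcs: "\<And>i j. i \<in> {1..N} \<Longrightarrow> j \<in> {0..N} \<Longrightarrow> 0 < a i j \<longleftrightarrow> (j, i) \<in> parcs G"
    and spanning_tree: "has_directed_spanning_tree (with_proj G) 0"
    and \<kappa>: "eigenvalue (cmat (H_hat N r a)) \<kappa>"
    and \<kappa>_least: "\<And>z. eigenvalue (cmat (H_hat N r a)) z \<Longrightarrow> Re \<kappa> \<le> Re z"
    and pos_def: "pos_def_mat \<nu> P\<^sub>0"
    and riccati_eq: "A * P\<^sub>0 + P\<^sub>0 * transpose_mat A + 1\<^sub>m \<nu> - P\<^sub>0 * transpose_mat C * C * P\<^sub>0 = 0\<^sub>m \<nu> \<nu>"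
    and \<mu>: "1 / Re \<kappa> \<le> \<mu>" and K_eq: "K = \<mu> \<cdot>\<^sub>m (P\<^sub>0 * transpose_mat C)"
begin

text \<open>\<open>Re \<kappa> > 0\<close> makes \<open>\<mu>\<close> positive, so the condition on the smallest real part extends to all
eigenvalues.\<close>

lemma gain_condition:
  assumes "eigenvalue (cmat (H_hat N r a)) z" shows "1 \<le> \<mu> * Re z"
proof -
  have k: "0 < Re \<kappa>"
    by (rule H_hat_eigenvalue_pos[OF r1 _ a_nonneg verts a_arcs spanning_tree \<kappa>]) (use a_diag in auto)
  then have "1 \<le> \<mu> * Re \<kappa>" using \<mu> by (simp add: field_simps)
  moreover have "0 \<le> \<mu>" using k \<mu> by (meson divide_nonneg_nonneg less_imp_le order_trans zero_le_one)
  then have "\<mu> * Re \<kappa> \<le> \<mu> * Re z" using \<kappa>_least[OF assms] by (intro mult_left_mono)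
  ultimately show ?thesis by linarith
qed

sublocale ric: riccati \<nu> A C P\<^sub>0 \<mu>
  by unfold_locales (fact A C pos_def riccati_eq)+

lemma K_carrier: "K \<in> carrier_mat \<nu> 1"
  unfolding K_eq using ric.P C by auto

lemma col_K: "col K 0 = ric.gain"
proof (rule eq_vecI)
  have Ct: "transpose_mat C \<in> carrier_mat \<nu> 1" using C by simp
  have c0: "col (transpose_mat C) 0 = row C 0" using C by simp
  show "dim_vec (col K 0) = dim_vec ric.gain" using K_carrier ric.gain_carrier by auto
  fix q assume "q < dim_vec ric.gain"
  then have q: "q < \<nu>" using ric.gain_carrier by auto
  show "col K 0 $ q = ric.gain $ q"
    using q K_carrier ric.P Ct C by (simp add: K_eq ric.gain_def c0)
qed

lemma KC_mult:
  assumes v: "v \<in> carrier_vec \<nu>" shows "(K * C) *\<^sub>v v = ric.out v \<cdot>\<^sub>v ric.gain"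
proof (rule eq_vecI)
  show "dim_vec ((K * C) *\<^sub>v v) = dim_vec (ric.out v \<cdot>\<^sub>v ric.gain)" using K_carrier ric.gain_carrier by auto
  fix q assume "q < dim_vec (ric.out v \<cdot>\<^sub>v ric.gain)"
  then have q: "q < \<nu>" using ric.gain_carrier by auto
  have Cv: "C *\<^sub>v v \<in> carrier_vec 1" using C v by auto
  have "((K * C) *\<^sub>v v) $ q = (K *\<^sub>v (C *\<^sub>v v)) $ q" by (simp only: assoc_mult_mat_vec[OF K_carrier C v])
  also have "\<dots> = row K q \<bullet> (C *\<^sub>v v)" using K_carrier q by simp
  also have "\<dots> = K $$ (q, 0) * (C *\<^sub>v v) $ 0" using K_carrier q by (simp add: scalar_prod_sum[OF Cv])
  also have "K $$ (q, 0) = ric.gain $ q" using K_carrier q by (simp flip: col_K)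
  also have "(C *\<^sub>v v) $ 0 = ric.out v" using C by (simp add: ric.out_def)
  finally show "((K * C) *\<^sub>v v) $ q = (ric.out v \<cdot>\<^sub>v ric.gain) $ q"
    using q ric.gain_carrier by simp
qed

lemma agent_locale: "i \<in> {1..N} \<Longrightarrow> adaptive_agent \<nu> A C K (m i) (c i) (\<psi> i) (r i) (\<theta> i)"
  by unfold_locales (use r1 A C K_carrier \<theta>_carrier smooth_\<psi> c_pos in auto)

lemma agent_solution_of_solution:
  assumes sol: "solution_on S z" and i: "i \<in> {1..N}"
  shows "adaptive_agent.agent_solution \<nu> A C K (m i) (c i) (\<psi> i) (r i) (\<theta> i) S (\<lambda>t. agent (z t) i)"
proof -
  interpret ag: adaptive_agent \<nu> A C K "m i" "c i" "\<psi> i" "r i" "\<theta> i" by (rule agent_locale[OF i])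
  show ?thesis
    using sol i unfolding ag.agent_solution_def ag.well_formed_def solution_on_def state_space_def
      Let_def control_def update_law_def by fast
qed

text \<open>The first backstepping error, extended by 0 to the leader, which tracks itself.\<close>

definition tracking_error :: "nat \<Rightarrow> net_state \<Rightarrow> real" where
  "tracking_error j z = (if j = 0 then 0 else plant (agent z j) 1 - ric.out (compens (agent z j) 1))"

lemma tracking_error_err:
  assumes "i \<in> {1..N}" "z \<in> state_space"
  shows "tracking_error i z = backstepping.err \<nu> A C K (m i) (c i) (\<psi> i) 1 (agent z i)"
proof -
  interpret ag: adaptive_agent \<nu> A C K "m i" "c i" "\<psi> i" "r i" "\<theta> i" by (rule agent_locale[OF assms(1)])
  show ?thesis using assms C unfolding ag.err_1 tracking_error_def ric.out_def by simp
qed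

text \<open>\<open>\<eta>\<^sub>i\<^sub>,\<^sub>l - x\<^sub>0\<close> and the input it receives, numbered like the rows of \<open>H\<close>; only the last compensator of
a subsystem communicates and has a nonzero input.\<close>

definition deviation :: "nat \<Rightarrow> net_state \<Rightarrow> real vec" where
  "deviation p z = (case block_index N r ! p of (i, l) \<Rightarrow> compens (agent z i) l - leader z)"

definition disturbance :: "nat \<Rightarrow> net_state \<Rightarrow> real vec" where
  "disturbance p z = (case block_index N r ! p of (i, l) \<Rightarrow>
     (if l \<le> r i then 0 else - (\<Sum>j=0..N. a i j * (tracking_error i z - tracking_error j z))) \<cdot>\<^sub>v ric.gain)"

lemma block_index_nth:
  assumes "p < length (block_index N r)"
  obtains i l where "block_index N r ! p = (i, l)" "i \<in> {1..N}" "l \<in> {1..r i + 1}"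
  using nth_mem[OF assms] unfolding set_block_index by force

lemma out_diff: "u \<in> carrier_vec \<nu> \<Longrightarrow> v \<in> carrier_vec \<nu> \<Longrightarrow> ric.out (u - v) = ric.out u - ric.out v"
  unfolding ric.out_def by (rule scalar_prod_minus_distrib[OF ric.C0])

lemma sys_output_out: "sys_output z 0 = ric.out (leader z)"
  using C by (simp add: sys_output_def ric.out_def)

text \<open>The terms of \<open>H\<close> in the last row arise from two sources: the compensator coupling, which compares
\<open>\<eta>\<^sub>i\<^sub>,\<^sub>r\<^sub>+\<^sub>1\<close> with \<open>\<eta>\<^sub>i\<^sub>,\<^sub>1\<close>, and the output coupling \<open>y\<^sub>i - y\<^sub>j\<close>. Each output is its tracking error
plus the output of \<open>\<eta>\<^sub>j\<^sub>,\<^sub>1\<close>, so the contributions of \<open>\<eta>\<^sub>i\<^sub>,\<^sub>1\<close> cancel and the difference between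
\<open>\<eta>\<^sub>i\<^sub>,\<^sub>r\<^sub>+\<^sub>1\<close> and the \<open>\<eta>\<^sub>j\<^sub>,\<^sub>1\<close> is left, with the tracking errors as input.\<close>

lemma coupled_deviation:
  assumes sol: "solution_on S z"
  shows "ric.coupled (length (block_index N r)) (\<lambda>p s. H_hat N r a $$ (p, s)) S
    (\<lambda>p t. deviation p (z t)) (\<lambda>p t. disturbance p (z t))"
  unfolding ric.coupled_def
proof (intro ballI allI impI)
  fix t p assume t: "t \<in> S" and p: "p < length (block_index N r)"
  define Z where "Z = z t"
  obtain i l where ip: "block_index N r ! p = (i, l)" and i: "i \<in> {1..N}" and l: "l \<in> {1..r i + 1}"
    using block_index_nth[OF p] by blast
  have ssp: "z s \<in> state_space" if "s \<in> S" for s using sol that by (simp add: solution_on_def)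
  have Z: "Z \<in> state_space" unfolding Z_def by (rule ssp[OF t])
  have x0: "leader Z \<in> carrier_vec \<nu>" using Z by (simp add: state_space_def)
  have \<eta>: "compens (agent Z j) k \<in> carrier_vec \<nu>" if "j \<in> {1..N}" "k \<in> {1..r j + 1}" for j k
    using Z that by (simp add: state_space_def)
  have gc: "ric.gain \<in> carrier_vec \<nu>" by (rule ric.gain_carrier)
  have dv: "deviation p Z \<in> carrier_vec \<nu>" using x0 \<eta>[OF i l] by (simp add: deviation_def ip)
  have ds: "disturbance p Z \<in> carrier_vec \<nu>" using gc by (simp add: disturbance_def ip)
  define out_at where "out_at x = ric.out (compens (agent Z (fst x)) (snd x) - leader Z)" for x
  have out_at_dev: "ric.out (deviation s Z) = out_at (block_index N r ! s)" for s
    by (simp add: deviation_def out_at_def split_def)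
  define s where "s = (\<Sum>j=0..N. a i j)"
  define \<sigma> where "\<sigma> = (\<Sum>q<length (block_index N r). H_hat N r a $$ (p, q) * ric.out (deviation q Z))"
  have \<sigma>: "\<sigma> = (if l \<le> r i then out_at (i, l) - out_at (i, l + 1)
       else s * out_at (i, r i + 1) - (\<Sum>j=1..N. a i j * out_at (j, 1)))"
    unfolding \<sigma>_def out_at_dev s_def
    using H_hat_row[where f = out_at and a = a, OF r1 _ p ip] a_diag by simp
  have oi: "out_at (j, k) = ric.out (compens (agent Z j) k) - ric.out (leader Z)"
    if "j \<in> {1..N}" "k \<in> {1..r j + 1}" for j k
    unfolding out_at_def by (simp add: out_diff[OF \<eta>[OF that] x0])
  define D where "D = (if l \<le> r i then backstepping.eta_rhs A C K l (agent Z i) else last_eta_rhs i Z)"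
  have der: "vec_has_derivative \<nu> (\<lambda>s. compens (agent (z s) i) l) D t S"
  proof (cases "l \<le> r i")
    case True
    then have "l \<in> {1..r i}" using l by simp
    then show ?thesis using sol t i True unfolding solution_on_def Let_def D_def Z_def by auto
  next
    case False
    then have "l = r i + 1" using l by simp
    then show ?thesis using sol t i unfolding solution_on_def Let_def D_def Z_def by auto
  qed
  have Dq: "D $ q - (A *\<^sub>v leader Z) $ q
      = ric.block_field \<sigma> (disturbance p Z) (deviation p Z) $ q" if q: "q < \<nu>" for q
  proof -
    define \<eta>l where "\<eta>l = compens (agent Z i) l"
    have \<eta>l: "\<eta>l \<in> carrier_vec \<nu>" unfolding \<eta>l_def by (rule \<eta>[OF i l])
    have Ad: "(A *\<^sub>v deviation p Z) $ q = (A *\<^sub>v \<eta>l) $ q - (A *\<^sub>v leader Z) $ q"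
      using A q mult_minus_distrib_mat_vec[OF A \<eta>l x0] by (simp add: deviation_def ip \<eta>l_def[symmetric])
    have A1: "A *\<^sub>v \<eta>l \<in> carrier_vec \<nu>" using A \<eta>l by auto
    have A2: "A *\<^sub>v deviation p Z \<in> carrier_vec \<nu>" using A dv by auto
    have bf: "ric.block_field \<sigma> (disturbance p Z) (deviation p Z) $ q
        = (A *\<^sub>v deviation p Z) $ q - \<sigma> * ric.gain $ q + disturbance p Z $ q"
      unfolding ric.block_field_def using q A2 gc ds by (simp del: index_mult_mat_vec)
    show ?thesis
    proof (cases "l \<le> r i")
      case True
      have l1: "l + 1 \<in> {1..r i + 1}" using True by simp
      have dd: "\<eta>l - compens (agent Z i) (l + 1) \<in> carrier_vec \<nu>" using \<eta>l \<eta>[OF i l1] by simp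
      have "D = A *\<^sub>v \<eta>l - ric.out (\<eta>l - compens (agent Z i) (l + 1)) \<cdot>\<^sub>v ric.gain"
        using True unfolding D_def backstepping.eta_rhs_def \<eta>l_def[symmetric] KC_mult[OF dd] by simp
      moreover have "ric.out (\<eta>l - compens (agent Z i) (l + 1)) = \<sigma>"
        using True oi[OF i l] oi[OF i l1] out_diff[OF \<eta>l \<eta>[OF i l1]] by (simp add: \<sigma> \<eta>l_def)
      ultimately have "D $ q = (A *\<^sub>v \<eta>l) $ q - \<sigma> * ric.gain $ q"
        using q A1 gc by (simp del: index_mult_mat_vec)
      moreover have "disturbance p Z $ q = 0" using True q gc by (simp add: disturbance_def ip)
      ultimately show ?thesis unfolding bf Ad by simp
    next
      case False
      then have lr: "l = r i + 1" using l by simp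
      have one: "1 \<in> {1..r j + 1}" for j by simp
      have dd: "compens (agent Z i) (r i + 1) - compens (agent Z i) 1 \<in> carrier_vec \<nu>"
        using \<eta>[OF i] by simp
      define b where "b = (\<Sum>j=0..N. a i j * (sys_output Z i - sys_output Z j))"
      define d where "d = (\<Sum>j=0..N. a i j * (tracking_error i Z - tracking_error j Z))"
      have D: "D = A *\<^sub>v \<eta>l - s \<cdot>\<^sub>v (ric.out (compens (agent Z i) (r i + 1) - compens (agent Z i) 1) \<cdot>\<^sub>v ric.gain)
          - b \<cdot>\<^sub>v ric.gain"
        using False unfolding D_def last_eta_rhs_def Let_def \<eta>l_def lr KC_mult[OF dd] col_K b_def s_def by simp
      have Dq: "D $ q = (A *\<^sub>v \<eta>l) $ q
          - (s * ric.out (compens (agent Z i) (r i + 1) - compens (agent Z i) 1) + b) * ric.gain $ q"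
        unfolding D using q A1 gc by (simp add: algebra_simps del: index_mult_mat_vec)
      \<comment> \<open>the deviation output of \<open>\<eta>\<^sub>j\<^sub>,\<^sub>1\<close>, with value 0 for the leader\<close>
      define e where "e j = (if j = 0 then 0 else out_at (j, 1))" for j
      have y: "sys_output Z j = tracking_error j Z + e j + ric.out (leader Z)" if "j \<in> {0..N}" for j
      proof (cases "j = 0")
        case True
        then show ?thesis by (simp add: e_def tracking_error_def sys_output_out)
      next
        case False
        then show ?thesis
          using that oi[of j 1] by (simp add: e_def tracking_error_def sys_output_def)
      qed
      have "b = (\<Sum>j=0..N. a i j * (tracking_error i Z - tracking_error j Z) + (a i j * e i - a i j * e j))"
        unfolding b_def using i by (intro sum.cong refl) (simp add: y algebra_simps)
      also have "\<dots> = d + (s * e i - (\<Sum>j=0..N. a i j * e j))"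
        unfolding d_def s_def by (simp add: sum.distrib sum_subtractf sum_distrib_right)
      also have "(\<Sum>j=0..N. a i j * e j) = (\<Sum>j=1..N. a i j * out_at (j, 1))"
        by (simp add: sum.atLeast_Suc_atMost[of 0 N] e_def)
      finally have b: "b = d + (s * e i - (\<Sum>j=1..N. a i j * out_at (j, 1)))" .
      have out1: "ric.out (compens (agent Z i) (r i + 1) - compens (agent Z i) 1) = out_at (i, r i + 1) - e i"
        using i oi[OF i, of "r i + 1"] oi[OF i one] out_diff[OF \<eta>[OF i, of "r i + 1"] \<eta>[OF i one]]
        by (simp add: e_def)
      have "s * ric.out (compens (agent Z i) (r i + 1) - compens (agent Z i) 1) + b = \<sigma> + d"
        unfolding out1 b \<sigma> using False by (simp add: algebra_simps)
      moreover have "disturbance p Z $ q = - d * ric.gain $ q"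
        using False q gc by (simp add: disturbance_def ip d_def)
      ultimately show ?thesis unfolding bf Ad Dq by (simp add: algebra_simps)
    qed
  qed
  have "vec_has_derivative \<nu> (\<lambda>t. deviation p (z t)) (ric.block_field \<sigma> (disturbance p Z) (deviation p Z)) t S"
    unfolding vec_has_derivative_def
  proof (intro allI impI)
    fix q assume q: "q < \<nu>"
    have "((\<lambda>s. compens (agent (z s) i) l $ q) has_real_derivative D $ q) (at t within S)"
      using der q by (simp add: vec_has_derivative_def)
    moreover have "((\<lambda>s. leader (z s) $ q) has_real_derivative (A *\<^sub>v leader Z) $ q) (at t within S)"
      using sol t q by (auto simp: solution_on_def vec_has_derivative_def Z_def simp del: index_mult_mat_vec)
    ultimately have "((\<lambda>s. compens (agent (z s) i) l $ q - leader (z s) $ q) has_real_derivative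
        D $ q - (A *\<^sub>v leader Z) $ q) (at t within S)" by (rule DERIV_diff)
    then have "((\<lambda>s. deviation p (z s) $ q) has_real_derivative D $ q - (A *\<^sub>v leader Z) $ q) (at t within S)"
    proof (rule has_field_derivative_transform_within[where d = 1])
      fix s assume "s \<in> S"
      then have "leader (z s) \<in> carrier_vec \<nu>" using ssp by (simp add: state_space_def)
      then show "compens (agent (z s) i) l $ q - leader (z s) $ q = deviation p (z s) $ q"
        using q by (simp add: deviation_def ip)
    qed (use t in auto)
    then show "((\<lambda>t. deviation p (z t) $ q) has_real_derivative
        ric.block_field \<sigma> (disturbance p Z) (deviation p Z) $ q) (at t within S)"
      unfolding Dq[OF q] .
  qed
  with dv ds show "deviation p (z t) \<in> carrier_vec \<nu> \<and> disturbance p (z t) \<in> carrier_vec \<nu> \<and>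
     vec_has_derivative \<nu> (\<lambda>t. deviation p (z t))
      (ric.block_field (\<Sum>s<length (block_index N r). H_hat N r a $$ (p, s) * ric.out (deviation s (z t)))
        (disturbance p (z t)) (deviation p (z t))) t S"
    unfolding \<sigma>_def Z_def by blast
qed

lemma bounded_uptoD:
  assumes "state_bounded R z" "z \<in> state_space" "i \<in> {1..N}"
  shows "adaptive_agent.bounded_upto \<nu> (m i) (r i) R (agent z i)"
proof -
  interpret ag: adaptive_agent \<nu> A C K "m i" "c i" "\<psi> i" "r i" "\<theta> i" by (rule agent_locale[OF assms(3)])
  show ?thesis
    using assms unfolding ag.bounded_upto_def state_bounded_def vec_bounded_def state_space_def by fastforce
qed

text \<open>The bounds are obtained in the order in which they depend on each other: errors and estimates, inputs
of the deviations, deviations and leader, compensators, chain states and controls. The statement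
covers every time interval that begins at 0, because it also serves as the a priori bound in the
proof of existence.\<close>

lemma trajectories_bounded:
  "\<exists>B. \<forall>S z. time_interval S \<and> solution_on S z \<and> state_bounded R (z 0) \<longrightarrow>
     (\<forall>t\<in>S. state_bounded B (z t) \<and> (\<forall>i\<in>{1..N}. \<bar>control i (z t)\<bar> \<le> B))"
proof -
  have "\<exists>B. \<forall>S z. time_interval S \<and> solution_on S z \<and> state_bounded R (z 0) \<longrightarrow>
     (\<forall>t\<in>S. (\<forall>k\<in>{1..r i}. \<bar>backstepping.err \<nu> A C K (m i) (c i) (\<psi> i) k (agent (z t) i)\<bar> \<le> B) \<and>
        (\<forall>q<m i. \<bar>estim (agent (z t) i) $ q\<bar> \<le> B))" if i: "i \<in> {1..N}" for i
  proof -
    interpret ag: adaptive_agent \<nu> A C K "m i" "c i" "\<psi> i" "r i" "\<theta> i" by (rule agent_locale[OF i])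
    obtain B where B: "\<forall>S z. time_interval S \<and> ag.agent_solution S z \<and> ag.bounded_upto (r i) R (z 0) \<longrightarrow>
       (\<forall>t\<in>S. (\<forall>k\<in>{1..r i}. \<bar>ag.err k (z t)\<bar> \<le> B) \<and> (\<forall>q<m i. \<bar>estim (z t) $ q\<bar> \<le> B))"
      using ag.err_estim_bounded by blast
    show ?thesis
    proof (intro exI[of _ B] allI impI)
      fix S z assume *: "time_interval S \<and> solution_on S z \<and> state_bounded R (z 0)"
      show "\<forall>t\<in>S. (\<forall>k\<in>{1..r i}. \<bar>ag.err k (agent (z t) i)\<bar> \<le> B) \<and> (\<forall>q<m i. \<bar>estim (agent (z t) i) $ q\<bar> \<le> B)"
      proof (cases "S = {}")
        case False
        then have "0 \<in> S" using * time_intervalD[of S] by fastforce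
        then have "z 0 \<in> state_space" using * by (simp add: solution_on_def)
        then have "ag.bounded_upto (r i) R (agent (z 0) i)" using * i by (intro bounded_uptoD) auto
        then show ?thesis
          using B[THEN spec, of S, THEN spec, of "\<lambda>t. agent (z t) i"] agent_solution_of_solution[of S z i] * i by blast
      qed simp
    qed
  qed
  then obtain BE where BE: "\<And>i S z t. i \<in> {1..N} \<Longrightarrow> time_interval S \<Longrightarrow> solution_on S z \<Longrightarrow> state_bounded R (z 0) \<Longrightarrow> t \<in> S \<Longrightarrow>
     (\<forall>k\<in>{1..r i}. \<bar>backstepping.err \<nu> A C K (m i) (c i) (\<psi> i) k (agent (z t) i)\<bar> \<le> BE i) \<and>
        (\<forall>q<m i. \<bar>estim (agent (z t) i) $ q\<bar> \<le> BE i)" by metis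
  define E where "E = (\<Sum>i=1..N. \<bar>BE i\<bar>)"
  have E: "\<bar>BE i\<bar> \<le> E" if "i \<in> {1..N}" for i
    unfolding E_def using that by (intro member_le_sum[of i "{1..N}" "\<lambda>i. \<bar>BE i\<bar>"]) auto
  have E0: "0 \<le> E" by (simp add: E_def sum_nonneg)
  define n where "n = length (block_index N r)"
  \<comment> \<open>bounds the inputs of the deviations when all tracking errors are at most \<open>E\<close>\<close>
  define W where "W = (\<Sum>i=1..N. \<Sum>j=0..N. a i j) * (2 * E) * (\<Sum>q<\<nu>. \<bar>ric.gain $ q\<bar>)"
  obtain BZ where BZ: "\<forall>S \<zeta> d. time_interval S \<and> ric.coupled n (\<lambda>p s. H_hat N r a $$ (p, s)) S \<zeta> d \<and>
     (\<forall>p<n. \<forall>q<\<nu>. \<bar>\<zeta> p 0 $ q\<bar> \<le> max (2 * R) W \<and> (\<forall>t\<in>S. \<bar>d p t $ q\<bar> \<le> max (2 * R) W)) \<longrightarrow>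
     (\<forall>t\<in>S. \<forall>p<n. \<forall>q<\<nu>. \<bar>\<zeta> p t $ q\<bar> \<le> BZ)"
    using ric.coupled_bounded[OF H_hat_carrier[of N r a] gain_condition, of "max (2 * R) W"]
    unfolding n_def by blast
  obtain cl where cl: "0 \<le> cl" "\<forall>S x R. time_interval S \<and>
      (\<forall>t\<in>S. x t \<in> carrier_vec \<nu> \<and> vec_has_derivative \<nu> x (A *\<^sub>v x t) t S) \<and>
      (\<forall>q<\<nu>. \<bar>x 0 $ q\<bar> \<le> R) \<longrightarrow> (\<forall>t\<in>S. \<forall>q<\<nu>. \<bar>x t $ q\<bar> \<le> cl * R)"
    using semisimple_flow_bounded[OF A leader_eigenvalues] by blast
  define B1 where "B1 = max E (\<bar>BZ\<bar> + \<bar>cl * R\<bar>)"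
  have "\<exists>B'. \<forall>z :: net_state. adaptive_agent.signals_bounded \<nu> A C K (m i) (c i) (\<psi> i) (r i) B1 (agent z i) \<longrightarrow>
     (\<forall>l\<in>{1..r i}. \<bar>plant (agent z i) l\<bar> \<le> B') \<and> \<bar>control i z\<bar> \<le> B'" if i: "i \<in> {1..N}" for i
  proof -
    interpret ag: adaptive_agent \<nu> A C K "m i" "c i" "\<psi> i" "r i" "\<theta> i" by (rule agent_locale[OF i])
    obtain B' where B': "\<forall>z. ag.signals_bounded B1 z \<longrightarrow> ag.bounded_upto (r i) B' z \<and> \<bar>ag.alpha (r i) z\<bar> \<le> B'"
      using ag.state_control_bounded by blast
    show ?thesis
    proof (intro exI[of _ B'] allI impI)
      fix z :: net_state assume "ag.signals_bounded B1 (agent z i)"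
      from B'[THEN spec, THEN mp, OF this]
      show "(\<forall>l\<in>{1..r i}. \<bar>plant (agent z i) l\<bar> \<le> B') \<and> \<bar>control i z\<bar> \<le> B'"
        by (simp add: control_def ag.bounded_upto_def)
    qed
  qed
  then obtain BP where BP: "\<And>i (z :: net_state). i \<in> {1..N} \<Longrightarrow>
     adaptive_agent.signals_bounded \<nu> A C K (m i) (c i) (\<psi> i) (r i) B1 (agent z i) \<Longrightarrow>
     (\<forall>l\<in>{1..r i}. \<bar>plant (agent z i) l\<bar> \<le> BP i) \<and> \<bar>control i z\<bar> \<le> BP i" by metis
  define B where "B = B1 + (\<Sum>i=1..N. \<bar>BP i\<bar>)"
  have BPB: "BP i \<le> B" if "i \<in> {1..N}" for i
  proof -
    have "\<bar>BP i\<bar> \<le> (\<Sum>i=1..N. \<bar>BP i\<bar>)"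
      using that by (intro member_le_sum[of i "{1..N}" "\<lambda>i. \<bar>BP i\<bar>"]) auto
    then show ?thesis using E0 by (simp add: B_def B1_def)
  qed
  have B1B: "B1 \<le> B" by (simp add: B_def sum_nonneg)
  show ?thesis
  proof (intro exI[of _ B] allI impI ballI)
    fix S z t
    assume *: "time_interval S \<and> solution_on S z \<and> state_bounded R (z 0)" and t: "t \<in> S"
    have S0: "0 \<in> S" using * t time_intervalD[of S t] by auto
    have ssp: "z s \<in> state_space" if "s \<in> S" for s using * that by (simp add: solution_on_def)
    have x0: "leader (z s) \<in> carrier_vec \<nu>" if "s \<in> S" for s using ssp[OF that] by (simp add: state_space_def)
    have \<eta>: "compens (agent (z s) j) k \<in> carrier_vec \<nu>" if "s \<in> S" "j \<in> {1..N}" "k \<in> {1..r j + 1}" for s j k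
      using ssp[OF that(1)] that by (simp add: state_space_def)
    have err: "\<bar>backstepping.err \<nu> A C K (m i) (c i) (\<psi> i) k (agent (z s) i)\<bar> \<le> E"
      and est: "q < m i \<Longrightarrow> \<bar>estim (agent (z s) i) $ q\<bar> \<le> E"
      if "i \<in> {1..N}" "s \<in> S" "k \<in> {1..r i}" for i s k q
      using BE[OF that(1), of S z s] * that E[OF that(1)] by fastforce+
    have te: "\<bar>tracking_error j (z s)\<bar> \<le> E" if "j \<in> {0..N}" "s \<in> S" for j s
    proof (cases "j = 0")
      case True
      then show ?thesis using E0 by (simp add: tracking_error_def)
    next
      case False
      then have j: "j \<in> {1..N}" using that by auto
      then show ?thesis using err[OF j that(2), of 1] r1[OF j] tracking_error_err[OF j ssp[OF that(2)]] by simp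
    qed
    have dist: "\<bar>disturbance p (z s) $ q\<bar> \<le> W" if p: "p < n" and q: "q < \<nu>" and s: "s \<in> S" for p q s
    proof -
      obtain i l where ip: "block_index N r ! p = (i, l)" and i: "i \<in> {1..N}" and l: "l \<in> {1..r i + 1}"
        using block_index_nth p n_def by metis
      have an: "0 \<le> a i j" if "j \<in> {0..N}" for j using a_nonneg[of i j] i that by simp
      have an2: "0 \<le> (\<Sum>j=0..N. a i j)" if "i \<in> {1..N}" for i
        using a_nonneg that by (intro sum_nonneg) auto
      have "\<bar>\<Sum>j=0..N. a i j * (tracking_error i (z s) - tracking_error j (z s))\<bar> \<le> (\<Sum>j=0..N. a i j * (2 * E))"
      proof (rule order_trans[OF sum_abs], rule sum_mono)
        fix j assume j: "j \<in> {0..N}"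
        have "\<bar>tracking_error i (z s) - tracking_error j (z s)\<bar> \<le> 2 * E"
          using te[of i s] te[OF j s] i s by auto
        then show "\<bar>a i j * (tracking_error i (z s) - tracking_error j (z s))\<bar> \<le> a i j * (2 * E)"
          using an[OF j] by (simp add: abs_mult mult_left_mono)
      qed
      also have "\<dots> = (\<Sum>j=0..N. a i j) * (2 * E)" by (simp add: sum_distrib_right)
      also have "\<dots> \<le> (\<Sum>i=1..N. \<Sum>j=0..N. a i j) * (2 * E)"
        using E0 i an2 by (intro mult_right_mono member_le_sum[of i "{1..N}" "\<lambda>i. \<Sum>j=0..N. a i j"]) auto
      finally have "\<bar>\<Sum>j=0..N. a i j * (tracking_error i (z s) - tracking_error j (z s))\<bar>
          \<le> (\<Sum>i=1..N. \<Sum>j=0..N. a i j) * (2 * E)" .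
      moreover have y0: "0 \<le> (\<Sum>i=1..N. \<Sum>j=0..N. a i j) * (2 * E)"
        using E0 by (intro mult_nonneg_nonneg sum_nonneg an2) auto
      ultimately have le: "\<bar>if l \<le> r i then 0 else - (\<Sum>j=0..N. a i j * (tracking_error i (z s) - tracking_error j (z s)))\<bar>
          \<le> (\<Sum>i=1..N. \<Sum>j=0..N. a i j) * (2 * E)" (is "\<bar>?x\<bar> \<le> ?y") by auto
      have "\<bar>disturbance p (z s) $ q\<bar> = \<bar>?x\<bar> * \<bar>ric.gain $ q\<bar>"
        using q ric.gain_carrier by (simp add: disturbance_def ip abs_mult)
      also have "\<dots> \<le> ?y * (\<Sum>q<\<nu>. \<bar>ric.gain $ q\<bar>)"
        using le y0 q by (intro mult_mono member_le_sum[of q "{..<\<nu>}" "\<lambda>q. \<bar>ric.gain $ q\<bar>"]) auto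
      finally show ?thesis unfolding W_def .
    qed
    have l0: "\<bar>leader (z 0) $ q\<bar> \<le> R" if "q < \<nu>" for q
      using * x0[OF S0] that by (auto simp: state_bounded_def vec_bounded_def)
    have dev0: "\<bar>deviation p (z 0) $ q\<bar> \<le> 2 * R" if p: "p < n" and q: "q < \<nu>" for p q
    proof -
      obtain i l where ip: "block_index N r ! p = (i, l)" and i: "i \<in> {1..N}" and l: "l \<in> {1..r i + 1}"
        using block_index_nth p n_def by metis
      have "\<bar>compens (agent (z 0) i) l $ q\<bar> \<le> R"
        using * \<eta>[OF S0 i l] i l q unfolding state_bounded_def vec_bounded_def by auto
      moreover have "deviation p (z 0) $ q = compens (agent (z 0) i) l $ q - leader (z 0) $ q"
        using q x0[OF S0] by (simp add: deviation_def ip)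
      ultimately show ?thesis using l0[OF q] by linarith
    qed
    have "\<forall>t\<in>S. \<forall>p<n. \<forall>q<\<nu>. \<bar>deviation p (z t) $ q\<bar> \<le> BZ"
      by (rule BZ[THEN spec, of S, THEN spec, of "\<lambda>p t. deviation p (z t)", THEN spec, of "\<lambda>p t. disturbance p (z t)", THEN mp])
        (use * dev0 dist coupled_deviation[of S z] in \<open>auto simp: n_def le_max_iff_disj\<close>)
    then have dev: "\<bar>deviation p (z t) $ q\<bar> \<le> BZ" if "p < n" "q < \<nu>" for p q using t that by blast
    have "\<forall>t\<in>S. \<forall>q<\<nu>. \<bar>leader (z t) $ q\<bar> \<le> cl * R"
      by (rule cl(2)[THEN spec, of S, THEN spec, of "\<lambda>t. leader (z t)", THEN spec, of R, THEN mp])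
        (use * l0 x0 in \<open>auto simp: solution_on_def\<close>)
    then have lead: "\<bar>leader (z t) $ q\<bar> \<le> cl * R" if "q < \<nu>" for q using t that by blast
    have comp: "\<bar>compens (agent (z t) i) l $ q\<bar> \<le> B1" if i: "i \<in> {1..N}" and l: "l \<in> {1..r i + 1}" and q: "q < \<nu>" for i l q
    proof -
      have "(i, l) \<in> set (block_index N r)" using i l by (simp add: set_block_index)
      then obtain p where p: "p < n" "block_index N r ! p = (i, l)" unfolding n_def in_set_conv_nth by blast
      have "deviation p (z t) $ q = compens (agent (z t) i) l $ q - leader (z t) $ q"
        using q x0[OF t] by (simp add: deviation_def p(2))
      then show ?thesis using dev[OF p(1) q] lead[OF q] unfolding B1_def by linarith
    qed
    have EB1: "E \<le> B1" by (simp add: B1_def)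
    have ctrl: "(\<forall>l\<in>{1..r i}. \<bar>plant (agent (z t) i) l\<bar> \<le> BP i) \<and> \<bar>control i (z t)\<bar> \<le> BP i" if i: "i \<in> {1..N}" for i
    proof (rule BP[OF i])
      interpret ag: adaptive_agent \<nu> A C K "m i" "c i" "\<psi> i" "r i" "\<theta> i" by (rule agent_locale[OF i])
      have "ag.well_formed (r i) (agent (z t) i)"
        using ssp[OF t] i by (simp add: ag.well_formed_def state_space_def)
      moreover have "\<forall>k\<in>{1..r i}. \<bar>ag.err k (agent (z t) i)\<bar> \<le> B1" using err[OF i t] EB1 by force
      moreover have "\<forall>l\<in>{1..r i + 1}. \<forall>q<\<nu>. \<bar>compens (agent (z t) i) l $ q\<bar> \<le> B1" using comp[OF i] by blast
      moreover have "\<forall>q<m i. \<bar>estim (agent (z t) i) $ q\<bar> \<le> B1" using est[OF i t, of 1] r1[OF i] EB1 by force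
      ultimately show "ag.signals_bounded B1 (agent (z t) i)" unfolding ag.signals_bounded_def by blast
    qed
    have "state_bounded B (z t)"
      unfolding state_bounded_def vec_bounded_def
    proof (intro conjI ballI allI impI)
      fix q assume "q < dim_vec (leader (z t))"
      then have "q < \<nu>" using x0[OF t] by simp
      from lead[OF this] show "\<bar>leader (z t) $ q\<bar> \<le> B" using B1B unfolding B1_def by linarith
    next
      fix i l assume "i \<in> {1..N}" "l \<in> {1..r i}"
      then show "\<bar>plant (agent (z t) i) l\<bar> \<le> B" using ctrl[of i] BPB[of i] by force
    next
      fix i l q assume "i \<in> {1..N}" "l \<in> {1..r i + 1}" "q < dim_vec (compens (agent (z t) i) l)"
      then show "\<bar>compens (agent (z t) i) l $ q\<bar> \<le> B" using comp[of i l q] \<eta>[OF t, of i l] B1B by auto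
    next
      fix i q assume i: "i \<in> {1..N}" and q: "q < dim_vec (estim (agent (z t) i))"
      have "estim (agent (z t) i) \<in> carrier_vec (m i)" using ssp[OF t] i by (simp add: state_space_def)
      then show "\<bar>estim (agent (z t) i) $ q\<bar> \<le> B" using est[OF i t, of 1 q] r1[OF i] q EB1 B1B by auto
    qed
    moreover have "\<forall>i\<in>{1..N}. \<bar>control i (z t)\<bar> \<le> B" using ctrl BPB by force
    ultimately show "state_bounded B (z t) \<and> (\<forall>i\<in>{1..N}. \<bar>control i (z t)\<bar> \<le> B)" by blast
  qed
qed

end

section \<open>The closed loop as a flow in finitely many coordinates\<close>

datatype net_coord = Lead nat | Agent nat coord

definition net_flat :: "net_state \<Rightarrow> net_coord \<Rightarrow> real" where
  "net_flat z p = (case p of Lead q \<Rightarrow> leader z $ q | Agent i p \<Rightarrow> flat (agent z i) p)"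

context tracking_network begin

definition net_coords :: "net_coord set" where
  "net_coords = Lead ` {..<\<nu>} \<union> (\<Union>i\<in>{1..N}. Agent i ` coords_upto \<nu> (m i) (r i))"

lemma finite_net_coords: "finite net_coords"
  by (auto simp: net_coords_def finite_coords_upto)

lemma net_coords_iff:
  "Lead q \<in> net_coords \<longleftrightarrow> q < \<nu>"
  "Agent i (Plant l) \<in> net_coords \<longleftrightarrow> i \<in> {1..N} \<and> l \<in> {1..r i}"
  "Agent i (Comp l q) \<in> net_coords \<longleftrightarrow> i \<in> {1..N} \<and> l \<in> {1..r i + 1} \<and> q < \<nu>"
  "Agent i (Estim q) \<in> net_coords \<longleftrightarrow> i \<in> {1..N} \<and> q < m i"
  by (auto simp: net_coords_def coords_upto_def image_iff)

lemma net_coords_cases: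
  assumes "p \<in> net_coords"
  obtains (lead) q where "p = Lead q" "q < \<nu>"
  | (plant) i l where "p = Agent i (Plant l)" "i \<in> {1..N}" "l \<in> {1..r i}"
  | (comp) i l q where "p = Agent i (Comp l q)" "i \<in> {1..N}" "l \<in> {1..r i + 1}" "q < \<nu>"
  | (estim) i q where "p = Agent i (Estim q)" "i \<in> {1..N}" "q < m i"
proof (cases p)
  case (Agent i c)
  then show ?thesis using assms that by (cases c) (auto simp: net_coords_iff)
qed (use assms that in \<open>auto simp: net_coords_iff\<close>)

definition net_rate :: "net_state \<Rightarrow> net_coord \<Rightarrow> real" where
  "net_rate z p = (case p of Lead q \<Rightarrow> (A *\<^sub>v leader z) $ q
     | Agent i c \<Rightarrow> (case c of
         Plant l \<Rightarrow> (if l < r i then plant (agent z i) (l + 1) else control i z)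
           + \<psi> i l (plant (agent z i)) \<bullet> \<theta> i
       | Comp l q \<Rightarrow> (if l \<le> r i then backstepping.eta_rhs A C K l (agent z i) else last_eta_rhs i z) $ q
       | Estim q \<Rightarrow> update_law i z $ q))"

lemma solution_on_iff:
  "solution_on S z \<longleftrightarrow> (\<forall>t\<in>S. z t \<in> state_space) \<and>
    (\<forall>t\<in>S. \<forall>p\<in>net_coords. ((\<lambda>s. net_flat (z s) p) has_real_derivative net_rate (z t) p) (at t within S))"
  (is "?L \<longleftrightarrow> ?R1 \<and> ?R2")
proof (intro iffI conjI)
  assume L: ?L
  then show ?R1 by (simp add: solution_on_def)
  show ?R2
  proof (intro ballI)
    fix t p assume t: "t \<in> S" and p: "p \<in> net_coords"
    show "((\<lambda>s. net_flat (z s) p) has_real_derivative net_rate (z t) p) (at t within S)"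
      using p
    proof (cases rule: net_coords_cases)
      case (lead q)
      then show ?thesis using L t
        by (auto simp: solution_on_def vec_has_derivative_def net_flat_def net_rate_def simp del: index_mult_mat_vec)
    next
      case (plant i l)
      then show ?thesis using L t unfolding solution_on_def Let_def
        by (cases "l < r i") (auto simp: net_flat_def net_rate_def flat_def le_antisym)
    next
      case (comp i l q)
      then consider "l \<in> {1..r i}" | "l = r i + 1" by fastforce
      then show ?thesis
      proof cases
        case 1
        then have "vec_has_derivative \<nu> (\<lambda>s. compens (agent (z s) i) l)
            (backstepping.eta_rhs A C K l (agent (z t) i)) t S"
          using L t comp unfolding solution_on_def Let_def by blast
        then show ?thesis using comp 1 by (simp add: vec_has_derivative_def net_flat_def flat_def net_rate_def)
      next
        case 2
        then have "vec_has_derivative \<nu> (\<lambda>s. compens (agent (z s) i) l) (last_eta_rhs i (z t)) t S"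
          using L t comp unfolding solution_on_def Let_def by blast
        then show ?thesis using comp 2 by (simp add: vec_has_derivative_def net_flat_def flat_def net_rate_def)
      qed
    next
      case (estim i q)
      then show ?thesis using L t unfolding solution_on_def Let_def vec_has_derivative_def
        by (auto simp: net_flat_def net_rate_def flat_def)
    qed
  qed
next
  assume R: "?R1 \<and> ?R2"
  then have d: "((\<lambda>s. net_flat (z s) p) has_real_derivative net_rate (z t) p) (at t within S)"
    if "t \<in> S" "p \<in> net_coords" for t p using that by blast
  show ?L
    unfolding solution_on_def Let_def vec_has_derivative_def
  proof (intro ballI conjI allI impI)
    fix t assume t: "t \<in> S"
    show "z t \<in> state_space" using R t by blast
    show "((\<lambda>s. leader (z s) $ q) has_real_derivative (A *\<^sub>v leader (z t)) $ q) (at t within S)" if "q < \<nu>" for q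
      using d[OF t, of "Lead q"] that by (simp add: net_coords_iff net_flat_def net_rate_def)
    fix i assume i: "i \<in> {1..N}"
    show "((\<lambda>s. plant (agent (z s) i) l) has_real_derivative
        plant (agent (z t) i) (l + 1) + \<psi> i l (plant (agent (z t) i)) \<bullet> \<theta> i) (at t within S)"
      if "l \<in> {1..<r i}" for l
      using d[OF t, of "Agent i (Plant l)"] that i by (simp add: net_coords_iff net_flat_def net_rate_def flat_def)
    show "((\<lambda>s. plant (agent (z s) i) (r i)) has_real_derivative
        control i (z t) + \<psi> i (r i) (plant (agent (z t) i)) \<bullet> \<theta> i) (at t within S)"
      using d[OF t, of "Agent i (Plant (r i))"] i r1[OF i] by (simp add: net_coords_iff net_flat_def net_rate_def flat_def)
    show "((\<lambda>s. compens (agent (z s) i) l $ q) has_real_derivative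
        backstepping.eta_rhs A C K l (agent (z t) i) $ q) (at t within S)" if "l \<in> {1..r i}" "q < \<nu>" for l q
      using d[OF t, of "Agent i (Comp l q)"] that i by (simp add: net_coords_iff net_flat_def net_rate_def flat_def)
    show "((\<lambda>s. compens (agent (z s) i) (r i + 1) $ q) has_real_derivative
        last_eta_rhs i (z t) $ q) (at t within S)" if "q < \<nu>" for q
      using d[OF t, of "Agent i (Comp (r i + 1) q)"] that i by (simp add: net_coords_iff net_flat_def net_rate_def flat_def)
    show "((\<lambda>s. estim (agent (z s) i) $ q) has_real_derivative update_law i (z t) $ q) (at t within S)"
      if "q < m i" for q
      using d[OF t, of "Agent i (Estim q)"] that i by (simp add: net_coords_iff net_flat_def net_rate_def flat_def)
  qed
qed

text \<open>The state with coordinates \<open>x\<close>. Components of \<open>z\<close> outside the index ranges are retained, so that the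
overlay of \<open>z\<close> with its own coordinates is \<open>z\<close> itself and a solution can start at a prescribed state.\<close>

definition overlay :: "net_state \<Rightarrow> (net_coord \<Rightarrow> real) \<Rightarrow> net_state" where
  "overlay z x = \<lparr>leader = vec \<nu> (\<lambda>q. x (Lead q)), agent = (\<lambda>i. if i \<in> {1..N} then
      \<lparr>plant = (\<lambda>l. if l \<in> {1..r i} then x (Agent i (Plant l)) else plant (agent z i) l),
       compens = (\<lambda>l. if l \<in> {1..r i + 1} then vec \<nu> (\<lambda>q. x (Agent i (Comp l q))) else compens (agent z i) l),
       estim = vec (m i) (\<lambda>q. x (Agent i (Estim q)))\<rparr> else agent z i)\<rparr>"

lemma overlay_in_state_space: "overlay z x \<in> state_space"
  by (simp add: state_space_def overlay_def)

lemma net_flat_overlay: "p \<in> net_coords \<Longrightarrow> net_flat (overlay z x) p = x p"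
  by (erule net_coords_cases) (simp_all add: net_flat_def flat_def overlay_def)

lemma vec_nth_eq: "v \<in> carrier_vec n \<Longrightarrow> vec n (\<lambda>q. v $ q) = v"
  by (intro eq_vecI) auto

lemma overlay_net_flat_self:
  assumes "z \<in> state_space" shows "overlay z (net_flat z) = z"
proof -
  have "agent (overlay z (net_flat z)) i = agent z i" for i
    using assms by (auto simp: overlay_def net_flat_def flat_def state_space_def vec_nth_eq
        intro!: agent_state.equality)
  moreover have "leader (overlay z (net_flat z)) = leader z"
    using assms by (simp add: overlay_def net_flat_def state_space_def vec_nth_eq)
  ultimately show ?thesis by (intro net_state.equality) auto
qed

lemma same_state_iff:
  assumes "z \<in> state_space" "z' \<in> state_space"
  shows "same_state z z' \<longleftrightarrow> (\<forall>p\<in>net_coords. net_flat z p = net_flat z' p)"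
proof
  assume "same_state z z'"
  then show "\<forall>p\<in>net_coords. net_flat z p = net_flat z' p"
    by (auto elim!: net_coords_cases simp: same_state_def net_flat_def flat_def)
next
  assume R: "\<forall>p\<in>net_coords. net_flat z p = net_flat z' p"
  show "same_state z z'"
    unfolding same_state_def
  proof (intro conjI ballI)
    show "leader z = leader z'"
      using assms R[rule_format, of "Lead _"]
      by (intro eq_vecI) (auto simp: state_space_def net_coords_iff net_flat_def)
    fix i assume i: "i \<in> {1..N}"
    show "plant (agent z i) l = plant (agent z' i) l" if "l \<in> {1..r i}" for l
      using R[rule_format, of "Agent i (Plant l)"] i that by (simp add: net_coords_iff net_flat_def flat_def)
    show "compens (agent z i) l = compens (agent z' i) l" if l: "l \<in> {1..r i + 1}" for l
    proof (rule eq_vecI)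
      have c: "compens (agent z i) l \<in> carrier_vec \<nu>" "compens (agent z' i) l \<in> carrier_vec \<nu>"
        using assms i l by (auto simp: state_space_def)
      then show "dim_vec (compens (agent z i) l) = dim_vec (compens (agent z' i) l)" by simp
      fix q assume "q < dim_vec (compens (agent z' i) l)"
      then show "compens (agent z i) l $ q = compens (agent z' i) l $ q"
        using R[rule_format, of "Agent i (Comp l q)"] i l c by (simp add: net_coords_iff net_flat_def flat_def)
    qed
    show "estim (agent z i) = estim (agent z' i)"
    proof (rule eq_vecI)
      have c: "estim (agent z i) \<in> carrier_vec (m i)" "estim (agent z' i) \<in> carrier_vec (m i)"
        using assms i by (auto simp: state_space_def)
      then show "dim_vec (estim (agent z i)) = dim_vec (estim (agent z' i))" by simp
      fix q assume "q < dim_vec (estim (agent z' i))"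
      then show "estim (agent z i) $ q = estim (agent z' i) $ q"
        using R[rule_format, of "Agent i (Estim q)"] i c by (simp add: net_coords_iff net_flat_def flat_def)
    qed
  qed
qed

lemma same_state_agree: "same_state z z' \<Longrightarrow> i \<in> {1..N} \<Longrightarrow> agree_upto (r i) (agent z i) (agent z' i)"
  by (simp add: same_state_def agree_upto_def)

lemma net_rate_cong:
  assumes ss: "same_state z z'" and p: "p \<in> net_coords" shows "net_rate z p = net_rate z' p"
  using p
proof (cases rule: net_coords_cases)
  case (lead q)
  then show ?thesis using ss by (simp add: net_rate_def same_state_def)
next
  case (plant i l)
  interpret ag: adaptive_agent \<nu> A C K "m i" "c i" "\<psi> i" "r i" "\<theta> i" by (rule agent_locale[OF plant(2)])
  have ag: "agree_upto (r i) (agent z i) (agent z' i)" by (rule same_state_agree[OF ss plant(2)])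
  have "l < r i \<Longrightarrow> plant (agent z i) (l + 1) = plant (agent z' i) (l + 1)"
    by (rule depD[OF dep_plant ag]) simp
  moreover have "control i z = control i z'"
    unfolding control_def by (rule depD[OF ag.dep_alpha ag]) (use ag.r1 in simp)
  moreover have "\<psi> i l (plant (agent z i)) = \<psi> i l (plant (agent z' i))"
    by (rule depD[OF ag.dep_\<psi> ag]) (use plant in auto)
  ultimately show ?thesis by (simp add: net_rate_def plant(1))
next
  case (comp i l q)
  have ag: "agree_upto (r i) (agent z i) (agent z' i)" by (rule same_state_agree[OF ss comp(2)])
  have ce: "compens (agent z i) k = compens (agent z' i) k" if "k \<in> {1..r i + 1}" for k
    using ag that by (simp add: agree_upto_def)
  have so: "sys_output z j = sys_output z' j" if "j \<in> {0..N}" for j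
    using ss that r1[of j] by (auto simp: sys_output_def same_state_def)
  show ?thesis
  proof (cases "l \<le> r i")
    case True
    then have "backstepping.eta_rhs A C K l (agent z i) = backstepping.eta_rhs A C K l (agent z' i)"
      using ce[of l] ce[of "l + 1"] comp by (simp add: backstepping.eta_rhs_def)
    then show ?thesis using True by (simp add: net_rate_def comp(1))
  next
    case False
    have "(\<Sum>j=0..N. a i j * (sys_output z i - sys_output z j)) = (\<Sum>j=0..N. a i j * (sys_output z' i - sys_output z' j))"
      using so comp(2) by (intro sum.cong refl) auto
    then have "last_eta_rhs i z = last_eta_rhs i z'"
      unfolding last_eta_rhs_def Let_def using ce[of 1] ce[of "r i + 1"] by simp
    then show ?thesis using False by (simp add: net_rate_def comp(1))
  qed
next
  case (estim i q)
  interpret ag: adaptive_agent \<nu> A C K "m i" "c i" "\<psi> i" "r i" "\<theta> i" by (rule agent_locale[OF estim(2)])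
  have "update_law i z = update_law i z'"
    unfolding update_law_def by (rule depD[OF ag.dep_tau same_state_agree[OF ss estim(2)]]) (use ag.r1 in simp)
  then show ?thesis by (simp add: net_rate_def estim(1))
qed

lemma overlay_same_state:
  assumes "z' \<in> state_space" shows "same_state (overlay z (net_flat z')) z'"
  using same_state_iff[OF overlay_in_state_space assms] net_flat_overlay by blast

lemma flow_solution_of_solution:
  assumes "solution_on S z"
  shows "flow_solution net_coords (\<lambda>x. net_rate (overlay z\<^sub>0 x)) S (\<lambda>t. net_flat (z t))"
  unfolding flow_solution_def
proof (intro ballI)
  fix t p assume t: "t \<in> S" and p: "p \<in> net_coords"
  have "net_rate (overlay z\<^sub>0 (net_flat (z t))) p = net_rate (z t) p"
    using assms t by (intro net_rate_cong overlay_same_state p) (simp add: solution_on_iff)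
  then show "((\<lambda>s. net_flat (z s) p) has_real_derivative net_rate (overlay z\<^sub>0 (net_flat (z t))) p) (at t within S)"
    using assms t p by (simp add: solution_on_iff)
qed

lemma solution_of_flow_solution:
  assumes "flow_solution net_coords (\<lambda>x. net_rate (overlay z\<^sub>0 x)) S x"
  shows "solution_on S (\<lambda>t. overlay z\<^sub>0 (x t))"
  using assms unfolding solution_on_iff flow_solution_def
  by (simp add: overlay_in_state_space net_flat_overlay)

lemma agent_function_box_lipschitz:
  assumes i: "i \<in> {1..N}"
    and f: "adaptive_agent.smooth_fun \<nu> (m i) f" "depends_upto (r i) f"
  shows "box_lipschitz net_coords (\<lambda>x. f (agent (overlay z\<^sub>0 x) i))"
proof -
  interpret ag: adaptive_agent \<nu> A C K "m i" "c i" "\<psi> i" "r i" "\<theta> i" by (rule agent_locale[OF i])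
  have "box_lipschitz (coords_upto \<nu> (m i) (r i)) (\<lambda>y. f (ag.U y))"
    by (rule Ck_box_lipschitz[OF finite_coords_upto _ ag.depends_on_coords[OF f(2)]])
      (rule f(1)[unfolded ag.smooth_fun_def, rule_format])
  then have "box_lipschitz net_coords (\<lambda>x. f (ag.U (\<lambda>p. x (Agent i p))))"
    by (rule box_lipschitz_reindex) (use i in \<open>auto simp: inj_def net_coords_def finite_coords_upto\<close>)
  moreover have "f (agent (overlay z\<^sub>0 x) i) = f (ag.U (\<lambda>p. x (Agent i p)))" for x
    by (rule depD[OF f(2)]) (use i in \<open>auto simp: agree_upto_def overlay_def unflat_def\<close>)
  ultimately show ?thesis by (simp only:)
qed

text \<open>Every coordinate of the field is built by linear operations from coordinates and from smooth local
functions of one subsystem.\<close>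

lemma net_rate_box_lipschitz:
  assumes p: "p \<in> net_coords"
  shows "box_lipschitz net_coords (\<lambda>x. net_rate (overlay z\<^sub>0 x) p)"
  using p
proof (cases rule: net_coords_cases)
  case (lead q)
  have "net_rate (overlay z\<^sub>0 x) p = (\<Sum>j<\<nu>. A $$ (q, j) * x (Lead j))" for x
    using lead A by (simp add: net_rate_def overlay_def scalar_prod_sum[of _ \<nu>])
  moreover have "box_lipschitz net_coords (\<lambda>x. \<Sum>j<\<nu>. A $$ (q, j) * x (Lead j))"
    by (intro box_lipschitz_sum box_lipschitz_cmult box_lipschitz_coord finite_net_coords) (simp add: net_coords_iff)
  ultimately show ?thesis by (simp only:)
next
  case (plant i l)
  interpret ag: adaptive_agent \<nu> A C K "m i" "c i" "\<psi> i" "r i" "\<theta> i" by (rule agent_locale[OF plant(2)])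
  have s\<psi>: "ag.smooth_fun (\<lambda>w. \<psi> i l (plant w) \<bullet> \<theta> i)"
    by (rule ag.smooth_scalar_prod[OF ag.smooth_\<psi>_plant[OF plant(3)]])
      (use ag.\<theta> in \<open>auto simp: ag.smooth_vec_def ag.smooth_fun_const\<close>)
  have d\<psi>: "depends_upto (r i) (\<lambda>w. \<psi> i l (plant w) \<bullet> \<theta> i)"
    using ag.dep_\<psi>[OF plant(3) order.refl] by (rule dep_comp1[where F = "\<lambda>v. v \<bullet> \<theta> i"])
  show ?thesis
  proof (cases "l < r i")
    case True
    have "box_lipschitz net_coords (\<lambda>x. (\<lambda>w. plant w (l + 1) + \<psi> i l (plant w) \<bullet> \<theta> i) (agent (overlay z\<^sub>0 x) i))"
      by (rule agent_function_box_lipschitz[OF plant(2) ag.smooth_fun_add[OF ag.smooth_plant s\<psi>]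
            dep_comp2[where F = "(+)", OF dep_plant d\<psi>]]) (use True in simp)
    then show ?thesis using True by (simp add: net_rate_def plant(1))
  next
    case False
    have ri: "r i \<in> {1..r i}" using ag.r1 by simp
    have "box_lipschitz net_coords (\<lambda>x. (\<lambda>w. ag.alpha (r i) w + \<psi> i l (plant w) \<bullet> \<theta> i) (agent (overlay z\<^sub>0 x) i))"
      by (rule agent_function_box_lipschitz[OF plant(2) ag.smooth_fun_add[OF ag.smooth_alpha[OF ri] s\<psi>]
            dep_comp2[where F = "(+)", OF ag.dep_alpha[OF ri] d\<psi>]])
    then show ?thesis using False by (simp add: net_rate_def plant(1) control_def)
  qed
next
  case (estim i q)
  interpret ag: adaptive_agent \<nu> A C K "m i" "c i" "\<psi> i" "r i" "\<theta> i" by (rule agent_locale[OF estim(2)])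
  have ri: "r i \<in> {1..r i}" using ag.r1 by simp
  have "box_lipschitz net_coords (\<lambda>x. (\<lambda>w. ag.tau (r i) w $ q) (agent (overlay z\<^sub>0 x) i))"
    by (rule agent_function_box_lipschitz[OF estim(2) ag.smooth_vec_nth[OF ag.smooth_tau[OF ri] estim(3)]
          dep_comp1[where F = "\<lambda>v. v $ q", OF ag.dep_tau[OF ri]]])
  then show ?thesis by (simp add: net_rate_def estim(1) update_law_def)
next
  case (comp i l q)
  interpret ag: adaptive_agent \<nu> A C K "m i" "c i" "\<psi> i" "r i" "\<theta> i" by (rule agent_locale[OF comp(2)])
  show ?thesis
  proof (cases "l \<le> r i")
    case True
    have "depends_upto (r i) (\<lambda>w. ag.eta_rhs l w $ q)"
      unfolding depends_upto_def
    proof (intro allI impI)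
      fix w w' assume "agree_upto (r i) w w'"
      then have "compens w l = compens w' l" "compens w (l + 1) = compens w' (l + 1)"
        using True comp(3) by (auto simp: agree_upto_def)
      then show "ag.eta_rhs l w $ q = ag.eta_rhs l w' $ q" by (simp add: ag.eta_rhs_def)
    qed
    from agent_function_box_lipschitz[OF comp(2) ag.smooth_vec_nth[OF ag.smooth_eta_rhs comp(4)] this]
    show ?thesis using True by (simp add: net_rate_def comp(1))
  next
    case False
    define s where "s = (\<Sum>j=0..N. a i j)"
    define h where "h w = A *\<^sub>v compens w (r i + 1) - s \<cdot>\<^sub>v ((K * C) *\<^sub>v (compens w (r i + 1) - compens w 1))" for w :: agent_state
    have sh: "ag.smooth_vec \<nu> h"
      unfolding h_def[abs_def]
      by (rule ag.smooth_vec_diff[OF ag.smooth_mult_mat_vec[OF A ag.smooth_compens]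
          ag.smooth_vec_smult[OF ag.smooth_fun_const ag.smooth_mult_mat_vec[OF mult_carrier_mat[OF K_carrier C]
          ag.smooth_vec_diff[OF ag.smooth_compens ag.smooth_compens]]]])
    have dh: "depends_upto (r i) (\<lambda>w. h w $ q)"
      by (auto simp: depends_upto_def agree_upto_def h_def)
    have b1: "box_lipschitz net_coords (\<lambda>x. (\<lambda>w. h w $ q) (agent (overlay z\<^sub>0 x) i))"
      by (rule agent_function_box_lipschitz[OF comp(2) ag.smooth_vec_nth[OF sh comp(4)] dh])
    have out: "box_lipschitz net_coords (\<lambda>x. sys_output (overlay z\<^sub>0 x) j)" if j: "j \<in> {0..N}" for j
    proof (cases "j = 0")
      case True
      have "sys_output (overlay z\<^sub>0 x) j = (\<Sum>q<\<nu>. C $$ (0, q) * x (Lead q))" for x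
        using True C by (simp add: sys_output_def overlay_def scalar_prod_sum[of _ \<nu>])
      moreover have "box_lipschitz net_coords (\<lambda>x. \<Sum>q<\<nu>. C $$ (0, q) * x (Lead q))"
        by (intro box_lipschitz_sum box_lipschitz_cmult box_lipschitz_coord finite_net_coords) (simp add: net_coords_iff)
      ultimately show ?thesis by (simp only:)
    next
      case False
      with j have j1: "j \<in> {1..N}" by simp
      then have "sys_output (overlay z\<^sub>0 x) j = x (Agent j (Plant 1))" for x
        using False r1[OF j1] by (simp add: sys_output_def overlay_def)
      moreover have "box_lipschitz net_coords (\<lambda>x. x (Agent j (Plant 1)))"
        using r1[OF j1] j1 by (intro box_lipschitz_coord finite_net_coords) (simp add: net_coords_iff)
      ultimately show ?thesis by (simp only:)
    qed
    have b2: "box_lipschitz net_coords (\<lambda>x. col K 0 $ q *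
        (\<Sum>j=0..N. a i j * (sys_output (overlay z\<^sub>0 x) i - sys_output (overlay z\<^sub>0 x) j)))"
      using comp(2) by (intro box_lipschitz_cmult box_lipschitz_sum box_lipschitz_diff out) auto
    have "net_rate (overlay z\<^sub>0 x) p = h (agent (overlay z\<^sub>0 x) i) $ q - col K 0 $ q *
        (\<Sum>j=0..N. a i j * (sys_output (overlay z\<^sub>0 x) i - sys_output (overlay z\<^sub>0 x) j))" for x
    proof -
      have k: "col K 0 \<in> carrier_vec \<nu>" using K_carrier by auto
      have hc: "h (agent (overlay z\<^sub>0 x) i) \<in> carrier_vec \<nu>"
        using A K_carrier C comp(2) by (auto simp: h_def overlay_def)
      define b where "b = (\<Sum>j=0..N. a i j * (sys_output (overlay z\<^sub>0 x) i - sys_output (overlay z\<^sub>0 x) j))"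
      have "net_rate (overlay z\<^sub>0 x) p = (h (agent (overlay z\<^sub>0 x) i) - b \<cdot>\<^sub>v col K 0) $ q"
        using False unfolding net_rate_def comp(1) last_eta_rhs_def Let_def h_def s_def b_def by simp
      also have "\<dots> = h (agent (overlay z\<^sub>0 x) i) $ q - col K 0 $ q * b"
        using k hc comp(4) carrier_matD[OF K_carrier] by simp
      finally show ?thesis unfolding b_def .
    qed
    with box_lipschitz_diff[OF b1 b2] show ?thesis by (simp only:)
  qed
qed

lemma net_flat_bounded:
  assumes "state_bounded B z" "z \<in> state_space" "p \<in> net_coords" shows "\<bar>net_flat z p\<bar> \<le> B"
  using assms(3)
proof (cases rule: net_coords_cases)
  case (lead q)
  then show ?thesis using assms by (auto simp: state_bounded_def vec_bounded_def state_space_def net_flat_def)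
next
  case (plant i l)
  then show ?thesis using assms by (auto simp: state_bounded_def net_flat_def flat_def)
next
  case (comp i l q)
  then have "compens (agent z i) l \<in> carrier_vec \<nu>" using assms by (simp add: state_space_def)
  then show ?thesis using assms comp by (auto simp: state_bounded_def vec_bounded_def net_flat_def flat_def)
next
  case (estim i q)
  then have "estim (agent z i) \<in> carrier_vec (m i)" using assms by (simp add: state_space_def)
  then show ?thesis using assms estim by (auto simp: state_bounded_def vec_bounded_def net_flat_def flat_def)
qed

lemma state_bounded_exists:
  assumes z: "z \<in> state_space" shows "\<exists>R. state_bounded R z"
proof -
  define R where "R = (\<Sum>p\<in>net_coords. \<bar>net_flat z p\<bar>)"
  have R: "\<bar>net_flat z p\<bar> \<le> R" if "p \<in> net_coords" for p
    unfolding R_def using that by (intro member_le_sum[of p net_coords "\<lambda>p. \<bar>net_flat z p\<bar>"] finite_net_coords) auto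
  have "state_bounded R z"
    unfolding state_bounded_def vec_bounded_def
  proof (intro conjI ballI allI impI)
    fix q assume "q < dim_vec (leader z)"
    then show "\<bar>leader z $ q\<bar> \<le> R" using z R[of "Lead q"] by (auto simp: state_space_def net_coords_iff net_flat_def)
  next
    fix i l assume "i \<in> {1..N}" "l \<in> {1..r i}"
    then show "\<bar>plant (agent z i) l\<bar> \<le> R" using R[of "Agent i (Plant l)"] by (simp add: net_coords_iff net_flat_def flat_def)
  next
    fix i l q assume il: "i \<in> {1..N}" "l \<in> {1..r i + 1}" and q: "q < dim_vec (compens (agent z i) l)"
    then have "compens (agent z i) l \<in> carrier_vec \<nu>" using z by (simp add: state_space_def)
    then show "\<bar>compens (agent z i) l $ q\<bar> \<le> R"
      using R[of "Agent i (Comp l q)"] il q by (simp add: net_coords_iff net_flat_def flat_def)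
  next
    fix i q assume i: "i \<in> {1..N}" and q: "q < dim_vec (estim (agent z i))"
    then have "estim (agent z i) \<in> carrier_vec (m i)" using z by (simp add: state_space_def)
    then show "\<bar>estim (agent z i) $ q\<bar> \<le> R"
      using R[of "Agent i (Estim q)"] i q by (simp add: net_coords_iff net_flat_def flat_def)
  qed
  then show ?thesis ..
qed

section \<open>Global boundedness and tracking\<close>

lemma time_interval_atLeast: "time_interval {0..}" and time_interval_Ico: "time_interval {0..<T}"
  by (auto simp: time_interval_def)

lemma solution_on_subset:
  assumes "solution_on S z" "S' \<subseteq> S" shows "solution_on S' z"
  using assms unfolding solution_on_iff by (meson has_field_derivative_subset subsetD)

text \<open>\<open>trajectories_bounded\<close> provides the a priori bound, both for the existence of a global solution and
for the boundedness of the two solutions that are compared in the uniqueness argument.\<close>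

lemma forward_completeness: "forward_complete"
  unfolding forward_complete_def
proof
  fix z\<^sub>0 assume z0: "z\<^sub>0 \<in> state_space"
  obtain R where R: "state_bounded R z\<^sub>0" using state_bounded_exists[OF z0] by blast
  obtain B where B: "\<forall>S z. time_interval S \<and> solution_on S z \<and> state_bounded R (z 0) \<longrightarrow>
     (\<forall>t\<in>S. state_bounded B (z t) \<and> (\<forall>i\<in>{1..N}. \<bar>control i (z t)\<bar> \<le> B))"
    using trajectories_bounded by blast
  have bd: "\<bar>net_flat (z t) p\<bar> \<le> B"
    if S: "time_interval S" and sol: "solution_on S z" and "z 0 = z\<^sub>0" and t: "t \<in> S" and p: "p \<in> net_coords" for S z t p
  proof -
    have "state_bounded B (z t)"
      using B[THEN spec, of S, THEN spec, of z] S sol t R \<open>z 0 = z\<^sub>0\<close> by blast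
    moreover have "z t \<in> state_space" using sol t by (simp add: solution_on_def)
    ultimately show ?thesis by (rule net_flat_bounded[OF _ _ p])
  qed
  obtain x where x: "flow_solution net_coords (\<lambda>x. net_rate (overlay z\<^sub>0 x)) {0..} x" "\<And>p. x 0 p = net_flat z\<^sub>0 p"
  proof (rule flow_solution_exists[OF finite_net_coords, where F = "\<lambda>x. net_rate (overlay z\<^sub>0 x)" and x\<^sub>0 = "net_flat z\<^sub>0" and B = B])
    show "box_lipschitz net_coords (\<lambda>x. net_rate (overlay z\<^sub>0 x) p)" if "p \<in> net_coords" for p
      by (rule net_rate_box_lipschitz[OF that])
    fix T x t p
    assume "flow_solution net_coords (\<lambda>x. net_rate (overlay z\<^sub>0 x)) {0..<T} x"
      and x0: "\<And>p. x 0 p = net_flat z\<^sub>0 p" and t: "t \<in> {0..<T}" and p: "p \<in> net_coords"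
    then have "solution_on {0..<T} (\<lambda>t. overlay z\<^sub>0 (x t))" by (intro solution_of_flow_solution)
    moreover have "x 0 = net_flat z\<^sub>0" using x0 by auto
    then have "overlay z\<^sub>0 (x 0) = z\<^sub>0" by (simp add: overlay_net_flat_self[OF z0])
    ultimately have "\<bar>net_flat (overlay z\<^sub>0 (x t)) p\<bar> \<le> B"
      by (intro bd[OF time_interval_Ico _ _ t p])
    then show "\<bar>x t p\<bar> \<le> B" by (simp add: net_flat_overlay[OF p])
  qed (rule that)
  define z where "z t = overlay z\<^sub>0 (x t)" for t
  have sol: "solution_on {0..} z" unfolding z_def[abs_def] by (rule solution_of_flow_solution[OF x(1)])
  have "x 0 = net_flat z\<^sub>0" using x(2) by auto
  then have z0': "z 0 = z\<^sub>0" by (simp add: z_def overlay_net_flat_self[OF z0])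
  have "same_state (z' t) (z t)" if T: "0 < T" and z': "solution_on {0..<T} z'" "z' 0 = z\<^sub>0" and t: "t \<in> {0..<T}" for T z' t
  proof -
    have sT: "solution_on {0..<T} z" by (rule solution_on_subset[OF sol]) auto
    have "net_flat (z' t) p = net_flat (z t) p" if p: "p \<in> net_coords" for p
    proof (rule flow_solution_unique[where F = "\<lambda>x. net_rate (overlay z\<^sub>0 x)" and T = T and B = B and x = "\<lambda>t. net_flat (z' t)"
          and y = "\<lambda>t. net_flat (z t)"])
      show "flow_solution net_coords (\<lambda>x. net_rate (overlay z\<^sub>0 x)) {0..<T} (\<lambda>t. net_flat (z' t))"
        by (rule flow_solution_of_solution[OF z'(1)])
      show "flow_solution net_coords (\<lambda>x. net_rate (overlay z\<^sub>0 x)) {0..<T} (\<lambda>t. net_flat (z t))"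
        by (rule flow_solution_of_solution[OF sT])
      show "net_flat (z' 0) p = net_flat (z 0) p" for p by (simp add: z0' z'(2))
      show "\<bar>net_flat (z' t) p\<bar> \<le> B" if "t \<in> {0..<T}" "p \<in> net_coords" for t p
        by (rule bd[OF time_interval_Ico z' that])
      show "\<bar>net_flat (z t) p\<bar> \<le> B" if "t \<in> {0..<T}" "p \<in> net_coords" for t p
        by (rule bd[OF time_interval_Ico sT z0' that])
    qed (fact finite_net_coords net_rate_box_lipschitz t p)+
    moreover have "z' t \<in> state_space" "z t \<in> state_space" using z'(1) sT t by (simp_all add: solution_on_def)
    ultimately show ?thesis by (simp add: same_state_iff)
  qed
  with sol z0' show "\<exists>z. solution_on {0..} z \<and> z 0 = z\<^sub>0 \<and>
     (\<forall>T>0. \<forall>z'. solution_on {0..<T} z' \<and> z' 0 = z\<^sub>0 \<longrightarrow> (\<forall>t\<in>{0..<T}. same_state (z' t) (z t)))"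
    by (intro exI[of _ z]) blast
qed

lemma global_uniform_boundedness: "globally_uniformly_bounded"
  unfolding globally_uniformly_bounded_def
proof (intro conjI allI)
  show forward_complete by (rule forward_completeness)
  fix R
  obtain B where B: "\<forall>S z. time_interval S \<and> solution_on S z \<and> state_bounded R (z 0) \<longrightarrow>
     (\<forall>t\<in>S. state_bounded B (z t) \<and> (\<forall>i\<in>{1..N}. \<bar>control i (z t)\<bar> \<le> B))"
    using trajectories_bounded by blast
  show "\<exists>B. \<forall>z. solution_on {0..} z \<and> state_bounded R (z 0) \<longrightarrow>
     (\<forall>t\<ge>0. state_bounded B (z t) \<and> (\<forall>i\<in>{1..N}. \<bar>control i (z t)\<bar> \<le> B))"
    using B[THEN spec, of "{0..}"] time_interval_atLeast by (intro exI[of _ B]) auto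
qed

text \<open>\<open>y\<^sub>i - y\<^sub>0\<close> is the tracking error plus the output of the deviation at \<open>(i, 1)\<close>. The tracking errors
tend to 0 by the Lyapunov argument, and the deviations follow because they are driven by them.\<close>

lemma tracking: "consensus_tracking"
  unfolding consensus_tracking_def
proof (intro allI impI ballI)
  fix z i assume sol: "solution_on {0..} z" and i: "i \<in> {1..N}"
  have ssp: "z t \<in> state_space" if "0 \<le> t" for t using sol that by (simp add: solution_on_def)
  obtain R where R: "state_bounded R (z 0)" using state_bounded_exists[OF ssp[of 0]] by auto
  obtain B where B: "\<And>t. 0 \<le> t \<Longrightarrow> state_bounded B (z t)"
    using global_uniform_boundedness sol R unfolding globally_uniformly_bounded_def by blast
  have te: "((\<lambda>t. tracking_error j (z t)) \<longlongrightarrow> 0) at_top" if "j \<in> {0..N}" for j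
  proof (cases "j = 0")
    case True
    then show ?thesis by (simp add: tracking_error_def)
  next
    case False
    with that have j: "j \<in> {1..N}" by simp
    interpret ag: adaptive_agent \<nu> A C K "m j" "c j" "\<psi> j" "r j" "\<theta> j" by (rule agent_locale[OF j])
    have "((\<lambda>t. ag.err 1 (agent (z t) j)) \<longlongrightarrow> 0) at_top"
      by (rule ag.err_1_tendsto_0[where B = B, OF agent_solution_of_solution[OF sol j]])
        (rule bounded_uptoD[OF B ssp j])
    moreover have "eventually (\<lambda>t. ag.err 1 (agent (z t) j) = tracking_error j (z t)) at_top"
      using eventually_ge_at_top[of 0] by eventually_elim (simp only: tracking_error_err[OF j ssp])
    ultimately show ?thesis by (rule Lim_transform_eventually)
  qed
  define n where "n = length (block_index N r)"
  have "(i, 1) \<in> set (block_index N r)" using i by (simp add: set_block_index)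
  then obtain p where p: "p < n" "block_index N r ! p = (i, 1)" unfolding n_def in_set_conv_nth by blast
  have dev: "((\<lambda>t. deviation p (z t) $ q) \<longlongrightarrow> 0) at_top" if q: "q < \<nu>" for q
  proof (rule ric.coupled_tendsto_0[OF H_hat_carrier[of N r a, folded n_def] gain_condition
        coupled_deviation[OF sol, folded n_def] _ p(1) q])
    fix p' q' assume p': "p' < n" and q': "q' < \<nu>"
    obtain i' l where ip: "block_index N r ! p' = (i', l)" and i': "i' \<in> {1..N}"
      using block_index_nth p' n_def by metis
    have eq: "disturbance p' (z t) $ q' = (if l \<le> r i' then 0
        else - (\<Sum>j=0..N. a i' j * (tracking_error i' (z t) - tracking_error j (z t)))) * ric.gain $ q'" for t
      using q' ric.gain_carrier by (simp add: disturbance_def ip)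
    have "((\<lambda>t. \<Sum>j=0..N. a i' j * (tracking_error i' (z t) - tracking_error j (z t)))
        \<longlongrightarrow> (\<Sum>j=0..N. a i' j * (0 - 0))) at_top"
      using i' by (intro tendsto_sum tendsto_mult_left tendsto_diff te) auto
    then have "((\<lambda>t. \<Sum>j=0..N. a i' j * (tracking_error i' (z t) - tracking_error j (z t))) \<longlongrightarrow> 0) at_top" by simp
    from tendsto_mult_right[OF tendsto_minus[OF this], of "ric.gain $ q'"]
    show "((\<lambda>t. disturbance p' (z t) $ q') \<longlongrightarrow> 0) at_top"
      unfolding eq[abs_def] by (cases "l \<le> r i'") simp_all
  qed
  have "((\<lambda>t. tracking_error i (z t) + (\<Sum>q<\<nu>. C $$ (0, q) * deviation p (z t) $ q))
      \<longlongrightarrow> 0 + (\<Sum>q<\<nu>. C $$ (0, q) * 0)) at_top"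
    using i by (intro tendsto_add te tendsto_sum tendsto_mult_left dev) auto
  then have lim: "((\<lambda>t. tracking_error i (z t) + (\<Sum>q<\<nu>. C $$ (0, q) * deviation p (z t) $ q)) \<longlongrightarrow> 0) at_top" by simp
  have eqn: "sys_output (z t) i - sys_output (z t) 0
      = tracking_error i (z t) + (\<Sum>q<\<nu>. C $$ (0, q) * deviation p (z t) $ q)" if t: "0 \<le> t" for t
  proof -
    have c: "compens (agent (z t) i) 1 \<in> carrier_vec \<nu>" "leader (z t) \<in> carrier_vec \<nu>"
      using ssp[OF t] i by (simp_all add: state_space_def)
    have dc: "deviation p (z t) \<in> carrier_vec \<nu>" using c by (simp add: deviation_def p(2))
    have "(\<Sum>q<\<nu>. C $$ (0, q) * deviation p (z t) $ q) = ric.out (deviation p (z t))"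
      using C unfolding ric.out_def scalar_prod_sum[OF dc] by simp
    also have "\<dots> = ric.out (compens (agent (z t) i) 1) - ric.out (leader (z t))"
      unfolding deviation_def p(2) prod.case by (rule out_diff[OF c])
    finally show ?thesis
      using i by (simp add: tracking_error_def sys_output_out sys_output_def[of _ i])
  qed
  have "eventually (\<lambda>t. tracking_error i (z t) + (\<Sum>q<\<nu>. C $$ (0, q) * deviation p (z t) $ q)
      = sys_output (z t) i - sys_output (z t) 0) at_top"
    using eventually_ge_at_top[of 0] by eventually_elim (rule eqn[symmetric])
  with lim show "((\<lambda>t. sys_output (z t) i - sys_output (z t) 0) \<longlongrightarrow> 0) at_top"
    by (rule Lim_transform_eventually)
qed

end

theorem theorem2:
  fixes \<nu> N :: nat and A C K P\<^sub>0 :: "real mat" and \<mu> :: real and \<kappa> :: complex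
    and r m :: "nat \<Rightarrow> nat" and a c :: "nat \<Rightarrow> nat \<Rightarrow> real"
    and \<psi> :: "nat \<Rightarrow> nat \<Rightarrow> (nat \<Rightarrow> real) \<Rightarrow> real vec" and \<theta> :: "nat \<Rightarrow> real vec"
    and G :: "nat pair_pre_digraph"
  assumes "0 < \<nu>" and "0 < N"
    and "\<And>i. i \<in> {1..N} \<Longrightarrow> 1 \<le> r i"
    and "\<And>i. i \<in> {1..N} \<Longrightarrow> \<theta> i \<in> carrier_vec (m i)"
    and "\<And>i l. i \<in> {1..N} \<Longrightarrow> l \<in> {1..r i} \<Longrightarrow> smooth_map l (m i) (\<psi> i l)"
    and "\<And>i l. i \<in> {1..N} \<Longrightarrow> l \<in> {1..r i} \<Longrightarrow> 0 < c i l"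
    \<comment> \<open>leader\<close>
    and "A \<in> carrier_mat \<nu> \<nu>" and "C \<in> carrier_mat 1 \<nu>"
    and "detectable \<nu> A C"
    and "\<And>z. eigenvalue (cmat A) z \<Longrightarrow> Re z = 0 \<and> semisimple_eigenvalue (cmat A) z"
    \<comment> \<open>graph\<close>
    and "pair_wf_digraph G" and "pverts G = {0..N}"
    and "\<And>i j. i \<in> {0..N} \<Longrightarrow> j \<in> {0..N} \<Longrightarrow> 0 \<le> a i j"
    and "\<And>i. i \<in> {0..N} \<Longrightarrow> a i i = 0"
    and "\<And>i j. i \<in> {1..N} \<Longrightarrow> j \<in> {0..N} \<Longrightarrow> 0 < a i j \<longleftrightarrow> (j, i) \<in> parcs G"
    and "has_directed_spanning_tree (with_proj G) 0"
    \<comment> \<open>gain\<close>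
    and "eigenvalue (cmat (H_hat N r a)) \<kappa>"
    and "\<And>z. eigenvalue (cmat (H_hat N r a)) z \<Longrightarrow> Re \<kappa> \<le> Re z"
    and "pos_def_mat \<nu> P\<^sub>0"
    and "A * P\<^sub>0 + P\<^sub>0 * transpose_mat A + 1\<^sub>m \<nu> - P\<^sub>0 * transpose_mat C * C * P\<^sub>0 = 0\<^sub>m \<nu> \<nu>"
    and "1 / Re \<kappa> \<le> \<mu>"
    and "K = \<mu> \<cdot>\<^sub>m (P\<^sub>0 * transpose_mat C)"
  shows "closed_loop.globally_uniformly_bounded \<nu> A C K N r m a c \<psi> \<theta> \<and>
         closed_loop.consensus_tracking \<nu> A C K N r m a c \<psi> \<theta>"
proof -
  interpret tracking_network \<nu> A C K N r m a c \<psi> \<theta> P\<^sub>0 \<mu> \<kappa> G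
    by unfold_locales (fact assms)+
  show ?thesis using global_uniform_boundedness tracking by blast
qed

end
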